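(* Let $w$ be a doubling weight, $r\in\mathbb{N}$, $\nu_0\in\mathbb{N}$ with $\nu_0\ge r$, $0<p\le\infty$ and $f\in L_p[-1,1]$. Then, for every $n\in\mathbb{N}$ with $n\ge r$ and every $0<\vartheta\le 1$, there exists a polynomial $P_n\in\Pi_n$ such that $$\|f-P_n\|_{p,w_n}\le c\,\tilde\omega_\varphi^r(f,\vartheta/n)_{p,w_n}\le c\,\omega_\varphi^r(f,\vartheta/n)_{p,w_n}$$ and $$\|\rho_n^\nu P_n^{(\nu)}\|_{p,w_n}\le c\,\tilde\omega_\varphi^r(f,\vartheta/n)_{p,w_n}\le c\,\omega_\varphi^r(f,\vartheta/n)_{p,w_n},\qquad r\le\nu\le\nu_0,$$ where the constants $c>0$ depend only on $r$, $\nu_0$, $p$, $\vartheta$ and the doubling constant of $w$.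
   Context: A doubling weight is a nonnegative $w\in L_1[-1,1]$, extended by $0$ outside $[-1,1]$, for which there is a constant $L$ (the doubling constant of $w$) with $\int_{2I}w\le L\int_I w$ for all intervals $I\subset[-1,1]$, where $2I$ is the interval with the same center as $I$ and twice its length. Let $\varphi(x)=\sqrt{1-x^2}$, $\rho_n(x)=n^{-1}\sqrt{1-x^2}+n^{-2}$, and $w_n(x)=\frac{1}{\rho_n(x)}\int_{x-\rho_n(x)}^{x+\rho_n(x)}w(u)\,du$. $\Pi_n$ is the set of algebraic polynomials of degree $\le n-1$. For a weight $v$ on $[-1,1]$: $\|g\|_{p,v}=\left(\int_{-1}^1|g|^p v\right)^{1/p}$ if $0<p<\infty$, and $\|g\|_{\infty,v}=\operatorname{ess\,sup}_{[-1,1]}|g|v$. Symmetric difference: $\Delta_h^r(f,x)=\sum_{i=0}^r\binom ri(-1)^{r-i}f(x-rh/2+ih)$ if $x\pm rh/2\in[-1,1]$, and $\Delta_h^r(f,x)=0$ otherwise. Moduli: $\omega_\varphi^r(f,t)_{p,v}=\sup_{0<h\le t}\|\Delta_{h\varphi(\cdot)}^r(f,\cdot)\|_{p,v}$; for $0<p<\infty$, $\tilde\omega_\varphi^r(f,t)_{p,v}=\left(\frac1t\int_0^t\|\Delta^r_{h\varphi(\cdot)}(f,\cdot)\|_{p,v}^p\,dh\right)^{1/p}$, and $\tilde\omega_\varphi^r(f,t)_{\infty,v}=\omega_\varphi^r(f,t)_{\infty,v}$. *)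

theory Defs
  imports "HOL-Probability.Essential_Supremum" "HOL-Computational_Algebra.Polynomial"
begin

text \<open>
  Norms and moduli take values in \<^typ>\<open>ennreal\<close>, so that no integral silently defaults to 0, and the
  exponent \<^term>\<open>p :: ennreal\<close> ranges over \<open>0 < p \<le> \<infinity>\<close>.
\<close>

definition epowr :: "ennreal \<Rightarrow> real \<Rightarrow> ennreal" where
  \<comment> \<open>only used with a positive exponent\<close>
  "epowr x a = (if x = \<infinity> then \<infinity> else ennreal (enn2real x powr a))"

text \<open>
  The interval \<open>2I\<close> for \<open>I = [a, b]\<close> is \<open>[a - (b - a)/2, b + (b - a)/2]\<close>; it may leave \<open>[-1, 1]\<close>,
  where \<open>w\<close> is extended by 0.
\<close>

definition doubling_weight :: "(real \<Rightarrow> real) \<Rightarrow> real \<Rightarrow> bool" where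
  "doubling_weight w L \<longleftrightarrow>
     (\<forall>x. 0 \<le> w x) \<and> (\<forall>x. x \<notin> {-1..1} \<longrightarrow> w x = 0) \<and>
     w absolutely_integrable_on {-1..1} \<and>
     (\<forall>a b. -1 \<le> a \<longrightarrow> a \<le> b \<longrightarrow> b \<le> 1 \<longrightarrow>
        (LINT u:{a - (b - a) / 2..b + (b - a) / 2}|lebesgue. w u) \<le> L * (LINT u:{a..b}|lebesgue. w u))"

definition phi :: "real \<Rightarrow> real" where
  "phi x = sqrt (1 - x\<^sup>2)"

definition rho :: "nat \<Rightarrow> real \<Rightarrow> real" where
  "rho n x = phi x / real n + 1 / (real n)\<^sup>2"

definition avg_weight :: "(real \<Rightarrow> real) \<Rightarrow> nat \<Rightarrow> real \<Rightarrow> real" where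
  "avg_weight w n x = 1 / rho n x * (LINT u:{x - rho n x..x + rho n x}|lebesgue. w u)"

definition wnorm :: "ennreal \<Rightarrow> (real \<Rightarrow> real) \<Rightarrow> (real \<Rightarrow> real) \<Rightarrow> ennreal" where
  "wnorm p v g =
     (if p = \<infinity> then esssup (lebesgue_on {-1..1}) (\<lambda>x. ennreal (\<bar>g x\<bar> * v x))
      else epowr (\<integral>\<^sup>+x. ennreal (\<bar>g x\<bar> powr enn2real p * v x) \<partial>lebesgue_on {-1..1}) (1 / enn2real p))"

text \<open>The space \<open>L\<^sub>p[-1,1]\<close>, as a set of representatives; values outside \<open>[-1,1]\<close> are irrelevant.\<close>

definition Lp_space :: "ennreal \<Rightarrow> (real \<Rightarrow> real) set" where
  "Lp_space p = {f. f \<in> borel_measurable (lebesgue_on {-1..1}) \<and> wnorm p (\<lambda>_. 1) f < \<infinity>}"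

definition symm_difference :: "nat \<Rightarrow> real \<Rightarrow> (real \<Rightarrow> real) \<Rightarrow> real \<Rightarrow> real" where
  "symm_difference r h f x =
     (if x - real r * h / 2 \<in> {-1..1} \<and> x + real r * h / 2 \<in> {-1..1}
      then \<Sum>i\<le>r. real (r choose i) * (-1) ^ (r - i) * f (x - real r * h / 2 + real i * h)
      else 0)"

definition modulus :: "nat \<Rightarrow> (real \<Rightarrow> real) \<Rightarrow> real \<Rightarrow> ennreal \<Rightarrow> (real \<Rightarrow> real) \<Rightarrow> ennreal" where
  "modulus r f t p v = (SUP h\<in>{0<..t}. wnorm p v (\<lambda>x. symm_difference r (h * phi x) f x))"

definition avg_modulus :: "nat \<Rightarrow> (real \<Rightarrow> real) \<Rightarrow> real \<Rightarrow> ennreal \<Rightarrow> (real \<Rightarrow> real) \<Rightarrow> ennreal" where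
  "avg_modulus r f t p v =
     (if p = \<infinity> then modulus r f t p v
      else epowr (ennreal (1 / t) *
             (\<integral>\<^sup>+h. epowr (wnorm p v (\<lambda>x. symm_difference r (h * phi x) f x)) (enn2real p) \<partial>lebesgue_on {0..t}))
           (1 / enn2real p))"

end

theory Submission
  imports Defs "HOL-Complex_Analysis.Cauchy_Integral_Formula"
begin

text \<open>
  Put \<open>x = cos \<tau>\<close> and cut \<open>[-1, 1]\<close> at the points \<open>x\<^sub>i = cos (i \<pi> / n)\<close>. The cells have length comparable
  with \<open>\<rho>\<^sub>n\<close>, and by the doubling property \<open>w\<^sub>n\<close> is essentially constant on each of them and changes at most
  polynomially in the distance of the indices. On two consecutive cells \<open>f\<close> is approximated by a
  polynomial \<open>q\<^sub>i\<close> of degree less than \<open>r\<close> (Whitney's inequality). The polynomials are glued to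
  \<open>P = \<Sum> q\<^sub>j \<lambda>\<^sub>j\<close>, where the \<open>\<lambda>\<^sub>j\<close> are a partition of unity consisting of translates of a high power of the
  Dirichlet kernel. They decay so fast in the index distance, also at complex points within distance
  \<open>\<rho>\<^sub>n(x)\<close> of \<open>x\<close>, that \<open>P - q\<^sub>i\<close> on the \<open>i\<close>-th cell is bounded by the differences \<open>q\<^sub>l - q\<^sub>l\<^sub>+\<^sub>1\<close>; Cauchy's
  inequality turns this into the bounds for the derivatives of order at least \<open>r\<close>, which do not
  see \<open>q\<^sub>i\<close>.
\<close>

section \<open>Polynomial interpolation and finite differences\<close>

text \<open>The case p < 1 allows neither duality nor a triangle inequality, and the constants may
  see the weight only through L. The doubling property enters through a single exponent m: moving by
  d/n in the angle changes \<open>avg_weight\<close> at most by a constant times (1 + d)^m. The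
  decay of the partition of unity is fixed after m, large enough to absorb m, the growth of
  polynomials of degree below r away from their cell and, for small p, the loss from p-th powers.
  The steps h phi(x) with h \<le> \<theta>/n may be short against the cells, so Whitney's inequality
  is needed with steps restricted to a small fixed proportion of the interval; this makes the
  constant depend on \<theta>. The partition has degree at most n - r, which leaves room for factors
  of degree r - 1; hence n \<ge> r. For p = \<infinity> the local polynomials come from p = 1, and
  essential bounds follow by averaging a difference identity over its step. As f is only a class
  modulo null sets, null sets have to be pulled back along x + c phi(x).\<close>

lemma lagrange_interpolation:
  fixes x y :: "nat \<Rightarrow> 'a::field"
  assumes "inj_on x {..<r}" "1 \<le> r"
  obtains q where "degree q < r" "\<And>j. j < r \<Longrightarrow> poly q (x j) = y j"
    "\<And>z. poly q z = (\<Sum>i<r. y i * (\<Prod>k\<in>{..<r} - {i}. (z - x k) / (x i - x k)))"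
proof -
  define Q where "Q = (\<Sum>i<r. smult (y i) (\<Prod>k\<in>{..<r} - {i}. smult (1 / (x i - x k)) [:- x k, 1:]))"
  have pQ: "poly Q z = (\<Sum>i<r. y i * (\<Prod>k\<in>{..<r} - {i}. (z - x k) / (x i - x k)))" for z
    by (simp add: Q_def poly_sum poly_prod diff_divide_distrib)
  have "degree Q \<le> r - 1"
    unfolding Q_def
  proof (rule degree_sum_le)
    fix i assume "i \<in> {..<r}"
    have "degree (\<Prod>k\<in>{..<r} - {i}. smult (1 / (x i - x k)) [:- x k, 1:])
        \<le> (\<Sum>k\<in>{..<r} - {i}. degree (smult (1 / (x i - x k)) [:- x k, 1:]))"
      by (rule order.trans[OF degree_prod_sum_le]) auto
    also have "\<dots> \<le> (\<Sum>k\<in>{..<r} - {i}. 1)"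
      by (intro sum_mono order.trans[OF degree_smult_le]) simp
    also have "\<dots> = r - 1" using \<open>i \<in> {..<r}\<close> by simp
    finally show "degree (smult (y i) (\<Prod>k\<in>{..<r} - {i}. smult (1 / (x i - x k)) [:- x k, 1:])) \<le> r - 1"
      using degree_smult_le order.trans by blast
  qed simp
  moreover have "poly Q (x j) = y j" if j: "j < r" for j
  proof -
    have "(\<Prod>k\<in>{..<r} - {i}. (x j - x k) / (x i - x k)) = (if i = j then 1 else 0)" if "i < r" for i
    proof (cases "i = j")
      case True
      have "x j \<noteq> x k" if "k \<in> {..<r} - {j}" for k
        using assms(1) j that by (auto simp: inj_on_def)
      then show ?thesis using True by simp
    next
      case False
      then show ?thesis using j by (auto intro!: prod_zero bexI[of _ j])
    qed
    then have "poly Q (x j) = (\<Sum>i<r. y i * (if i = j then 1 else 0))"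
      unfolding pQ by (intro sum.cong) auto
    also have "\<dots> = y j" using j by (simp add: if_distrib[of "\<lambda>t. _ * t"] cong: if_cong)
    finally show ?thesis .
  qed
  ultimately show thesis using that[of Q] pQ assms(2) by force
qed

text \<open>Uniqueness of the interpolant turns the explicit formula into an identity for every
  polynomial of degree below r. It serves over the reals and over the complex numbers, and all later
  extrapolation bounds come from estimating its factors.\<close>

lemma lagrange_identity:
  fixes x :: "nat \<Rightarrow> 'a::field"
  assumes "inj_on x {..<r}" "degree q < r"
  shows "poly q z = (\<Sum>i<r. poly q (x i) * (\<Prod>k\<in>{..<r} - {i}. (z - x k) / (x i - x k)))"
proof -
  obtain Q where Q: "degree Q < r" "\<And>j. j < r \<Longrightarrow> poly Q (x j) = poly q (x j)"
    "\<And>z. poly Q z = (\<Sum>i<r. poly q (x i) * (\<Prod>k\<in>{..<r} - {i}. (z - x k) / (x i - x k)))"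
    using lagrange_interpolation[OF assms(1), of "\<lambda>i. poly q (x i)"] assms(2) by auto
  have "Q = q"
    by (rule poly_eqI_degree[where A = "x ` {..<r}"]) (use assms Q in \<open>auto simp: card_image\<close>)
  then show ?thesis using Q(3) by metis
qed

lemma interpolation_exists:
  fixes x y :: "nat \<Rightarrow> 'a::field"
  assumes "inj_on x {..<r}" "1 \<le> r"
  obtains q where "degree q < r" "\<And>i. i < r \<Longrightarrow> poly q (x i) = y i"
  using lagrange_interpolation[OF assms, of y] by blast

section \<open>Forward differences and the polynomials they annihilate\<close>

definition fwd_diff :: "nat \<Rightarrow> real \<Rightarrow> (real \<Rightarrow> real) \<Rightarrow> real \<Rightarrow> real" where
  "fwd_diff r s f y = (\<Sum>i\<le>r. real (r choose i) * (-1) ^ (r - i) * f (y + real i * s))"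

text \<open>Pascal's rule, arranged so that one first difference acts on f before the remaining r;
  this is the form needed for an induction that lowers the degree of a polynomial.\<close>

lemma fwd_diff_Suc:
  "fwd_diff (Suc r) s f y = fwd_diff r s (\<lambda>y. f (y + s) - f y) y"
proof -
  let ?a = "\<lambda>i. f (y + real i * s)"
  have "fwd_diff (Suc r) s f y
      = (-1) ^ Suc r * ?a 0 + (\<Sum>i\<le>r. real (Suc r choose Suc i) * (-1) ^ (r - i) * ?a (Suc i))"
    unfolding fwd_diff_def by (subst sum.atMost_Suc_shift) simp
  also have "(\<Sum>i\<le>r. real (Suc r choose Suc i) * (-1) ^ (r - i) * ?a (Suc i))
      = (\<Sum>i\<le>r. real (r choose i) * (-1) ^ (r - i) * ?a (Suc i))
        + (\<Sum>i\<le>r. real (r choose Suc i) * (-1) ^ (r - i) * ?a (Suc i))"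
    by (simp add: sum.distrib[symmetric] algebra_simps)
  also have "(-1) ^ Suc r * ?a 0 + (\<dots>) = (\<Sum>i\<le>r. real (r choose i) * (-1) ^ (r - i) * ?a (Suc i))
      + ((-1) ^ Suc r * ?a 0 + (\<Sum>i\<le>r. real (r choose Suc i) * (-1) ^ (r - i) * ?a (Suc i)))"
    by simp
  also have "(-1) ^ Suc r * ?a 0 + (\<Sum>i\<le>r. real (r choose Suc i) * (-1) ^ (r - i) * ?a (Suc i))
      = (\<Sum>i\<le>Suc r. real (r choose i) * (-1) ^ (Suc r - i) * ?a i)"
    by (simp only: sum.atMost_Suc_shift) simp
  also have "\<dots> = - (\<Sum>i\<le>r. real (r choose i) * (-1) ^ (r - i) * ?a i)"
    by (simp add: sum_negf[symmetric] Suc_diff_le)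
  finally show ?thesis
    unfolding fwd_diff_def by (simp add: sum_subtractf[symmetric] algebra_simps)
qed

lemma fwd_diff_poly:
  fixes q :: "real poly"
  assumes "degree q < r"
  shows "fwd_diff r s (poly q) y = 0"
  using assms
proof (induction r arbitrary: q y)
  case (Suc r)
  define q' where "q' = pcompose q [:s, 1:] - q"
  have eq: "(\<lambda>y. poly q (y + s) - poly q y) = poly q'"
    by (auto simp: q'_def poly_pcompose add.commute)
  show ?case
  proof (cases "degree q = 0")
    case True
    then obtain c where "q = [:c:]" by (metis degree_eq_zeroE)
    then show ?thesis by (simp only: fwd_diff_Suc) (simp add: fwd_diff_def)
  next
    case False
    have "degree q' < degree q"
    proof (rule le_neq_implies_less)
      show "degree q' \<le> degree q" unfolding q'_def
        by (rule degree_diff_le) (auto simp: degree_pcompose)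
      \<comment> \<open>A translate has the same leading coefficient, so the top coefficient of the
        first difference cancels.\<close>
      have "coeff (pcompose q [:s,1:]) (degree q) = lead_coeff q"
        using lead_coeff_comp[of "[:s,1:]" q] by (simp add: degree_pcompose)
      then have "coeff q' (degree q) = 0" by (simp add: q'_def)
      then show "degree q' \<noteq> degree q"
        using False by (metis degree_0 leading_coeff_0_iff)
    qed
    then show ?thesis using Suc by (simp add: fwd_diff_Suc eq)
  qed
qed simp

lemma fwd_diff_diff:
  "fwd_diff r s (\<lambda>x. f x - g x) y = fwd_diff r s f y - fwd_diff r s g y"
  by (simp add: fwd_diff_def sum_subtractf[symmetric] algebra_simps)

lemma fwd_diff_minus_poly:
  fixes q :: "real poly"
  assumes "degree q < r"
  shows "fwd_diff r s (\<lambda>x. f x - poly q x) y = fwd_diff r s f y"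
  using fwd_diff_poly[OF assms] by (simp add: fwd_diff_diff)

text \<open>Reversing the order of summation costs only the sign (-1)^r. It allows the right half of
  an interval to be treated by reflecting it onto the left half.\<close>

lemma abs_fwd_diff_reflect:
  "\<bar>fwd_diff r s (\<lambda>x. f (c - x)) y\<bar> = \<bar>fwd_diff r s f (c - y - real r * s)\<bar>"
proof -
  have "fwd_diff r s f (c - y - real r * s)
      = (\<Sum>i\<le>r. real (r choose (r - i)) * (-1) ^ (r - (r - i)) * f (c - y - real r * s + real (r - i) * s))"
    unfolding fwd_diff_def by (rule sum.nat_diff_reindex[of _ "Suc r", symmetric, unfolded lessThan_Suc_atMost, simplified])
  also have "\<dots> = (\<Sum>i\<le>r. (-1) ^ r * (real (r choose i) * (-1) ^ (r - i) * f (c - (y + real i * s))))"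
  proof (intro sum.cong refl)
    fix i assume "i \<in> {..r}"
    then have i: "i \<le> r" by simp
    have "(-1::real) ^ r * (-1) ^ (r - i) = (-1) ^ i"
      using i by (auto simp: minus_one_power_iff)
    moreover have *: "c - y - real r * s + real (r - i) * s = c - (y + real i * s)"
      using i by (simp add: of_nat_diff algebra_simps)
    ultimately show "real (r choose (r - i)) * (-1) ^ (r - (r - i)) * f (c - y - real r * s + real (r - i) * s)
        = (-1) ^ r * (real (r choose i) * (-1) ^ (r - i) * f (c - (y + real i * s)))"
      unfolding * using i by (simp add: binomial_symmetric[symmetric] mult.left_commute flip: mult.assoc)
  qed
  also have "\<dots> = (-1) ^ r * fwd_diff r s (\<lambda>x. f (c - x)) y"
    by (simp add: fwd_diff_def sum_distrib_left)
  finally show ?thesis by (simp add: abs_mult power_abs)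
qed

section \<open>Sequences controlled by their differences along a progression\<close>

definition seq_diff :: "nat \<Rightarrow> (nat \<Rightarrow> real) \<Rightarrow> nat \<Rightarrow> real" where
  "seq_diff r g j = (\<Sum>l\<le>r. real (r choose l) * (-1) ^ (r - l) * g (j + l))"

lemma seq_diff_AP: "seq_diff r (\<lambda>k. f (x + real k * s)) j = fwd_diff r s f (x + real j * s)"
  by (simp add: seq_diff_def fwd_diff_def algebra_simps)

text \<open>The r-th difference at j contains g (j + r) with coefficient 1, so every later value is
  expressed by a difference and by earlier values. The constant grows with N, which is harmless
  because N will be fixed by the parameters of the problem.\<close>

lemma seq_bound_of_initial_zeros:
  "\<exists>C\<ge>0. \<forall>g. (\<forall>i<r. g i = 0) \<longrightarrow> (\<forall>i\<le>N. \<bar>g i\<bar> \<le> C * (\<Sum>j<N + 1 - r. \<bar>seq_diff r g j\<bar>))"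
proof (induction N)
  case 0
  show ?case
  proof (cases "r = 0")
    case True
    then show ?thesis by (intro exI[of _ 1]) (simp add: seq_diff_def)
  next
    case False
    then show ?thesis by (intro exI[of _ 1]) auto
  qed
next
  case (Suc N)
  then obtain C where C: "C \<ge> 0" "\<And>g i. (\<forall>i<r. g i = 0) \<Longrightarrow> i \<le> N \<Longrightarrow>
      \<bar>g i\<bar> \<le> C * (\<Sum>j<N + 1 - r. \<bar>seq_diff r g j\<bar>)" by metis
  \<comment> \<open>\<open>D\<close> covers the old indices, through C, and the new one: its
    difference enters with weight 1, its predecessors with binomial weights times C.\<close>
  define D where "D = 1 + C + (\<Sum>l<r. real (r choose l) * C)"
  have sC: "0 \<le> (\<Sum>l<r. real (r choose l) * C)" using C by (intro sum_nonneg) auto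
  show ?case
  proof (intro exI[of _ D] conjI allI impI)
    show "0 \<le> D" using C sC by (simp add: D_def)
    fix g :: "nat \<Rightarrow> real" and i
    assume z: "\<forall>i<r. g i = 0" and i: "i \<le> Suc N"
    define S where "S = (\<Sum>j<Suc N + 1 - r. \<bar>seq_diff r g j\<bar>)"
    have S0: "(\<Sum>j<N + 1 - r. \<bar>seq_diff r g j\<bar>) \<le> S" "0 \<le> S"
      unfolding S_def by (rule sum_mono2; auto) (rule sum_nonneg; auto)
    have old: "\<bar>g i\<bar> \<le> C * S" if "i \<le> N" for i
      using C(2)[OF z that] mult_left_mono[OF S0(1) C(1)] by linarith
    have "C * S \<le> D * S" using C sC S0(2) by (intro mult_right_mono) (auto simp: D_def)
    show "\<bar>g i\<bar> \<le> D * (\<Sum>j<Suc N + 1 - r. \<bar>seq_diff r g j\<bar>)"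
    proof (cases "i \<le> N \<or> Suc N < r")
      case True
      then show ?thesis
      proof
        assume "i \<le> N" then show ?thesis using old \<open>C * S \<le> D * S\<close> S_def by force
      next
        assume "Suc N < r" then have "g i = 0" using z i by auto
        then show ?thesis using \<open>0 \<le> D\<close> S0(2) unfolding S_def by simp
      qed
    next
      case False
      then have i: "i = Suc N" and N: "r \<le> Suc N" using i by auto
      define j where "j = Suc N - r"
      have jr: "j + r = Suc N" using N by (simp add: j_def)
      have "seq_diff r g j = g (j + r) + (\<Sum>l<r. real (r choose l) * (-1) ^ (r - l) * g (j + l))"
        unfolding seq_diff_def by (simp add: lessThan_Suc_atMost[symmetric])
      then have "\<bar>g i\<bar> \<le> \<bar>seq_diff r g j\<bar> + \<bar>\<Sum>l<r. real (r choose l) * (-1) ^ (r - l) * g (j + l)\<bar>"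
        using jr i by simp
      also have "\<bar>\<Sum>l<r. real (r choose l) * (-1) ^ (r - l) * g (j + l)\<bar> \<le> (\<Sum>l<r. real (r choose l) * (C * S))"
      proof (rule order.trans[OF sum_abs], rule sum_mono)
        fix l assume "l \<in> {..<r}"
        then have "j + l \<le> N" using jr by auto
        then show "\<bar>real (r choose l) * (-1) ^ (r - l) * g (j + l)\<bar> \<le> real (r choose l) * (C * S)"
          using old by (simp add: abs_mult power_abs mult_left_mono)
      qed
      also have "(\<Sum>l<r. real (r choose l) * (C * S)) = (\<Sum>l<r. real (r choose l) * C) * S"
        by (simp add: sum_distrib_right mult.assoc)
      also have "\<bar>seq_diff r g j\<bar> \<le> S"
        unfolding S_def by (rule member_le_sum) (use N in \<open>auto simp: j_def\<close>)
      finally have "\<bar>g i\<bar> \<le> (1 + (\<Sum>l<r. real (r choose l) * C)) * S" by (simp add: algebra_simps)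
      also have "\<dots> \<le> D * S" using C S0(2) by (intro mult_right_mono) (auto simp: D_def)
      finally show ?thesis by (simp add: S_def)
    qed
  qed
qed

text \<open>The value at 0 of a polynomial through the nodes 1, 1 + K, ..., 1 + (r - 1) K is a
  Lagrange combination in which every far node carries the factor (0 - 1) / (l K) contributed by the
  node 1. The far values thus enter with a coefficient of order 1 / K, which is what later makes a
  bound of g by itself contractive; only the node 1 has no small coefficient, so its value is kept
  as a separate term.\<close>

lemma seq_contraction:
  assumes "1 \<le> r" "1 \<le> K"
  shows "\<exists>C\<ge>0. \<forall>g. \<bar>g 0\<bar> \<le> (\<Sum>l\<in>{1..<r}. real (r ^ r) / real K * \<bar>g (1 + l * K)\<bar>)
     + C * (\<bar>g 1\<bar> + (\<Sum>j<2 + r * K - r. \<bar>seq_diff r g j\<bar>))"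
proof -
  define N where "N = 1 + r * K"
  define k where "k l = 1 + l * K" for l :: nat
  define a where "a l = (\<Prod>m\<in>{..<r} - {l}. (0 - real (k m)) / (real (k l) - real (k m)))" for l
  have kN: "k l \<le> N" if "l < r" for l using that by (simp add: k_def N_def)
  have rN: "r \<le> N + 1" using mult_le_mono2[OF assms(2), of r] unfolding N_def by linarith
  have injk: "inj_on (\<lambda>l. real (k l)) {..<r}" using assms by (auto simp: inj_on_def k_def)
  have abs_a: "\<bar>a l\<bar> \<le> real (r ^ r) / real K" if l: "l \<in> {1..<r}" for l
  proof -
    have f: "\<bar>(0 - real (k m)) / (real (k l) - real (k m))\<bar> \<le> real r" if m: "m \<in> {..<r} - {l}" for m
    proof -
      have "real K \<le> \<bar>real (k l) - real (k m)\<bar>"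
      proof -
        have "real (k l) - real (k m) = (real l - real m) * real K"
          by (simp add: k_def algebra_simps)
        then have "\<bar>real (k l) - real (k m)\<bar> = \<bar>real l - real m\<bar> * real K"
          by (simp add: abs_mult)
        moreover have "1 \<le> \<bar>real l - real m\<bar>" using m by (auto simp: abs_if)
        ultimately show ?thesis using mult_right_mono[of 1 "\<bar>real l - real m\<bar>" "real K"] by simp
      qed
      moreover have "real (k m) \<le> real r * real K"
      proof -
        have "k m \<le> r * K" using m assms mult_le_mono1[of "Suc m" r K] by (simp add: k_def)
        then show ?thesis by (metis of_nat_le_iff of_nat_mult)
      qed
      moreover have "real r * real K \<le> real r * \<bar>real (k l) - real (k m)\<bar>"
        using calculation(1) by (intro mult_left_mono) auto
      moreover have "0 < \<bar>real (k l) - real (k m)\<bar>" using calculation(1) assms by linarith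
      ultimately show ?thesis by (simp add: abs_divide divide_le_eq)
    qed
    \<comment> \<open>The factor of the node \<open>k 0\<close> = 1 is at most 1 / K; every other
      factor is at most r.\<close>
    have "\<bar>a l\<bar> = \<bar>(0 - real (k 0)) / (real (k l) - real (k 0))\<bar>
        * (\<Prod>m\<in>{..<r} - {l} - {0}. \<bar>(0 - real (k m)) / (real (k l) - real (k m))\<bar>)"
      unfolding a_def abs_prod using l by (intro prod.remove) auto
    also have "\<dots> \<le> 1 / real K * real r ^ r"
    proof (rule mult_mono)
      have "real K \<le> real l * real K" using l by (cases l) (auto simp: field_simps)
      then show "\<bar>(0 - real (k 0)) / (real (k l) - real (k 0))\<bar> \<le> 1 / real K"
        using l assms by (simp add: k_def field_simps)
      have "(\<Prod>m\<in>{..<r} - {l} - {0}. \<bar>(0 - real (k m)) / (real (k l) - real (k m))\<bar>)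
          \<le> (\<Prod>m\<in>{..<r} - {l} - {0}. real r)"
        by (intro prod_mono) (use f in auto)
      also have "\<dots> = real r ^ card ({..<r} - {l} - {0})" by simp
      also have "\<dots> \<le> real r ^ r"
        using assms by (intro power_increasing) (auto simp: card_Diff_insert intro: order.trans[OF card_mono[of "{..<r}"]])
      finally show "(\<Prod>m\<in>{..<r} - {l} - {0}. \<bar>(0 - real (k m)) / (real (k l) - real (k m))\<bar>) \<le> real r ^ r" .
    qed (auto intro: prod_nonneg)
    finally show ?thesis by simp
  qed
  obtain C where C: "C \<ge> 0" "\<And>g i. (\<forall>i<r. g i = 0) \<Longrightarrow> i \<le> N \<Longrightarrow>
      \<bar>g i\<bar> \<le> C * (\<Sum>j<N + 1 - r. \<bar>seq_diff r g j\<bar>)"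
    using seq_bound_of_initial_zeros[of r N] by metis
  define A where "A = \<bar>a 0\<bar> + (\<Sum>l<r. \<bar>a l\<bar> * C)"
  have A0: "0 \<le> A" unfolding A_def using C(1) by (intro add_nonneg_nonneg sum_nonneg) auto
  show ?thesis
  proof (intro exI[of _ A] conjI allI)
    show "0 \<le> A" by fact
    fix g :: "nat \<Rightarrow> real"
    define S where "S = (\<Sum>j<N + 1 - r. \<bar>seq_diff r g j\<bar>)"
    have S0: "0 \<le> S" unfolding S_def by (intro sum_nonneg) auto
    \<comment> \<open>q agrees with g at 0, ..., r - 1, so h = g - q starts with zeros and has the
      same r-th differences as g. Hence h is bounded by differences up to N, and q can be replaced
      by g at the nodes.\<close>
    obtain q where q: "degree q < r" "\<And>i. i < r \<Longrightarrow> poly q (real i) = g i"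
      using interpolation_exists[of real r g] assms by (auto simp: inj_on_def)
    define h where "h i = g i - poly q (real i)" for i
    have "seq_diff r h j = seq_diff r g j" for j
    proof -
      have "seq_diff r h j = seq_diff r g j - fwd_diff r 1 (poly q) (real j)"
        by (simp add: seq_diff_def fwd_diff_def h_def sum_subtractf[symmetric] algebra_simps)
      then show ?thesis using fwd_diff_poly[OF q(1)] by simp
    qed
    then have h: "\<bar>h i\<bar> \<le> C * S" if "i \<le> N" for i
      using C(2)[of h i] q(2) that by (simp add: S_def h_def)
    have "g 0 = poly q 0" using q(2)[of 0] assms by simp
    also have "\<dots> = (\<Sum>l<r. poly q (real (k l)) * a l)"
      unfolding a_def by (rule lagrange_identity[OF injk q(1)])
    also have "\<dots> = (\<Sum>l<r. a l * g (k l)) - (\<Sum>l<r. a l * h (k l))"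
      by (simp add: h_def sum_subtractf[symmetric] algebra_simps)
    finally have "\<bar>g 0\<bar> \<le> \<bar>\<Sum>l<r. a l * g (k l)\<bar> + \<bar>\<Sum>l<r. a l * h (k l)\<bar>" by linarith
    also have "\<bar>\<Sum>l<r. a l * h (k l)\<bar> \<le> (\<Sum>l<r. \<bar>a l\<bar> * (C * S))"
      by (rule order.trans[OF sum_abs], rule sum_mono)
         (use h kN in \<open>auto simp: abs_mult intro: mult_left_mono\<close>)
    also have "\<dots> = (\<Sum>l<r. \<bar>a l\<bar> * C) * S" by (simp add: sum_distrib_right mult.assoc)
    also have "\<bar>\<Sum>l<r. a l * g (k l)\<bar> \<le> (\<Sum>l<r. \<bar>a l\<bar> * \<bar>g (k l)\<bar>)"
      by (rule order.trans[OF sum_abs]) (simp add: abs_mult)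
    also have "\<dots> = \<bar>a 0\<bar> * \<bar>g (k 0)\<bar> + (\<Sum>l\<in>{1..<r}. \<bar>a l\<bar> * \<bar>g (k l)\<bar>)"
      using assms by (simp add: lessThan_atLeast0 sum.atLeast_Suc_lessThan)
    also have "(\<Sum>l\<in>{1..<r}. \<bar>a l\<bar> * \<bar>g (k l)\<bar>) \<le> (\<Sum>l\<in>{1..<r}. real (r ^ r) / real K * \<bar>g (k l)\<bar>)"
      by (intro sum_mono mult_right_mono abs_a) auto
    finally have "\<bar>g 0\<bar> \<le> (\<Sum>l\<in>{1..<r}. real (r ^ r) / real K * \<bar>g (k l)\<bar>)
        + (\<bar>a 0\<bar> * \<bar>g 1\<bar> + (\<Sum>l<r. \<bar>a l\<bar> * C) * S)" by (simp add: k_def)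
    also have "\<bar>a 0\<bar> * \<bar>g 1\<bar> + (\<Sum>l<r. \<bar>a l\<bar> * C) * S \<le> A * \<bar>g 1\<bar> + A * S"
      using S0 C(1) by (intro add_mono mult_right_mono) (auto simp: A_def intro!: sum_nonneg)
    finally show "\<bar>g 0\<bar> \<le> (\<Sum>l\<in>{1..<r}. real (r ^ r) / real K * \<bar>g (1 + l * K)\<bar>)
        + A * (\<bar>g 1\<bar> + (\<Sum>j<2 + r * K - r. \<bar>seq_diff r g j\<bar>))"
      by (simp add: k_def S_def N_def algebra_simps)
  qed
qed

section \<open>Whitney's inequality for all exponents\<close>

text \<open>Comparing with the largest term gives a constant that is valid for every p > 0, so p < 1
  and p \<ge> 1 are treated alike.\<close>

lemma powr_sum_le:
  fixes a :: "'i \<Rightarrow> real"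
  assumes "finite A" "\<And>i. i \<in> A \<Longrightarrow> 0 \<le> a i" "0 < p"
  shows "(\<Sum>i\<in>A. a i) powr p \<le> real (card A) powr p * (\<Sum>i\<in>A. a i powr p)"
proof (cases "A = {}")
  case False
  define m where "m = Max (a ` A)"
  obtain k where k: "k \<in> A" "a k = m"
  proof -
    have "m \<in> a ` A" unfolding m_def using assms False by (intro Max_in) auto
    then show thesis using that by auto
  qed
  have le: "a i \<le> m" if "i \<in> A" for i using that assms by (simp add: m_def)
  have "(\<Sum>i\<in>A. a i) powr p \<le> (real (card A) * m) powr p"
    using assms le sum_bounded_above[of A a m] by (intro powr_mono2) (auto intro: sum_nonneg)
  also have "\<dots> = real (card A) powr p * a k powr p"
    using k assms by (simp add: powr_mult)
  also have "\<dots> \<le> real (card A) powr p * (\<Sum>i\<in>A. a i powr p)"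
    using k assms by (intro mult_left_mono member_le_sum) auto
  finally show ?thesis .
qed simp

lemma powr_add_le:
  fixes a b :: real
  assumes "0 \<le> a" "0 \<le> b" "0 < p"
  shows "(a + b) powr p \<le> 2 powr p * (a powr p + b powr p)"
  using powr_sum_le[of "{True, False}" "\<lambda>i. if i then a else b" p] assms by simp

lemma fwd_diff_measurable [measurable]:
  assumes [measurable]: "f \<in> borel_measurable borel" "a \<in> borel_measurable M" "b \<in> borel_measurable M"
  shows "(\<lambda>x. fwd_diff r (a x) f (b x)) \<in> borel_measurable M"
  unfolding fwd_diff_def by measurable

text \<open>The p-th power is kept without a root: in this form it is additive over cells for every
  p > 0.\<close>

definition Lp_integral :: "real \<Rightarrow> real set \<Rightarrow> (real \<Rightarrow> real) \<Rightarrow> ennreal" where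
  "Lp_integral p A g = (\<integral>\<^sup>+x\<in>A. ennreal (\<bar>g x\<bar> powr p) \<partial>lborel)"

text \<open>An unnormalised local averaged modulus; the range of y keeps all r + 1 points of the
  difference inside the interval.\<close>

definition diff_integral :: "nat \<Rightarrow> real \<Rightarrow> real \<Rightarrow> real \<Rightarrow> real \<Rightarrow> (real \<Rightarrow> real) \<Rightarrow> ennreal" where
  "diff_integral r p \<kappa> a b f =
    (\<integral>\<^sup>+s\<in>{0<..\<kappa>}. (\<integral>\<^sup>+y\<in>{a..b - real r * s}. ennreal (\<bar>fwd_diff r s f y\<bar> powr p) \<partial>lborel) \<partial>lborel)"

text \<open>The contraction for sequences, read along the progression x, x + s, x + 2 s and so on.
  The point x + s is kept apart because it will be a fixed node while x and s vary together.\<close>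

lemma half_pointwise:
  assumes "1 \<le> r" "1 \<le> K" "0 < p"
  shows "\<exists>C\<ge>0. \<forall>g x s. \<bar>g x\<bar> powr p \<le>
      2 powr p * real r powr p * (real (r ^ r) / real K) powr p * (\<Sum>l\<in>{1..<r}. \<bar>g (x + s + real l * real K * s)\<bar> powr p)
      + C * (\<bar>g (x + s)\<bar> powr p + (\<Sum>j<2 + r * K - r. \<bar>fwd_diff r s g (x + real j * s)\<bar> powr p))"
proof -
  define N where "N = 2 + r * K - r"
  define c where "c = real (r ^ r) / real K"
  have c0: "0 \<le> c" by (simp add: c_def)
  obtain C where C: "C \<ge> 0" "\<And>g::nat \<Rightarrow> real. \<bar>g 0\<bar> \<le> (\<Sum>l\<in>{1..<r}. c * \<bar>g (1 + l * K)\<bar>)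
     + C * (\<bar>g 1\<bar> + (\<Sum>j<N. \<bar>seq_diff r g j\<bar>))"
    using seq_contraction[OF assms(1,2)] unfolding N_def c_def by metis
  define C1 where "C1 = 2 powr p * (C powr p * (2 powr p * (1 + real N powr p)))"
  have "\<bar>g x\<bar> powr p \<le>
      2 powr p * real r powr p * c powr p * (\<Sum>l\<in>{1..<r}. \<bar>g (x + s + real l * real K * s)\<bar> powr p)
      + C1 * (\<bar>g (x + s)\<bar> powr p + (\<Sum>j<N. \<bar>fwd_diff r s g (x + real j * s)\<bar> powr p))" for g :: "real \<Rightarrow> real" and x s
  proof -
    define E where "E = (\<Sum>l\<in>{1..<r}. c * \<bar>g (x + s + real l * real K * s)\<bar>)"
    define F where "F = (\<Sum>j<N. \<bar>fwd_diff r s g (x + real j * s)\<bar>)"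
    define Fp where "Fp = (\<Sum>j<N. \<bar>fwd_diff r s g (x + real j * s)\<bar> powr p)"
    have Fp0: "0 \<le> Fp" unfolding Fp_def by (intro sum_nonneg) auto
    have E0: "0 \<le> E" "0 \<le> F" unfolding E_def F_def using c0 by (auto intro!: sum_nonneg)
    have "\<bar>g x\<bar> \<le> E + C * (\<bar>g (x + s)\<bar> + F)"
      using C(2)[of "\<lambda>k. g (x + real k * s)"] unfolding seq_diff_AP E_def F_def
      by (simp add: algebra_simps)
    then have "\<bar>g x\<bar> powr p \<le> (E + C * (\<bar>g (x + s)\<bar> + F)) powr p"
      using assms by (intro powr_mono2) auto
    also have "\<dots> \<le> 2 powr p * (E powr p + (C * (\<bar>g (x + s)\<bar> + F)) powr p)"
      using E0 C assms by (intro powr_add_le) auto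
    also have "E powr p \<le> real r powr p * (c powr p * (\<Sum>l\<in>{1..<r}. \<bar>g (x + s + real l * real K * s)\<bar> powr p))"
    proof -
      have "E powr p \<le> real (card {1..<r}) powr p * (\<Sum>l\<in>{1..<r}. (c * \<bar>g (x + s + real l * real K * s)\<bar>) powr p)"
        unfolding E_def using c0 assms by (intro powr_sum_le) auto
      also have "\<dots> \<le> real r powr p * (\<Sum>l\<in>{1..<r}. (c * \<bar>g (x + s + real l * real K * s)\<bar>) powr p)"
        using assms by (intro mult_right_mono powr_mono2 sum_nonneg) auto
      finally show ?thesis using c0 by (simp add: powr_mult sum_distrib_left)
    qed
    also have "(C * (\<bar>g (x + s)\<bar> + F)) powr p \<le> C powr p * (2 powr p * ((1 + real N powr p) * (\<bar>g (x + s)\<bar> powr p + Fp)))"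
    proof -
      have "(\<bar>g (x + s)\<bar> + F) powr p \<le> 2 powr p * (\<bar>g (x + s)\<bar> powr p + F powr p)"
        using E0 assms by (intro powr_add_le) auto
      also have "F powr p \<le> real N powr p * Fp"
        using powr_sum_le[of "{..<N}" "\<lambda>j. \<bar>fwd_diff r s g (x + real j * s)\<bar>" p] assms
        by (simp add: F_def Fp_def)
      also have "\<bar>g (x + s)\<bar> powr p + real N powr p * Fp \<le> (1 + real N powr p) * (\<bar>g (x + s)\<bar> powr p + Fp)"
        using Fp0 by (simp add: algebra_simps)
      finally have "(\<bar>g (x + s)\<bar> + F) powr p \<le> 2 powr p * ((1 + real N powr p) * (\<bar>g (x + s)\<bar> powr p + Fp))"
        by simp
      then show ?thesis using C E0 by (simp add: powr_mult mult_left_mono)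
    qed
    finally show ?thesis by (simp add: C1_def Fp_def algebra_simps)
  qed
  moreover have "0 \<le> C1" by (simp add: C1_def)
  ultimately show ?thesis unfolding N_def c_def by blast
qed

text \<open>The gain 1 / k is the Jacobian of the dilation.\<close>

lemma Lp_integral_affine_le:
  assumes [measurable]: "g \<in> borel_measurable borel" and "1 \<le> k"
  shows "(\<integral>\<^sup>+s. ennreal (\<bar>g (z + k * s)\<bar> powr p) * indicator {0..1} (z + k * s) \<partial>lborel) \<le> ennreal (1 / k) * Lp_integral p {0..1} g"
proof -
  have "Lp_integral p {0..1} g = ennreal \<bar>k\<bar> * (\<integral>\<^sup>+s. ennreal (\<bar>g (z + k * s)\<bar> powr p) * indicator {0..1} (z + k * s) \<partial>lborel)"
    unfolding Lp_integral_def using assms(2) by (subst nn_integral_real_affine[where c = k and t = z]) auto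
  then have "ennreal (1 / k) * Lp_integral p {0..1} g
      = ennreal (1 / k) * ennreal \<bar>k\<bar> * (\<integral>\<^sup>+s. ennreal (\<bar>g (z + k * s)\<bar> powr p) * indicator {0..1} (z + k * s) \<partial>lborel)"
    by (simp add: mult.assoc)
  also have "ennreal (1 / k) * ennreal \<bar>k\<bar> = 1"
    using assms(2) by (simp flip: ennreal_mult)
  finally show ?thesis by simp
qed

text \<open>Each x is paired with a node z i just to its right and with the step s = z i - x. Then x
  + s is the node itself, and the far points are z i + l K s: as x varies this is a dilation about
  the node by l K, whose Jacobian gains a further factor 1 / K. Summing over the nodes costs M + 1,
  which for M proportional to K is compensated by that gain, so the total factor behaves like K to
  the power -p.\<close>

lemma half_estimate:
  assumes "1 \<le> r" "1 \<le> K" "0 < p"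
  shows "\<exists>C\<ge>0. \<forall>\<sigma> g z. 0 < \<sigma> \<longrightarrow> \<sigma> \<le> 1 \<longrightarrow> (1 + real r * real K) * \<sigma> \<le> 1/2 \<longrightarrow>
     g \<in> borel_measurable borel \<longrightarrow> (\<forall>x\<in>{0..1/2}. \<exists>i\<le>M. z i - x \<in> {0<..\<sigma>}) \<longrightarrow>
     Lp_integral p {0..1/2} g \<le>
       ennreal (real (M + 1) * (2 powr p * real r powr p * (real (r ^ r) / real K) powr p * (real r / real K))) * Lp_integral p {0..1} g
       + ennreal C * (\<Sum>i\<le>M. ennreal (\<bar>g (z i)\<bar> powr p) + (\<Sum>j<2 + r * K - r.
           \<integral>\<^sup>+s\<in>{0<..\<sigma>}. (ennreal (\<bar>fwd_diff r s g (z i - s + real j * s)\<bar> powr p) * indicator {0..1/2} (z i - s)) \<partial>lborel))"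
proof -
  define N where "N = 2 + r * K - r"
  define T where "T = 2 powr p * real r powr p * (real (r ^ r) / real K) powr p"
  have T0: "0 \<le> T" by (simp add: T_def)
  obtain C where C: "C \<ge> 0" "\<And>(g::real\<Rightarrow>real) x s. \<bar>g x\<bar> powr p \<le> T * (\<Sum>l\<in>{1..<r}. \<bar>g (x + s + real l * real K * s)\<bar> powr p)
      + C * (\<bar>g (x + s)\<bar> powr p + (\<Sum>j<N. \<bar>fwd_diff r s g (x + real j * s)\<bar> powr p))"
    using half_pointwise[OF assms] unfolding N_def T_def by metis
  have "Lp_integral p {0..1/2} g \<le>
       ennreal (real (M + 1) * (T * (real r / real K))) * Lp_integral p {0..1} g
       + ennreal C * (\<Sum>i\<le>M. ennreal (\<bar>g (z i)\<bar> powr p) + (\<Sum>j<N.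
           \<integral>\<^sup>+s\<in>{0<..\<sigma>}. (ennreal (\<bar>fwd_diff r s g (z i - s + real j * s)\<bar> powr p) * indicator {0..1/2} (z i - s)) \<partial>lborel))"
    if \<sigma>: "0 < \<sigma>" "\<sigma> \<le> 1" "(1 + real r * real K) * \<sigma> \<le> 1/2" and g[measurable]: "g \<in> borel_measurable borel"
     and z: "\<forall>x\<in>{0..1/2}. \<exists>i\<le>M. z i - x \<in> {0<..\<sigma>}" for \<sigma> g and z :: "nat \<Rightarrow> real"
  proof -
    let ?I = "Lp_integral p {0..1} g"
    define Q where "Q i j = (\<integral>\<^sup>+s\<in>{0<..\<sigma>}. (ennreal (\<bar>fwd_diff r s g (z i - s + real j * s)\<bar> powr p) * indicator {0..1/2} (z i - s)) \<partial>lborel)" for i j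
    have one: "(\<integral>\<^sup>+x. ennreal (\<bar>g x\<bar> powr p) * indicator {0..1/2} x * indicator {0<..\<sigma>} (z i - x) \<partial>lborel)
      \<le> ennreal (T * (real r / real K)) * ?I + ennreal C * (ennreal (\<bar>g (z i)\<bar> powr p) + (\<Sum>j<N. Q i j))" for i
    proof -
      have "(\<integral>\<^sup>+x. ennreal (\<bar>g x\<bar> powr p) * indicator {0..1/2} x * indicator {0<..\<sigma>} (z i - x) \<partial>lborel)
         = (\<integral>\<^sup>+s. ennreal (\<bar>g (z i - s)\<bar> powr p) * indicator {0..1/2} (z i - s) * indicator {0<..\<sigma>} s \<partial>lborel)"
        by (subst nn_integral_real_affine[where c = "-1" and t = "z i"]) auto
      also have "\<dots> \<le> (\<integral>\<^sup>+s. ennreal T * (\<Sum>l\<in>{1..<r}. ennreal (\<bar>g (z i + real l * real K * s)\<bar> powr p) * indicator {0..1} (z i + real l * real K * s))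
          + ennreal C * (ennreal (\<bar>g (z i)\<bar> powr p) * indicator {0<..\<sigma>} s
             + (\<Sum>j<N. (ennreal (\<bar>fwd_diff r s g (z i - s + real j * s)\<bar> powr p) * indicator {0..1/2} (z i - s)) * indicator {0<..\<sigma>} s)) \<partial>lborel)"
      proof (rule nn_integral_mono)
        fix s
        show "ennreal (\<bar>g (z i - s)\<bar> powr p) * indicator {0..1/2} (z i - s) * indicator {0<..\<sigma>} s
          \<le> ennreal T * (\<Sum>l\<in>{1..<r}. ennreal (\<bar>g (z i + real l * real K * s)\<bar> powr p) * indicator {0..1} (z i + real l * real K * s))
          + ennreal C * (ennreal (\<bar>g (z i)\<bar> powr p) * indicator {0<..\<sigma>} s
             + (\<Sum>j<N. (ennreal (\<bar>fwd_diff r s g (z i - s + real j * s)\<bar> powr p) * indicator {0..1/2} (z i - s)) * indicator {0<..\<sigma>} s))"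
        proof (cases "z i - s \<in> {0..1/2} \<and> s \<in> {0<..\<sigma>}")
          case True
          \<comment> \<open>The condition on (1 + r K) \<sigma> keeps the far points in the unit
            interval when x is in its left half.\<close>
          have in01: "z i + real l * real K * s \<in> {0..1}" if "l \<in> {1..<r}" for l
          proof -
            have "real l * real K \<le> real r * real K" using that by (intro mult_right_mono) auto
            then have "(1 + real l * real K) * s \<le> (1 + real r * real K) * \<sigma>"
              using True by (intro mult_mono) auto
            moreover have "0 \<le> real l * real K * s" using True by auto
            ultimately show ?thesis using True \<sigma> by (auto simp: algebra_simps)
          qed
          have "ennreal (\<bar>g (z i - s)\<bar> powr p) \<le> ennreal (T * (\<Sum>l\<in>{1..<r}. \<bar>g (z i + real l * real K * s)\<bar> powr p)
            + C * (\<bar>g (z i)\<bar> powr p + (\<Sum>j<N. \<bar>fwd_diff r s g (z i - s + real j * s)\<bar> powr p)))"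
            using C(2)[of g "z i - s" s] by (intro ennreal_leI) simp
          also have "\<dots> = ennreal T * (\<Sum>l\<in>{1..<r}. ennreal (\<bar>g (z i + real l * real K * s)\<bar> powr p))
            + ennreal C * (ennreal (\<bar>g (z i)\<bar> powr p) + (\<Sum>j<N. ennreal (\<bar>fwd_diff r s g (z i - s + real j * s)\<bar> powr p)))"
            using T0 C(1) by (simp add: ennreal_plus ennreal_mult sum_nonneg sum_ennreal)
          also have "\<dots> = ennreal T * (\<Sum>l\<in>{1..<r}. ennreal (\<bar>g (z i + real l * real K * s)\<bar> powr p) * indicator {0..1} (z i + real l * real K * s))
            + ennreal C * (ennreal (\<bar>g (z i)\<bar> powr p) + (\<Sum>j<N. ennreal (\<bar>fwd_diff r s g (z i - s + real j * s)\<bar> powr p)))"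
            using in01 by (intro arg_cong2[where f = "(+)"] arg_cong2[where f = "(*)"] sum.cong) auto
          finally show ?thesis using True by (simp)
        qed auto
      qed
      also have "\<dots> = ennreal T * (\<Sum>l\<in>{1..<r}. (\<integral>\<^sup>+s. ennreal (\<bar>g (z i + real l * real K * s)\<bar> powr p) * indicator {0..1} (z i + real l * real K * s) \<partial>lborel))
          + ennreal C * (ennreal (\<bar>g (z i)\<bar> powr p) * ennreal \<sigma> + (\<Sum>j<N. Q i j))"
      proof -
        define h where "h l s = ennreal (\<bar>g (z i + real l * real K * s)\<bar> powr p) * indicator {0..1} (z i + real l * real K * s)" for l s
        define k where "k j s = (ennreal (\<bar>fwd_diff r s g (z i - s + real j * s)\<bar> powr p) * indicator {0..1/2} (z i - s)) * indicator {0<..\<sigma>} s" for j s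
        have [measurable]: "h l \<in> borel_measurable borel" "k j \<in> borel_measurable borel" for l j
          unfolding h_def k_def by measurable
        have "(\<integral>\<^sup>+s. ennreal T * (\<Sum>l\<in>{1..<r}. h l s) + ennreal C * (ennreal (\<bar>g (z i)\<bar> powr p) * indicator {0<..\<sigma>} s + (\<Sum>j<N. k j s)) \<partial>lborel)
          = ennreal T * (\<Sum>l\<in>{1..<r}. (\<integral>\<^sup>+s. h l s \<partial>lborel))
            + ennreal C * (ennreal (\<bar>g (z i)\<bar> powr p) * ennreal \<sigma> + (\<Sum>j<N. (\<integral>\<^sup>+s. k j s \<partial>lborel)))"
          using \<sigma> by (simp add: nn_integral_add nn_integral_cmult nn_integral_sum nn_integral_cmult_indicator)
        then show ?thesis unfolding h_def k_def Q_def .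
      qed
      also have "\<dots> \<le> ennreal T * (\<Sum>l\<in>{1..<r}. ennreal (1 / real K) * ?I) + ennreal C * (ennreal (\<bar>g (z i)\<bar> powr p) * 1 + (\<Sum>j<N. Q i j))"
      proof (intro add_mono mult_left_mono sum_mono)
        fix l assume l: "l \<in> {1..<r}"
        have lK: "1 \<le> real l * real K" "real K \<le> real l * real K"
          using l assms(2) by (auto intro: order.trans[OF _ mult_mono[of 1 "real l" 1 "real K"]] simp: )
        have "(\<integral>\<^sup>+s. ennreal (\<bar>g (z i + real l * real K * s)\<bar> powr p) * indicator {0..1} (z i + real l * real K * s) \<partial>lborel)
          \<le> ennreal (1 / (real l * real K)) * ?I"
          by (rule Lp_integral_affine_le) (use lK in auto)
        also have "\<dots> \<le> ennreal (1 / real K) * ?I"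
          using lK assms(2) by (intro mult_right_mono ennreal_leI divide_left_mono) auto
        finally show "(\<integral>\<^sup>+s. ennreal (\<bar>g (z i + real l * real K * s)\<bar> powr p) * indicator {0..1} (z i + real l * real K * s) \<partial>lborel)
          \<le> ennreal (1 / real K) * ?I" .
      qed (use \<sigma> in auto)
      also have "ennreal T * (\<Sum>l\<in>{1..<r}. ennreal (1 / real K) * ?I) \<le> ennreal (T * (real r / real K)) * ?I"
      proof -
        have "ennreal T * (\<Sum>l\<in>{1..<r}. ennreal (1 / real K) * ?I) = ennreal (T * (real (r - 1) / real K)) * ?I"
          using T0 assms by (simp add: ennreal_mult[symmetric] ennreal_of_nat_eq_real_of_nat mult.assoc[symmetric])
        also have "\<dots> \<le> ennreal (T * (real r / real K)) * ?I"
          using T0 by (intro mult_right_mono ennreal_leI mult_left_mono divide_right_mono) auto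
        finally show ?thesis .
      qed
      finally show ?thesis by simp
    qed
    have "Lp_integral p {0..1/2} g \<le> (\<integral>\<^sup>+x. (\<Sum>i\<le>M. ennreal (\<bar>g x\<bar> powr p) * indicator {0..1/2} x * indicator {0<..\<sigma>} (z i - x)) \<partial>lborel)"
      unfolding Lp_integral_def
    proof (rule nn_integral_mono)
      fix x :: real
      show "ennreal (\<bar>g x\<bar> powr p) * indicator {0..1/2} x \<le> (\<Sum>i\<le>M. ennreal (\<bar>g x\<bar> powr p) * indicator {0..1/2} x * indicator {0<..\<sigma>} (z i - x))"
      proof (cases "x \<in> {0..1/2}")
        case True
        then obtain i where i: "i \<le> M" "z i - x \<in> {0<..\<sigma>}" using z by blast
        then have "ennreal (\<bar>g x\<bar> powr p) * indicator {0..1/2} x \<le> ennreal (\<bar>g x\<bar> powr p) * indicator {0..1/2} x * indicator {0<..\<sigma>} (z i - x)"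
          by simp
        also have "\<dots> \<le> (\<Sum>i\<le>M. ennreal (\<bar>g x\<bar> powr p) * indicator {0..1/2} x * indicator {0<..\<sigma>} (z i - x))"
          using i by (intro member_le_sum) auto
        finally show ?thesis .
      qed simp
    qed
    also have "\<dots> = (\<Sum>i\<le>M. (\<integral>\<^sup>+x. ennreal (\<bar>g x\<bar> powr p) * indicator {0..1/2} x * indicator {0<..\<sigma>} (z i - x) \<partial>lborel))"
      by (intro nn_integral_sum) auto
    also have "\<dots> \<le> (\<Sum>i\<le>M. ennreal (T * (real r / real K)) * ?I + ennreal C * (ennreal (\<bar>g (z i)\<bar> powr p) + (\<Sum>j<N. Q i j)))"
      by (intro sum_mono one)
    also have "\<dots> = ennreal (real (M + 1) * (T * (real r / real K))) * ?I + ennreal C * (\<Sum>i\<le>M. ennreal (\<bar>g (z i)\<bar> powr p) + (\<Sum>j<N. Q i j))"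
    proof -
      define R where "R i = ennreal (\<bar>g (z i)\<bar> powr p) + (\<Sum>j<N. Q i j)" for i
      have "ennreal (real (M + 1) * (T * (real r / real K))) = of_nat (M + 1) * ennreal (T * (real r / real K))"
        using T0 by (subst ennreal_mult) (auto simp: ennreal_of_nat_eq_real_of_nat)
      then have "(\<Sum>i\<le>M. ennreal (T * (real r / real K)) * ?I + ennreal C * R i)
          = ennreal (real (M + 1) * (T * (real r / real K))) * ?I + ennreal C * (\<Sum>i\<le>M. R i)"
        by (simp add: sum.distrib sum_distrib_left mult.assoc del: of_nat_add of_nat_Suc)
      then show ?thesis unfolding R_def .
    qed
    finally show ?thesis unfolding Q_def .
  qed
  then show ?thesis using C(1) unfolding N_def T_def by blast
qed

text \<open>The nodes are chosen with this: no prescribed point is good for f, but some point does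
  not exceed the average. An infinite integral is covered, since then every point of B
  qualifies.\<close>

lemma nn_integral_exists_le_average:
  assumes [measurable]: "A \<in> borel_measurable M" "B \<in> sets M" and B: "0 < emeasure M B" "emeasure M B < \<infinity>"
  shows "\<exists>x\<in>B. A x * emeasure M B \<le> (\<integral>\<^sup>+x\<in>B. A x \<partial>M)"
proof (rule ccontr)
  define c where "c = (\<integral>\<^sup>+x\<in>B. A x \<partial>M)"
  assume "\<not> ?thesis"
  then have less: "c < A x * emeasure M B" if "x \<in> B" for x using that by (auto simp: c_def not_le)
  have "B \<noteq> {}" using B by auto
  then have cfin: "c < \<infinity>" using less by (metis ex_in_conv infinity_ennreal_def less_top order_less_le_trans top_greatest)
  define a where "a = c / emeasure M B"
  have a: "a * emeasure M B = c" unfolding a_def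
    using B by (metis ennreal_divide_self ennreal_times_divide infinity_ennreal_def less_irrefl mult.commute mult.right_neutral top.not_eq_extremum)
  have B0: "emeasure M B \<noteq> 0" using B by auto
  then have afin: "a < \<infinity>" unfolding a_def infinity_ennreal_def less_top[symmetric] ennreal_divide_eq_top_iff
    using cfin by auto
  have aA: "a < A x" if "x \<in> B" for x
    using less[OF that] B a by (metis leD mult_right_mono not_le zero_le)
  have "c = (\<integral>\<^sup>+x. (A x - a) * indicator B x + a * indicator B x \<partial>M)"
    unfolding c_def by (intro nn_integral_cong) (use aA in \<open>auto simp: diff_add_cancel_ennreal less_imp_le split: split_indicator\<close>)
  also have "\<dots> = (\<integral>\<^sup>+x. (A x - a) * indicator B x \<partial>M) + c"
    by (subst nn_integral_add) (auto simp: nn_integral_cmult_indicator a)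
  finally have "(\<integral>\<^sup>+x. (A x - a) * indicator B x \<partial>M) = 0"
    using cfin by (metis add.commute add.right_neutral ennreal_add_left_cancel infinity_ennreal_def less_irrefl)
  then have "AE x in M. (A x - a) * indicator B x = 0"
    by (subst (asm) nn_integral_0_iff_AE) auto
  then have "AE x in M. x \<notin> B"
  proof eventually_elim
    case (elim x)
    then show ?case using aA[of x] afin by (auto simp: diff_eq_0_iff_ennreal)
  qed
  then have "emeasure M B = 0"
    using AE_iff_measurable[of B M "\<lambda>x. x \<notin> B"] assms(2) sets.sets_into_space[of B M] by auto
  then show False using B by simp
qed

lemma Lp_integral_reflect:
  assumes [measurable]: "g \<in> borel_measurable borel"
  shows "Lp_integral p {a..b} (\<lambda>x. g (1 - x)) = Lp_integral p {1 - b..1 - a} g"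
  unfolding Lp_integral_def
  by (subst nn_integral_real_affine[where c = "-1" and t = 1 and f = "\<lambda>x. ennreal (\<bar>g x\<bar> powr p) * indicator {1 - b..1 - a} x"])
     (auto intro!: nn_integral_cong split: split_indicator)

lemma mult_indicator_mono:
  fixes a b :: ennreal
  assumes "x \<in> A \<Longrightarrow> a \<le> b"
  shows "a * indicator A x \<le> b * indicator A x"
  using assms by (auto split: split_indicator)

lemma nn_integral_shift_le:
  fixes h :: "real \<Rightarrow> ennreal"
  assumes [measurable]: "h \<in> borel_measurable borel" and "\<And>u. u \<in> U \<Longrightarrow> u + t \<in> {a..b}"
  shows "(\<integral>\<^sup>+u\<in>U. h (u + t) \<partial>lborel) \<le> (\<integral>\<^sup>+y\<in>{a..b}. h y \<partial>lborel)"
proof -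
  have "(\<integral>\<^sup>+y\<in>{a..b}. h y \<partial>lborel) = (\<integral>\<^sup>+u. h (t + u) * indicator {a..b} (t + u) \<partial>lborel)"
    by (subst nn_integral_real_affine[where c = 1 and t = t]) auto
  then show ?thesis using assms(2) by (auto intro!: nn_integral_mono simp: add.commute split: split_indicator)
qed

lemma nn_integral_set_swap:
  fixes H :: "real \<Rightarrow> real \<Rightarrow> ennreal"
  assumes [measurable]: "(\<lambda>(u, s). H u s) \<in> borel_measurable (borel \<Otimes>\<^sub>M borel)" "U \<in> sets borel" "S \<in> sets borel"
  shows "(\<integral>\<^sup>+u\<in>U. (\<integral>\<^sup>+s\<in>S. H u s \<partial>lborel) \<partial>lborel) = (\<integral>\<^sup>+s\<in>S. (\<integral>\<^sup>+u\<in>U. H u s \<partial>lborel) \<partial>lborel)"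
proof -
  have "(\<integral>\<^sup>+u\<in>U. (\<integral>\<^sup>+s\<in>S. H u s \<partial>lborel) \<partial>lborel) = (\<integral>\<^sup>+u. (\<integral>\<^sup>+s. H u s * indicator S s * indicator U u \<partial>lborel) \<partial>lborel)"
    by (intro nn_integral_cong) (simp add: nn_integral_multc)
  also have "\<dots> = (\<integral>\<^sup>+s. (\<integral>\<^sup>+u. H u s * indicator S s * indicator U u \<partial>lborel) \<partial>lborel)"
    by (rule lborel_pair.Fubini') simp
  also have "\<dots> = (\<integral>\<^sup>+s. (\<integral>\<^sup>+u. (H u s * indicator U u) * indicator S s \<partial>lborel) \<partial>lborel)"
    by (simp add: mult_ac)
  also have "\<dots> = (\<integral>\<^sup>+s\<in>S. (\<integral>\<^sup>+u\<in>U. H u s \<partial>lborel) \<partial>lborel)"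
    by (intro nn_integral_cong nn_integral_multc) measurable
  finally show ?thesis .
qed

text \<open>Finiteness is what permits a multiple of the integral of f - q to be absorbed into its
  own upper bound.\<close>

lemma Lp_integral_minus_poly_finite:
  fixes q :: "real poly"
  assumes [measurable]: "f \<in> borel_measurable borel" and "Lp_integral p {a..b} f < \<infinity>" "0 < p"
  shows "Lp_integral p {a..b} (\<lambda>x. f x - poly q x) < \<infinity>"
proof -
  have "compact (poly q ` {a..b})" by (intro compact_continuous_image continuous_intros) auto
  then have "\<exists>B. \<forall>x\<in>{a..b}. \<bar>poly q x\<bar> \<le> B"
    by (auto dest!: compact_imp_bounded simp: bounded_iff)
  then obtain B where B: "\<And>x. x \<in> {a..b} \<Longrightarrow> \<bar>poly q x\<bar> \<le> B" by blast
  have [measurable]: "poly q \<in> borel_measurable borel"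
    by (intro borel_measurable_continuous_onI continuous_intros)
  have "Lp_integral p {a..b} (\<lambda>x. f x - poly q x) \<le>
     (\<integral>\<^sup>+x. ennreal (2 powr p) * (ennreal (\<bar>f x\<bar> powr p) * indicator {a..b} x) + ennreal (2 powr p * \<bar>B\<bar> powr p) * indicator {a..b} x \<partial>lborel)"
    unfolding Lp_integral_def
  proof (rule nn_integral_mono)
    fix x :: real
    show "ennreal (\<bar>f x - poly q x\<bar> powr p) * indicator {a..b} x \<le> ennreal (2 powr p) * (ennreal (\<bar>f x\<bar> powr p) * indicator {a..b} x) + ennreal (2 powr p * \<bar>B\<bar> powr p) * indicator {a..b} x"
    proof (cases "x \<in> {a..b}")
      case True
      have "\<bar>f x - poly q x\<bar> powr p \<le> (\<bar>f x\<bar> + \<bar>B\<bar>) powr p"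
        using B[OF True] assms by (intro powr_mono2) auto
      also have "\<dots> \<le> 2 powr p * (\<bar>f x\<bar> powr p + \<bar>B\<bar> powr p)"
        using assms by (intro powr_add_le) auto
      finally have "ennreal (\<bar>f x - poly q x\<bar> powr p) \<le> ennreal (2 powr p * \<bar>f x\<bar> powr p + 2 powr p * \<bar>B\<bar> powr p)"
        by (intro ennreal_leI) (simp add: algebra_simps)
      then show ?thesis using True by (simp add: ennreal_plus ennreal_mult)
    qed simp
  qed
  also have "\<dots> = ennreal (2 powr p) * Lp_integral p {a..b} f + ennreal (2 powr p * \<bar>B\<bar> powr p) * emeasure lborel {a..b}"
    unfolding Lp_integral_def by (subst nn_integral_add) (auto simp: nn_integral_cmult nn_integral_cmult_indicator)
  also have "\<dots> < \<infinity>" using assms(2) by (simp add: ennreal_mult_less_top emeasure_lborel_Icc_eq)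
  finally show ?thesis .
qed

lemma Lp_integral_union_le:
  assumes [measurable]: "g \<in> borel_measurable borel"
  shows "Lp_integral p {a..c} g \<le> Lp_integral p {a..b} g + Lp_integral p {b..c} g"
proof -
  have "Lp_integral p {a..c} g \<le> (\<integral>\<^sup>+x. ennreal (\<bar>g x\<bar> powr p) * indicator {a..b} x + ennreal (\<bar>g x\<bar> powr p) * indicator {b..c} x \<partial>lborel)"
    unfolding Lp_integral_def by (intro nn_integral_mono) (auto split: split_indicator)
  then show ?thesis unfolding Lp_integral_def by (subst (asm) nn_integral_add) auto
qed

text \<open>
  If \<open>q\<close> interpolates \<open>f\<close> at points of an arithmetic progression, then \<open>g = f - q\<close> is controlled
  by differences at the later nodes, and a dilation about the nodes expands \<open>g\<close> with a small factor,
  so that \<open>\<parallel>g\<parallel>\<close> is bounded by itself with a constant less than 1 plus differences. This works for every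
  \<open>p > 0\<close>; the nodes are chosen by averaging, because \<open>f\<close> has no meaningful values at fixed points.
\<close>

lemma whitney_unit:
  assumes r: "1 \<le> r" and p: "0 < p" and \<kappa>: "0 < \<kappa>"
  shows "\<exists>C>0. \<forall>f\<in>borel_measurable borel. Lp_integral p {0..1} f < \<infinity> \<longrightarrow>
     (\<exists>q. degree q < r \<and> Lp_integral p {0..1} (\<lambda>x. f x - poly q x) \<le> ennreal C * diff_integral r p \<kappa> 0 1 f)"
proof -
  \<comment> \<open>\<open>B\<close> bounds the contraction factor times K^p once M = b K, so K is
    taken with K^p \<ge> 4 B. The size of b leaves room for the far points and keeps the steps
    \<sigma> = 2 / M below \<kappa>.\<close>
  define b where "b = 4 * (1 + r) + nat \<lceil>2 / \<kappa>\<rceil> + 1"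
  define B where "B = 2 * real b * (2 powr p * real r powr p * real (r ^ r) powr p * real r)"
  have B0: "0 \<le> B" by (simp add: B_def)
  define K where "K = nat \<lceil>(4 * B) powr (1 / p)\<rceil> + 1"
  define M where "M = b * K"
  define N where "N = 2 + r * K - r"
  define \<sigma> where "\<sigma> = 2 / real M"
  have K1: "1 \<le> K" by (simp add: K_def)
  have b1: "1 \<le> b" by (simp add: b_def)
  have M4: "4 * (1 + r * K) \<le> M"
  proof -
    have "4 * (1 + r * K) \<le> 4 * (K + r * K)" using K1 by simp
    also have "\<dots> = 4 * (1 + r) * K" by (simp add: algebra_simps)
    also have "\<dots> \<le> M" unfolding M_def b_def by (intro mult_right_mono) auto
    finally show ?thesis .
  qed
  have Mpos: "0 < real M" "4 \<le> M" using M4 by auto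
  have rM: "r \<le> M"
  proof -
    have "r \<le> r * K" using K1 by simp
    also have "\<dots> \<le> 4 * (1 + r * K)" by simp
    finally show ?thesis using M4 by linarith
  qed
  have Mk: "2 / \<kappa> \<le> real M"
  proof -
    have "2 / \<kappa> \<le> real b" unfolding b_def using \<kappa> by (simp add: of_nat_ceiling) linarith
    also have "\<dots> \<le> real M" unfolding M_def using K1 by (simp add: mult_le_cancel_left1)
    finally show ?thesis .
  qed
  have \<sigma>k: "\<sigma> \<le> \<kappa>" unfolding \<sigma>_def using Mk \<kappa> Mpos by (simp add: field_simps)
  have \<sigma>0: "0 < \<sigma>" using Mpos by (simp add: \<sigma>_def)
  have \<sigma>1: "(1 + real r * real K) * \<sigma> \<le> 1 / 2"
  proof -
    have "4 * (1 + real r * real K) \<le> real M" using of_nat_mono[OF M4, where 'a = real] by simp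
    then show ?thesis using Mpos by (simp add: \<sigma>_def field_simps)
  qed
  have \<sigma>half: "\<sigma> \<le> 1/2" 
  proof -
    have "1 * \<sigma> \<le> (1 + real r * real K) * \<sigma>" using \<sigma>0 by (intro mult_right_mono) auto
    then show ?thesis using \<sigma>1 by simp
  qed
  define \<Theta> where "\<Theta> = real (M + 1) * (2 powr p * real r powr p * (real (r ^ r) / real K) powr p * (real r / real K))"
  have \<Theta>: "\<Theta> \<le> 1 / 4"
  proof -
    define Z where "Z = 2 powr p * real r powr p * real (r ^ r) powr p * real r"
    have Z0: "0 \<le> Z" by (simp add: Z_def)
    have "\<Theta> = real (M + 1) / real K * Z / real K powr p"
      unfolding \<Theta>_def Z_def using K1 by (simp add: powr_divide)
    also have "\<dots> \<le> (2 * real b) * Z / real K powr p"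
    proof (intro divide_right_mono mult_right_mono)
      have "M + 1 \<le> 2 * M" using Mpos by linarith
      then have "M + 1 \<le> 2 * b * K" by (simp add: M_def)
      from of_nat_mono[OF this, where 'a = real] have "real (M + 1) \<le> 2 * real b * real K" by simp
      then show "real (M + 1) / real K \<le> 2 * real b" using K1 by (simp add: divide_le_eq)
    qed (use Z0 in auto)
    also have "\<dots> = B / real K powr p" by (simp add: B_def Z_def)
    also have "\<dots> \<le> 1 / 4"
    proof -
      have "(4 * B) powr (1 / p) \<le> real K" unfolding K_def by linarith
      then have "((4 * B) powr (1 / p)) powr p \<le> real K powr p" using p by (intro powr_mono2) auto
      then have "4 * B \<le> real K powr p" using p B0 by (simp add: powr_powr)
      then show ?thesis using K1 by (simp add: divide_le_eq)
    qed
    finally show ?thesis .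
  qed
  obtain C0 where C0: "C0 \<ge> 0" and C0': "\<And>g i. (\<forall>i<r. g i = 0) \<Longrightarrow> i \<le> M \<Longrightarrow>
      \<bar>g i\<bar> \<le> C0 * (\<Sum>j<M + 1 - r. \<bar>seq_diff r g j\<bar>)"
    using seq_bound_of_initial_zeros[of r M] by metis
  obtain C1 where C1: "C1 \<ge> 0" and half: "\<And>g z. g \<in> borel_measurable borel \<Longrightarrow> \<forall>x\<in>{0..1/2}. \<exists>i\<le>M. z i - x \<in> {0<..\<sigma>} \<Longrightarrow>
     Lp_integral p {0..1/2} g \<le> ennreal \<Theta> * Lp_integral p {0..1} g
       + ennreal C1 * (\<Sum>i\<le>M. ennreal (\<bar>g (z i)\<bar> powr p) + (\<Sum>j<N.
           \<integral>\<^sup>+s\<in>{0<..\<sigma>}. (ennreal (\<bar>fwd_diff r s g (z i - s + real j * s)\<bar> powr p) * indicator {0..1/2} (z i - s)) \<partial>lborel))"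
    using half_estimate[OF r K1 p, of M] \<sigma>0 \<sigma>1 \<sigma>half unfolding N_def \<Theta>_def by fastforce
  define C2 where "C2 = C0 powr p * real (M + 1 - r) powr p"
  define C3 where "C3 = C1 * (real (M + 1) * C2 + 1)"
  have C3: "0 \<le> C3" using C1 by (simp add: C3_def C2_def)
  \<comment> \<open>The steps \<delta> are a little below 1 / M: with a start in [0, \<mu>] the
    nodes 0, ..., M stay inside the unit interval, and the last one comes within \<sigma> of 1. The
    windows [\<delta>1, \<delta>2] and [0, \<mu>] have positive length so that step and start can be
    chosen by averaging.\<close>
  define \<delta>1 where "\<delta>1 = (real M - 2) / (real M)\<^sup>2"
  define \<delta>2 where "\<delta>2 = (real M - 1) / (real M)\<^sup>2"
  define \<mu> where "\<mu> = 1 / (2 * real M)"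
  have \<mu>0: "0 < \<mu>" using Mpos by (simp add: \<mu>_def)
  have \<delta>diff: "\<delta>2 - \<delta>1 = 1 / (real M)\<^sup>2" by (simp add: \<delta>1_def \<delta>2_def flip: diff_divide_distrib)
  have \<delta>lt: "\<delta>1 < \<delta>2"
    unfolding \<delta>1_def \<delta>2_def by (intro divide_strict_right_mono) (use Mpos in auto)
  have \<delta>1pos: "0 < \<delta>1" using Mpos by (simp add: \<delta>1_def)
  have \<delta>2\<sigma>: "\<delta>2 \<le> \<sigma>" using Mpos by (simp add: \<delta>2_def \<sigma>_def power2_eq_square field_simps)
  have fit: "\<mu> + real M * \<delta>2 \<le> 1" using Mpos by (simp add: \<mu>_def \<delta>2_def power2_eq_square field_simps)
  have cover: "1 - \<sigma> \<le> real M * \<delta>1" using Mpos by (simp add: \<sigma>_def \<delta>1_def power2_eq_square field_simps)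
  have \<mu>\<sigma>: "\<mu> \<le> \<sigma>" using Mpos by (simp add: \<mu>_def \<sigma>_def field_simps)
  define n1 where "n1 = (M + 1 - r)"
  define n2 where "n2 = (M + 1) * (N * 2)"
  define C where "C = 4 * C3 * (real n1 * (real M)\<^sup>2 + real n2) / \<mu> + 1"
  have "\<exists>q. degree q < r \<and> Lp_integral p {0..1} (\<lambda>x. f x - poly q x) \<le> ennreal C * diff_integral r p \<kappa> 0 1 f"
    if f[measurable]: "f \<in> borel_measurable borel" and fin: "Lp_integral p {0..1} f < \<infinity>" for f
  proof -
    define G where "G s = (\<integral>\<^sup>+y\<in>{0..1 - real r * s}. ennreal (\<bar>fwd_diff r s f y\<bar> powr p) \<partial>lborel)" for s
    define W where "W = diff_integral r p \<kappa> 0 1 f"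
    have W: "W = (\<integral>\<^sup>+s\<in>{0<..\<kappa>}. G s \<partial>lborel)" by (simp add: W_def diff_integral_def G_def)
    have [measurable]: "G \<in> borel_measurable borel"
      unfolding G_def indicator_def atLeastAtMost_iff by measurable
    \<comment> \<open>A single good step: its difference integral will be at most M^2 times the
      integral over all steps.\<close>
    have "\<exists>\<delta>\<in>{\<delta>1..\<delta>2}. G \<delta> * emeasure lborel {\<delta>1..\<delta>2} \<le> (\<integral>\<^sup>+\<delta>\<in>{\<delta>1..\<delta>2}. G \<delta> \<partial>lborel)"
      by (rule nn_integral_exists_le_average) (use \<delta>lt in \<open>auto simp: emeasure_lborel_Icc_eq\<close>)
    then obtain \<delta> where \<delta>: "\<delta>1 \<le> \<delta>" "\<delta> \<le> \<delta>2"
      and "G \<delta> * emeasure lborel {\<delta>1..\<delta>2} \<le> (\<integral>\<^sup>+\<delta>\<in>{\<delta>1..\<delta>2}. G \<delta> \<partial>lborel)" by auto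
    moreover have "(\<integral>\<^sup>+\<delta>\<in>{\<delta>1..\<delta>2}. G \<delta> \<partial>lborel) \<le> W"
      unfolding W by (intro nn_integral_mono) (use \<delta>1pos \<delta>2\<sigma> \<sigma>k in \<open>auto split: split_indicator\<close>)
    ultimately have "G \<delta> * ennreal (1 / (real M)\<^sup>2) \<le> W"
      using \<delta>diff \<delta> by (simp add: emeasure_lborel_Icc_eq)
    then have "ennreal ((real M)\<^sup>2) * (G \<delta> * ennreal (1 / (real M)\<^sup>2)) \<le> ennreal ((real M)\<^sup>2) * W"
      by (intro mult_left_mono) auto
    moreover have "ennreal ((real M)\<^sup>2) * (G \<delta> * ennreal (1 / (real M)\<^sup>2)) = G \<delta>"
    proof -
      have "ennreal ((real M)\<^sup>2) * (G \<delta> * ennreal (1 / (real M)\<^sup>2)) = G \<delta> * (ennreal ((real M)\<^sup>2) * ennreal (1 / (real M)\<^sup>2))"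
        by (simp only: ac_simps)
      also have "ennreal ((real M)\<^sup>2) * ennreal (1 / (real M)\<^sup>2) = 1"
        using Mpos by (simp flip: ennreal_mult)
      finally show ?thesis by simp
    qed
    ultimately have G\<delta>: "G \<delta> \<le> ennreal ((real M)\<^sup>2) * W" by simp
    have \<delta>0: "0 < \<delta>" using \<delta> \<delta>1pos by linarith
    \<comment> \<open>The quantities to be controlled at one start u: \<open>T\<close> governs the
      values of f - q at the nodes, while \<open>X\<close> and \<open>Y\<close> are the difference
      terms of the half estimate on the left half and on the reflected right half.\<close>
    define T where "T j u = ennreal (\<bar>fwd_diff r \<delta> f (u + real j * \<delta>)\<bar> powr p)" for j u
    define X where "X i j u = (\<integral>\<^sup>+s\<in>{0<..\<sigma>}. (ennreal (\<bar>fwd_diff r s f ((u + real i * \<delta>) - s + real j * s)\<bar> powr p)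
        * indicator {0..1/2} ((u + real i * \<delta>) - s)) \<partial>lborel)" for i j u
    define Y where "Y i j u = (\<integral>\<^sup>+s\<in>{0<..\<sigma>}. (ennreal (\<bar>fwd_diff r s f ((u + real i * \<delta>) + s - real j * s - real r * s)\<bar> powr p)
        * indicator {0..1/2} (1 - (u + real i * \<delta>) - s)) \<partial>lborel)" for i j u
    have [measurable]: "T j \<in> borel_measurable borel" "X i j \<in> borel_measurable borel" "Y i j \<in> borel_measurable borel" for i j
      unfolding T_def X_def Y_def by measurable
    define A where "A u = (\<Sum>j<n1. T j u) + (\<Sum>i\<le>M. \<Sum>j<N. X i j u + Y i j u)" for u
    have [measurable]: "A \<in> borel_measurable borel" unfolding A_def by measurable
    have geom: "real i * \<delta> \<le> real M * \<delta>2" if "i \<le> M" for i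
      using that \<delta> \<delta>0 by (intro mult_mono) auto
    have jr: "(real j + real r) * s \<le> 1 / 2" if "j < N" "s \<in> {0<..\<sigma>}" for j s
    proof -
      have "j + r \<le> 1 + r * K" using that(1) by (auto simp: N_def)
      from of_nat_mono[OF this, where 'a = real] have "real j + real r \<le> 1 + real r * real K" by simp
      then have "(real j + real r) * s \<le> (1 + real r * real K) * \<sigma>"
        using that by (intro mult_mono) auto
      then show ?thesis using \<sigma>1 by linarith
    qed
    have T_le: "(\<integral>\<^sup>+u\<in>{0..\<mu>}. T j u \<partial>lborel) \<le> G \<delta>" if "j < n1" for j
      unfolding T_def G_def
    proof (rule nn_integral_shift_le[where h = "\<lambda>y. ennreal (\<bar>fwd_diff r \<delta> f y\<bar> powr p)"])
      fix u assume u: "u \<in> {0..\<mu>}"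
      have "real (j + r) * \<delta> \<le> real M * \<delta>2" using that rM by (intro geom) (auto simp: n1_def)
      then show "u + real j * \<delta> \<in> {0..1 - real r * \<delta>}"
        using u fit \<delta>0 by (auto simp: algebra_simps)
    qed measurable
    have shrink: "(\<integral>\<^sup>+s\<in>{0<..\<sigma>}. G s \<partial>lborel) \<le> W"
      unfolding W by (intro nn_integral_mono) (use \<sigma>k in \<open>auto split: split_indicator\<close>)
    have X_le: "(\<integral>\<^sup>+u\<in>{0..\<mu>}. X i j u \<partial>lborel) \<le> W" if j: "j < N" for i j
    proof -
      have "(\<integral>\<^sup>+u\<in>{0..\<mu>}. X i j u \<partial>lborel) = (\<integral>\<^sup>+s\<in>{0<..\<sigma>}. (\<integral>\<^sup>+u\<in>{0..\<mu>}. (ennreal (\<bar>fwd_diff r s f ((u + real i * \<delta>) - s + real j * s)\<bar> powr p)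
        * indicator {0..1/2} ((u + real i * \<delta>) - s)) \<partial>lborel) \<partial>lborel)"
        unfolding X_def by (rule nn_integral_set_swap) auto
      also have "\<dots> \<le> (\<integral>\<^sup>+s\<in>{0<..\<sigma>}. G s \<partial>lborel)"
      proof (intro nn_integral_mono, rule mult_indicator_mono)
        fix s assume s: "s \<in> {0<..\<sigma>}"
        have "(\<integral>\<^sup>+u\<in>{0..\<mu>}. (ennreal (\<bar>fwd_diff r s f ((u + real i * \<delta>) - s + real j * s)\<bar> powr p)
            * indicator {0..1/2} ((u + real i * \<delta>) - s)) \<partial>lborel)
          = (\<integral>\<^sup>+u\<in>{u. u + real i * \<delta> - s \<in> {0..1/2} \<and> u \<in> {0..\<mu>}}. ennreal (\<bar>fwd_diff r s f (u + (real i * \<delta> - s + real j * s))\<bar> powr p) \<partial>lborel)"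
          by (intro nn_integral_cong) (auto simp: algebra_simps split: split_indicator)
        also have "\<dots> \<le> G s"
          unfolding G_def
        proof (rule nn_integral_shift_le[where h = "\<lambda>y. ennreal (\<bar>fwd_diff r s f y\<bar> powr p)"])
          fix u assume u: "u \<in> {u. u + real i * \<delta> - s \<in> {0..1/2} \<and> u \<in> {0..\<mu>}}"
          have "0 \<le> real j * s" using s by auto
          then show "u + (real i * \<delta> - s + real j * s) \<in> {0..1 - real r * s}"
            using u jr[OF j s] by (auto simp: algebra_simps)
        qed measurable
        finally show "(\<integral>\<^sup>+u\<in>{0..\<mu>}. (ennreal (\<bar>fwd_diff r s f ((u + real i * \<delta>) - s + real j * s)\<bar> powr p)
            * indicator {0..1/2} ((u + real i * \<delta>) - s)) \<partial>lborel) \<le> G s" .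
      qed
      finally show ?thesis using shrink by simp
    qed
    have Y_le: "(\<integral>\<^sup>+u\<in>{0..\<mu>}. Y i j u \<partial>lborel) \<le> W" if j: "j < N" for i j
    proof -
      have "(\<integral>\<^sup>+u\<in>{0..\<mu>}. Y i j u \<partial>lborel) = (\<integral>\<^sup>+s\<in>{0<..\<sigma>}. (\<integral>\<^sup>+u\<in>{0..\<mu>}. (ennreal (\<bar>fwd_diff r s f ((u + real i * \<delta>) + s - real j * s - real r * s)\<bar> powr p)
        * indicator {0..1/2} (1 - (u + real i * \<delta>) - s)) \<partial>lborel) \<partial>lborel)"
        unfolding Y_def by (rule nn_integral_set_swap) auto
      also have "\<dots> \<le> (\<integral>\<^sup>+s\<in>{0<..\<sigma>}. G s \<partial>lborel)"
      proof (intro nn_integral_mono, rule mult_indicator_mono)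
        fix s assume s: "s \<in> {0<..\<sigma>}"
        have "(\<integral>\<^sup>+u\<in>{0..\<mu>}. (ennreal (\<bar>fwd_diff r s f ((u + real i * \<delta>) + s - real j * s - real r * s)\<bar> powr p)
            * indicator {0..1/2} (1 - (u + real i * \<delta>) - s)) \<partial>lborel)
          = (\<integral>\<^sup>+u\<in>{u. 1 - (u + real i * \<delta>) - s \<in> {0..1/2} \<and> u \<in> {0..\<mu>}}. ennreal (\<bar>fwd_diff r s f (u + (real i * \<delta> + s - real j * s - real r * s))\<bar> powr p) \<partial>lborel)"
          by (intro nn_integral_cong) (auto simp: algebra_simps split: split_indicator)
        also have "\<dots> \<le> G s"
          unfolding G_def
        proof (rule nn_integral_shift_le[where h = "\<lambda>y. ennreal (\<bar>fwd_diff r s f y\<bar> powr p)"])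
          fix u assume u: "u \<in> {u. 1 - (u + real i * \<delta>) - s \<in> {0..1/2} \<and> u \<in> {0..\<mu>}}"
          have "0 \<le> real j * s" using s by auto
          then show "u + (real i * \<delta> + s - real j * s - real r * s) \<in> {0..1 - real r * s}"
            using u jr[OF j s] by (auto simp: algebra_simps)
        qed measurable
        finally show "(\<integral>\<^sup>+u\<in>{0..\<mu>}. (ennreal (\<bar>fwd_diff r s f ((u + real i * \<delta>) + s - real j * s - real r * s)\<bar> powr p)
            * indicator {0..1/2} (1 - (u + real i * \<delta>) - s)) \<partial>lborel) \<le> G s" .
      qed
      finally show ?thesis using shrink by simp
    qed
    have "(\<integral>\<^sup>+u\<in>{0..\<mu>}. A u \<partial>lborel)
       = (\<Sum>j<n1. (\<integral>\<^sup>+u\<in>{0..\<mu>}. T j u \<partial>lborel)) + (\<Sum>i\<le>M. \<Sum>j<N. (\<integral>\<^sup>+u\<in>{0..\<mu>}. X i j u \<partial>lborel) + (\<integral>\<^sup>+u\<in>{0..\<mu>}. Y i j u \<partial>lborel))"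
      unfolding A_def by (simp add: distrib_right sum_distrib_right nn_integral_add nn_integral_sum del: sum_mult_indicator sum_indicator_mult)
    also have "\<dots> \<le> (\<Sum>j<n1. ennreal ((real M)\<^sup>2) * W) + (\<Sum>i\<le>M. \<Sum>j<N. W + W)"
      by (intro add_mono sum_mono X_le Y_le order.trans[OF T_le G\<delta>]) auto
    also have "\<dots> = ennreal (real n1 * (real M)\<^sup>2 + real n2) * W"
    proof -
      have "(\<Sum>i\<le>M. \<Sum>j<N. W + W) = ennreal (real n2) * W"
      proof -
        have "ennreal (real n2) = of_nat n2" by (simp add: ennreal_of_nat_eq_real_of_nat)
        then show ?thesis
          by (simp only: n2_def of_nat_mult of_nat_numeral sum_constant
            card_atMost card_lessThan mult_2[symmetric] Suc_eq_plus1 mult.assoc)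
      qed
      moreover have "(\<Sum>j<n1. ennreal ((real M)\<^sup>2) * W) = ennreal (real n1 * (real M)\<^sup>2) * W"
        by (simp add: ennreal_mult ennreal_of_nat_eq_real_of_nat mult.assoc)
      ultimately show ?thesis by (simp add: ennreal_plus distrib_right)
    qed
    finally have intA: "(\<integral>\<^sup>+u\<in>{0..\<mu>}. A u \<partial>lborel) \<le> ennreal (real n1 * (real M)\<^sup>2 + real n2) * W" .
    \<comment> \<open>A single good start: one u bounds all terms of \<open>A\<close>
      simultaneously.\<close>
    have "\<exists>u\<in>{0..\<mu>}. A u * emeasure lborel {0..\<mu>} \<le> (\<integral>\<^sup>+u\<in>{0..\<mu>}. A u \<partial>lborel)"
      by (rule nn_integral_exists_le_average) (use \<mu>0 in \<open>auto simp: emeasure_lborel_Icc_eq\<close>)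
    then obtain u where u: "0 \<le> u" "u \<le> \<mu>" and "A u * ennreal \<mu> \<le> (\<integral>\<^sup>+u\<in>{0..\<mu>}. A u \<partial>lborel)"
      using \<mu>0 by (auto simp: emeasure_lborel_Icc_eq)
    with intA have "A u * ennreal \<mu> \<le> ennreal (real n1 * (real M)\<^sup>2 + real n2) * W" by simp
    then have "ennreal (1 / \<mu>) * (A u * ennreal \<mu>) \<le> ennreal (1 / \<mu>) * (ennreal (real n1 * (real M)\<^sup>2 + real n2) * W)"
      by (intro mult_left_mono) auto
    moreover have "ennreal (1 / \<mu>) * (A u * ennreal \<mu>) = A u"
    proof -
      have "ennreal (1 / \<mu>) * (A u * ennreal \<mu>) = A u * (ennreal (1 / \<mu>) * ennreal \<mu>)" by (simp only: ac_simps)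
      also have "ennreal (1 / \<mu>) * ennreal \<mu> = 1" using \<mu>0 by (simp flip: ennreal_mult)
      finally show ?thesis by simp
    qed
    moreover have "ennreal (1 / \<mu>) * (ennreal (real n1 * (real M)\<^sup>2 + real n2) * W) = ennreal ((real n1 * (real M)\<^sup>2 + real n2) / \<mu>) * W"
      using \<mu>0 by (subst mult.assoc[symmetric], subst ennreal_mult[symmetric]) auto
    ultimately have Au: "A u \<le> ennreal ((real n1 * (real M)\<^sup>2 + real n2) / \<mu>) * W" by simp
    define z where "z i = u + real i * \<delta>" for i :: nat
    obtain q where q: "degree q < r" "\<And>i. i < r \<Longrightarrow> poly q (z i) = f (z i)"
      using interpolation_exists[of z r "\<lambda>i. f (z i)"] r \<delta>0 by (auto simp: inj_on_def z_def)
    define g where "g x = f x - poly q x" for x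
    have [measurable]: "poly q \<in> borel_measurable borel"
      by (intro borel_measurable_continuous_onI continuous_intros)
    have [measurable]: "g \<in> borel_measurable borel" unfolding g_def by measurable
    have dg: "fwd_diff r s g y = fwd_diff r s f y" for s y
      unfolding g_def by (rule fwd_diff_minus_poly[OF q(1)])
    \<comment> \<open>Only the first r nodes are interpolated; at the others the recursion along the
      progression bounds f - q by differences of step \<delta>.\<close>
    have gz: "ennreal (\<bar>g (z i)\<bar> powr p) \<le> ennreal C2 * A u" if i: "i \<le> M" for i
    proof -
      have "\<bar>g (z i)\<bar> \<le> C0 * (\<Sum>j<n1. \<bar>seq_diff r (\<lambda>k. g (z k)) j\<bar>)"
        unfolding n1_def by (rule C0'[OF _ i]) (simp add: g_def q(2))
      also have "(\<lambda>k. g (z k)) = (\<lambda>k. g (u + real k * \<delta>))" by (simp add: z_def)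
      finally have "\<bar>g (z i)\<bar> \<le> C0 * (\<Sum>j<n1. \<bar>fwd_diff r \<delta> f (u + real j * \<delta>)\<bar>)"
        unfolding seq_diff_AP dg by (simp add: z_def)
      then have "\<bar>g (z i)\<bar> powr p \<le> (C0 * (\<Sum>j<n1. \<bar>fwd_diff r \<delta> f (u + real j * \<delta>)\<bar>)) powr p"
        using p by (intro powr_mono2) auto
      also have "\<dots> = C0 powr p * (\<Sum>j<n1. \<bar>fwd_diff r \<delta> f (u + real j * \<delta>)\<bar>) powr p"
        using C0 by (simp add: powr_mult sum_nonneg)
      also have "\<dots> \<le> C0 powr p * (real n1 powr p * (\<Sum>j<n1. \<bar>fwd_diff r \<delta> f (u + real j * \<delta>)\<bar> powr p))"
        using powr_sum_le[of "{..<n1}" "\<lambda>j. \<bar>fwd_diff r \<delta> f (u + real j * \<delta>)\<bar>" p] p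
        by (intro mult_left_mono) auto
      finally have "ennreal (\<bar>g (z i)\<bar> powr p) \<le> ennreal (C2 * (\<Sum>j<n1. \<bar>fwd_diff r \<delta> f (u + real j * \<delta>)\<bar> powr p))"
        by (intro ennreal_leI) (simp add: C2_def n1_def mult.assoc)
      also have "\<dots> = ennreal C2 * (\<Sum>j<n1. T j u)"
        by (simp add: C2_def T_def ennreal_mult sum_ennreal sum_nonneg)
      also have "\<dots> \<le> ennreal C2 * A u" unfolding A_def by (intro mult_left_mono) auto
      finally show ?thesis .
    qed
    have sumX: "(\<Sum>i\<le>M. \<Sum>j<N. X i j u) \<le> A u" "(\<Sum>i\<le>M. \<Sum>j<N. Y i j u) \<le> A u"
      unfolding A_def by (simp_all add: sum.distrib add_increasing add_increasing2)
    have fin_sum: "ennreal C1 * (\<Sum>i\<le>M. E i + (\<Sum>j<N. F i j)) \<le> ennreal C3 * A u"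
      if "\<And>i. i \<le> M \<Longrightarrow> E i \<le> ennreal C2 * A u" "(\<Sum>i\<le>M. \<Sum>j<N. F i j) \<le> A u" for E :: "nat \<Rightarrow> ennreal" and F
    proof -
      have "(\<Sum>i\<le>M. E i + (\<Sum>j<N. F i j)) \<le> (\<Sum>i\<le>M. ennreal C2 * A u) + A u"
        unfolding sum.distrib using that by (intro add_mono sum_mono) auto
      also have "\<dots> = ennreal (real (M + 1) * C2 + 1) * A u"
      proof -
        have "(\<Sum>i\<le>M. ennreal C2 * A u) = ennreal (real (M + 1) * C2) * A u"
          by (subst ennreal_mult) (auto simp: C2_def ennreal_of_nat_eq_real_of_nat mult.assoc)
        moreover have "ennreal (real (M + 1) * C2 + 1) = ennreal (real (M + 1) * C2) + 1"
          by (subst ennreal_plus) (auto simp: C2_def)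
        ultimately show ?thesis by (simp add: distrib_right)
      qed
      finally have "ennreal C1 * (\<Sum>i\<le>M. E i + (\<Sum>j<N. F i j)) \<le> ennreal C1 * (ennreal (real (M + 1) * C2 + 1) * A u)"
        by (intro mult_left_mono) auto
      also have "\<dots> = ennreal C3 * A u"
        unfolding C3_def using C1 by (subst ennreal_mult) (auto simp: C2_def mult.assoc)
      finally show ?thesis .
    qed
    have left: "Lp_integral p {0..1/2} g \<le> ennreal \<Theta> * Lp_integral p {0..1} g + ennreal C3 * A u"
    proof -
      have "\<forall>x\<in>{0..1/2}. \<exists>i\<le>M. z i - x \<in> {0<..\<sigma>}"
      proof
        fix x :: real assume x: "x \<in> {0..1/2}"
        \<comment> \<open>The last node lies at 1 - \<sigma> or beyond, hence to the right of the
          whole left half.\<close>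
        have zM: "x < z M"
        proof -
          have "real M * \<delta>1 \<le> real M * \<delta>" using \<delta> by (intro mult_left_mono) auto
          moreover have "real M * \<delta>1 = 1 - \<sigma>" using Mpos by (simp add: \<sigma>_def \<delta>1_def power2_eq_square field_simps)
          moreover have "\<sigma> < 1/2" using \<sigma>1 K1 r \<sigma>0 
          proof -
            have "2 * \<sigma> \<le> (1 + real r * real K) * \<sigma>" using \<sigma>0 r K1 by (intro mult_right_mono) (auto simp: mult_ge1_I)
            then show ?thesis using \<sigma>1 \<sigma>0 by linarith
          qed
          ultimately show ?thesis using x u by (simp add: z_def)
        qed
        \<comment> \<open>The first node beyond x: the gap to it is at most one step, or at most
          \<mu> if it is the initial node.\<close>
        define i where "i = (LEAST i. x < z i)"
        have i: "x < z i" unfolding i_def by (rule LeastI[of _ M]) (rule zM)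
        have iM: "i \<le> M" unfolding i_def by (rule Least_le) (rule zM)
        have "z i - x \<le> \<sigma>"
        proof (cases i)
          case 0
          then show ?thesis using x u \<mu>\<sigma> by (simp add: z_def)
        next
          case (Suc k)
          have "\<not> x < z k" using not_less_Least[of k "\<lambda>i. x < z i"] Suc by (simp add: i_def)
          then show ?thesis using Suc \<delta> \<delta>2\<sigma> by (simp add: z_def algebra_simps)
        qed
        then show "\<exists>i\<le>M. z i - x \<in> {0<..\<sigma>}" using i iM by (intro exI[of _ i]) auto
      qed
      then have "Lp_integral p {0..1/2} g \<le> ennreal \<Theta> * Lp_integral p {0..1} g
       + ennreal C1 * (\<Sum>i\<le>M. ennreal (\<bar>g (z i)\<bar> powr p) + (\<Sum>j<N.
           \<integral>\<^sup>+s\<in>{0<..\<sigma>}. (ennreal (\<bar>fwd_diff r s g (z i - s + real j * s)\<bar> powr p) * indicator {0..1/2} (z i - s)) \<partial>lborel))"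
        by (intro half) auto
      also have "\<dots> \<le> ennreal \<Theta> * Lp_integral p {0..1} g + ennreal C3 * A u"
        by (intro add_mono order.refl fin_sum gz) (use sumX(1) in \<open>simp_all add: dg X_def z_def\<close>)
      finally show ?thesis .
    qed
    have right: "Lp_integral p {1/2..1} g \<le> ennreal \<Theta> * Lp_integral p {0..1} g + ennreal C3 * A u"
    proof -
      define g' where "g' x = g (1 - x)" for x
      have [measurable]: "g' \<in> borel_measurable borel" unfolding g'_def by measurable
      have "\<forall>x\<in>{0..1/2}. \<exists>i\<le>M. (1 - z i) - x \<in> {0<..\<sigma>}"
      proof
        fix x :: real assume x: "x \<in> {0..1/2}"
        define y where "y = 1 - x"
        have y: "1/2 \<le> y" "y \<le> 1" using x by (auto simp: y_def)
        have z0: "z 0 < y"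
        proof -
          have "\<mu> < 1/2" using Mpos by (simp add: \<mu>_def field_simps)
          then show ?thesis using u y by (simp add: z_def)
        qed
        define i where "i = Max {i. i \<le> M \<and> z i < y}"
        have "i \<in> {i. i \<le> M \<and> z i < y}" unfolding i_def by (rule Max_in) (use z0 in auto)
        then have i: "i \<le> M" "z i < y" by auto
        have "y - z i \<le> \<sigma>"
        proof (cases "i = M")
          case True
          have "real M * \<delta>1 \<le> real M * \<delta>" using \<delta> by (intro mult_left_mono) auto
          then show ?thesis using True y cover u by (simp add: z_def)
        next
          case False
          have "\<not> z (Suc i) < y"
          proof
            assume "z (Suc i) < y"
            then have "Suc i \<le> i" unfolding i_def using False i by (intro Max_ge) (auto simp: i_def)
            then show False by simp
          qed
          then show ?thesis using \<delta> \<delta>2\<sigma> by (simp add: z_def algebra_simps)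
        qed
        then show "\<exists>i\<le>M. (1 - z i) - x \<in> {0<..\<sigma>}" using i by (intro exI[of _ i]) (auto simp: y_def)
      qed
      then have "Lp_integral p {0..1/2} g' \<le> ennreal \<Theta> * Lp_integral p {0..1} g'
       + ennreal C1 * (\<Sum>i\<le>M. ennreal (\<bar>g' (1 - z i)\<bar> powr p) + (\<Sum>j<N.
           \<integral>\<^sup>+s\<in>{0<..\<sigma>}. (ennreal (\<bar>fwd_diff r s g' ((1 - z i) - s + real j * s)\<bar> powr p) * indicator {0..1/2} ((1 - z i) - s)) \<partial>lborel))"
        by (intro half) auto
      also have "\<dots> \<le> ennreal \<Theta> * Lp_integral p {0..1} g' + ennreal C3 * A u"
      proof (intro add_mono order.refl fin_sum)
        show "ennreal (\<bar>g' (1 - z i)\<bar> powr p) \<le> ennreal C2 * A u" if "i \<le> M" for i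
          using gz[OF that] by (simp add: g'_def)
        \<comment> \<open>Reflection moves the starting point of a difference to its other end;
          hence the shift by r s in \<open>Y\<close>.\<close>
        have "\<bar>fwd_diff r s g' ((1 - z i) - s + real j * s)\<bar> = \<bar>fwd_diff r s f (z i + s - real j * s - real r * s)\<bar>" for s i j
          unfolding g'_def abs_fwd_diff_reflect dg by (simp add: algebra_simps)
        then show "(\<Sum>i\<le>M. \<Sum>j<N. \<integral>\<^sup>+s\<in>{0<..\<sigma>}. (ennreal (\<bar>fwd_diff r s g' ((1 - z i) - s + real j * s)\<bar> powr p) * indicator {0..1/2} ((1 - z i) - s)) \<partial>lborel) \<le> A u"
          using sumX(2) unfolding Y_def z_def by simp
      qed
      also have "Lp_integral p {0..1} g' = Lp_integral p {0..1} g"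
        unfolding g'_def by (subst Lp_integral_reflect) auto
      also have "Lp_integral p {0..1/2} g' = Lp_integral p {1/2..1} g"
        unfolding g'_def by (subst Lp_integral_reflect) auto
      finally show ?thesis .
    qed
    have gfin: "Lp_integral p {0..1} g < \<infinity>"
      unfolding g_def by (rule Lp_integral_minus_poly_finite[OF f fin p])
    have "Lp_integral p {0..1} g \<le> (ennreal \<Theta> * Lp_integral p {0..1} g + ennreal C3 * A u) + (ennreal \<Theta> * Lp_integral p {0..1} g + ennreal C3 * A u)"
      by (rule order.trans[OF Lp_integral_union_le[of g p 0 1 "1/2"]]) (auto intro: add_mono left right)
    also have "\<dots> \<le> (ennreal (1/4) * Lp_integral p {0..1} g + ennreal C3 * A u) + (ennreal (1/4) * Lp_integral p {0..1} g + ennreal C3 * A u)"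
      using \<Theta> by (intro add_mono mult_right_mono ennreal_leI) auto
    finally have main: "Lp_integral p {0..1} g \<le> (ennreal (1/4) * Lp_integral p {0..1} g + ennreal C3 * A u) + (ennreal (1/4) * Lp_integral p {0..1} g + ennreal C3 * A u)" .
    \<comment> \<open>Both halves together give I \<le> I / 2 + 2 c, where I is the integral of f -
      q and c the difference term; finiteness of I allows the absorption.\<close>
    have "Lp_integral p {0..1} g \<le> ennreal (4 * C3) * A u"
    proof (cases "ennreal C3 * A u = \<infinity>")
      case True
      have "ennreal (4 * C3) * A u = ennreal 4 * (ennreal C3 * A u)" using C3 by (simp add: ennreal_mult mult.assoc)
      then show ?thesis using True by (simp add: ennreal_mult_top)
    next
      case False
      obtain a where a: "Lp_integral p {0..1} g = ennreal a" "0 \<le> a" using gfin by (metis ennreal_cases infinity_ennreal_def less_irrefl)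
      obtain c where c: "ennreal C3 * A u = ennreal c" "0 \<le> c" using False by (metis ennreal_cases infinity_ennreal_def)
      have "ennreal a \<le> ennreal (a / 2 + 2 * c)"
        using main unfolding a(1) c(1) using a(2) c(2) by (simp add: ennreal_mult[symmetric] ennreal_plus[symmetric] del: ennreal_plus)
      then have "a \<le> a / 2 + 2 * c" using a(2) c(2) by (simp del: ennreal_plus)
      then have "a \<le> 4 * c" by simp
      then have "ennreal a \<le> ennreal 4 * ennreal c" using c(2) by (simp add: ennreal_mult[symmetric] del: ennreal_numeral)
      also have "\<dots> = ennreal (4 * C3) * A u" unfolding c(1)[symmetric] using C3 by (simp add: ennreal_mult mult.assoc)
      finally show ?thesis using a by simp
    qed
    also have "\<dots> \<le> ennreal (4 * C3) * (ennreal ((real n1 * (real M)\<^sup>2 + real n2) / \<mu>) * W)"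
      by (intro mult_left_mono Au) auto
    also have "\<dots> = ennreal (4 * C3 * (real n1 * (real M)\<^sup>2 + real n2) / \<mu>) * W"
      using C3 \<mu>0 by (subst mult.assoc[symmetric], subst ennreal_mult[symmetric]) auto
    also have "\<dots> \<le> ennreal C * W" by (intro mult_right_mono ennreal_leI) (auto simp: C_def)
    finally show ?thesis using q(1) unfolding g_def W_def by blast
  qed
  moreover have "0 < C" using C3 \<mu>0 by (auto simp: C_def intro!: add_nonneg_pos divide_nonneg_pos mult_nonneg_nonneg)
  ultimately show ?thesis by blast
qed

section \<open>Local approximation with steps proportional to \<open>\<phi>\<close>\<close>

lemma sin_ge_two_over_pi:
  fixes x :: real
  assumes "0 \<le> x" "x \<le> pi / 2"
  shows "2 / pi * x \<le> sin x"
proof -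
  have "concave_on {0..pi/2} (sin :: real \<Rightarrow> real)"
  proof (rule f''_le0_imp_concave)
    show "(sin has_real_derivative cos x) (at x)" for x :: real by (rule DERIV_sin)
    show "(cos has_real_derivative - sin x) (at x)" for x :: real by (rule DERIV_cos)
    show "- sin x \<le> 0" if "x \<in> {0..pi/2}" for x :: real using that by (simp add: sin_ge_zero)
  qed auto
  from concave_onD[OF this, of "2 / pi * x" 0 "pi / 2"] show ?thesis
    using assms by (simp add: field_simps)
qed

lemma sin_add_dist:
  fixes s t :: real
  shows "sin t \<le> sin s + \<bar>t - s\<bar>"
proof -
  have "sin t - sin s = 2 * sin ((t - s) / 2) * cos ((t + s) / 2)" by (rule sin_diff_sin)
  also have "\<dots> \<le> \<bar>2 * sin ((t - s) / 2) * cos ((t + s) / 2)\<bar>" by simp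
  also have "\<dots> = 2 * \<bar>sin ((t - s) / 2)\<bar> * \<bar>cos ((t + s) / 2)\<bar>" by (simp add: abs_mult)
  also have "\<dots> \<le> 2 * (\<bar>t - s\<bar> / 2) * 1"
    using abs_sin_x_le_abs_x[of "(t - s) / 2"] by (intro mult_mono) auto
  finally show ?thesis by simp
qed

text \<open>The product formula brings in the sine of the midpoint, which the Lipschitz bound
  compares with sin s; this retains the smallness of the increments near the endpoints.\<close>

lemma cos_diff_le:
  fixes s t :: real
  assumes "0 \<le> s" "s \<le> pi" "0 \<le> t" "t \<le> pi"
  shows "\<bar>cos t - cos s\<bar> \<le> \<bar>t - s\<bar> * (sin s + \<bar>t - s\<bar>)"
proof -
  have "cos t - cos s = 2 * sin ((t + s) / 2) * sin ((s - t) / 2)" by (rule cos_diff_cos)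
  then have "\<bar>cos t - cos s\<bar> = 2 * \<bar>sin ((t + s) / 2)\<bar> * \<bar>sin ((s - t) / 2)\<bar>" by (simp add: abs_mult)
  also have "\<dots> \<le> 2 * (sin s + \<bar>t - s\<bar>) * (\<bar>t - s\<bar> / 2)"
  proof (intro mult_mono)
    have "0 \<le> sin ((t + s) / 2)" using assms by (intro sin_ge_zero) auto
    then show "\<bar>sin ((t + s) / 2)\<bar> \<le> sin s + \<bar>t - s\<bar>"
      using sin_add_dist[of "(t + s) / 2" s] by (simp add: abs_if field_simps split: if_splits)
    show "\<bar>sin ((s - t) / 2)\<bar> \<le> \<bar>t - s\<bar> / 2"
      using abs_sin_x_le_abs_x[of "(s - t) / 2"] by simp
    show "0 \<le> 2 * (sin s + \<bar>t - s\<bar>)" using assms by (simp add: sin_ge_zero)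
  qed auto
  also have "\<dots> = \<bar>t - s\<bar> * (sin s + \<bar>t - s\<bar>)" by simp
  finally show ?thesis .
qed

lemma phi_cos: "0 \<le> t \<Longrightarrow> t \<le> pi \<Longrightarrow> phi (cos t) = sin t"
  by (simp add: phi_def sin_ge_zero flip: sin_squared_eq)

lemma phi_nonneg: "x \<in> {-1..1} \<Longrightarrow> 0 \<le> phi x"
  by (auto simp: phi_def abs_square_le_1)

lemma rho_cos: "0 \<le> t \<Longrightarrow> t \<le> pi \<Longrightarrow> rho n (cos t) = sin t / real n + 1 / (real n)\<^sup>2"
  by (simp add: rho_def phi_cos)

lemma rho_pos: "x \<in> {-1..1} \<Longrightarrow> 1 \<le> n \<Longrightarrow> 0 < rho n x"
  unfolding rho_def by (intro add_nonneg_pos divide_nonneg_nonneg phi_nonneg) auto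

text \<open>The sine is 1-Lipschitz, so the first summand of \<open>rho\<close> changes by at most d
  / n^2, which the second summand absorbs: in the angle, \<open>rho\<close> varies slowly on the
  scale 1 / n.\<close>

lemma rho_cos_le:
  assumes "0 \<le> s" "s \<le> pi" "0 \<le> t" "t \<le> pi" "1 \<le> n" "real n * \<bar>t - s\<bar> \<le> d"
  shows "rho n (cos t) \<le> rho n (cos s) * (1 + d)"
proof -
  have d0: "0 \<le> d" using assms(6) by (rule order.trans[rotated]) simp
  have "\<bar>t - s\<bar> \<le> d / real n" using assms(5,6) by (simp add: field_simps)
  then have "sin t \<le> sin s + d / real n" using sin_add_dist[of t s] by linarith
  then have "sin t / real n \<le> (sin s + d / real n) / real n" by (intro divide_right_mono) auto
  then have "rho n (cos t) \<le> sin s / real n + 1 / (real n)\<^sup>2 + d * (1 / (real n)\<^sup>2)"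
    using assms by (simp add: rho_cos add_divide_distrib power2_eq_square)
  also have "\<dots> \<le> sin s / real n + 1 / (real n)\<^sup>2 + d * (sin s / real n + 1 / (real n)\<^sup>2)"
    using assms d0 by (intro add_left_mono mult_left_mono) (auto simp: sin_ge_zero)
  finally show ?thesis unfolding rho_cos[OF assms(1,2), symmetric] by (simp add: algebra_simps)
qed

lemma cos_diff_le_rho:
  assumes "0 \<le> s" "s \<le> pi" "0 \<le> t" "t \<le> pi" "1 \<le> n" "real n * \<bar>t - s\<bar> \<le> d"
  shows "\<bar>cos t - cos s\<bar> \<le> rho n (cos s) * (d * (1 + d))"
proof -
  have d0: "0 \<le> d" using assms(6) by (rule order.trans[rotated]) simp
  have n: "0 < real n" using assms by simp
  have ts: "\<bar>t - s\<bar> \<le> d / real n" using assms(6) n by (simp add: field_simps)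
  have s0: "0 \<le> sin s" using assms by (simp add: sin_ge_zero)
  have "\<bar>cos t - cos s\<bar> \<le> \<bar>t - s\<bar> * (sin s + \<bar>t - s\<bar>)" using cos_diff_le assms by simp
  also have "\<dots> \<le> d / real n * (sin s + d / real n)"
    using ts s0 d0 by (intro mult_mono) auto
  also have "\<dots> = d * (sin s / real n) + d * d * (1 / (real n)\<^sup>2)"
    by (simp add: power2_eq_square add_divide_distrib distrib_left)
  also have "\<dots> \<le> d * (sin s / real n + 1 / (real n)\<^sup>2) + d * d * (sin s / real n + 1 / (real n)\<^sup>2)"
    using s0 d0 by (intro add_mono mult_left_mono) auto
  finally show ?thesis unfolding rho_cos[OF assms(1,2), symmetric] by (simp add: algebra_simps)
qed

text \<open>With midpoint m and half-length h the length is 2 sin m sin h, where 1 / n \<le> sin h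
  \<le> sin m; thus sin m is comparable with sin t + 1 / n on the whole interval, also next to the
  endpoints. One or two angular steps are allowed because the local polynomials live on up to two
  cells.\<close>

lemma cos_interval_length:
  assumes ab: "0 \<le> a" "b \<le> pi" and n: "1 \<le> n" and len: "pi / real n \<le> b - a" "b - a \<le> 2 * pi / real n"
    and t: "a \<le> t" "t \<le> b"
  shows "rho n (cos t) \<le> 3 * (cos a - cos b)" "cos a - cos b \<le> 46 * rho n (cos t)"
proof -
  define m where "m = (a + b) / 2"
  define h where "h = (b - a) / 2"
  have n0: "0 < real n" using n by simp
  have h0: "0 < h" "pi / (2 * real n) \<le> h" "h \<le> pi / real n"
  proof -
    have "0 < pi / real n" using n0 by simp
    then have "0 < b - a" using len by linarith
    then show "0 < h" "pi / (2 * real n) \<le> h" "h \<le> pi / real n"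
      using len n0 by (auto simp: h_def field_simps)
  qed
  have hm: "h \<le> m" "m \<le> pi - h" "h \<le> pi / 2" using ab h0 by (auto simp: h_def m_def field_simps)
  have sinh_le: "sin h \<le> sin m"
  proof (cases "m \<le> pi / 2")
    case True
    then show ?thesis using hm h0 by (intro sin_mono_le_eq[THEN iffD2]) auto
  next
    case False
    have "sin h \<le> sin (pi - m)" using hm h0 False by (intro sin_mono_le_eq[THEN iffD2]) auto
    then show ?thesis by simp
  qed
  have sinh_ge: "1 / real n \<le> sin h"
  proof -
    have "2 / pi * (pi / (2 * real n)) \<le> 2 / pi * h" using h0 by (intro mult_left_mono) auto
    also have "\<dots> \<le> sin h" using h0 hm by (intro sin_ge_two_over_pi) auto
    finally show ?thesis by simp
  qed
  have sm0: "0 < sin m" "1 / real n \<le> sin m" using sinh_le sinh_ge n0 by (auto intro: order.strict_trans2[of 0 "1 / real n"])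
  have len_eq: "cos a - cos b = 2 * sin m * sin h"
    by (simp add: cos_diff_cos m_def h_def)
  have tm: "\<bar>t - m\<bar> \<le> h" using t by (auto simp: m_def h_def abs_if field_simps)
  have hle: "h \<le> pi * sin m"
  proof -
    have "h \<le> pi * (1 / real n)" using h0 by simp
    also have "\<dots> \<le> pi * sin m" using sm0 by (intro mult_left_mono) auto
    finally show ?thesis .
  qed
  have pi4: "pi < 4" using pi_less_4 .
  have "sin t \<le> sin m + h" using sin_add_dist[of t m] tm by simp
  also have "\<dots> \<le> 5 * sin m"
  proof -
    have "pi * sin m \<le> 4 * sin m" using pi4 sm0 by (intro mult_right_mono) auto
    then show ?thesis using hle by simp
  qed
  finally have st: "sin t \<le> 5 * sin m" .
  have "rho n (cos t) \<le> 5 * sin m / real n + sin m / real n"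
  proof -
    have "1 / (real n)\<^sup>2 = 1 / real n / real n" by (simp add: power2_eq_square)
    also have "\<dots> \<le> sin m / real n" using sm0 by (intro divide_right_mono) auto
    moreover have "sin t / real n \<le> 5 * sin m / real n" using st by (intro divide_right_mono) auto
    moreover have "rho n (cos t) = sin t / real n + 1 / (real n)\<^sup>2" using ab t by (intro rho_cos) auto
    ultimately show ?thesis by linarith
  qed
  also have "\<dots> = 6 * sin m * (1 / real n)" by (simp add: field_simps)
  also have "\<dots> \<le> 6 * sin m * sin h" using sinh_ge sm0 by (intro mult_left_mono) auto
  finally show "rho n (cos t) \<le> 3 * (cos a - cos b)" by (simp add: len_eq)
  have s0: "0 \<le> sin t" using ab t by (intro sin_ge_zero) auto
  have "cos a - cos b \<le> 2 * (sin t + 4 / real n) * (4 / real n)"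
    unfolding len_eq
  proof (intro mult_mono)
    have "h \<le> 4 / real n" using h0(3) pi4 n0 by (smt (verit) divide_right_mono)
    then show "sin m \<le> sin t + 4 / real n" using sin_add_dist[of m t] tm by simp
    have "sin h \<le> h" using h0 by (intro sin_x_le_x) auto
    then show "sin h \<le> 4 / real n" using \<open>h \<le> 4 / real n\<close> by simp
  qed (use s0 sinh_ge n0 sm0 in \<open>auto intro: order.trans[of 0 "1 / real n"]\<close>)
  also have "\<dots> = 8 * (sin t / real n) + 32 * (1 / (real n)\<^sup>2)"
    by (simp add: power2_eq_square add_divide_distrib distrib_left distrib_right)
  also have "\<dots> \<le> 46 * (sin t / real n) + 46 * (1 / (real n)\<^sup>2)"
    using s0 by (intro add_mono mult_right_mono) auto
  finally show "cos a - cos b \<le> 46 * rho n (cos t)" using ab t by (simp add: rho_cos)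
qed

section \<open>Whitney's inequality on intervals of any length\<close>

lemma Lp_integral_scale:
  assumes [measurable]: "g \<in> borel_measurable borel" and "0 < l"
  shows "Lp_integral p {a..a + l} g = ennreal l * Lp_integral p {0..1} (\<lambda>x. g (a + l * x))"
proof -
  have "indicator {a..a + l} (a + l * x) = (indicator {0..1} x :: ennreal)" for x
    using assms(2) by (auto simp: zero_le_mult_iff split: split_indicator)
  then show ?thesis
    unfolding Lp_integral_def using assms(2) by (subst nn_integral_real_affine[where c = l and t = a]) auto
qed

lemma fwd_diff_scale: "fwd_diff r s (\<lambda>x. f (a + l * x)) y = fwd_diff r (l * s) f (a + l * y)"
  by (simp add: fwd_diff_def algebra_simps)

lemma fwd_diff_integral_measurable [measurable]:
  assumes [measurable]: "f \<in> borel_measurable borel"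
  shows "(\<lambda>s. \<integral>\<^sup>+y\<in>{a..b - real r * s}. ennreal (\<bar>fwd_diff r s f y\<bar> powr p) \<partial>lborel) \<in> borel_measurable borel"
  unfolding indicator_def atLeastAtMost_iff by measurable

text \<open>Both the step and the position scale by l, hence the factor l * l; the proportion
  \<kappa> of the step to the interval is invariant.\<close>

lemma diff_integral_scale:
  assumes [measurable]: "f \<in> borel_measurable borel" and l: "0 < l"
  shows "diff_integral r p (\<kappa> * l) a (a + l) f = ennreal (l * l) * diff_integral r p \<kappa> 0 1 (\<lambda>x. f (a + l * x))"
proof -
  have inner: "(\<integral>\<^sup>+y\<in>{a..a + l - real r * (l * s)}. ennreal (\<bar>fwd_diff r (l * s) f y\<bar> powr p) \<partial>lborel)
      = ennreal l * (\<integral>\<^sup>+y\<in>{0..1 - real r * s}. ennreal (\<bar>fwd_diff r s (\<lambda>x. f (a + l * x)) y\<bar> powr p) \<partial>lborel)" for s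
  proof -
    have "indicator {a..a + l - real r * (l * s)} (a + l * y) = (indicator {0..1 - real r * s} y :: ennreal)" for y
    proof -
      have "l * y \<le> l - real r * (l * s) \<longleftrightarrow> l * y \<le> l * (1 - real r * s)" by (simp add: algebra_simps)
      then have "l * y \<le> l - real r * (l * s) \<longleftrightarrow> y \<le> 1 - real r * s" using l by simp
      then show ?thesis using l by (auto simp: zero_le_mult_iff split: split_indicator)
    qed
    then show ?thesis
      unfolding fwd_diff_scale using l by (subst nn_integral_real_affine[where c = l and t = a]) auto
  qed
  have "diff_integral r p (\<kappa> * l) a (a + l) f = ennreal \<bar>l\<bar> *
     (\<integral>\<^sup>+s. (\<integral>\<^sup>+y\<in>{a..a + l - real r * (0 + l * s)}. ennreal (\<bar>fwd_diff r (0 + l * s) f y\<bar> powr p) \<partial>lborel) * indicator {0<..\<kappa> * l} (0 + l * s) \<partial>lborel)"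
    unfolding diff_integral_def using l by (intro nn_integral_real_affine) measurable
  also have "\<dots> = ennreal l * (\<integral>\<^sup>+s. ennreal l * ((\<integral>\<^sup>+y\<in>{0..1 - real r * s}. ennreal (\<bar>fwd_diff r s (\<lambda>x. f (a + l * x)) y\<bar> powr p) \<partial>lborel) * indicator {0<..\<kappa>} s) \<partial>lborel)"
  proof -
    have "indicator {0<..\<kappa> * l} (0 + l * s) = (indicator {0<..\<kappa>} s :: ennreal)" for s
      using l by (auto simp: zero_less_mult_iff mult.commute split: split_indicator)
    then show ?thesis using l unfolding add_0_left inner by (simp add: mult.assoc)
  qed
  also have "\<dots> = ennreal (l * l) * diff_integral r p \<kappa> 0 1 (\<lambda>x. f (a + l * x))"
    unfolding diff_integral_def using l by (subst nn_integral_cmult) (auto simp: ennreal_mult mult.assoc)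
  finally show ?thesis .
qed

text \<open>Rescaling gives one factor l from the error integral and l^2 from the difference
  integral, which leaves C / l.\<close>

lemma whitney_interval:
  assumes r: "1 \<le> r" and p: "0 < p" and \<kappa>: "0 < \<kappa>"
  shows "\<exists>C>0. \<forall>f\<in>borel_measurable borel. \<forall>a l. 0 < l \<longrightarrow> Lp_integral p {a..a + l} f < \<infinity> \<longrightarrow>
     (\<exists>q. degree q < r \<and> Lp_integral p {a..a + l} (\<lambda>x. f x - poly q x) \<le> ennreal (C / l) * diff_integral r p (\<kappa> * l) a (a + l) f)"
proof -
  obtain C where C: "C > 0" "\<And>f. f \<in> borel_measurable borel \<Longrightarrow> Lp_integral p {0..1} f < \<infinity> \<Longrightarrow>
     (\<exists>q. degree q < r \<and> Lp_integral p {0..1} (\<lambda>x. f x - poly q x) \<le> ennreal C * diff_integral r p \<kappa> 0 1 f)"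
    using whitney_unit[OF assms] by metis
  have "\<exists>q. degree q < r \<and> Lp_integral p {a..a + l} (\<lambda>x. f x - poly q x) \<le> ennreal (C / l) * diff_integral r p (\<kappa> * l) a (a + l) f"
    if f[measurable]: "f \<in> borel_measurable borel" and l: "0 < l" and fin: "Lp_integral p {a..a + l} f < \<infinity>" for f a l
  proof -
    have "Lp_integral p {0..1} (\<lambda>x. f (a + l * x)) < \<infinity>"
      using fin l unfolding Lp_integral_scale[OF f l] by (auto simp: ennreal_mult_less_top less_top)
    then obtain Q where Q: "degree Q < r" "Lp_integral p {0..1} (\<lambda>x. f (a + l * x) - poly Q x) \<le> ennreal C * diff_integral r p \<kappa> 0 1 (\<lambda>x. f (a + l * x))"
      using C(2)[of "\<lambda>x. f (a + l * x)"] by auto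
    define q where "q = pcompose Q [:- a / l, 1 / l:]"
    have pq: "poly q (a + l * x) = poly Q x" for x
    proof -
      have "- (a / l) + (a + l * x) / l = x" using l by (simp add: field_simps)
      then show ?thesis by (simp add: q_def poly_pcompose)
    qed
    have [measurable]: "poly q \<in> borel_measurable borel"
      by (intro borel_measurable_continuous_onI continuous_intros)
    have "Lp_integral p {a..a + l} (\<lambda>x. f x - poly q x) = ennreal l * Lp_integral p {0..1} (\<lambda>x. f (a + l * x) - poly Q x)"
      using l by (subst Lp_integral_scale) (auto simp: pq)
    also have "\<dots> \<le> ennreal l * (ennreal C * diff_integral r p \<kappa> 0 1 (\<lambda>x. f (a + l * x)))"
      using Q(2) by (intro mult_left_mono) auto
    also have "\<dots> = ennreal (l * C) * diff_integral r p \<kappa> 0 1 (\<lambda>x. f (a + l * x))"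
      using l C(1) by (simp add: ennreal_mult mult.assoc)
    also have "l * C = C / l * (l * l)" using l by simp
    also have "ennreal (C / l * (l * l)) * diff_integral r p \<kappa> 0 1 (\<lambda>x. f (a + l * x)) = ennreal (C / l) * diff_integral r p (\<kappa> * l) a (a + l) f"
      unfolding diff_integral_scale[OF f l] using l C(1) by (subst ennreal_mult) (auto simp: mult.assoc)
    finally show ?thesis using Q(1) l by (intro exI[of _ q]) (auto simp: q_def degree_pcompose)
  qed
  then show ?thesis using C(1) by blast
qed

section \<open>From free steps to steps proportional to \<open>phi\<close>\<close>

lemma symm_difference_eq_fwd_diff:
  assumes "x - real r * s / 2 \<in> {-1..1}" "x + real r * s / 2 \<in> {-1..1}"
  shows "symm_difference r s f x = fwd_diff r s f (x - real r * s / 2)"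
  using assms by (simp add: symm_difference_def fwd_diff_def)

lemma phi_measurable [measurable]: "phi \<in> borel_measurable borel"
  unfolding phi_def by measurable

lemma symm_difference_measurable [measurable]:
  assumes [measurable]: "f \<in> borel_measurable borel" "a \<in> borel_measurable M" "b \<in> borel_measurable M"
  shows "(\<lambda>x. symm_difference r (a x) f (b x)) \<in> borel_measurable M"
  unfolding symm_difference_def atLeastAtMost_iff by measurable

lemma fwd_diff_integral_centered:
  fixes \<Phi> :: "real \<Rightarrow> ennreal"
  assumes [measurable]: "f \<in> borel_measurable borel" "\<Phi> \<in> borel_measurable borel"
  shows "(\<integral>\<^sup>+y\<in>{a..b - real r * s}. \<Phi> (fwd_diff r s f y) \<partial>lborel)
    = (\<integral>\<^sup>+x\<in>{a + real r * s / 2..b - real r * s / 2}. \<Phi> (fwd_diff r s f (x - real r * s / 2)) \<partial>lborel)"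
proof -
  have "indicator {a..b - real r * s} (- (real r * s / 2) + 1 * x) = (indicator {a + real r * s / 2..b - real r * s / 2} x :: ennreal)" for x
    by (auto simp: field_simps split: split_indicator)
  then show ?thesis
    by (subst nn_integral_real_affine[where c = 1 and t = "- (real r * s / 2)"]) (auto simp: algebra_simps)
qed

lemma nn_integral_scale_interval:
  fixes g :: "real \<Rightarrow> ennreal"
  assumes [measurable]: "g \<in> borel_measurable borel" and c: "0 \<le> c"
  shows "(\<integral>\<^sup>+s\<in>{0<..t * c}. g s \<partial>lborel) = ennreal c * (\<integral>\<^sup>+h\<in>{0<..t}. g (h * c) \<partial>lborel)"
proof (cases "c = 0")
  case False
  then have c0: "0 < c" using c by simp
  have "indicator {0<..t * c} (0 + c * h) = (indicator {0<..t} h :: ennreal)" for h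
    using c0 by (auto simp: zero_less_mult_iff mult.commute split: split_indicator)
  then show ?thesis
    using c0 by (subst nn_integral_real_affine[where c = c and t = 0]) (auto simp: mult.commute)
qed simp

text \<open>
  A step \<open>s\<close> that fits into the interval is automatically of the form \<open>h \<phi>(x)\<close> with \<open>h \<le> \<theta>/n\<close>:
  away from the endpoints \<open>\<phi>(x)\<close> is comparable with \<open>n \<rho>\<^sub>n(x)\<close>, and near an endpoint the condition
  \<open>x \<plusminus> rs/2 \<in> [-1, 1]\<close> gives \<open>\<phi>(x)\<^sup>2 \<ge> s/2\<close>.
\<close>

lemma step_le_phi:
  assumes \<theta>: "0 < \<theta>" "\<theta> \<le> 1" and n: "1 \<le> n" and r: "1 \<le> r" and s: "0 < s" "s \<le> \<theta>\<^sup>2 / 4 * rho n x"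
    and x: "x - real r * s / 2 \<in> {-1..1}" "x + real r * s / 2 \<in> {-1..1}"
  shows "s \<le> \<theta> / real n * phi x"
proof (cases "1 / real n \<le> phi x")
  case True
  have n0: "0 < real n" using n by simp
  have "1 / (real n)\<^sup>2 \<le> phi x / real n"
    using divide_right_mono[OF True, of "real n"] n0 by (simp add: power2_eq_square)
  then have "rho n x \<le> 2 * (phi x / real n)" by (simp add: rho_def)
  moreover have "0 \<le> phi x / real n" using True n0 by (smt (verit) divide_nonneg_pos zero_less_divide_1_iff)
  moreover have "\<theta>\<^sup>2 \<le> \<theta>" using \<theta> by (simp add: power2_eq_square mult_left_le)
  ultimately have "\<theta>\<^sup>2 / 4 * rho n x \<le> \<theta> / 4 * (2 * (phi x / real n))"
    using \<theta> \<open>0 \<le> phi x / real n\<close> by (intro mult_mono) (auto simp: rho_def)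
  also have "\<dots> = \<theta> * (phi x / real n) / 2" by (simp add: field_simps)
  also have "\<dots> \<le> \<theta> * (phi x / real n)"
  proof -
    have "a / 2 \<le> a" if "0 \<le> a" for a :: real using that by simp
    then show ?thesis using \<theta> \<open>0 \<le> phi x / real n\<close> by (meson less_imp_le mult_nonneg_nonneg)
  qed
  finally have "\<theta>\<^sup>2 / 4 * rho n x \<le> \<theta> * (phi x / real n)" .
  from order.trans[OF s(2) this] show ?thesis by simp
next
  case False
  have n0: "0 < real n" using n by simp
  have s2: "s \<le> real r * s" using r s by simp
  have ax: "\<bar>x\<bar> \<le> 1 - s / 2" using x s2 by (auto simp: abs_if)
  have "s / 2 * 1 \<le> (1 - \<bar>x\<bar>) * (1 + \<bar>x\<bar>)" using ax s by (intro mult_mono) auto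
  also have "\<dots> = (phi x)\<^sup>2"
  proof -
    have "x\<^sup>2 \<le> 1" using ax s by (simp add: abs_square_le_1)
    then show ?thesis by (simp add: phi_def algebra_simps power2_eq_square flip: power2_abs)
  qed
  finally have ph: "s / 2 \<le> (phi x)\<^sup>2" by simp
  have ph0: "0 \<le> phi x" using ax s by (intro phi_nonneg) (auto simp: abs_if split: if_splits)
  have "rho n x \<le> 2 / (real n)\<^sup>2"
    using divide_right_mono[of "phi x" "1 / real n" "real n"] False n0 by (simp add: rho_def power2_eq_square)
  then have "\<theta>\<^sup>2 / 4 * rho n x \<le> \<theta>\<^sup>2 / 4 * (2 / (real n)\<^sup>2)" by (intro mult_left_mono) auto
  then have "s \<le> \<theta>\<^sup>2 / (real n)\<^sup>2 / 2" using s by simp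
  \<comment> \<open>The smallness of s is multiplied by s / 2 \<le> phi(x)^2 and a root is taken;
    this root is the reason for the square of \<theta> in the hypothesis.\<close>
  then have "s * s \<le> \<theta>\<^sup>2 / (real n)\<^sup>2 / 2 * s" using s by (intro mult_right_mono) auto
  also have "\<dots> = \<theta>\<^sup>2 / (real n)\<^sup>2 * (s / 2)" by simp
  also have "\<dots> \<le> \<theta>\<^sup>2 / (real n)\<^sup>2 * (phi x)\<^sup>2" using ph by (intro mult_left_mono) auto
  finally have "s\<^sup>2 \<le> (\<theta> / real n * phi x)\<^sup>2" by (simp add: power_mult_distrib power_divide power2_eq_square mult_ac)
  then show ?thesis by (rule power2_le_imp_le) (use ph0 \<theta> in \<open>simp\<close>)
qed

text \<open>An arbitrary \<Phi> is carried along so that one transfer serves p-th powers for finite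
  p and indicators of level sets for p = \<infinity>. After exchanging the integrals, the
  substitution s = h phi(x) is made for each x separately; its Jacobian phi(x) is at most 3 n times
  the length of the interval.\<close>

lemma difference_transfer:
  fixes \<Phi> :: "real \<Rightarrow> ennreal"
  assumes r: "1 \<le> r" and \<theta>: "0 < \<theta>" "\<theta> \<le> 1" and n: "1 \<le> n"
    and f[measurable]: "f \<in> borel_measurable borel" and \<Phi>[measurable]: "\<Phi> \<in> borel_measurable borel"
    and ab: "0 \<le> a" "b \<le> pi" "pi / real n \<le> b - a" "b - a \<le> 2 * pi / real n"
  shows "(\<integral>\<^sup>+s\<in>{0<..\<theta>\<^sup>2 / 184 * (cos a - cos b)}. (\<integral>\<^sup>+y\<in>{cos b..cos a - real r * s}. \<Phi> (fwd_diff r s f y) \<partial>lborel) \<partial>lborel)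
    \<le> ennreal (3 * real n * (cos a - cos b)) *
      (\<integral>\<^sup>+h\<in>{0<..\<theta> / real n}. (\<integral>\<^sup>+x\<in>{cos b..cos a}. \<Phi> (symm_difference r (h * phi x) f x) \<partial>lborel) \<partial>lborel)"
    (is "?lhs \<le> _")
proof -
  \<comment> \<open>184 = 4 * 46: the comparison of the length with \<open>rho\<close> turns s \<le>
    \<kappa> l into s \<le> \<theta>^2 / 4 * rho, as \<open>step_le_phi\<close> requires.\<close>
  define \<kappa> where "\<kappa> = \<theta>\<^sup>2 / 184"
  have \<kappa>0: "0 < \<kappa>" using \<theta> by (simp add: \<kappa>_def)
  define J where "J = {cos b..cos a}"
  define l where "l = cos a - cos b"
  have n0: "0 < real n" using n by simp
  have "0 < pi / real n" using n0 by simp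
  then have ab': "a < b" using ab by linarith
  have l0: "0 < l" unfolding l_def using ab ab' cos_monotone_0_pi[of a b] by simp
  have J01: "J \<subseteq> {-1..1}" by (auto simp: J_def intro: order.trans[OF cos_ge_minus_one] order.trans[OF _ cos_le_one])
  have rhoJ: "rho n x \<le> 3 * l" "l \<le> 46 * rho n x" if "x \<in> J" for x
  proof -
    have x1: "-1 \<le> x" "x \<le> 1" using that J01 by auto
    have "a \<le> arccos x"
    proof -
      have "arccos (cos a) \<le> arccos x" using that x1 by (intro arccos_le_arccos) (auto simp: J_def)
      then show ?thesis using ab ab' by (simp add: arccos_cos)
    qed
    moreover have "arccos x \<le> b"
    proof -
      have "arccos x \<le> arccos (cos b)" using that x1 by (intro arccos_le_arccos) (auto simp: J_def)
      then show ?thesis using ab ab' by (simp add: arccos_cos)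
    qed
    ultimately show "rho n x \<le> 3 * l" "l \<le> 46 * rho n x"
      using cos_interval_length[OF ab(1,2) n ab(3,4), of "arccos x"] x1 by (simp_all add: l_def)
  qed
  define D where "D s x = \<Phi> (symm_difference r s f x)" for s x
  have D_meas [measurable]: "(\<lambda>x. D (a x) (b x)) \<in> borel_measurable M"
    if [measurable]: "a \<in> borel_measurable M" "b \<in> borel_measurable M" for a b and M :: "'z measure"
    unfolding D_def by measurable
  have [measurable]: "J \<in> sets borel" by (simp add: J_def)
  \<comment> \<open>The constraint that the whole difference fits into the interval is exchanged for
    the bound s \<le> \<theta> / n * phi x.\<close>
  have "?lhs
     \<le> (\<integral>\<^sup>+s. (\<integral>\<^sup>+x. D s x * indicator {0<..\<theta> / real n * phi x} s * indicator J x \<partial>lborel) \<partial>lborel)"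
  proof -
    have "?lhs
      = (\<integral>\<^sup>+s. (\<integral>\<^sup>+x\<in>{cos b + real r * s / 2..cos a - real r * s / 2}. \<Phi> (fwd_diff r s f (x - real r * s / 2)) \<partial>lborel) * indicator {0<..\<kappa> * l} s \<partial>lborel)"
      unfolding \<kappa>_def l_def by (subst fwd_diff_integral_centered) auto
    also have "\<dots> \<le> (\<integral>\<^sup>+s. (\<integral>\<^sup>+x. D s x * indicator {0<..\<theta> / real n * phi x} s * indicator J x \<partial>lborel) \<partial>lborel)"
    proof (rule nn_integral_mono)
      fix s :: real
      show "(\<integral>\<^sup>+x\<in>{cos b + real r * s / 2..cos a - real r * s / 2}. \<Phi> (fwd_diff r s f (x - real r * s / 2)) \<partial>lborel) * indicator {0<..\<kappa> * l} s
        \<le> (\<integral>\<^sup>+x. D s x * indicator {0<..\<theta> / real n * phi x} s * indicator J x \<partial>lborel)"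
      proof (cases "s \<in> {0<..\<kappa> * l}")
        case True
        have "(\<integral>\<^sup>+x\<in>{cos b + real r * s / 2..cos a - real r * s / 2}. \<Phi> (fwd_diff r s f (x - real r * s / 2)) \<partial>lborel)
          \<le> (\<integral>\<^sup>+x. D s x * indicator {0<..\<theta> / real n * phi x} s * indicator J x \<partial>lborel)"
        proof (rule nn_integral_mono)
          fix x :: real
          show "\<Phi> (fwd_diff r s f (x - real r * s / 2)) * indicator {cos b + real r * s / 2..cos a - real r * s / 2} x
            \<le> D s x * indicator {0<..\<theta> / real n * phi x} s * indicator J x"
          proof (cases "x \<in> {cos b + real r * s / 2..cos a - real r * s / 2}")
            case x: True
            have rs: "0 \<le> real r * s / 2" using True by simp
            have "x - real r * s / 2 \<in> J" "x + real r * s / 2 \<in> J" "x \<in> J" using x rs by (auto simp: J_def)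
            then have xi: "x - real r * s / 2 \<in> {-1..1}" "x + real r * s / 2 \<in> {-1..1}" and xJ: "x \<in> J" using J01 by blast+
            have "s \<le> \<kappa> * l" using True by simp
            also have "\<dots> \<le> \<kappa> * (46 * rho n x)" using rhoJ(2)[OF xJ] \<kappa>0 by (intro mult_left_mono) auto
            finally have "s \<le> \<kappa> * (46 * rho n x)" .
            then have "s \<le> \<theta>\<^sup>2 / 4 * rho n x" by (simp add: \<kappa>_def mult.commute)
            then have "s \<le> \<theta> / real n * phi x" using True by (intro step_le_phi[OF \<theta> n r _ _ xi]) auto
            then show ?thesis using True x xJ by (simp add: D_def symm_difference_eq_fwd_diff[OF xi])
          qed simp
        qed
        then show ?thesis using True by simp
      qed simp
    qed
    finally show ?thesis .
  qed
  also have "\<dots> = (\<integral>\<^sup>+x. (\<integral>\<^sup>+s. D s x * indicator {0<..\<theta> / real n * phi x} s * indicator J x \<partial>lborel) \<partial>lborel)"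
  proof -
    have m: "(\<lambda>(x, s). D s x * indicator {0<..\<theta> / real n * phi x} s * indicator J x) \<in> borel_measurable (lborel \<Otimes>\<^sub>M lborel)"
      unfolding indicator_def greaterThanAtMost_iff by measurable
    show ?thesis using lborel_pair.Fubini'[OF m] by simp
  qed
  also have "\<dots> = (\<integral>\<^sup>+x\<in>J. (\<integral>\<^sup>+s\<in>{0<..\<theta> / real n * phi x}. D s x \<partial>lborel) \<partial>lborel)"
    by (rule nn_integral_cong, rule nn_integral_multc) measurable
  also have "\<dots> \<le> (\<integral>\<^sup>+x\<in>J. ennreal (3 * real n * l) * (\<integral>\<^sup>+h\<in>{0<..\<theta> / real n}. D (h * phi x) x \<partial>lborel) \<partial>lborel)"
  proof (intro nn_integral_mono, rule mult_indicator_mono)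
    fix x assume x: "x \<in> J"
    have ph0: "0 \<le> phi x" using x J01 by (intro phi_nonneg) auto
    have "phi x \<le> real n * rho n x" using n0 by (simp add: rho_def distrib_left power2_eq_square)
    also have "\<dots> \<le> real n * (3 * l)" using rhoJ(1)[OF x] n0 by (intro mult_left_mono) auto
    finally have "phi x \<le> 3 * real n * l" by simp
    then show "(\<integral>\<^sup>+s\<in>{0<..\<theta> / real n * phi x}. D s x \<partial>lborel) \<le> ennreal (3 * real n * l) * (\<integral>\<^sup>+h\<in>{0<..\<theta> / real n}. D (h * phi x) x \<partial>lborel)"
      using ph0 by (subst nn_integral_scale_interval) (auto intro!: mult_right_mono ennreal_leI)
  qed
  also have "\<dots> = ennreal (3 * real n * l) * (\<integral>\<^sup>+x\<in>J. (\<integral>\<^sup>+h\<in>{0<..\<theta> / real n}. D (h * phi x) x \<partial>lborel) \<partial>lborel)"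
    by (simp add: mult.assoc nn_integral_cmult)
  also have "(\<integral>\<^sup>+x\<in>J. (\<integral>\<^sup>+h\<in>{0<..\<theta> / real n}. D (h * phi x) x \<partial>lborel) \<partial>lborel) = (\<integral>\<^sup>+h\<in>{0<..\<theta> / real n}. (\<integral>\<^sup>+x\<in>J. D (h * phi x) x \<partial>lborel) \<partial>lborel)"
    by (rule nn_integral_set_swap) auto
  finally have "?lhs \<le> ennreal (3 * real n * l) * (\<integral>\<^sup>+h\<in>{0<..\<theta> / real n}. (\<integral>\<^sup>+x\<in>J. D (h * phi x) x \<partial>lborel) \<partial>lborel)" .
  then show ?thesis unfolding D_def J_def l_def .
qed

text \<open>The factor C / l of Whitney's inequality cancels the length in the transfer and leaves
  n; then n \<le> n / \<theta> gives the integral over h the form of an average.\<close>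

lemma local_approximation:
  assumes r: "1 \<le> r" and p: "0 < p" and \<theta>: "0 < \<theta>" "\<theta> \<le> 1"
  shows "\<exists>C>0. \<forall>f\<in>borel_measurable borel. \<forall>n a b. 1 \<le> n \<longrightarrow> 0 \<le> a \<longrightarrow> b \<le> pi \<longrightarrow>
     pi / real n \<le> b - a \<longrightarrow> b - a \<le> 2 * pi / real n \<longrightarrow> Lp_integral p {cos b..cos a} f < \<infinity> \<longrightarrow>
     (\<exists>q. degree q < r \<and> Lp_integral p {cos b..cos a} (\<lambda>x. f x - poly q x) \<le> ennreal C * (ennreal (real n / \<theta>) *
        (\<integral>\<^sup>+h\<in>{0<..\<theta> / real n}. (\<integral>\<^sup>+x\<in>{cos b..cos a}. ennreal (\<bar>symm_difference r (h * phi x) f x\<bar> powr p) \<partial>lborel) \<partial>lborel)))"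
proof -
  define \<kappa> where "\<kappa> = \<theta>\<^sup>2 / 184"
  have \<kappa>0: "0 < \<kappa>" using \<theta> by (simp add: \<kappa>_def)
  obtain C where C: "C > 0" and whitney: "\<forall>f\<in>borel_measurable borel. \<forall>a l. 0 < l \<longrightarrow> Lp_integral p {a..a + l} f < \<infinity> \<longrightarrow>
     (\<exists>q. degree q < r \<and> Lp_integral p {a..a + l} (\<lambda>x. f x - poly q x) \<le> ennreal (C / l) * diff_integral r p (\<kappa> * l) a (a + l) f)"
    using whitney_interval[OF r p \<kappa>0] by (elim exE conjE)
  have "\<exists>q. degree q < r \<and> Lp_integral p {cos b..cos a} (\<lambda>x. f x - poly q x) \<le> ennreal (3 * C) * (ennreal (real n / \<theta>) *
        (\<integral>\<^sup>+h\<in>{0<..\<theta> / real n}. (\<integral>\<^sup>+x\<in>{cos b..cos a}. ennreal (\<bar>symm_difference r (h * phi x) f x\<bar> powr p) \<partial>lborel) \<partial>lborel))"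
    if f[measurable]: "f \<in> borel_measurable borel" and n: "1 \<le> n" and ab: "0 \<le> a" "b \<le> pi" "pi / real n \<le> b - a" "b - a \<le> 2 * pi / real n"
      and fin: "Lp_integral p {cos b..cos a} f < \<infinity>" for f n a b
  proof -
    define J where "J = {cos b..cos a}"
    define l where "l = cos a - cos b"
    have n0: "0 < real n" using n by simp
    have "0 < pi / real n" using n0 by simp
    then have ab': "a < b" using ab by linarith
    have l0: "0 < l" unfolding l_def using ab ab' cos_monotone_0_pi[of a b] by simp
    obtain q where q: "degree q < r" "Lp_integral p J (\<lambda>x. f x - poly q x) \<le> ennreal (C / l) * diff_integral r p (\<kappa> * l) (cos b) (cos a) f"
      using whitney[rule_format, OF f l0, of "cos b"] fin by (auto simp: J_def l_def)
    define D where "D s x = ennreal (\<bar>symm_difference r s f x\<bar> powr p)" for s x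
    have "diff_integral r p (\<kappa> * l) (cos b) (cos a) f \<le> ennreal (3 * real n * l) * (\<integral>\<^sup>+h\<in>{0<..\<theta> / real n}. (\<integral>\<^sup>+x\<in>J. D (h * phi x) x \<partial>lborel) \<partial>lborel)"
      using difference_transfer[OF r \<theta> n f, of "\<lambda>y. ennreal (\<bar>y\<bar> powr p)", OF _ ab]
      unfolding diff_integral_def J_def D_def l_def \<kappa>_def by simp
    then have "ennreal (C / l) * diff_integral r p (\<kappa> * l) (cos b) (cos a) f
       \<le> ennreal (C / l) * (ennreal (3 * real n * l) * (\<integral>\<^sup>+h\<in>{0<..\<theta> / real n}. (\<integral>\<^sup>+x\<in>J. D (h * phi x) x \<partial>lborel) \<partial>lborel))"
      by (intro mult_left_mono) auto
    also have "\<dots> = ennreal (3 * C * real n) * (\<integral>\<^sup>+h\<in>{0<..\<theta> / real n}. (\<integral>\<^sup>+x\<in>J. D (h * phi x) x \<partial>lborel) \<partial>lborel)"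
    proof -
      have "C / l * (3 * real n * l) = 3 * C * real n" using l0 by simp
      then have "ennreal (C / l) * ennreal (3 * real n * l) = ennreal (3 * C * real n)"
        using l0 C n0 by (subst ennreal_mult[symmetric]) auto
      then show ?thesis by (simp add: mult.assoc[symmetric])
    qed
    also have "\<dots> \<le> ennreal (3 * C * (real n / \<theta>)) * (\<integral>\<^sup>+h\<in>{0<..\<theta> / real n}. (\<integral>\<^sup>+x\<in>J. D (h * phi x) x \<partial>lborel) \<partial>lborel)"
    proof (intro mult_right_mono ennreal_leI mult_left_mono)
      show "real n \<le> real n / \<theta>" using n0 \<theta> by (simp add: le_divide_eq mult_left_le)
    qed (use C in auto)
    also have "\<dots> = ennreal (3 * C) * (ennreal (real n / \<theta>) * (\<integral>\<^sup>+h\<in>{0<..\<theta> / real n}. (\<integral>\<^sup>+x\<in>J. D (h * phi x) x \<partial>lborel) \<partial>lborel))"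
      using C n0 \<theta> by (subst ennreal_mult) (auto simp: mult.assoc)
    finally show ?thesis
      using q unfolding J_def D_def by (intro exI[of _ q]) auto
  qed
  then show ?thesis using C by (intro exI[of _ "3 * C"]) auto
qed

section \<open>Averaged doubling weights\<close>

lemma doubling_weight_integrable:
  assumes "doubling_weight w L"
  shows "integrable lebesgue w"
proof -
  have "integrable lebesgue (\<lambda>x. indicator {-1..1} x *\<^sub>R w x)"
    using assms by (simp add: doubling_weight_def absolutely_integrable_on_def set_integrable_def)
  moreover have "indicator {-1..1} x *\<^sub>R w x = w x" for x
    using assms by (auto simp: doubling_weight_def split: split_indicator)
  ultimately show ?thesis by (simp only:)
qed

lemma doubling_weight_set_integrable:
  assumes "doubling_weight w L" "A \<in> sets lebesgue"
  shows "set_integrable lebesgue A w"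
  using integrable_mult_indicator[OF assms(2) doubling_weight_integrable[OF assms(1)]]
  by (simp add: set_integrable_def)

lemma doubling_weight_set_integral_mono:
  assumes "doubling_weight w L" "A \<in> sets lebesgue" "B \<in> sets lebesgue" "A \<inter> {-1..1} \<subseteq> B"
  shows "(LINT u:A|lebesgue. w u) \<le> (LINT u:B|lebesgue. w u)"
  unfolding set_lebesgue_integral_def
proof (rule integral_mono)
  show "integrable lebesgue (\<lambda>x. indicator A x *\<^sub>R w x)" "integrable lebesgue (\<lambda>x. indicator B x *\<^sub>R w x)"
    using doubling_weight_set_integrable assms by (auto simp: set_integrable_def)
  show "indicator A x *\<^sub>R w x \<le> indicator B x *\<^sub>R w x" for x
    using assms(1,4) unfolding doubling_weight_def by (cases "x \<in> {-1..1}") (auto split: split_indicator)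
qed

lemma doubling_weight_set_integral_nonneg:
  assumes "doubling_weight w L"
  shows "0 \<le> (LINT u:A|lebesgue. w u)"
  unfolding set_lebesgue_integral_def
  using assms by (intro Bochner_Integration.integral_nonneg) (auto simp: doubling_weight_def)

text \<open>The interval is first cut to [-1, 1], since doubling is assumed only for subintervals.
  Unless the result is all of [-1, 1], its length is at least R, so doubling it gains R / 2 on each
  side; this is the origin of the factor 3/2 in place of 2.\<close>

lemma doubling_centered:
  assumes w: "doubling_weight w L" and y: "y \<in> {-1..1}" and R: "0 < R"
  shows "(LINT u:{y - (3/2) * R..y + (3/2) * R}|lebesgue. w u) \<le> max L 1 * (LINT u:{y - R..y + R}|lebesgue. w u)"
proof -
  define a where "a = max (-1) (y - R)"
  define b where "b = min 1 (y + R)"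
  have ab: "-1 \<le> a" "a \<le> b" "b \<le> 1" using y R by (auto simp: a_def b_def)
  have "(LINT u:{y - (3/2) * R..y + (3/2) * R}|lebesgue. w u) \<le> (LINT u:{a - (b - a) / 2..b + (b - a) / 2}|lebesgue. w u)"
    using y R by (intro doubling_weight_set_integral_mono[OF w]) (auto simp: a_def b_def max_def min_def field_simps)
  also have "\<dots> \<le> L * (LINT u:{a..b}|lebesgue. w u)"
    using w ab by (simp add: doubling_weight_def)
  also have "\<dots> \<le> max L 1 * (LINT u:{a..b}|lebesgue. w u)"
    using doubling_weight_set_integral_nonneg[OF w] by (intro mult_right_mono) auto
  also have "\<dots> \<le> max L 1 * (LINT u:{y - R..y + R}|lebesgue. w u)"
    by (intro mult_left_mono doubling_weight_set_integral_mono[OF w]) (auto simp: a_def b_def)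
  finally show ?thesis .
qed

lemma doubling_centered_iterate:
  assumes w: "doubling_weight w L" and y: "y \<in> {-1..1}" and R: "0 < R"
  shows "(LINT u:{y - (3/2) ^ k * R..y + (3/2) ^ k * R}|lebesgue. w u) \<le> max L 1 ^ k * (LINT u:{y - R..y + R}|lebesgue. w u)"
proof (induction k)
  case (Suc k)
  have "(LINT u:{y - (3/2) ^ Suc k * R..y + (3/2) ^ Suc k * R}|lebesgue. w u)
     \<le> max L 1 * (LINT u:{y - (3/2) ^ k * R..y + (3/2) ^ k * R}|lebesgue. w u)"
    using doubling_centered[OF w y, of "(3/2) ^ k * R"] R by (simp add: mult.assoc)
  also have "\<dots> \<le> max L 1 * (max L 1 ^ k * (LINT u:{y - R..y + R}|lebesgue. w u))"
    using Suc by (intro mult_left_mono) auto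
  finally show ?case by (simp add: mult.assoc)
qed simp

lemma avg_weight_nonneg:
  assumes "doubling_weight w L" "x \<in> {-1..1}" "1 \<le> n"
  shows "0 \<le> avg_weight w n x"
  unfolding avg_weight_def using rho_pos[OF assms(2,3)] doubling_weight_set_integral_nonneg[OF assms(1)] by simp

text \<open>Iterated doubling gives polynomial growth: the averaging interval at cos t lies in the
  one at cos s enlarged (1 + d)^2 times. This takes k doublings with (3/2)^k of the order (1 + d)^2,
  so the k-th power of the doubling constant is bounded by a power of 1 + d whose exponent depends
  only on L. The quotient of the two radii gives one more factor 1 + d.\<close>

lemma avg_weight_comparison:
  "\<exists>C>0. \<exists>m::nat. \<forall>w n s t d. doubling_weight w L \<longrightarrow> 1 \<le> n \<longrightarrow> s \<in> {0..pi} \<longrightarrow> t \<in> {0..pi} \<longrightarrow> real n * \<bar>t - s\<bar> \<le> d \<longrightarrow>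
     avg_weight w n (cos t) \<le> C * (1 + d) ^ m * avg_weight w n (cos s)"
proof -
  obtain m where m: "max L 1 \<le> (3/2) ^ m"
    using real_arch_pow[of "3/2" "max L 1"] by (auto intro: less_imp_le)
  have "avg_weight w n (cos t) \<le> (3/2) ^ m * (1 + d) ^ (2 * m + 1) * avg_weight w n (cos s)"
    if w: "doubling_weight w L" and n: "1 \<le> n" and st: "s \<in> {0..pi}" "t \<in> {0..pi}" and d: "real n * \<bar>t - s\<bar> \<le> d" for w n s t d
  proof -
    have d0: "0 \<le> d" using d by (rule order.trans[rotated]) simp
    define G where "G x = (LINT u:{x - rho n x..x + rho n x}|lebesgue. w u)" for x
    have G0: "0 \<le> G x" for x unfolding G_def by (rule doubling_weight_set_integral_nonneg[OF w])
    define K where "K = (1 + d)\<^sup>2"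
    have K1: "1 \<le> K" using d0 by (simp add: K_def)
    have ys: "cos s \<in> {-1..1}" "cos t \<in> {-1..1}" by auto
    note rp = rho_pos[OF ys(1) n] rho_pos[OF ys(2) n]
    have "\<exists>k. K \<le> (3/2) ^ k" using real_arch_pow[of "3/2" K] by (auto intro: less_imp_le)
    \<comment> \<open>The least k is taken so that (3/2)^k overshoots K by a factor of at most
      3/2.\<close>
    define k where "k = (LEAST k. K \<le> (3/2) ^ k)"
    have k: "K \<le> (3/2) ^ k" unfolding k_def using \<open>\<exists>k. K \<le> (3/2) ^ k\<close> by (rule LeastI_ex)
    have k': "(3/2) ^ k \<le> 3/2 * K"
    proof (cases k)
      case 0 then show ?thesis using K1 by simp
    next
      case (Suc j)
      have "\<not> K \<le> (3/2) ^ j" using not_less_Least[of j "\<lambda>k. K \<le> (3/2) ^ k"] Suc by (simp add: k_def)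
      then show ?thesis using Suc by simp
    qed
    have "G (cos t) \<le> (LINT u:{cos s - (3/2) ^ k * rho n (cos s)..cos s + (3/2) ^ k * rho n (cos s)}|lebesgue. w u)"
      unfolding G_def
    proof (rule doubling_weight_set_integral_mono[OF w])
      \<comment> \<open>The distance of the centres contributes d (1 + d) and the radius 1 + d;
        together they make (1 + d)^2.\<close>
      have "\<bar>cos t - cos s\<bar> + rho n (cos t) \<le> rho n (cos s) * (d * (1 + d)) + rho n (cos s) * (1 + d)"
        using st n d by (intro add_mono cos_diff_le_rho rho_cos_le) auto
      also have "\<dots> = K * rho n (cos s)" by (simp add: K_def power2_eq_square algebra_simps)
      also have "\<dots> \<le> (3/2) ^ k * rho n (cos s)" using k rp by (intro mult_right_mono) auto
      finally have "\<bar>cos t - cos s\<bar> + rho n (cos t) \<le> (3/2) ^ k * rho n (cos s)" .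
      then show "{cos t - rho n (cos t)..cos t + rho n (cos t)} \<inter> {-1..1} \<subseteq> {cos s - (3/2) ^ k * rho n (cos s)..cos s + (3/2) ^ k * rho n (cos s)}"
        by (auto simp: abs_if split: if_splits)
    qed auto
    also have "\<dots> \<le> max L 1 ^ k * G (cos s)"
      unfolding G_def by (rule doubling_centered_iterate[OF w ys(1) rp(1)])
    also have "\<dots> \<le> ((3/2) ^ m * (1 + d) ^ (2 * m)) * G (cos s)"
    proof (rule mult_right_mono[OF _ G0])
      have "max L 1 ^ k \<le> ((3/2) ^ m) ^ k" using m by (intro power_mono) auto
      also have "\<dots> = ((3/2) ^ k) ^ m" by (simp add: power_mult[symmetric] mult.commute)
      also have "\<dots> \<le> (3/2 * K) ^ m" using k' by (intro power_mono) auto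
      also have "\<dots> = (3/2) ^ m * (1 + d) ^ (2 * m)" unfolding K_def power_mult_distrib power_mult[symmetric] ..
      finally show "max L 1 ^ k \<le> (3/2) ^ m * (1 + d) ^ (2 * m)" .
    qed
    finally have GG: "G (cos t) \<le> (3/2) ^ m * (1 + d) ^ (2 * m) * G (cos s)" .
    have "rho n (cos s) \<le> rho n (cos t) * (1 + d)"
      using st n d by (intro rho_cos_le) (auto simp: abs_minus_commute)
    then have "1 / rho n (cos t) \<le> (1 + d) / rho n (cos s)" using rp by (simp add: field_simps)
    then have "1 / rho n (cos t) * G (cos t) \<le> (1 + d) / rho n (cos s) * ((3/2) ^ m * (1 + d) ^ (2 * m) * G (cos s))"
      using GG rp d0 G0 by (intro mult_mono) auto
    then show ?thesis by (simp add: avg_weight_def G_def mult_ac)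
  qed
  then show ?thesis by (intro exI[of _ "(3/2) ^ m"] conjI exI[of _ "2 * m + 1"]) auto
qed

text \<open>The weight is only Lebesgue measurable, but its distribution functions are monotone and
  hence Borel. The half-line for the lower end is open so that both ends of the averaging interval
  are included.\<close>

lemma avg_weight_measurable:
  assumes w: "doubling_weight w L"
  shows "avg_weight w n \<in> borel_measurable borel"
proof -
  define F1 where "F1 x = (LINT u:{..x}|lebesgue. w u)" for x :: real
  define F2 where "F2 x = (LINT u:{..<x}|lebesgue. w u)" for x :: real
  have "mono F1" "mono F2"
    unfolding F1_def F2_def by (auto intro!: monoI doubling_weight_set_integral_mono[OF w])
  then have [measurable]: "F1 \<in> borel_measurable borel" "F2 \<in> borel_measurable borel"
    by (auto intro: borel_measurable_mono)
  have phi_rho [measurable]: "rho n \<in> borel_measurable borel" unfolding rho_def phi_def by measurable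
  \<comment> \<open>Outside [-1, 1] the root in \<open>phi\<close> is taken of a negative number and
    is itself negative, so \<open>rho\<close> can be negative and the averaging interval
    empty.\<close>
  have eq: "avg_weight w n x = (if rho n x < 0 then 0 else 1 / rho n x * (F1 (x + rho n x) - F2 (x - rho n x)))" for x
  proof (cases "rho n x < 0")
    case True
    then have "{x - rho n x..x + rho n x} = {}" by auto
    then show ?thesis using True by (simp add: avg_weight_def set_lebesgue_integral_def)
  next
    case False
    have "{..x + rho n x} = {..<x - rho n x} \<union> {x - rho n x..x + rho n x}" using False by auto
    then have "F1 (x + rho n x) = F2 (x - rho n x) + (LINT u:{x - rho n x..x + rho n x}|lebesgue. w u)"
      unfolding F1_def F2_def
      by (simp only:) (intro set_integral_Un doubling_weight_set_integrable[OF w]; auto)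
    then show ?thesis using False by (simp add: avg_weight_def)
  qed
  show ?thesis unfolding eq[abs_def] by measurable
qed

section \<open>A polynomial partition of unity\<close>

definition cpoly :: "real poly \<Rightarrow> complex \<Rightarrow> complex" where
  "cpoly P z = poly (map_poly complex_of_real P) z"

lemma cpoly_0 [simp]: "cpoly 0 z = 0"
  by (simp add: cpoly_def)

lemma cpoly_pCons [simp]: "cpoly (pCons a P) z = of_real a + z * cpoly P z"
  by (simp add: cpoly_def map_poly_pCons)

lemma cpoly_1 [simp]: "cpoly 1 z = 1"
  by (simp add: one_pCons)

lemma cpoly_add [simp]: "cpoly (P + Q) z = cpoly P z + cpoly Q z"
proof (induction P arbitrary: Q)
  case (pCons a P)
  show ?case by (cases Q) (simp add: pCons.IH distrib_left)
qed simp

lemma cpoly_smult [simp]: "cpoly (smult c P) z = of_real c * cpoly P z"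
  by (induction P) (auto simp: algebra_simps)

lemma cpoly_minus [simp]: "cpoly (- P) z = - cpoly P z"
  using cpoly_smult[of "-1" P z] by simp

lemma cpoly_diff [simp]: "cpoly (P - Q) z = cpoly P z - cpoly Q z"
  using cpoly_add[of P "- Q" z] by simp

lemma cpoly_mult [simp]: "cpoly (P * Q) z = cpoly P z * cpoly Q z"
  by (induction P) (auto simp: algebra_simps)

lemma cpoly_power [simp]: "cpoly (P ^ k) z = cpoly P z ^ k"
  by (induction k) auto

lemma cpoly_sum [simp]: "cpoly (\<Sum>i\<in>A. P i) z = (\<Sum>i\<in>A. cpoly (P i) z)"
  by (induction A rule: infinite_finite_induct) auto

lemma cpoly_of_real: "cpoly P (of_real x) = of_real (poly P x)"
  by (induction P) auto

lemma cpoly_altdef: "cpoly P z = (\<Sum>i\<le>degree P. of_real (coeff P i) * z ^ i)"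
  by (simp add: cpoly_def poly_altdef coeff_map_poly degree_map_poly)

lemma cpoly_has_derivative: "(cpoly P has_field_derivative cpoly (pderiv P) z) (at z)"
proof (induction P)
  case (pCons a P)
  have "((\<lambda>z. of_real a + z * cpoly P z) has_field_derivative cpoly (pderiv (pCons a P)) z) (at z)"
    by (auto intro!: derivative_eq_intros pCons.IH simp: pderiv_pCons)
  then show ?case by simp
qed simp

lemma cpoly_higher_deriv: "(deriv ^^ k) (cpoly P) = cpoly ((pderiv ^^ k) P)"
proof (induction k)
  case (Suc k)
  have "(deriv ^^ Suc k) (cpoly P) = deriv (cpoly ((pderiv ^^ k) P))"
    using Suc by simp
  also have "\<dots> = cpoly (pderiv ((pderiv ^^ k) P))"
    using DERIV_imp_deriv[OF cpoly_has_derivative] by auto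
  finally show ?case by simp
qed simp

lemma cpoly_holomorphic: "cpoly P holomorphic_on A"
  using cpoly_has_derivative by (meson field_differentiable_at_within field_differentiable_def holomorphic_on_def)

text \<open>The Chebyshev polynomials; their recurrence involves two predecessors, so the induction
  carries two consecutive ones.\<close>

lemma cos_multiple_polynomial:
  "\<exists>P. degree P \<le> l \<and> (\<forall>z. cpoly P (cos z) = cos (of_nat l * z))"
proof -
  have "(\<exists>P. degree P \<le> l \<and> (\<forall>z. cpoly P (cos z) = cos (of_nat l * z)))
      \<and> (\<exists>P. degree P \<le> Suc l \<and> (\<forall>z. cpoly P (cos z) = cos (of_nat (Suc l) * z)))"
  proof (induction l)
    case 0
    show ?case by (intro conjI exI[of _ 1] exI[of _ "[:0, 1:]"]) auto
  next
    case (Suc l)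
    then obtain P Q where P: "degree P \<le> l" "\<And>z. cpoly P (cos z) = cos (of_nat l * z)"
      and Q: "degree Q \<le> Suc l" "\<And>z. cpoly Q (cos z) = cos (of_nat (Suc l) * z)" by blast
    have "degree ([:0, 2:] * Q - P) \<le> Suc (Suc l)"
      using P(1) Q(1) degree_mult_le[of "[:0, 2::real:]" Q] by (intro degree_diff_le) auto
    moreover have "cpoly ([:0, 2:] * Q - P) (cos z) = cos (of_nat (Suc (Suc l)) * z)" for z
    proof -
      have "cos (of_nat (Suc (Suc l)) * z) + cos (of_nat l * z) = 2 * cos z * cos (of_nat (Suc l) * z)"
        using cos_plus_cos[of "of_nat (Suc (Suc l)) * z" "of_nat l * z"]
        by (simp add: algebra_simps add_divide_distrib)
      then show ?thesis by (simp only: cpoly_diff cpoly_mult P Q) (simp add: algebra_simps)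
    qed
    ultimately show ?case using Q by blast
  qed
  then show ?thesis by blast
qed

text \<open>A splitting into a part even in z and a part odd in z. The alternative O' = 0 is there
  for k = 0, where degree O' + 1 \<le> k cannot hold.\<close>

lemma trig_power_split:
  "\<exists>E O'. degree E \<le> k \<and> (O' = 0 \<or> degree O' + 1 \<le> k) \<and>
    (\<forall>z. (of_real c * cos z + of_real s * sin z) ^ k = cpoly E (cos z) + sin z * cpoly O' (cos z))"
proof (induction k)
  case 0
  show ?case by (intro exI[of _ 1] exI[of _ 0]) auto
next
  case (Suc k)
  then obtain E O' where EO: "degree E \<le> k" "O' = 0 \<or> degree O' + 1 \<le> k"
    "\<And>z. (of_real c * cos z + of_real s * sin z) ^ k = cpoly E (cos z) + sin z * cpoly O' (cos z)" by blast
  define E1 where "E1 = [:0, c:] * E + smult s ([:1, 0, -1:] * O')"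
  define O1 where "O1 = [:0, c:] * O' + smult s E"
  have "degree ([:0, c:] * E) \<le> Suc k"
    using EO(1) degree_mult_le[of "[:0, c:]" E] by (auto intro: order.trans split: if_splits)
  moreover have "degree (smult s ([:1, 0, -1:] * O')) \<le> Suc k"
    using EO(2) degree_mult_le[of "[:1, 0, -1:]" O'] by (auto intro!: order.trans[OF degree_smult_le])
  ultimately have "degree E1 \<le> Suc k" unfolding E1_def by (rule degree_add_le)
  moreover have "degree O1 + 1 \<le> Suc k"
  proof -
    have "degree ([:0, c:] * O') \<le> k"
      using EO(2) degree_mult_le[of "[:0, c:]" O'] by (auto intro: order.trans split: if_splits)
    moreover have "degree (smult s E) \<le> k" using EO(1) degree_smult_le order.trans by blast
    ultimately have "degree O1 \<le> k" unfolding O1_def by (rule degree_add_le)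
    then show ?thesis by simp
  qed
  moreover have "(of_real c * cos z + of_real s * sin z) ^ Suc k = cpoly E1 (cos z) + sin z * cpoly O1 (cos z)" for z
  proof -
    have s2: "sin z * sin z = 1 - cos z * cos z" using sin_squared_eq[of z] by (simp add: power2_eq_square)
    have "(of_real c * cos z + of_real s * sin z) ^ Suc k
      = (of_real c * cos z + of_real s * sin z) * (cpoly E (cos z) + sin z * cpoly O' (cos z))"
      by (simp add: EO(3))
    also have "\<dots> = of_real c * cos z * cpoly E (cos z) + of_real s * (sin z * sin z) * cpoly O' (cos z)
       + sin z * (of_real c * cos z * cpoly O' (cos z) + of_real s * cpoly E (cos z))"
      by (simp add: algebra_simps)
    also have "\<dots> = cpoly E1 (cos z) + sin z * cpoly O1 (cos z)"
      unfolding s2 by (simp add: E1_def O1_def algebra_simps)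
    finally show ?thesis .
  qed
  ultimately show ?case by blast
qed

text \<open>A polynomial in cos (z - v) is in general not one in cos z, but the sum of the
  translates by v and -v is even in z, so the odd parts cancel.\<close>

lemma symmetrized_translate_polynomial:
  "\<exists>E. degree E \<le> degree Q \<and>
    (\<forall>z. cpoly Q (cos (z - of_real v)) + cpoly Q (cos (z + of_real v)) = cpoly E (cos z))"
proof -
  have "\<exists>E O'. \<forall>k. degree (E k) \<le> k \<and> (\<forall>z. (of_real (cos v) * cos z + of_real (sin v) * sin z) ^ k = cpoly (E k) (cos z) + sin z * cpoly (O' k) (cos z))"
    using trig_power_split[of _ "cos v" "sin v"] by metis
  then obtain E O' where EO: "\<And>k. degree (E k) \<le> k"
    "\<And>k z. (of_real (cos v) * cos z + of_real (sin v) * sin z) ^ k = cpoly (E k) (cos z) + sin z * cpoly (O' k) (cos z)" by blast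
  have minus: "cos (z - of_real v) ^ k = cpoly (E k) (cos z) + sin z * cpoly (O' k) (cos z)" for z k
    using EO(2)[of z k] by (simp add: cos_diff cos_of_real sin_of_real mult.commute)
  have plus: "cos (z + of_real v) ^ k = cpoly (E k) (cos z) - sin z * cpoly (O' k) (cos z)" for z k
    using minus[of "- z" k] cos_minus[of "z + of_real v"] by simp
  define F where "F = (\<Sum>k\<le>degree Q. smult (2 * coeff Q k) (E k))"
  have "degree F \<le> degree Q" unfolding F_def
    using EO(1) by (intro degree_sum_le) (auto intro: order.trans[OF degree_smult_le] order.trans)
  moreover have "cpoly Q (cos (z - of_real v)) + cpoly Q (cos (z + of_real v)) = cpoly F (cos z)" for z
    by (simp add: cpoly_altdef[of Q] minus plus F_def sum.distrib[symmetric] algebra_simps)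
  ultimately show ?thesis by blast
qed

lemma sum_roots_of_unity:
  fixes m :: int
  assumes "m \<noteq> 0" "\<bar>m\<bar> < int N"
  shows "(\<Sum>j<N. exp (\<i> * of_int m * of_real (2 * pi * real j / real N))) = 0"
proof -
  define \<omega> where "\<omega> = exp (\<i> * of_int m * of_real (2 * pi / real N))"
  have N: "0 < N" using assms by simp
  have "\<omega> \<noteq> 1"
  proof
    assume "\<omega> = 1"
    then obtain k :: int where "of_int m * (2 * pi / real N) = of_int (2 * k) * pi"
      by (auto simp: \<omega>_def exp_eq_1)
    then have "real_of_int m = real_of_int (k * int N)" using N by (simp add: field_simps)
    then have "m = k * int N" by (simp only: of_int_eq_iff)
    then have "k \<noteq> 0" "\<bar>k\<bar> * int N < int N" using assms by (auto simp: abs_mult)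
    moreover from \<open>k \<noteq> 0\<close> have "1 \<le> \<bar>k\<bar>" by linarith
    ultimately show False using mult_right_mono[of 1 "\<bar>k\<bar>" "int N"] by simp
  qed
  moreover have "\<omega> ^ N = 1"
  proof -
    have "\<omega> ^ N = exp (of_nat N * (\<i> * of_int m * of_real (2 * pi / real N)))"
      unfolding \<omega>_def by (rule exp_of_nat_mult[symmetric])
    also have "of_nat N * (\<i> * of_int m * of_real (2 * pi / real N)) = 2 * of_int m * of_real pi * \<i>"
      using N by (simp add: field_simps)
    also have "exp (2 * of_int m * of_real pi * \<i>) = 1" by (subst exp_eq_1) auto
    finally show ?thesis .
  qed
  moreover have "(\<Sum>j<N. exp (\<i> * of_int m * of_real (2 * pi * real j / real N))) = (\<Sum>j<N. \<omega> ^ j)"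
    unfolding \<omega>_def by (intro sum.cong) (auto simp: exp_of_nat_mult[symmetric] field_simps)
  ultimately show ?thesis by (simp add: geometric_sum)
qed

text \<open>Discrete orthogonality: the k-th power of the cosine has only frequencies between -k and
  k, and summing over N > k equally spaced translates annihilates all of them except 0. This makes
  the translates of the kernel add up to a constant.\<close>

lemma sum_translates_cos_power:
  fixes z :: complex
  assumes "k < N"
  shows "(\<Sum>j<N. cos (z - of_real (2 * pi * real j / real N)) ^ k) = (\<Sum>j<N. cos (of_real (2 * pi * real j / real N)) ^ k)"
proof -
  define v where "v j = complex_of_real (2 * pi * real j / real N)" for j
  have expand: "cos w ^ k = (\<Sum>l\<le>k. of_nat (k choose l) * exp (\<i> * of_int (2 * int l - int k) * w)) / 2 ^ k" for w :: complex
  proof -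
    have "cos w ^ k = (exp (\<i> * w) + exp (- (\<i> * w))) ^ k / 2 ^ k"
      by (simp add: cos_exp_eq power_divide)
    also have "(exp (\<i> * w) + exp (- (\<i> * w))) ^ k = (\<Sum>l\<le>k. of_nat (k choose l) * exp (\<i> * w) ^ l * exp (- (\<i> * w)) ^ (k - l))"
      by (rule binomial_ring)
    also have "\<dots> = (\<Sum>l\<le>k. of_nat (k choose l) * exp (\<i> * of_int (2 * int l - int k) * w))"
    proof (intro sum.cong refl)
      fix l assume "l \<in> {..k}"
      then have "of_nat l * (\<i> * w) + of_nat (k - l) * (- (\<i> * w)) = \<i> * of_int (2 * int l - int k) * w"
        by (simp add: of_nat_diff algebra_simps)
      then have "exp (\<i> * w) ^ l * exp (- (\<i> * w)) ^ (k - l) = exp (\<i> * of_int (2 * int l - int k) * w)"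
        by (simp only: exp_of_nat_mult[symmetric] exp_add[symmetric])
      then show "of_nat (k choose l) * exp (\<i> * w) ^ l * exp (- (\<i> * w)) ^ (k - l) = of_nat (k choose l) * exp (\<i> * of_int (2 * int l - int k) * w)"
        by (simp add: mult.assoc)
    qed
    finally show ?thesis .
  qed
  \<comment> \<open>Either the frequency m is 0 and the exponential is 1, or the sum over the nodes
    vanishes.\<close>
  have inner: "exp (\<i> * of_int m * z) * (\<Sum>j<N. exp (- (\<i> * of_int m * v j))) = (\<Sum>j<N. exp (- (\<i> * of_int m * v j)))"
    if "\<bar>m\<bar> < int N" for m :: int and z :: complex
  proof (cases "m = 0")
    case False
    have "(\<Sum>j<N. exp (- (\<i> * of_int m * v j))) = 0"
      using sum_roots_of_unity[of "- m" N] False that by (simp add: v_def)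
    then show ?thesis by simp
  qed simp
  have eq: "(\<Sum>j<N. cos (z - v j) ^ k) = (\<Sum>l\<le>k. of_nat (k choose l) *
      (exp (\<i> * of_int (2 * int l - int k) * z) * (\<Sum>j<N. exp (- (\<i> * of_int (2 * int l - int k) * v j))))) / 2 ^ k" for z
    unfolding expand sum_divide_distrib[symmetric] sum_distrib_left
    by (subst sum.swap) (simp add: exp_add[symmetric] algebra_simps)
  have "(\<Sum>j<N. cos (z - v j) ^ k) = (\<Sum>l\<le>k. of_nat (k choose l) * (\<Sum>j<N. exp (- (\<i> * of_int (2 * int l - int k) * v j)))) / 2 ^ k" for z
  proof -
    have "(\<Sum>l\<le>k. of_nat (k choose l) * (exp (\<i> * of_int (2 * int l - int k) * z) * (\<Sum>j<N. exp (- (\<i> * of_int (2 * int l - int k) * v j)))))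
      = (\<Sum>l\<le>k. of_nat (k choose l) * (\<Sum>j<N. exp (- (\<i> * of_int (2 * int l - int k) * v j))))"
    proof (intro sum.cong refl arg_cong2[where f = "(*)"])
      fix l assume "l \<in> {..k}"
      then have "\<bar>2 * int l - int k\<bar> < int N" using assms by auto
      then show "exp (\<i> * of_int (2 * int l - int k) * z) * (\<Sum>j<N. exp (- (\<i> * of_int (2 * int l - int k) * v j)))
         = (\<Sum>j<N. exp (- (\<i> * of_int (2 * int l - int k) * v j)))" by (rule inner)
    qed
    then show ?thesis unfolding eq by simp
  qed
  from this[of z] this[of 0] show ?thesis unfolding v_def by simp
qed

section \<open>Size and decay of the Dirichlet kernel\<close>

definition dirichlet_kernel :: "nat \<Rightarrow> complex \<Rightarrow> complex" where
  "dirichlet_kernel k z = 1 + 2 * (\<Sum>l\<in>{1..k}. cos (of_nat l * z))"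

lemma dirichlet_kernel_polynomial:
  "\<exists>Q. degree Q \<le> k \<and> (\<forall>z. cpoly Q (cos z) = dirichlet_kernel k z)"
proof -
  have "\<exists>P. \<forall>l. degree (P l) \<le> l \<and> (\<forall>z. cpoly (P l) (cos z) = cos (of_nat l * z))"
    using cos_multiple_polynomial by metis
  then obtain P where P: "\<And>l. degree (P l) \<le> l" "\<And>l z. cpoly (P l) (cos z) = cos (of_nat l * z)" by blast
  define Q where "Q = 1 + smult 2 (\<Sum>l\<in>{1..k}. P l)"
  have "degree (\<Sum>l\<in>{1..k}. P l) \<le> k"
    using P(1) by (intro degree_sum_le) (auto intro: order.trans)
  then have "degree Q \<le> k" unfolding Q_def
    by (intro degree_add_le) (auto intro: order.trans[OF degree_smult_le])
  moreover have "cpoly Q (cos z) = dirichlet_kernel k z" for z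
    by (simp add: Q_def dirichlet_kernel_def P(2))
  ultimately show ?thesis by blast
qed

lemma norm_cos_le_exp: "norm (cos z) \<le> exp \<bar>Im z\<bar>"
proof -
  have "norm (cos z) \<le> (norm (exp (\<i> * z)) + norm (exp (- (\<i> * z)))) / 2"
    using norm_triangle_ineq[of "exp (\<i> * z)" "exp (- (\<i> * z))"]
    by (simp only: cos_exp_eq norm_divide norm_numeral divide_right_mono)
  also have "\<dots> \<le> (exp \<bar>Im z\<bar> + exp \<bar>Im z\<bar>) / 2"
    by (intro divide_right_mono add_mono) auto
  finally show ?thesis by simp
qed

lemma norm_sin_le_exp: "norm (sin z) \<le> exp \<bar>Im z\<bar>"
proof -
  have "sin z = cos (of_real (pi / 2) - z)" by (simp add: cos_diff sin_of_real cos_of_real)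
  then show ?thesis using norm_cos_le_exp[of "of_real (pi / 2) - z"] by simp
qed

text \<open>The real part of sin z is sin (Re z) times a hyperbolic cosine, which is at least
  1.\<close>

lemma norm_sin_ge: "\<bar>sin (Re z)\<bar> \<le> norm (sin z)"
proof -
  have "\<bar>sin (Re z)\<bar> * 1 \<le> \<bar>sin (Re z)\<bar> * ((exp (Im z) + exp (- Im z)) / 2)"
    using cosh_real_ge_1[of "Im z"] by (intro mult_left_mono) (auto simp: cosh_def)
  also have "\<dots> = \<bar>Re (sin z)\<bar>" by (simp add: Re_sin abs_mult)
  finally show ?thesis using abs_Re_le_cmod[of "sin z"] by linarith
qed

lemma norm_dirichlet_kernel_le:
  "norm (dirichlet_kernel k z) \<le> (2 * real k + 1) * exp (real k * \<bar>Im z\<bar>)"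
proof -
  have "norm (\<Sum>l\<in>{1..k}. cos (of_nat l * z)) \<le> (\<Sum>l\<in>{1..k}. exp (real k * \<bar>Im z\<bar>))"
  proof (rule sum_norm_le)
    fix l assume l: "l \<in> {1..k}"
    have "norm (cos (of_nat l * z)) \<le> exp (real l * \<bar>Im z\<bar>)"
      using norm_cos_le_exp[of "of_nat l * z"] by (simp add: abs_mult)
    also have "\<dots> \<le> exp (real k * \<bar>Im z\<bar>)" using l by (simp add: mult_right_mono)
    finally show "norm (cos (of_nat l * z)) \<le> exp (real k * \<bar>Im z\<bar>)" .
  qed
  then have "norm (\<Sum>l\<in>{1..k}. cos (of_nat l * z)) \<le> real k * exp (real k * \<bar>Im z\<bar>)" by simp
  moreover have "norm (dirichlet_kernel k z) \<le> 1 + 2 * norm (\<Sum>l\<in>{1..k}. cos (of_nat l * z))"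
    unfolding dirichlet_kernel_def by (rule order.trans[OF norm_triangle_ineq]) (simp add: norm_mult)
  ultimately have "norm (dirichlet_kernel k z) \<le> 1 + 2 * (real k * exp (real k * \<bar>Im z\<bar>))" by linarith
  also have "\<dots> \<le> exp (real k * \<bar>Im z\<bar>) + 2 * (real k * exp (real k * \<bar>Im z\<bar>))" by simp
  finally show ?thesis by (simp add: distrib_right mult.assoc)
qed

text \<open>The classical closed form as a product, which makes sense also at the zeros of sin (z /
  2).\<close>

lemma sin_half_times_dirichlet_kernel:
  "sin (z / 2) * dirichlet_kernel k z = sin ((2 * of_nat k + 1) * z / 2)"
proof (induction k)
  case (Suc k)
  have "dirichlet_kernel (Suc k) z = dirichlet_kernel k z + 2 * cos (of_nat (Suc k) * z)"
    by (simp add: dirichlet_kernel_def algebra_simps)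
  moreover have "2 * (sin (z / 2) * cos (of_nat (Suc k) * z)) = sin ((2 * of_nat (Suc k) + 1) * z / 2) - sin ((2 * of_nat k + 1) * z / 2)"
  proof -
    have a: "(2 * of_nat (Suc k) + 1) * z / 2 = of_nat (Suc k) * z + z / 2"
      "(2 * of_nat k + 1) * z / 2 = of_nat (Suc k) * z - z / 2"
      by (simp_all add: field_simps)
    show ?thesis unfolding a sin_add sin_diff by (simp add: algebra_simps)
  qed
  ultimately show ?case using Suc by (simp add: algebra_simps)
qed (simp add: dirichlet_kernel_def)

lemma norm_dirichlet_kernel_decay:
  "norm (dirichlet_kernel k z) * \<bar>sin (Re z / 2)\<bar> \<le> exp ((2 * real k + 1) / 2 * \<bar>Im z\<bar>)"
proof -
  have "norm (dirichlet_kernel k z) * \<bar>sin (Re z / 2)\<bar> \<le> norm (dirichlet_kernel k z) * norm (sin (z / 2))"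
    using norm_sin_ge[of "z / 2"] by (intro mult_left_mono) auto
  also have "\<dots> = norm (sin ((2 * of_nat k + 1) * z / 2))"
    by (simp add: sin_half_times_dirichlet_kernel[symmetric] norm_mult)
  also have "\<dots> \<le> exp \<bar>Im ((2 * of_nat k + 1) * z / 2)\<bar>" by (rule norm_sin_le_exp)
  also have "Im ((2 * of_nat k + 1) * z / 2) = (2 * real k + 1) / 2 * Im z" by simp
  finally show ?thesis by (simp add: abs_mult)
qed

text \<open>The squares of the two sines differ by sin \<alpha> sin u \<ge> 0. Hence the kernel at
  \<zeta> + u obeys the same decay as at \<zeta> - u, measured by the distance of the real part of
  \<zeta> to u.\<close>

lemma half_angle_sines:
  fixes \<alpha> u :: real
  assumes "0 \<le> \<alpha>" "\<alpha> \<le> pi" "0 \<le> u" "u \<le> pi"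
  shows "\<bar>\<alpha> - u\<bar> / pi \<le> \<bar>sin ((\<alpha> - u) / 2)\<bar>" "\<bar>sin ((\<alpha> - u) / 2)\<bar> \<le> \<bar>sin ((\<alpha> + u) / 2)\<bar>"
proof -
  have "2 / pi * (\<bar>\<alpha> - u\<bar> / 2) \<le> sin (\<bar>\<alpha> - u\<bar> / 2)"
    using assms by (intro sin_ge_two_over_pi) auto
  also have "\<dots> \<le> \<bar>sin ((\<alpha> - u) / 2)\<bar>"
    using sin_minus[of "(\<alpha> - u) / 2"] by (cases "\<alpha> \<ge> u") (auto simp: abs_if minus_divide_left)
  finally show "\<bar>\<alpha> - u\<bar> / pi \<le> \<bar>sin ((\<alpha> - u) / 2)\<bar>" by simp
  have "0 \<le> sin \<alpha> * sin u" using assms by (simp add: sin_ge_zero)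
  also have "sin \<alpha> * sin u = sin ((\<alpha> + u) / 2 + (\<alpha> - u) / 2) * sin ((\<alpha> + u) / 2 - (\<alpha> - u) / 2)"
    by (simp add: field_simps)
  also have "\<dots> = (sin ((\<alpha> + u) / 2))\<^sup>2 - (sin ((\<alpha> - u) / 2))\<^sup>2"
  proof -
    have "sin (A + B) * sin (A - B) = (sin A)\<^sup>2 - (sin B)\<^sup>2" for A B :: real
    proof -
      have "sin (A + B) * sin (A - B) = (sin A)\<^sup>2 * (cos B)\<^sup>2 - (cos A)\<^sup>2 * (sin B)\<^sup>2"
        by (simp add: sin_add sin_diff algebra_simps power2_eq_square)
      then show ?thesis unfolding cos_squared_eq by (simp add: algebra_simps)
    qed
    then show ?thesis .
  qed
  finally show "\<bar>sin ((\<alpha> - u) / 2)\<bar> \<le> \<bar>sin ((\<alpha> + u) / 2)\<bar>"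
    by (simp add: abs_le_square_iff)
qed

text \<open>Close nodes use the trivial bound, distant ones the decay by the sine. Three units of
  index distance are lost on the way: one because \<tau> is only known up to its cell and two
  because Re \<zeta> is only near \<tau>. The hypothesis on M makes n comparable with the order of
  the kernel.\<close>

lemma dirichlet_kernel_localized:
  fixes i j :: nat
  assumes n: "1 \<le> n" and k: "k \<le> n" and M: "real n \<le> M * (2 * real k + 1)"
    and j: "j \<le> n" and z: "0 \<le> Re \<zeta>" "Re \<zeta> \<le> pi" "\<bar>Im \<zeta>\<bar> \<le> 4 / real n"
    and \<tau>: "real i * pi / real n \<le> \<tau>" "\<tau> \<le> (real i + 1) * pi / real n" "\<bar>Re \<zeta> - \<tau>\<bar> \<le> 2 * pi / real n"
    and w: "w = \<zeta> - of_real (pi * real j / real n) \<or> w = \<zeta> + of_real (pi * real j / real n)"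
  shows "norm (dirichlet_kernel k w) \<le> exp 6 * (7 + 3 * M) * (2 * real k + 1) / (1 + \<bar>real j - real i\<bar>)"
proof -
  define X where "X = \<bar>real j - real i\<bar>"
  define u where "u = pi * real j / real n"
  define D where "D = norm (dirichlet_kernel k w)"
  have n0: "0 < real n" using n by simp
  have X0: "0 \<le> X" by (simp add: X_def)
  have M0: "0 < M" using M n0 by (smt (verit) mult_nonpos_nonneg of_nat_0_le_iff)
  have Imw: "\<bar>Im w\<bar> \<le> 4 / real n" using w z by auto
  have kn: "real k \<le> real n" "1 \<le> real n" using k n by auto
  have "D * (1 + X) \<le> exp 6 * (7 + 3 * M) * (2 * real k + 1)"
  proof (cases "X \<le> 6")
    case True
    have "real k * \<bar>Im w\<bar> \<le> real n * (4 / real n)" using kn Imw by (intro mult_mono) auto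
    then have "exp (real k * \<bar>Im w\<bar>) \<le> exp 6" using n0 by simp
    then have "D \<le> (2 * real k + 1) * exp 6"
      unfolding D_def using norm_dirichlet_kernel_le[of k w] by (smt (verit) mult_left_mono of_nat_0_le_iff)
    then have "D * (1 + X) \<le> (2 * real k + 1) * exp 6 * 7"
      using True X0 by (intro mult_mono) auto
    also have "\<dots> \<le> (2 * real k + 1) * exp 6 * (7 + 3 * M)" using M0 by (intro mult_left_mono) auto
    finally show ?thesis by (simp add: mult_ac)
  next
    case False
    have u: "0 \<le> u" "u \<le> pi" using j n0 by (auto simp: u_def field_simps)
    \<comment> \<open>The origin of exp 6: (2 k + 1) / 2 is at most 3 n / 2 and the imaginary part
      at most 4 / n.\<close>
    have "(2 * real k + 1) / 2 * \<bar>Im w\<bar> \<le> (3 * real n / 2) * (4 / real n)"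
      using kn Imw by (intro mult_mono) auto
    then have e6: "exp ((2 * real k + 1) / 2 * \<bar>Im w\<bar>) \<le> exp 6" using n0 by simp
    have "\<bar>Re \<zeta> - u\<bar> / pi \<le> \<bar>sin (Re w / 2)\<bar>"
      using w half_angle_sines[OF z(1,2) u] by (auto simp: u_def)
    then have "D * (\<bar>Re \<zeta> - u\<bar> / pi) \<le> D * \<bar>sin (Re w / 2)\<bar>" by (intro mult_left_mono) (auto simp: D_def)
    also have "\<dots> \<le> exp 6" using norm_dirichlet_kernel_decay[of k w] e6 unfolding D_def by linarith
    finally have D6: "D * (\<bar>Re \<zeta> - u\<bar> / pi) \<le> exp 6" .
    have "pi * (X - 3) \<le> real n * \<bar>Re \<zeta> - u\<bar>"
    proof -
      have nt: "real i * pi \<le> real n * \<tau>" "real n * \<tau> \<le> (real i + 1) * pi" using \<tau> n0 by (auto simp: field_simps)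
      have nu: "real n * u = pi * real j" using n0 by (simp add: u_def)
      have "pi * X \<le> \<bar>real n * \<tau> - real n * u\<bar> + pi"
      proof -
        have "pi * X = \<bar>pi * real j - pi * real i\<bar>" by (simp add: X_def abs_mult flip: right_diff_distrib)
        also have "\<dots> \<le> \<bar>real n * \<tau> - real n * u\<bar> + pi" using nt nu by (auto simp: abs_if algebra_simps)
        finally show ?thesis .
      qed
      moreover have "\<bar>real n * \<tau> - real n * u\<bar> \<le> real n * \<bar>Re \<zeta> - u\<bar> + 2 * pi"
      proof -
        have "real n * \<tau> - real n * u = real n * (\<tau> - u)" by (simp add: algebra_simps)
        then have "\<bar>real n * \<tau> - real n * u\<bar> = real n * \<bar>\<tau> - u\<bar>" using n0 by (simp add: abs_mult)
        also have "\<dots> \<le> real n * (\<bar>Re \<zeta> - u\<bar> + 2 * pi / real n)" using \<tau>(3) by (intro mult_left_mono) auto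
        finally show ?thesis using n0 by (simp add: algebra_simps)
      qed
      ultimately show ?thesis by (simp add: algebra_simps)
    qed
    then have dist: "(X - 3) / real n \<le> \<bar>Re \<zeta> - u\<bar> / pi" using n0 by (simp add: field_simps)
    \<comment> \<open>For X > 6 the three lost units are affordable: 1 + X \<le> 3 (X - 3).\<close>
    have "D * (1 + X) \<le> D * (3 * (X - 3))" using False by (intro mult_left_mono) (auto simp: D_def)
    also have "\<dots> = 3 * real n * (D * ((X - 3) / real n))" using n0 by simp
    also have "\<dots> \<le> 3 * real n * (D * (\<bar>Re \<zeta> - u\<bar> / pi))"
      using dist n0 by (intro mult_left_mono) (auto simp: D_def)
    also have "\<dots> \<le> 3 * real n * exp 6" using D6 n0 by (intro mult_left_mono) auto
    also have "\<dots> \<le> 3 * (M * (2 * real k + 1)) * exp 6" using M by simp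
    also have "\<dots> \<le> exp 6 * (7 + 3 * M) * (2 * real k + 1)" using M0 by (simp add: algebra_simps)
    finally show ?thesis .
  qed
  then show ?thesis using X0 unfolding D_def[symmetric] X_def[symmetric] by (simp add: le_divide_eq)
qed

text \<open>
  The powers of the Dirichlet kernel, translated to the nodes \<open>\<pi>j/n\<close> and symmetrized, form a
  polynomial partition of unity in \<open>x = cos \<zeta>\<close>; the index \<open>j\<close> runs over a full period, so that
  \<open>j\<close> and \<open>2n - j\<close> belong to the same point of \<open>[-1, 1]\<close>.
\<close>

lemma polynomial_partition_of_unity:
  assumes r: "1 \<le> r" and \<mu>: "1 \<le> \<mu>"
  shows "\<exists>C>0. \<forall>n\<ge>r. \<exists>\<Lambda>::nat \<Rightarrow> real poly. (\<forall>j. degree (\<Lambda> j) \<le> n - r) \<and>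
     (\<forall>z. (\<Sum>j<2 * n. cpoly (\<Lambda> j) (cos z)) = 1) \<and>
     (\<forall>j<2 * n. \<forall>i \<tau> \<zeta>. 0 \<le> Re \<zeta> \<longrightarrow> Re \<zeta> \<le> pi \<longrightarrow> \<bar>Im \<zeta>\<bar> \<le> 4 / real n \<longrightarrow>
        real i * pi / real n \<le> \<tau> \<longrightarrow> \<tau> \<le> (real i + 1) * pi / real n \<longrightarrow> \<bar>Re \<zeta> - \<tau>\<bar> \<le> 2 * pi / real n \<longrightarrow>
        norm (cpoly (\<Lambda> j) (cos \<zeta>)) \<le> C / (1 + \<bar>real (min j (2 * n - j)) - real i\<bar>) ^ (2 * \<mu>))"
proof -
  define M where "M = real (r + 2 * \<mu>)"
  define C where "C = (exp 6 * (7 + 3 * M)) ^ (2 * \<mu>)"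
  have C0: "0 < C" by (simp add: C_def M_def)
  have "\<exists>\<Lambda>::nat \<Rightarrow> real poly. (\<forall>j. degree (\<Lambda> j) \<le> n - r) \<and>
     (\<forall>z. (\<Sum>j<2 * n. cpoly (\<Lambda> j) (cos z)) = 1) \<and>
     (\<forall>j<2 * n. \<forall>i \<tau> \<zeta>. 0 \<le> Re \<zeta> \<longrightarrow> Re \<zeta> \<le> pi \<longrightarrow> \<bar>Im \<zeta>\<bar> \<le> 4 / real n \<longrightarrow>
        real i * pi / real n \<le> \<tau> \<longrightarrow> \<tau> \<le> (real i + 1) * pi / real n \<longrightarrow> \<bar>Re \<zeta> - \<tau>\<bar> \<le> 2 * pi / real n \<longrightarrow>
        norm (cpoly (\<Lambda> j) (cos \<zeta>)) \<le> C / (1 + \<bar>real (min j (2 * n - j)) - real i\<bar>) ^ (2 * \<mu>))"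
    if nr: "r \<le> n" for n
  proof -
    \<comment> \<open>The largest order for which the power 2 \<mu> of the kernel still has degree
      at most n - r. The even exponent makes that power nonnegative at real points.\<close>
    define k where "k = (n - r) div (2 * \<mu>)"
    have n1: "1 \<le> n" using r nr by simp
    have n0: "0 < real n" using n1 by simp
    have k1: "2 * \<mu> * k \<le> n - r" by (simp add: k_def)
    have k2: "n - r < 2 * \<mu> * (k + 1)"
      using \<mu> dividend_less_times_div[of "2 * \<mu>" "n - r"] by (simp add: k_def algebra_simps)
    have kn: "k \<le> n"
    proof -
      have "k \<le> 2 * \<mu> * k" using \<mu> by simp
      then show ?thesis using k1 by linarith
    qed
    \<comment> \<open>For n close to r the order k may be 0; the summand r in \<open>M\<close>
      covers this.\<close>
    have nM: "real n \<le> M * (2 * real k + 1)"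
    proof -
      have "n \<le> r + 2 * \<mu> * (k + 1)" using k2 by linarith
      also have "\<dots> \<le> r * (k + 1) + 2 * \<mu> * (k + 1)" by simp
      also have "\<dots> = (r + 2 * \<mu>) * (k + 1)" by (simp add: algebra_simps)
      also have "\<dots> \<le> (r + 2 * \<mu>) * (2 * k + 1)" by (intro mult_left_mono) auto
      finally have "real n \<le> real ((r + 2 * \<mu>) * (2 * k + 1))" by (rule of_nat_mono)
      then show ?thesis by (simp add: M_def algebra_simps)
    qed
    obtain Q0 where Q0: "degree Q0 \<le> k" "\<And>z. cpoly Q0 (cos z) = dirichlet_kernel k z"
      using dirichlet_kernel_polynomial[of k] by blast
    define Q where "Q = Q0 ^ (2 * \<mu>)"
    have degQ: "degree Q \<le> n - r"
    proof -
      have "degree Q \<le> degree Q0 * (2 * \<mu>)" unfolding Q_def by (rule degree_power_le)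
      also have "\<dots> \<le> k * (2 * \<mu>)" using Q0(1) by (intro mult_right_mono) auto
      finally show ?thesis using k1 by (simp add: mult_ac)
    qed
    \<comment> \<open>\<open>u\<close> folds the 2 n nodes \<open>v\<close> of the full period onto
      [0, \<pi>]; both give the same pair of symmetrized translates.\<close>
    define u where "u j = pi * real (min j (2 * n - j)) / real n" for j
    define v where "v j = 2 * pi * real j / real (2 * n)" for j
    define S where "S = (\<Sum>j<2 * n. poly Q (cos (v j)))"
    have Qnn: "0 \<le> poly Q x" for x by (simp add: Q_def poly_power)
    have Q1: "poly Q 1 = (2 * real k + 1) ^ (2 * \<mu>)"
    proof -
      have "complex_of_real (poly Q0 1) = of_real (2 * real k + 1)"
        using Q0(2)[of 0] cpoly_of_real[of Q0 1] by (simp add: dirichlet_kernel_def add.commute)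
      then have "poly Q0 1 = 2 * real k + 1" by (simp only: of_real_eq_iff)
      then show ?thesis by (simp add: Q_def poly_power)
    qed
    \<comment> \<open>All terms are nonnegative and the node 0 alone contributes the peak value, so
      dividing by S removes the power of 2 k + 1 from the kernel bound.\<close>
    have S: "(2 * real k + 1) ^ (2 * \<mu>) \<le> S"
    proof -
      have "poly Q (cos (v 0)) \<le> S" unfolding S_def
        using Qnn n1 by (intro member_le_sum) auto
      then show ?thesis by (simp add: v_def Q1)
    qed
    have Kpos: "0 < (2 * real k + 1) ^ (2 * \<mu>)" by (intro zero_less_power) simp
    have Spos: "0 < S" using S Kpos by linarith
    \<comment> \<open>Every power occurring in \<open>Q\<close> is below the number 2 n of nodes, so
      its translates sum to a constant.\<close>
    have sumJ: "(\<Sum>j<2 * n. cpoly Q (cos (z - of_real (v j)))) = of_real S" for z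
    proof -
      have "(\<Sum>j<2 * n. cpoly Q (cos (z - of_real (v j)))) = (\<Sum>i\<le>degree Q. of_real (coeff Q i) * (\<Sum>j<2 * n. cos (z - of_real (v j)) ^ i))"
        unfolding cpoly_altdef by (subst sum.swap) (simp add: sum_distrib_left)
      also have "\<dots> = (\<Sum>i\<le>degree Q. of_real (coeff Q i) * (\<Sum>j<2 * n. cos (of_real (v j)) ^ i))"
      proof (rule sum.cong[OF refl])
        fix i assume "i \<in> {..degree Q}"
        then have "i < 2 * n" using degQ n1 r by simp
        then have "(\<Sum>j<2 * n. cos (z - of_real (v j)) ^ i) = (\<Sum>j<2 * n. cos (of_real (v j)) ^ i)"
          unfolding v_def by (rule sum_translates_cos_power)
        then show "of_real (coeff Q i) * (\<Sum>j<2 * n. cos (z - of_real (v j)) ^ i) = of_real (coeff Q i) * (\<Sum>j<2 * n. cos (of_real (v j)) ^ i)"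
          by (simp only:)
      qed
      also have "\<dots> = (\<Sum>j<2 * n. cpoly Q (cos (of_real (v j))))"
        unfolding cpoly_altdef by (subst sum.swap) (simp add: sum_distrib_left)
      also have "\<dots> = of_real S" by (simp add: S_def cos_of_real cpoly_of_real)
      finally show ?thesis .
    qed
    have "\<exists>E. \<forall>j. degree (E j) \<le> degree Q \<and> (\<forall>z. cpoly Q (cos (z - of_real (u j))) + cpoly Q (cos (z + of_real (u j))) = cpoly (E j) (cos z))"
      by (rule choice, rule allI, rule symmetrized_translate_polynomial)
    then obtain E where E0: "\<forall>j. degree (E j) \<le> degree Q \<and> (\<forall>z. cpoly Q (cos (z - of_real (u j))) + cpoly Q (cos (z + of_real (u j))) = cpoly (E j) (cos z))" ..
    have E: "degree (E j) \<le> degree Q"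
      "cpoly (E j) (cos z) = cpoly Q (cos (z - of_real (u j))) + cpoly Q (cos (z + of_real (u j)))" for j z
      using E0 by simp_all
    \<comment> \<open>For j > n the folded node is 2 \<pi> - \<open>v j\<close>, and periodicity
      exchanges the two translates.\<close>
    have EJ: "cpoly (E j) (cos z) = cpoly Q (cos (z - of_real (v j))) + cpoly Q (cos (- z - of_real (v j)))" if j: "j < 2 * n" for j z
    proof -
      have m: "cos (- z - of_real (v j)) = cos (z + of_real (v j))"
        using cos_minus[of "z + of_real (v j)"] by simp
      show ?thesis
      proof (cases "j \<le> n")
        case True
        then have "u j = v j" by (simp add: u_def v_def min_def)
        then show ?thesis unfolding E(2) m by simp
      next
        case False
        have uv: "u j = 2 * pi - v j" using False j n0 by (simp add: u_def v_def min_def of_nat_diff field_simps)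
        have "cos (z - of_real (u j)) = cos (z + of_real (v j) - 2 * of_real pi)"
          unfolding uv by (rule arg_cong[where f = cos]) simp
        also have "\<dots> = cos (z + of_real (v j))"
          using sin_cos_eq_iff by (simp add: cos_diff)
        finally have a: "cos (z - of_real (u j)) = cos (z + of_real (v j))" .
        have "cos (z + of_real (u j)) = cos (z - of_real (v j) + 2 * of_real pi)"
          unfolding uv by (rule arg_cong[where f = cos]) simp
        also have "\<dots> = cos (z - of_real (v j))" by (simp add: cos_add)
        finally show ?thesis unfolding E(2) m a by simp
      qed
    qed
    \<comment> \<open>Each \<open>E j\<close> contains two translates, and both families sum to S;
      hence the factor 2.\<close>
    define \<Lambda> where "\<Lambda> j = smult (1 / (2 * S)) (E j)" for j
    have deg: "degree (\<Lambda> j) \<le> n - r" for j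
      unfolding \<Lambda>_def by (rule order.trans[OF degree_smult_le order.trans[OF E(1) degQ]])
    have one: "(\<Sum>j<2 * n. cpoly (\<Lambda> j) (cos z)) = 1" for z
    proof -
      have "(\<Sum>j<2 * n. cpoly (\<Lambda> j) (cos z)) = of_real (1 / (2 * S)) * (\<Sum>j<2 * n. cpoly (E j) (cos z))"
        by (simp add: \<Lambda>_def sum_distrib_left)
      also have "(\<Sum>j<2 * n. cpoly (E j) (cos z)) = of_real S + of_real S"
        by (simp add: EJ sum.distrib sumJ)
      finally show ?thesis using Spos by (simp add: field_simps)
    qed
    have bound: "norm (cpoly (\<Lambda> j) (cos \<zeta>)) \<le> C / (1 + \<bar>real (min j (2 * n - j)) - real i\<bar>) ^ (2 * \<mu>)"
      if z: "0 \<le> Re \<zeta>" "Re \<zeta> \<le> pi" "\<bar>Im \<zeta>\<bar> \<le> 4 / real n"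
        and \<tau>: "real i * pi / real n \<le> \<tau>" "\<tau> \<le> (real i + 1) * pi / real n" "\<bar>Re \<zeta> - \<tau>\<bar> \<le> 2 * pi / real n" for j i \<tau> \<zeta>
    proof -
      define X where "X = \<bar>real (min j (2 * n - j)) - real i\<bar>"
      define B where "B = exp 6 * (7 + 3 * M) * (2 * real k + 1) / (1 + X)"
      have mn: "min j (2 * n - j) \<le> n" by auto
      have J: "norm (cpoly Q (cos w)) \<le> B ^ (2 * \<mu>)" if "w = \<zeta> - of_real (u j) \<or> w = \<zeta> + of_real (u j)" for w
      proof -
        have "norm (dirichlet_kernel k w) \<le> B"
          unfolding B_def X_def by (rule dirichlet_kernel_localized[OF n1 kn nM mn z \<tau>]) (use that in \<open>simp add: u_def\<close>)
        then have "norm (dirichlet_kernel k w) ^ (2 * \<mu>) \<le> B ^ (2 * \<mu>)" by (intro power_mono) auto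
        then show ?thesis by (simp add: Q_def Q0(2) norm_power)
      qed
      have "norm (cpoly (E j) (cos \<zeta>)) \<le> B ^ (2 * \<mu>) + B ^ (2 * \<mu>)"
        unfolding E(2) by (rule order.trans[OF norm_triangle_ineq]) (intro add_mono J; simp)
      then have "1 / (2 * S) * norm (cpoly (E j) (cos \<zeta>)) \<le> 1 / (2 * S) * (2 * B ^ (2 * \<mu>))"
        using Spos by (intro mult_left_mono) auto
      moreover have "norm (cpoly (\<Lambda> j) (cos \<zeta>)) = 1 / (2 * S) * norm (cpoly (E j) (cos \<zeta>))"
        using Spos by (simp add: \<Lambda>_def norm_mult norm_divide)
      ultimately have "norm (cpoly (\<Lambda> j) (cos \<zeta>)) \<le> 1 / (2 * S) * (2 * B ^ (2 * \<mu>))" by simp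
      also have "\<dots> = B ^ (2 * \<mu>) / S" by simp
      also have "\<dots> \<le> B ^ (2 * \<mu>) / (2 * real k + 1) ^ (2 * \<mu>)"
        using S Kpos Spos by (intro divide_left_mono) (auto simp: zero_le_even_power)
      also have "\<dots> = (B / (2 * real k + 1)) ^ (2 * \<mu>)" by (simp add: power_divide)
      also have "B / (2 * real k + 1) = exp 6 * (7 + 3 * M) / (1 + X)" by (simp add: B_def)
      also have "(\<dots>) ^ (2 * \<mu>) = C / (1 + X) ^ (2 * \<mu>)" by (simp add: C_def power_divide)
      finally show ?thesis unfolding X_def .
    qed
    show ?thesis using deg one bound by (intro exI[of _ \<Lambda>]) blast
  qed
  then show ?thesis using C0 by (intro exI[of _ C]) blast
qed

section \<open>Gluing local polynomials\<close>

text \<open>The distance from cos \<zeta> to cos \<tau> is 2 A B with the half-angle sines A and B,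
  where B \<le> A and sin \<tau> \<le> 2 A. If B exceeded 2 / n, then A B would be at least sin
  \<tau> / n and also larger than 1 / n^2, contradicting the radius \<open>rho\<close>. A small B in
  turn bounds both the real and the imaginary part of \<zeta> - \<tau>.\<close>

lemma arccos_localized:
  assumes n: "1 \<le> n" and \<tau>: "0 \<le> \<tau>" "\<tau> \<le> pi" and z: "norm (z - of_real (cos \<tau>)) \<le> rho n (cos \<tau>)"
  obtains \<zeta> where "cos \<zeta> = z" "0 \<le> Re \<zeta>" "Re \<zeta> \<le> pi" "\<bar>Im \<zeta>\<bar> \<le> 4 / real n" "\<bar>Re \<zeta> - \<tau>\<bar> \<le> 2 * pi / real n"
proof -
  \<comment> \<open>The cosine is even, so the sign of the preimage can be chosen to put its real
    part into [0, \<pi>].\<close>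
  define \<zeta> where "\<zeta> = (if 0 \<le> Re (Arccos z) then Arccos z else - Arccos z)"
  have cz: "cos \<zeta> = z" by (simp add: \<zeta>_def)
  have re: "0 \<le> Re \<zeta>" "Re \<zeta> \<le> pi" using Re_Arccos_bounds[of z] by (auto simp: \<zeta>_def)
  have n0: "0 < real n" using n by simp
  define A where "A = norm (sin ((\<zeta> + of_real \<tau>) / 2))"
  define B where "B = norm (sin ((\<zeta> - of_real \<tau>) / 2))"
  have A0: "0 \<le> A" "0 \<le> B" by (auto simp: A_def B_def)
  have sA: "\<bar>sin ((Re \<zeta> + \<tau>) / 2)\<bar> \<le> A" using norm_sin_ge[of "(\<zeta> + of_real \<tau>) / 2"] by (simp add: A_def)
  have sB: "\<bar>sin ((Re \<zeta> - \<tau>) / 2)\<bar> \<le> B" using norm_sin_ge[of "(\<zeta> - of_real \<tau>) / 2"] by (simp add: B_def)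
  have "B\<^sup>2 \<le> A\<^sup>2"
  proof -
    have "0 \<le> sin (Re \<zeta>) * sin \<tau>" using re \<tau> by (simp add: sin_ge_zero)
    then have "cos (Re \<zeta> + \<tau>) \<le> cos (Re \<zeta> - \<tau>)" by (simp add: cos_add cos_diff)
    moreover have "2 * Re ((\<zeta> + of_real \<tau>) / 2) = Re \<zeta> + \<tau>" "2 * Re ((\<zeta> - of_real \<tau>) / 2) = Re \<zeta> - \<tau>"
      "Im ((\<zeta> + of_real \<tau>) / 2) = Im \<zeta> / 2" "Im ((\<zeta> - of_real \<tau>) / 2) = Im \<zeta> / 2" by simp_all
    ultimately show ?thesis unfolding A_def B_def norm_sin_squared by (simp only:) simp
  qed
  then have BA: "B \<le> A" using A0 by (simp add: power2_le_iff_abs_le)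
  have "sin \<tau> = sin ((Re \<zeta> + \<tau>) / 2 - (Re \<zeta> - \<tau>) / 2)" by (simp add: field_simps)
  also have "\<dots> \<le> \<bar>sin ((Re \<zeta> + \<tau>) / 2)\<bar> * 1 + 1 * \<bar>sin ((Re \<zeta> - \<tau>) / 2)\<bar>"
  proof -
    have "sin (a - b) \<le> \<bar>sin a\<bar> * 1 + 1 * \<bar>sin b\<bar>" for a b :: real
    proof -
      have "sin (a - b) \<le> \<bar>sin a * cos b\<bar> + \<bar>cos a * sin b\<bar>" unfolding sin_diff by linarith
      also have "\<dots> \<le> \<bar>sin a\<bar> * 1 + 1 * \<bar>sin b\<bar>" unfolding abs_mult by (intro add_mono mult_mono) auto
      finally show ?thesis .
    qed
    then show ?thesis .
  qed
  finally have AB: "sin \<tau> \<le> 2 * A" using sA sB BA by linarith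
  have st: "0 \<le> sin \<tau>" using \<tau> by (simp add: sin_ge_zero)
  have prod: "2 * A * B \<le> sin \<tau> / real n + 1 / (real n)\<^sup>2"
  proof -
    have "z - of_real (cos \<tau>) = cos \<zeta> - cos (of_real \<tau>)" by (simp add: cz cos_of_real)
    also have "\<dots> = 2 * sin ((\<zeta> + of_real \<tau>) / 2) * sin ((of_real \<tau> - \<zeta>) / 2)" by (rule cos_diff_cos)
    also have "norm \<dots> = 2 * A * B"
      using sin_minus[of "(\<zeta> - of_real \<tau>) / 2"] by (simp add: A_def B_def norm_mult minus_divide_left norm_minus_cancel)
    finally show ?thesis using z \<tau> by (simp add: rho_cos)
  qed
  have B2: "B \<le> 2 / real n"
  proof (rule ccontr)
    assume "\<not> B \<le> 2 / real n"
    then have Bn: "2 / real n < B" by simp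
    have "sin \<tau> * (1 / real n) \<le> sin \<tau> * (B / 2)" using Bn st by (intro mult_left_mono) auto
    also have "\<dots> \<le> 2 * A * (B / 2)" using AB A0 by (intro mult_right_mono) auto
    finally have "sin \<tau> / real n \<le> A * B" by simp
    moreover have "1 / (real n)\<^sup>2 < A * B"
    proof -
      have "1 / (real n)\<^sup>2 < (2 / real n) * (2 / real n)" using n0 by (simp add: power2_eq_square divide_strict_right_mono)
      also have "\<dots> \<le> A * B" using Bn BA n0 A0 by (intro mult_mono) auto
      finally show ?thesis .
    qed
    ultimately show False using prod by (simp add: mult.assoc)
  qed
  have "\<bar>Re \<zeta> - \<tau>\<bar> / pi \<le> 2 / real n"
    using half_angle_sines(1)[OF re \<tau>] sB B2 by linarith
  then have "\<bar>Re \<zeta> - \<tau>\<bar> \<le> 2 * pi / real n" using pi_gt_zero by (simp add: divide_le_eq)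
  moreover have "\<bar>Im \<zeta>\<bar> \<le> 4 / real n"
  proof -
    \<comment> \<open>The modulus of sin (a + i y) is at least that of sinh y, and hence at least
      that of y.\<close>
    define y where "y = Im \<zeta> / 2"
    have "y\<^sup>2 \<le> ((exp y - inverse (exp y)) / 2)\<^sup>2"
      using real_le_abs_sinh[of y] unfolding abs_le_square_iff .
    also have "\<dots> = (exp (2 * y) + inverse (exp (2 * y)) - 2) / 4"
    proof -
      have "exp (2 * y) = exp y * exp y" by (simp only: mult_2 exp_add)
      moreover have "((e - inverse e) / 2)\<^sup>2 = (e * e + inverse (e * e) - 2) / 4" if "0 < e" for e :: real
      proof -
        have "e * inverse e = 1" using that by simp
        moreover have "((e - inverse e) / 2)\<^sup>2 = (e * e + inverse e * inverse e - 2 * (e * inverse e)) / 4"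
          by (simp add: power2_eq_square algebra_simps)
        ultimately show ?thesis by simp
      qed
      ultimately show ?thesis by (simp only: exp_gt_zero)
    qed
    also have "\<dots> \<le> B\<^sup>2"
      unfolding B_def norm_sin_squared using cos_le_one[of "Re \<zeta> - \<tau>"] by (simp add: y_def divide_right_mono)
    finally have "\<bar>y\<bar> \<le> B" using A0 by (simp add: power2_le_iff_abs_le)
    then show ?thesis using B2 by (simp add: y_def)
  qed
  ultimately show thesis using that cz re by blast
qed

text \<open>Interpolation at r equally spaced points of the interval: the numerators grow with the
  distance of z, while the denominators are at least l / r.\<close>

lemma poly_growth:
  fixes q :: "real poly"
  assumes deg: "degree q < r" and l: "0 < l" and y: "y \<in> {a..a + l}" and D: "\<And>x. x \<in> {a..a + l} \<Longrightarrow> \<bar>poly q x\<bar> \<le> D"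
  shows "norm (cpoly q z) \<le> D * real r * (real r * (1 + norm (z - of_real y) / l)) ^ r"
proof -
  have r0: "0 < real r" using deg by simp
  define x where "x i = a + l * real i / real r" for i :: nat
  have inj: "inj_on (\<lambda>i. complex_of_real (x i)) {..<r}" using l r0 by (auto simp: inj_on_def x_def)
  have xin: "x i \<in> {a..a + l}" if "i < r" for i
    using that l r0 by (auto simp: x_def divide_le_eq)
  have D0: "0 \<le> D" using D[OF y] by linarith
  define T where "T = real r * (1 + norm (z - of_real y) / l)"
  have T1: "1 \<le> T"
  proof -
    have "1 * 1 \<le> real r * (1 + norm (z - of_real y) / l)" using r0 l by (intro mult_mono) auto
    then show ?thesis by (simp add: T_def)
  qed
  have "cpoly q z = (\<Sum>i<r. cpoly q (of_real (x i)) * (\<Prod>k\<in>{..<r} - {i}. (z - of_real (x k)) / (of_real (x i) - of_real (x k))))"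
    unfolding cpoly_def by (rule lagrange_identity[OF inj]) (use deg in \<open>simp add: degree_map_poly\<close>)
  also have "norm \<dots> \<le> (\<Sum>i<r. D * T ^ r)"
  proof (rule sum_norm_le)
    fix i assume "i \<in> {..<r}"
    then have i: "i < r" by simp
    have fac: "norm ((z - of_real (x k)) / (of_real (x i) - of_real (x k))) \<le> T" if k: "k \<in> {..<r} - {i}" for k
    proof -
      have "norm (z - of_real (x k)) \<le> norm (z - of_real y) + \<bar>y - x k\<bar>"
        using norm_triangle_ineq[of "z - of_real y" "of_real (y - x k)"] by (simp add: norm_of_real del: of_real_diff) (simp add: algebra_simps)
      also have "\<bar>y - x k\<bar> \<le> l" using y xin[of k] k by (auto simp: abs_if)
      finally have num: "norm (z - of_real (x k)) \<le> norm (z - of_real y) + l" by simp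
      have den: "l / real r \<le> norm (complex_of_real (x i) - of_real (x k))"
      proof -
        have "x i - x k = l / real r * (real i - real k)" by (simp add: x_def right_diff_distrib diff_divide_distrib)
        then have "\<bar>x i - x k\<bar> = l / real r * \<bar>real i - real k\<bar>" using l r0 by (simp add: abs_mult)
        moreover have "1 \<le> \<bar>real i - real k\<bar>" using k by (auto simp: abs_if)
        ultimately have "l / real r * 1 \<le> \<bar>x i - x k\<bar>" using l r0 by (metis divide_nonneg_pos less_imp_le mult_left_mono)
        then show ?thesis by (simp flip: of_real_diff)
      qed
      have "norm ((z - of_real (x k)) / (of_real (x i) - of_real (x k))) \<le> (norm (z - of_real y) + l) / (l / real r)"
        unfolding norm_divide using num den l r0 by (intro frac_le) auto
      also have "\<dots> = T" using l r0 by (simp add: T_def field_simps)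
      finally show ?thesis .
    qed
    have "norm (\<Prod>k\<in>{..<r} - {i}. (z - of_real (x k)) / (of_real (x i) - of_real (x k))) \<le> (\<Prod>k\<in>{..<r} - {i}. T)"
      by (rule order.trans[OF norm_prod_le]) (intro prod_mono, use fac in auto)
    also have "\<dots> = T ^ (r - 1)" using i by simp
    also have "\<dots> \<le> T ^ r" using T1 by (intro power_increasing) auto
    finally have "norm (\<Prod>k\<in>{..<r} - {i}. (z - of_real (x k)) / (of_real (x i) - of_real (x k))) \<le> T ^ r" .
    moreover have "norm (cpoly q (of_real (x i))) \<le> D" using D[OF xin[OF i]] by (simp add: cpoly_of_real)
    ultimately show "norm (cpoly q (of_real (x i)) * (\<Prod>k\<in>{..<r} - {i}. (z - of_real (x k)) / (of_real (x i) - of_real (x k)))) \<le> D * T ^ r"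
      unfolding norm_mult using D0 by (intro mult_mono) auto
  qed
  finally show ?thesis by (simp add: T_def mult_ac)
qed

lemma sum_inverse_squares_le: "(\<Sum>m\<le>N. 1 / (1 + real m)\<^sup>2) \<le> 2 - 1 / (1 + real N)"
proof (induction N)
  case (Suc N)
  define x where "x = 1 + real N"
  have x0: "0 < x" by (simp add: x_def)
  have "1 / (1 + x)\<^sup>2 \<le> 1 / (x * (1 + x))"
    using x0 by (intro divide_left_mono) (auto simp: power2_eq_square)
  also have "\<dots> = 1 / x - 1 / (1 + x)" using x0 by (simp add: field_simps)
  finally have "1 / (1 + x)\<^sup>2 \<le> 1 / x - 1 / (1 + x)" .
  then show ?case using Suc by (simp add: x_def add.commute)
qed simp

text \<open>The indices on either side of i each contribute at most the one-sided sum, which is at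
  most 2.\<close>

lemma sum_inverse_square_distances_le:
  assumes "finite A"
  shows "(\<Sum>m\<in>A. 1 / (1 + \<bar>real m - real i\<bar>)\<^sup>2) \<le> 4"
proof -
  define N where "N = Max (insert i A)"
  have N: "m \<le> N" if "m \<in> A" for m using that assms by (simp add: N_def)
  have iN: "i \<le> N" using assms by (simp add: N_def)
  have two: "(\<Sum>m\<le>N. 1 / (1 + real m)\<^sup>2) \<le> 2" using sum_inverse_squares_le[of N]
    by (rule order.trans) simp
  have "(\<Sum>m\<in>A. 1 / (1 + \<bar>real m - real i\<bar>)\<^sup>2) \<le> (\<Sum>m\<in>{i..N} \<union> {..<i}. 1 / (1 + \<bar>real m - real i\<bar>)\<^sup>2)"
    using N by (intro sum_mono2) auto
  also have "\<dots> = (\<Sum>m\<in>{i..N}. 1 / (1 + \<bar>real m - real i\<bar>)\<^sup>2) + (\<Sum>m\<in>{..<i}. 1 / (1 + \<bar>real m - real i\<bar>)\<^sup>2)"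
    by (intro sum.union_disjoint) auto
  also have "(\<Sum>m\<in>{i..N}. 1 / (1 + \<bar>real m - real i\<bar>)\<^sup>2) = (\<Sum>m\<le>N - i. 1 / (1 + real m)\<^sup>2)"
    by (rule sum.reindex_bij_witness[of _ "\<lambda>m. m + i" "\<lambda>m. m - i"]) (use iN in \<open>auto simp: of_nat_diff\<close>)
  also have "\<dots> \<le> (\<Sum>m\<le>N. 1 / (1 + real m)\<^sup>2)" by (intro sum_mono2) auto
  also have "(\<Sum>m\<in>{..<i}. 1 / (1 + \<bar>real m - real i\<bar>)\<^sup>2) = (\<Sum>m\<in>{1..i}. 1 / (1 + real m)\<^sup>2)"
    by (rule sum.reindex_bij_witness[of _ "\<lambda>m. i - m" "\<lambda>m. i - m"]) (auto simp: of_nat_diff)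
  also have "\<dots> \<le> (\<Sum>m\<le>N. 1 / (1 + real m)\<^sup>2)" using iN by (intro sum_mono2) auto
  finally show ?thesis using two by simp
qed

lemma higher_pderiv_eq_0:
  fixes q :: "real poly"
  assumes "degree q < k"
  shows "(pderiv ^^ k) q = 0"
  by (rule poly_eqI) (use assms in \<open>simp add: coeff_higher_pderiv coeff_eq_0\<close>)

lemma telescope_bound:
  fixes a :: "nat \<Rightarrow> 'a::real_normed_vector" and c :: "nat \<Rightarrow> real"
  assumes "\<And>l. min m i \<le> l \<Longrightarrow> l < max m i \<Longrightarrow> norm (a l - a (Suc l)) \<le> c l"
  shows "norm (a m - a i) \<le> (\<Sum>l\<in>{min m i..<max m i}. c l)"
proof -
  have *: "norm (a s - a t) \<le> (\<Sum>l\<in>{s..<t}. c l)" if "s \<le> t" "\<And>l. s \<le> l \<Longrightarrow> l < t \<Longrightarrow> norm (a l - a (Suc l)) \<le> c l" for s t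
    using that
  proof (induction t rule: dec_induct)
    case (step t)
    have "norm (a s - a (Suc t)) \<le> norm (a s - a t) + norm (a t - a (Suc t))"
      using norm_triangle_ineq[of "a s - a t" "a t - a (Suc t)"] by simp
    also have "\<dots> \<le> (\<Sum>l\<in>{s..<t}. c l) + c t" using step by (intro add_mono) auto
    finally show ?case using step by simp
  qed simp
  show ?thesis
  proof (cases "m \<le> i")
    case True
    then show ?thesis using *[of m i] assms by (simp add: min_def max_def)
  next
    case False
    then show ?thesis using *[of i m] assms by (simp add: min_def max_def norm_minus_commute)
  qed
qed

text \<open>Relative to the length of the cell on which q is bounded, distances are at most
  quadratic in the index distance; a polynomial of degree below r therefore grows at most like the
  power 2 r. The constant 100 is 4 * 5^2, from 1 + 3 (1 + d)^2 \<le> 4 (1 + d)^2 and 1 + d \<le> 5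
  (1 + X).\<close>

lemma piecewise_difference_growth:
  assumes n: "1 \<le> n" and l: "Suc l < n" and deg: "degree q < r"
    and D: "\<And>x. x \<in> {cos (real (l + 2) * pi / real n)..cos (real (l + 1) * pi / real n)} \<Longrightarrow> \<bar>poly q x\<bar> \<le> D"
    and \<tau>: "0 \<le> \<tau>" "\<tau> \<le> pi" "real i * pi / real n \<le> \<tau>" "\<tau> \<le> (real i + 1) * pi / real n"
    and z: "norm (z - of_real (cos \<tau>)) \<le> rho n (cos \<tau>)"
  shows "norm (cpoly q z) \<le> D * real r * (100 * real r) ^ r * (1 + \<bar>real i - real l\<bar>) ^ (2 * r)"
proof -
  define X where "X = \<bar>real i - real l\<bar>"
  define s where "s = real (l + 1) * pi / real n"
  define t where "t = real (l + 2) * pi / real n"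
  define h where "h = cos s - cos t"
  have n0: "0 < real n" using n by simp
  have st: "0 \<le> s" "s < t" "t \<le> pi" "t - s = pi / real n"
  proof -
    have "real (l + 2) * pi \<le> real n * pi" using l by (intro mult_right_mono) auto
    then show "t \<le> pi" using n0 by (simp add: t_def divide_le_eq mult.commute)
    show d: "t - s = pi / real n" by (simp add: s_def t_def diff_divide_distrib[symmetric] algebra_simps)
    have "0 < pi / real n" using n0 by simp
    then show "s < t" using d by linarith
    show "0 \<le> s" by (simp add: s_def)
  qed
  have h0: "0 < h" unfolding h_def using st cos_monotone_0_pi[of s t] by simp
  have "rho n (cos s) \<le> 3 * (cos s - cos t)"
    by (rule cos_interval_length(1)[OF st(1) st(3) n]) (use st n0 in \<open>auto simp: divide_right_mono\<close>)
  then have rh: "rho n (cos s) \<le> 3 * h" by (simp add: h_def)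
  define d where "d = real n * \<bar>\<tau> - s\<bar>"
  have d0: "0 \<le> d" by (simp add: d_def)
  have dX: "d \<le> 4 * (1 + X)"
  proof -
    have nt: "real i * pi \<le> real n * \<tau>" "real n * \<tau> \<le> (real i + 1) * pi" using \<tau> n0 by (auto simp: field_simps)
    have ns: "real n * s = (real l + 1) * pi" using n0 by (simp add: s_def)
    have "d = \<bar>real n * \<tau> - real n * s\<bar>" using n0 by (simp add: d_def abs_mult flip: right_diff_distrib)
    also have "\<dots> \<le> \<bar>(real i - real l) * pi\<bar> + pi"
    proof -
      have "real n * \<tau> - real n * s = (real i - real l) * pi + (real n * \<tau> - real i * pi - pi)"
        unfolding ns by (simp add: algebra_simps)
      moreover have "\<bar>real n * \<tau> - real i * pi - pi\<bar> \<le> pi" using nt by (simp add: distrib_right abs_le_iff)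
      ultimately show ?thesis using abs_triangle_ineq[of "(real i - real l) * pi" "real n * \<tau> - real i * pi - pi"] by simp
    qed
    also have "\<dots> = pi * (1 + X)" by (simp add: X_def abs_mult distrib_left)
    also have "\<dots> \<le> 4 * (1 + X)" using pi_less_4 by (intro mult_right_mono) (auto simp: X_def)
    finally show ?thesis .
  qed
  have "norm (z - of_real (cos s)) \<le> norm (z - of_real (cos \<tau>)) + \<bar>cos \<tau> - cos s\<bar>"
    using norm_triangle_ineq[of "z - of_real (cos \<tau>)" "of_real (cos \<tau> - cos s)"] by (simp add: norm_of_real del: of_real_diff) simp
  also have "\<dots> \<le> rho n (cos s) * (1 + d) + rho n (cos s) * (d * (1 + d))"
    using st \<tau> n by (intro add_mono order.trans[OF z] rho_cos_le cos_diff_le_rho) (auto simp: d_def)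
  also have "\<dots> = rho n (cos s) * (1 + d)\<^sup>2" by (simp add: power2_eq_square algebra_simps)
  also have "\<dots> \<le> 3 * h * (1 + d)\<^sup>2" using rh by (intro mult_right_mono) auto
  finally have "norm (z - of_real (cos s)) / h \<le> 3 * (1 + d)\<^sup>2" using h0 by (simp add: divide_le_eq mult_ac)
  then have "1 + norm (z - of_real (cos s)) / h \<le> 4 * (1 + d)\<^sup>2"
    using d0 one_le_power[of "1 + d" 2] by linarith
  also have "\<dots> \<le> 4 * (5 * (1 + X))\<^sup>2"
  proof -
    have "0 \<le> X" by (simp add: X_def)
    then have "1 + d \<le> 5 * (1 + X)" using dX by simp
    then show ?thesis using d0 by (intro mult_left_mono power_mono) auto
  qed
  also have "\<dots> = 100 * (1 + X)\<^sup>2" unfolding power_mult_distrib by simp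
  finally have g: "1 + norm (z - of_real (cos s)) / h \<le> 100 * (1 + X)\<^sup>2" .
  have D0: "0 \<le> D" using D[of "cos s"] h0 by (auto simp: h_def s_def t_def intro: order.trans[OF abs_ge_zero])
  have "norm (cpoly q z) \<le> D * real r * (real r * (1 + norm (z - of_real (cos s)) / h)) ^ r"
    by (rule poly_growth[OF deg h0, of _ "cos t"]) (use D h0 in \<open>auto simp: h_def s_def t_def\<close>)
  also have "\<dots> \<le> D * real r * (real r * (100 * (1 + X)\<^sup>2)) ^ r"
    using g D0 h0 by (intro mult_left_mono power_mono mult_nonneg_nonneg) auto
  also have "(real r * (100 * (1 + X)\<^sup>2)) ^ r = (100 * real r) ^ r * (1 + X) ^ (2 * r)"
    unfolding power_mult_distrib power_mult[of "1 + X" 2 r] by (simp only: mult_ac)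
  finally show ?thesis by (simp add: X_def mult.assoc)
qed

text \<open>Folding hits every index at most twice, hence twice the bound 4.\<close>

lemma sum_folded_inverse_squares_le:
  "(\<Sum>j<2 * n. 1 / (1 + \<bar>real (min j (2 * n - j)) - real i\<bar>)\<^sup>2) \<le> 8"
proof -
  have "(\<Sum>j<2 * n. 1 / (1 + \<bar>real (min j (2 * n - j)) - real i\<bar>)\<^sup>2)
     = (\<Sum>j\<in>{..<n} \<union> {n..<2 * n}. 1 / (1 + \<bar>real (min j (2 * n - j)) - real i\<bar>)\<^sup>2)"
    by (intro sum.cong) auto
  also have "\<dots> = (\<Sum>j\<in>{..<n}. 1 / (1 + \<bar>real (min j (2 * n - j)) - real i\<bar>)\<^sup>2) + (\<Sum>j\<in>{n..<2 * n}. 1 / (1 + \<bar>real (min j (2 * n - j)) - real i\<bar>)\<^sup>2)"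
    by (intro sum.union_disjoint) auto
  also have "(\<Sum>j\<in>{..<n}. 1 / (1 + \<bar>real (min j (2 * n - j)) - real i\<bar>)\<^sup>2) = (\<Sum>j\<in>{..<n}. 1 / (1 + \<bar>real j - real i\<bar>)\<^sup>2)"
    by (intro sum.cong) (auto simp: min_def)
  also have "(\<Sum>j\<in>{n..<2 * n}. 1 / (1 + \<bar>real (min j (2 * n - j)) - real i\<bar>)\<^sup>2) = (\<Sum>j\<in>{1..n}. 1 / (1 + \<bar>real j - real i\<bar>)\<^sup>2)"
    by (rule sum.reindex_bij_witness[of _ "\<lambda>j. 2 * n - j" "\<lambda>j. 2 * n - j"]) (auto simp: min_def)
  also have "(\<Sum>j\<in>{..<n}. 1 / (1 + \<bar>real j - real i\<bar>)\<^sup>2) + (\<Sum>j\<in>{1..n}. 1 / (1 + \<bar>real j - real i\<bar>)\<^sup>2) \<le> 4 + 4"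
    by (intro add_mono sum_inverse_square_distances_le) auto
  finally show ?thesis by simp
qed

text \<open>The decay \<kappa> is a parameter because it can be fixed only when the growth exponent
  of the weight and p are known. The disks on which the estimate is carried out have radius exactly
  \<open>rho\<close>, so that Cauchy's inequality produces the weight rho^\<nu> of the derivative
  bound.\<close>

lemma polynomial_gluing:
  assumes r: "1 \<le> r"
  shows "\<exists>C>0. \<forall>n q D. r \<le> n \<longrightarrow> (\<forall>i<n. degree (q i) < r) \<longrightarrow>
    (\<forall>l. Suc l < n \<longrightarrow> (\<forall>x\<in>{cos (real (l + 2) * pi / real n)..cos (real (l + 1) * pi / real n)}. \<bar>poly (q l) x - poly (q (Suc l)) x\<bar> \<le> D l)) \<longrightarrow>
    (\<exists>P. degree P \<le> n - 1 \<and> (\<forall>i<n. \<forall>\<tau>. real i * pi / real n \<le> \<tau> \<longrightarrow> \<tau> \<le> (real i + 1) * pi / real n \<longrightarrow>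
       \<bar>poly (q i) (cos \<tau>) - poly P (cos \<tau>)\<bar> \<le> C * (\<Sum>l<n - 1. D l / (1 + \<bar>real i - real l\<bar>) ^ \<kappa>) \<and>
       (\<forall>\<nu>. r \<le> \<nu> \<longrightarrow> \<nu> \<le> \<nu>\<^sub>0 \<longrightarrow> \<bar>rho n (cos \<tau>) ^ \<nu> * poly ((pderiv ^^ \<nu>) P) (cos \<tau>)\<bar>
           \<le> C * (\<Sum>l<n - 1. D l / (1 + \<bar>real i - real l\<bar>) ^ \<kappa>))))"
proof -
  \<comment> \<open>Of the decay 2 \<mu> = 2 r + 2 \<kappa> + 2, the part 2 r pays for the growth of
    the neighbouring differences and 2 for the sum over j; of the rest, \<kappa> remains in the
    result.\<close>
  define \<mu> where "\<mu> = r + \<kappa> + 1"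
  have \<mu>1: "1 \<le> \<mu>" by (simp add: \<mu>_def)
  obtain C1 where C1: "0 < C1" and part: "\<forall>n\<ge>r. \<exists>\<Lambda>::nat \<Rightarrow> real poly. (\<forall>j. degree (\<Lambda> j) \<le> n - r) \<and>
     (\<forall>z. (\<Sum>j<2 * n. cpoly (\<Lambda> j) (cos z)) = 1) \<and>
     (\<forall>j<2 * n. \<forall>i \<tau> \<zeta>. 0 \<le> Re \<zeta> \<longrightarrow> Re \<zeta> \<le> pi \<longrightarrow> \<bar>Im \<zeta>\<bar> \<le> 4 / real n \<longrightarrow>
        real i * pi / real n \<le> \<tau> \<longrightarrow> \<tau> \<le> (real i + 1) * pi / real n \<longrightarrow> \<bar>Re \<zeta> - \<tau>\<bar> \<le> 2 * pi / real n \<longrightarrow>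
        norm (cpoly (\<Lambda> j) (cos \<zeta>)) \<le> C1 / (1 + \<bar>real (min j (2 * n - j)) - real i\<bar>) ^ (2 * \<mu>))"
    using polynomial_partition_of_unity[OF r \<mu>1] by (elim exE conjE)
  define C2 where "C2 = real r * (100 * real r) ^ r"
  have C2: "0 < C2" using r by (simp add: C2_def)
  define C where "C = fact \<nu>\<^sub>0 * (8 * C1 * C2)"
  have f1: "(1::real) \<le> fact \<nu>\<^sub>0" by simp
  have C0: "0 < C" using C1 C2 by (simp add: C_def)
  have "\<exists>P. degree P \<le> n - 1 \<and> (\<forall>i<n. \<forall>\<tau>. real i * pi / real n \<le> \<tau> \<longrightarrow> \<tau> \<le> (real i + 1) * pi / real n \<longrightarrow>
       \<bar>poly (q i) (cos \<tau>) - poly P (cos \<tau>)\<bar> \<le> C * (\<Sum>l<n - 1. D l / (1 + \<bar>real i - real l\<bar>) ^ \<kappa>) \<and>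
       (\<forall>\<nu>. r \<le> \<nu> \<longrightarrow> \<nu> \<le> \<nu>\<^sub>0 \<longrightarrow> \<bar>rho n (cos \<tau>) ^ \<nu> * poly ((pderiv ^^ \<nu>) P) (cos \<tau>)\<bar>
           \<le> C * (\<Sum>l<n - 1. D l / (1 + \<bar>real i - real l\<bar>) ^ \<kappa>)))"
    if nr: "r \<le> n" and deg: "\<forall>i<n. degree (q i) < r"
      and D: "\<forall>l. Suc l < n \<longrightarrow> (\<forall>x\<in>{cos (real (l + 2) * pi / real n)..cos (real (l + 1) * pi / real n)}. \<bar>poly (q l) x - poly (q (Suc l)) x\<bar> \<le> D l)"
    for n D and q :: "nat \<Rightarrow> real poly"
  proof -
    have n1: "1 \<le> n" using r nr by simp
    have n0: "0 < real n" using n1 by simp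
    obtain \<Lambda> :: "nat \<Rightarrow> real poly" where \<Lambda>deg: "\<And>j. degree (\<Lambda> j) \<le> n - r"
      and \<Lambda>one: "\<And>z. (\<Sum>j<2 * n. cpoly (\<Lambda> j) (cos z)) = 1"
      and \<Lambda>bd: "\<forall>j<2 * n. \<forall>i \<tau> \<zeta>. 0 \<le> Re \<zeta> \<longrightarrow> Re \<zeta> \<le> pi \<longrightarrow> \<bar>Im \<zeta>\<bar> \<le> 4 / real n \<longrightarrow>
        real i * pi / real n \<le> \<tau> \<longrightarrow> \<tau> \<le> (real i + 1) * pi / real n \<longrightarrow> \<bar>Re \<zeta> - \<tau>\<bar> \<le> 2 * pi / real n \<longrightarrow>
        norm (cpoly (\<Lambda> j) (cos \<zeta>)) \<le> C1 / (1 + \<bar>real (min j (2 * n - j)) - real i\<bar>) ^ (2 * \<mu>)"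
      using part[rule_format, OF nr] by (elim exE conjE) (rule that, auto)
    \<comment> \<open>The nodes fold to the indices 0, ..., n, but there are only n local
      polynomials, so index n is moved to n - 1.\<close>
    define m where "m j = min (min j (2 * n - j)) (n - 1)" for j
    have mn: "m j < n" for j using n1 by (auto simp: m_def)
    define P where "P = (\<Sum>j<2 * n. \<Lambda> j * q (m j))"
    have degP: "degree P \<le> n - 1"
      unfolding P_def
    proof (rule degree_sum_le)
      fix j
      have "degree (\<Lambda> j * q (m j)) \<le> degree (\<Lambda> j) + degree (q (m j))" by (rule degree_mult_le)
      also have "\<dots> \<le> (n - r) + (r - 1)" using \<Lambda>deg[of j] deg mn[of j] by (intro add_mono) (auto simp: less_eq_Suc_le)
      finally show "degree (\<Lambda> j * q (m j)) \<le> n - 1" using nr r by simp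
    qed simp
    have core: "norm (cpoly (P - q i) z) \<le> 8 * C1 * C2 * (\<Sum>l<n - 1. D l / (1 + \<bar>real i - real l\<bar>) ^ \<kappa>)"
      if i: "i < n" and \<tau>: "real i * pi / real n \<le> \<tau>" "\<tau> \<le> (real i + 1) * pi / real n"
        and z: "norm (z - of_real (cos \<tau>)) \<le> rho n (cos \<tau>)" for i \<tau> z
    proof -
      have \<tau>0: "0 \<le> \<tau>" using \<tau>(1) by (rule order.trans[rotated]) simp
      have "(real i + 1) * pi / real n \<le> real n * pi / real n" using i by (intro divide_right_mono mult_right_mono) auto
      then have \<tau>pi: "\<tau> \<le> pi" using \<tau>(2) n0 by simp
      obtain \<zeta> where \<zeta>: "cos \<zeta> = z" "0 \<le> Re \<zeta>" "Re \<zeta> \<le> pi" "\<bar>Im \<zeta>\<bar> \<le> 4 / real n" "\<bar>Re \<zeta> - \<tau>\<bar> \<le> 2 * pi / real n"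
        using arccos_localized[OF n1 \<tau>0 \<tau>pi z] by blast
      define X where "X l = \<bar>real i - real l\<bar>" for l
      define Y where "Y j = \<bar>real (min j (2 * n - j)) - real i\<bar>" for j
      define S where "S = (\<Sum>l<n - 1. D l / (1 + X l) ^ \<kappa>)"
      \<comment> \<open>The cell is nonempty, so a bound on an absolute value there forces D l to be
        nonnegative.\<close>
      have D0: "0 \<le> D l" if "l < n - 1" for l
      proof -
        have "Suc l < n" using that by simp
        moreover have "cos (real (l + 1) * pi / real n) \<in> {cos (real (l + 2) * pi / real n)..cos (real (l + 1) * pi / real n)}"
        proof -
          have "real (l + 2) * pi / real n \<le> real n * pi / real n" using \<open>Suc l < n\<close> by (intro divide_right_mono mult_right_mono) auto
          then have "real (l + 2) * pi / real n \<le> pi" using n0 by simp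
          moreover have "real (l + 1) * pi / real n \<le> real (l + 2) * pi / real n" by (intro divide_right_mono mult_right_mono) auto
          ultimately show ?thesis by (auto intro!: cos_monotone_0_pi_le)
        qed
        ultimately show ?thesis using D by (meson abs_ge_zero order.trans)
      qed
      have diff: "norm (cpoly (q l) z - cpoly (q (Suc l)) z) \<le> D l * C2 * (1 + X l) ^ (2 * r)" if "Suc l < n" for l
      proof -
        have "norm (cpoly (q l - q (Suc l)) z) \<le> D l * real r * (100 * real r) ^ r * (1 + \<bar>real i - real l\<bar>) ^ (2 * r)"
        proof (rule piecewise_difference_growth[OF n1 that _ _ \<tau>0 \<tau>pi \<tau> z])
          show "degree (q l - q (Suc l)) < r" using deg that by (intro degree_diff_less) auto
        qed (use D that in auto)
        then show ?thesis by (simp add: X_def C2_def mult.assoc)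
      qed
      have summand: "norm (cpoly (\<Lambda> j) z * (cpoly (q (m j)) z - cpoly (q i) z)) \<le> C1 / (1 + Y j)\<^sup>2 * (C2 * S)" if j: "j < 2 * n" for j
      proof -
        have L: "norm (cpoly (\<Lambda> j) z) \<le> C1 / (1 + Y j) ^ (2 * \<mu>)"
          using \<Lambda>bd[rule_format, OF j \<zeta>(2,3,4) \<tau> \<zeta>(5)] \<zeta>(1) by (simp add: Y_def)
        have "norm (cpoly (q (m j)) z - cpoly (q i) z) \<le> (\<Sum>l\<in>{min (m j) i..<max (m j) i}. D l * C2 * (1 + X l) ^ (2 * r))"
          by (rule telescope_bound, rule diff) (use mn[of j] i in \<open>auto simp: max_def split: if_splits\<close>)
        then have "norm (cpoly (\<Lambda> j) z) * norm (cpoly (q (m j)) z - cpoly (q i) z)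
          \<le> C1 / (1 + Y j) ^ (2 * \<mu>) * (\<Sum>l\<in>{min (m j) i..<max (m j) i}. D l * C2 * (1 + X l) ^ (2 * r))"
          using L C1 by (intro mult_mono) (auto simp: Y_def)
        also have "\<dots> = (\<Sum>l\<in>{min (m j) i..<max (m j) i}. C1 / (1 + Y j) ^ (2 * \<mu>) * (D l * C2 * (1 + X l) ^ (2 * r)))"
          by (rule sum_distrib_left)
        also have "\<dots> \<le> (\<Sum>l\<in>{min (m j) i..<max (m j) i}. C1 / (1 + Y j)\<^sup>2 * (C2 * (D l / (1 + X l) ^ \<kappa>)))"
        proof (rule sum_mono)
          fix l assume l: "l \<in> {min (m j) i..<max (m j) i}"
          have ln: "l < n - 1" using l mn[of j] i by (auto simp: max_def split: if_splits)
          \<comment> \<open>An index l between \<open>m j\<close> and i is no farther from i than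
            the folded node of j, so decay in Y can be traded for decay in X.\<close>
          have XY: "X l \<le> Y j" using l i n1 by (auto simp: X_def Y_def m_def min_def max_def abs_if of_nat_diff split: if_splits)
          have X0: "0 \<le> X l" "0 \<le> Y j" by (auto simp: X_def Y_def)
          have "(1 + X l) ^ (2 * r) * (1 + X l) ^ \<kappa> = (1 + X l) ^ (2 * r + \<kappa>)" by (simp add: power_add)
          also have "\<dots> \<le> (1 + X l) ^ (2 * r + 2 * \<kappa>)" using X0 by (intro power_increasing) auto
          also have "\<dots> \<le> (1 + Y j) ^ (2 * r + 2 * \<kappa>)" using XY X0 by (intro power_mono) auto
          finally have "(1 + X l) ^ (2 * r) * (1 + X l) ^ \<kappa> * (1 + Y j)\<^sup>2 \<le> (1 + Y j) ^ (2 * r + 2 * \<kappa>) * (1 + Y j)\<^sup>2"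
            by (intro mult_right_mono) auto
          also have "\<dots> = (1 + Y j) ^ (2 * \<mu>)" by (simp add: \<mu>_def flip: power_add)
          finally have "(1 + X l) ^ (2 * r) / (1 + Y j) ^ (2 * \<mu>) \<le> 1 / ((1 + Y j)\<^sup>2 * (1 + X l) ^ \<kappa>)"
            using X0 by (simp add: divide_le_eq le_divide_eq mult_ac)
          then have "(C1 * C2 * D l) * ((1 + X l) ^ (2 * r) / (1 + Y j) ^ (2 * \<mu>)) \<le> (C1 * C2 * D l) * (1 / ((1 + Y j)\<^sup>2 * (1 + X l) ^ \<kappa>))"
            using C1 C2 D0[OF ln] by (intro mult_left_mono) auto
          then show "C1 / (1 + Y j) ^ (2 * \<mu>) * (D l * C2 * (1 + X l) ^ (2 * r)) \<le> C1 / (1 + Y j)\<^sup>2 * (C2 * (D l / (1 + X l) ^ \<kappa>))"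
            by (simp add: mult_ac)
        qed
        also have "\<dots> = C1 / (1 + Y j)\<^sup>2 * (C2 * (\<Sum>l\<in>{min (m j) i..<max (m j) i}. D l / (1 + X l) ^ \<kappa>))"
          by (simp add: sum_distrib_left)
        also have "\<dots> \<le> C1 / (1 + Y j)\<^sup>2 * (C2 * S)"
        proof (intro mult_left_mono)
          show "(\<Sum>l\<in>{min (m j) i..<max (m j) i}. D l / (1 + X l) ^ \<kappa>) \<le> S" unfolding S_def
            using mn[of j] i D0 by (intro sum_mono2) (auto simp: max_def X_def split: if_splits)
        qed (use C1 C2 in auto)
        finally show ?thesis by (simp add: norm_mult)
      qed
      have S0: "0 \<le> S" unfolding S_def using D0 by (intro sum_nonneg divide_nonneg_nonneg) (auto simp: X_def)
      have "cpoly (P - q i) z = (\<Sum>j<2 * n. cpoly (\<Lambda> j) z * (cpoly (q (m j)) z - cpoly (q i) z))"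
      proof -
        have one: "(\<Sum>j<2 * n. cpoly (\<Lambda> j) z) = 1" using \<Lambda>one[of \<zeta>] \<zeta>(1) by simp
        have "(\<Sum>j<2 * n. cpoly (\<Lambda> j) z * (cpoly (q (m j)) z - cpoly (q i) z))
          = (\<Sum>j<2 * n. cpoly (\<Lambda> j) z * cpoly (q (m j)) z) - (\<Sum>j<2 * n. cpoly (\<Lambda> j) z) * cpoly (q i) z"
          by (simp add: right_diff_distrib sum_subtractf sum_distrib_right)
        then show ?thesis unfolding one by (simp add: P_def)
      qed
      also have "norm \<dots> \<le> (\<Sum>j<2 * n. C1 / (1 + Y j)\<^sup>2 * (C2 * S))"
        by (rule sum_norm_le) (use summand in auto)
      also have "\<dots> = C1 * C2 * S * (\<Sum>j<2 * n. 1 / (1 + Y j)\<^sup>2)"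
        by (simp add: sum_distrib_left sum_distrib_right mult_ac)
      also have "\<dots> \<le> C1 * C2 * S * 8"
        using sum_folded_inverse_squares_le[of n i] C1 C2 S0 unfolding Y_def by (intro mult_left_mono) auto
      finally show ?thesis by (simp add: S_def X_def mult_ac)
    qed
    have "\<bar>poly (q i) (cos \<tau>) - poly P (cos \<tau>)\<bar> \<le> C * (\<Sum>l<n - 1. D l / (1 + \<bar>real i - real l\<bar>) ^ \<kappa>) \<and>
       (\<forall>\<nu>. r \<le> \<nu> \<longrightarrow> \<nu> \<le> \<nu>\<^sub>0 \<longrightarrow> \<bar>rho n (cos \<tau>) ^ \<nu> * poly ((pderiv ^^ \<nu>) P) (cos \<tau>)\<bar>
           \<le> C * (\<Sum>l<n - 1. D l / (1 + \<bar>real i - real l\<bar>) ^ \<kappa>))"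
      if i: "i < n" and \<tau>: "real i * pi / real n \<le> \<tau>" "\<tau> \<le> (real i + 1) * pi / real n" for i \<tau>
    proof -
      define B where "B = 8 * C1 * C2 * (\<Sum>l<n - 1. D l / (1 + \<bar>real i - real l\<bar>) ^ \<kappa>)"
      have rp: "0 < rho n (cos \<tau>)" using n1 by (intro rho_pos) auto
      have B: "norm (cpoly (P - q i) z) \<le> B" if "norm (z - of_real (cos \<tau>)) \<le> rho n (cos \<tau>)" for z
        using core[OF i \<tau> that] by (simp add: B_def)
      have B0: "0 \<le> B" using B[of "of_real (cos \<tau>)"] rp by (auto intro: order.trans[OF norm_ge_zero])
      have CB: "C * (\<Sum>l<n - 1. D l / (1 + \<bar>real i - real l\<bar>) ^ \<kappa>) = fact \<nu>\<^sub>0 * B" by (simp add: C_def B_def)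
      have "\<bar>poly (q i) (cos \<tau>) - poly P (cos \<tau>)\<bar> = norm (cpoly (P - q i) (of_real (cos \<tau>)))"
        unfolding cpoly_of_real norm_of_real by (simp add: abs_minus_commute)
      also have "\<dots> \<le> B" using rp by (intro B) simp
      also have "\<dots> \<le> fact \<nu>\<^sub>0 * B" using B0 mult_right_mono[OF f1 B0] by simp
      finally have first: "\<bar>poly (q i) (cos \<tau>) - poly P (cos \<tau>)\<bar> \<le> fact \<nu>\<^sub>0 * B" .
      have second: "\<bar>rho n (cos \<tau>) ^ \<nu> * poly ((pderiv ^^ \<nu>) P) (cos \<tau>)\<bar> \<le> fact \<nu>\<^sub>0 * B" if \<nu>: "r \<le> \<nu>" "\<nu> \<le> \<nu>\<^sub>0" for \<nu>
      proof -
        have "(pderiv ^^ \<nu>) (q i) = 0" using deg i \<nu> by (intro higher_pderiv_eq_0) auto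
        then have "(pderiv ^^ \<nu>) (P - q i) = (pderiv ^^ \<nu>) P"
          using higher_pderiv_add[of \<nu> "P - q i" "q i"] by simp
        then have "\<bar>poly ((pderiv ^^ \<nu>) P) (cos \<tau>)\<bar> = norm ((deriv ^^ \<nu>) (cpoly (P - q i)) (of_real (cos \<tau>)))"
          by (simp add: cpoly_higher_deriv cpoly_of_real)
        also have "\<dots> \<le> fact \<nu> * B / rho n (cos \<tau>) ^ \<nu>"
        proof (rule Cauchy_inequality[OF cpoly_holomorphic _ rp])
          show "continuous_on (cball (complex_of_real (cos \<tau>)) (rho n (cos \<tau>))) (cpoly (P - q i))"
            by (rule holomorphic_on_imp_continuous_on[OF cpoly_holomorphic])
          show "norm (cpoly (P - q i) x) \<le> B" if "norm (complex_of_real (cos \<tau>) - x) = rho n (cos \<tau>)" for x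
            using that by (intro B) (simp add: norm_minus_commute)
        qed
        finally have "rho n (cos \<tau>) ^ \<nu> * \<bar>poly ((pderiv ^^ \<nu>) P) (cos \<tau>)\<bar> \<le> fact \<nu> * B"
          using rp by (simp add: le_divide_eq mult.commute)
        also have "\<dots> \<le> fact \<nu>\<^sub>0 * B" using \<nu> B0 by (intro mult_right_mono fact_mono) auto
        finally show ?thesis using rp by (simp add: abs_mult)
      qed
      show ?thesis using first second unfolding CB by blast
    qed
    then show ?thesis using degP by blast
  qed
  then show ?thesis using C0 by (intro exI[of _ C]) blast
qed

section \<open>Finite exponents\<close>

definition grid :: "nat \<Rightarrow> nat \<Rightarrow> real" where
  "grid n i = cos (real i * pi / real n)"

lemma grid_angle:
  assumes "1 \<le> n" "i \<le> n"
  shows "0 \<le> real i * pi / real n" "real i * pi / real n \<le> pi"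
  using assms by (auto simp: field_simps)

lemma grid_antimono: "1 \<le> n \<Longrightarrow> i \<le> j \<Longrightarrow> j \<le> n \<Longrightarrow> grid n j \<le> grid n i"
  unfolding grid_def using grid_angle[of n i] grid_angle[of n j]
  by (intro cos_monotone_0_pi_le) (auto simp: divide_right_mono mult_right_mono)

lemma grid_strict_antimono: "1 \<le> n \<Longrightarrow> i < j \<Longrightarrow> j \<le> n \<Longrightarrow> grid n j < grid n i"
  unfolding grid_def using grid_angle[of n i] grid_angle[of n j]
  by (intro cos_monotone_0_pi) (auto simp: divide_strict_right_mono)

lemma grid_bounds: "grid n i \<in> {-1..1}"
  by (simp add: grid_def)

lemma grid_interval_param:
  assumes n: "1 \<le> n" and ij: "i \<le> j" "j \<le> n" and x: "x \<in> {grid n j..grid n i}"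
  obtains \<tau> where "x = cos \<tau>" "real i * pi / real n \<le> \<tau>" "\<tau> \<le> real j * pi / real n" "0 \<le> \<tau>" "\<tau> \<le> pi"
proof -
  have x1: "-1 \<le> x" "x \<le> 1" using x grid_bounds[of n i] grid_bounds[of n j] by auto
  have "arccos (grid n i) \<le> arccos x" "arccos x \<le> arccos (grid n j)"
    using x x1 by (auto intro!: arccos_le_arccos simp: grid_def)
  moreover have "arccos (grid n i) = real i * pi / real n" "arccos (grid n j) = real j * pi / real n"
    unfolding grid_def using grid_angle[of n i] grid_angle[of n j] n ij by (auto intro!: arccos_cos)
  ultimately show thesis using that[of "arccos x"] x1 arccos_lbound[of x] arccos_ubound[of x] by simp
qed

lemma grid_cover:
  assumes n: "1 \<le> n" and x: "x \<in> {-1..1}"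
  obtains i where "i < n" "x \<in> {grid n (Suc i)..grid n i}"
proof -
  define A where "A = {i. i < n \<and> x \<le> grid n i}"
  have "0 \<in> A" using n x by (simp add: A_def grid_def)
  define i where "i = Max A"
  have fin: "finite A" by (simp add: A_def)
  have iA: "i \<in> A" unfolding i_def using fin \<open>0 \<in> A\<close> by (intro Max_in) auto
  have "grid n (Suc i) \<le> x"
  proof (cases "Suc i = n")
    case True
    then have "grid n (Suc i) = -1" using n by (simp add: grid_def)
    then show ?thesis using x by simp
  next
    case False
    have "Suc i \<notin> A" using Max_ge[OF fin, of "Suc i"] by (auto simp: i_def)
    then show ?thesis using False iA by (auto simp: A_def)
  qed
  then show thesis using that[of i] iA by (auto simp: A_def)
qed

text \<open>Three rather than two, because the closed two-cell intervals also meet at grid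
  points.\<close>

lemma grid_overlap:
  assumes n: "1 \<le> n" and x: "x \<in> {-1..1}"
  shows "(\<Sum>i<n. indicator {grid n (min (i + 2) n)..grid n i} x) \<le> (3::ennreal)"
proof -
  define t where "t = arccos x"
  define k where "k = nat \<lfloor>real n * t / pi\<rfloor>"
  have n0: "0 < real n" using n by simp
  have t0: "0 \<le> t" "t \<le> pi" using x arccos_lbound[of x] arccos_ubound[of x] by (auto simp: t_def)
  have "i \<in> {k - 2..k}" if i: "i < n" and xi: "x \<in> {grid n (min (i + 2) n)..grid n i}" for i
  proof -
    obtain \<tau> where \<tau>: "x = cos \<tau>" "real i * pi / real n \<le> \<tau>" "\<tau> \<le> real (min (i + 2) n) * pi / real n" "0 \<le> \<tau>" "\<tau> \<le> pi"
      using grid_interval_param[OF n _ _ xi] i by auto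
    then have tt: "t = \<tau>" by (simp add: t_def arccos_cos)
    have "real i \<le> real n * t / pi" using \<tau> n0 tt by (simp add: field_simps)
    then have "int i \<le> \<lfloor>real n * t / pi\<rfloor>" by (simp add: le_floor_iff)
    then have 1: "i \<le> k" by (simp add: k_def)
    have "real (min (i + 2) n) * pi / real n \<le> real (i + 2) * pi / real n" by (intro divide_right_mono mult_right_mono) auto
    then have "\<tau> \<le> real (i + 2) * pi / real n" using \<tau>(3) by linarith
    then have "real n * t / pi \<le> real (i + 2)" using n0 tt by (simp add: field_simps)
    then have "\<lfloor>real n * t / pi\<rfloor> \<le> int (i + 2)" by linarith
    then have "k \<le> i + 2" by (simp add: k_def)
    then show ?thesis using 1 by auto
  qed
  then have sub: "{i. i < n \<and> x \<in> {grid n (min (i + 2) n)..grid n i}} \<subseteq> {k - 2..k}" by auto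
  have "(\<Sum>i<n. indicator {grid n (min (i + 2) n)..grid n i} x) = (\<Sum>i\<in>{i. i < n \<and> x \<in> {grid n (min (i + 2) n)..grid n i}}. (1::ennreal))"
    by (rule sum.mono_neutral_cong_right) (auto split: split_indicator)
  also have "\<dots> = of_nat (card {i. i < n \<and> x \<in> {grid n (min (i + 2) n)..grid n i}})" by simp
  also have "\<dots> \<le> of_nat (card {k - 2..k})" using sub by (intro of_nat_mono card_mono) auto
  also have "\<dots> \<le> of_nat 3" by (intro of_nat_mono) auto
  finally show ?thesis by simp
qed

text \<open>Interpolation at r nodes shifted by u, averaged over the shifts: this passes from values
  at points to an integral and works for every p > 0.\<close>

lemma poly_sup_le_Lp_integral:
  fixes q :: "real poly"
  assumes p: "0 < p" and deg: "degree q < r" and l: "0 < l" and y: "y \<in> {a..a + l}"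
  shows "ennreal (\<bar>poly q y\<bar> powr p) * ennreal l \<le> ennreal (real r * real r * (real r * real r ^ r) powr p) * Lp_integral p {a..a + l} (poly q)"
proof -
  have r0: "0 < real r" using deg by simp
  have [measurable]: "poly q \<in> borel_measurable borel"
    by (intro borel_measurable_continuous_onI continuous_intros)
  \<comment> \<open>Shifts of size at most l / r keep all r nodes inside the interval.\<close>
  define x where "x u i = u + (a + l * real i / real r)" for u and i :: nat
  define A where "A = (real r * real r ^ r) powr p"
  have xin: "x u i \<in> {a..a + l}" if "i < r" "u \<in> {0..l / real r}" for u i
  proof -
    have "l * real i / real r + l / real r = l * (real i + 1) / real r" by (simp add: distrib_left add_divide_distrib)
    also have "\<dots> \<le> l * real r / real r" using that l by (intro divide_right_mono mult_left_mono) auto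
    finally have "l * real i / real r + l / real r \<le> l" using r0 by simp
    then show ?thesis using that l by (auto simp: x_def)
  qed
  have pt: "\<bar>poly q y\<bar> powr p \<le> A * (\<Sum>i<r. \<bar>poly q (x u i)\<bar> powr p)" if u: "u \<in> {0..l / real r}" for u
  proof -
    have inj: "inj_on (x u) {..<r}" using l r0 by (auto simp: inj_on_def x_def)
    have "\<bar>poly q y\<bar> = \<bar>\<Sum>i<r. poly q (x u i) * (\<Prod>k\<in>{..<r} - {i}. (y - x u k) / (x u i - x u k))\<bar>"
      using lagrange_identity[OF inj deg, of y] by simp
    also have "\<dots> \<le> (\<Sum>i<r. \<bar>poly q (x u i)\<bar> * real r ^ r)"
    proof (rule order.trans[OF sum_abs], rule sum_mono)
      fix i assume i: "i \<in> {..<r}"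
      have fac: "\<bar>(y - x u k) / (x u i - x u k)\<bar> \<le> real r" if k: "k \<in> {..<r} - {i}" for k
      proof -
        have num: "\<bar>y - x u k\<bar> \<le> l" using y xin[of k u] k u by (auto simp: abs_if)
        have "x u i - x u k = l / real r * (real i - real k)" by (simp add: x_def right_diff_distrib diff_divide_distrib)
        then have "\<bar>x u i - x u k\<bar> = l / real r * \<bar>real i - real k\<bar>" using l r0 by (simp add: abs_mult)
        moreover have "1 \<le> \<bar>real i - real k\<bar>" using k by (auto simp: abs_if)
        ultimately have den: "l / real r * 1 \<le> \<bar>x u i - x u k\<bar>" using l r0 by (metis divide_nonneg_pos less_imp_le mult_left_mono)
        have "\<bar>(y - x u k) / (x u i - x u k)\<bar> \<le> l / (l / real r * 1)"
          unfolding abs_divide using num den l r0 by (intro frac_le) auto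
        then show ?thesis using l r0 by simp
      qed
      have "\<bar>\<Prod>k\<in>{..<r} - {i}. (y - x u k) / (x u i - x u k)\<bar> \<le> (\<Prod>k\<in>{..<r} - {i}. real r)"
        unfolding abs_prod by (intro prod_mono) (use fac in auto)
      also have "\<dots> = real r ^ (r - 1)" using i by simp
      also have "\<dots> \<le> real r ^ r" using r0 by (intro power_increasing) auto
      finally show "\<bar>poly q (x u i) * (\<Prod>k\<in>{..<r} - {i}. (y - x u k) / (x u i - x u k))\<bar> \<le> \<bar>poly q (x u i)\<bar> * real r ^ r"
        unfolding abs_mult by (intro mult_left_mono) auto
    qed
    finally have "\<bar>poly q y\<bar> powr p \<le> (\<Sum>i<r. \<bar>poly q (x u i)\<bar> * real r ^ r) powr p" using p by (intro powr_mono2) auto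
    also have "\<dots> \<le> real (card {..<r}) powr p * (\<Sum>i<r. (\<bar>poly q (x u i)\<bar> * real r ^ r) powr p)"
      using p by (intro powr_sum_le) auto
    also have "\<dots> = A * (\<Sum>i<r. \<bar>poly q (x u i)\<bar> powr p)"
      by (simp add: A_def powr_mult sum_distrib_left sum_distrib_right mult_ac)
    finally show ?thesis .
  qed
  have A0: "0 \<le> A" by (simp add: A_def)
  have "ennreal (\<bar>poly q y\<bar> powr p) * ennreal (l / real r) = (\<integral>\<^sup>+u\<in>{0..l / real r}. ennreal (\<bar>poly q y\<bar> powr p) \<partial>lborel)"
    using l r0 by (simp add: nn_integral_cmult_indicator emeasure_lborel_Icc_eq)
  also have "\<dots> \<le> (\<integral>\<^sup>+u. ennreal A * (\<Sum>i<r. ennreal (\<bar>poly q (x u i)\<bar> powr p) * indicator {0..l / real r} u) \<partial>lborel)"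
  proof (rule nn_integral_mono)
    fix u :: real
    show "ennreal (\<bar>poly q y\<bar> powr p) * indicator {0..l / real r} u \<le> ennreal A * (\<Sum>i<r. ennreal (\<bar>poly q (x u i)\<bar> powr p) * indicator {0..l / real r} u)"
    proof (cases "u \<in> {0..l / real r}")
      case True
      have "ennreal (\<bar>poly q y\<bar> powr p) \<le> ennreal (A * (\<Sum>i<r. \<bar>poly q (x u i)\<bar> powr p))"
        using pt[OF True] by (rule ennreal_leI)
      also have "\<dots> = ennreal A * (\<Sum>i<r. ennreal (\<bar>poly q (x u i)\<bar> powr p))"
        using A0 by (simp add: ennreal_mult sum_nonneg sum_ennreal)
      finally show ?thesis using True by simp
    qed simp
  qed
  also have "\<dots> = ennreal A * (\<Sum>i<r. (\<integral>\<^sup>+u\<in>{0..l / real r}. ennreal (\<bar>poly q (x u i)\<bar> powr p) \<partial>lborel))"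
    unfolding x_def by (subst nn_integral_cmult, measurable) (subst nn_integral_sum, auto)
  also have "\<dots> \<le> ennreal A * (\<Sum>i<r. Lp_integral p {a..a + l} (poly q))"
  proof (intro mult_left_mono sum_mono)
    fix i assume i: "i \<in> {..<r}"
    show "(\<integral>\<^sup>+u\<in>{0..l / real r}. ennreal (\<bar>poly q (x u i)\<bar> powr p) \<partial>lborel) \<le> Lp_integral p {a..a + l} (poly q)"
      unfolding Lp_integral_def x_def
      by (rule nn_integral_shift_le) (use xin i in \<open>auto simp: x_def\<close>)
  qed simp
  also have "\<dots> = ennreal (A * real r) * Lp_integral p {a..a + l} (poly q)"
    using A0 by (simp add: ennreal_mult ennreal_of_nat_eq_real_of_nat mult.assoc)
  finally have "ennreal (real r) * (ennreal (\<bar>poly q y\<bar> powr p) * ennreal (l / real r)) \<le> ennreal (real r) * (ennreal (A * real r) * Lp_integral p {a..a + l} (poly q))"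
    by (intro mult_left_mono) auto
  moreover have "ennreal (real r) * (ennreal (\<bar>poly q y\<bar> powr p) * ennreal (l / real r)) = ennreal (\<bar>poly q y\<bar> powr p) * ennreal l"
  proof -
    have "ennreal (real r) * (ennreal (\<bar>poly q y\<bar> powr p) * ennreal (l / real r)) = ennreal (\<bar>poly q y\<bar> powr p) * (ennreal (real r) * ennreal (l / real r))"
      by (simp only: ac_simps)
    also have "ennreal (real r) * ennreal (l / real r) = ennreal l" using r0 l by (subst ennreal_mult[symmetric]) auto
    finally show ?thesis .
  qed
  moreover have "ennreal (real r) * (ennreal (A * real r) * Lp_integral p {a..a + l} (poly q)) = ennreal (real r * real r * A) * Lp_integral p {a..a + l} (poly q)"
    using A0 by (simp add: ennreal_mult mult_ac)
  ultimately show ?thesis by (simp add: A_def)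
qed

text \<open>Half of the exponent, k, is spent on the largest quotient D l / (1 + |i - l|)^k, the
  other half on summability. The p-th power then falls on a single term, so the argument is the same
  for p < 1 and p \<ge> 1.\<close>

lemma discrete_kernel_sum:
  fixes D :: "nat \<Rightarrow> real"
  assumes D: "\<And>l. l < N \<Longrightarrow> 0 \<le> D l" and p: "0 < p" and k: "2 \<le> k" "real M \<le> real k * p"
  shows "(\<Sum>l<N. D l / (1 + \<bar>real i - real l\<bar>) ^ (2 * k)) powr p \<le> 4 powr p * (\<Sum>l<N. D l powr p / (1 + \<bar>real i - real l\<bar>) ^ M)"
proof (cases "N = 0")
  case False
  define X where "X l = 1 + \<bar>real i - real l\<bar>" for l
  have X1: "1 \<le> X l" for l by (simp add: X_def)
  have X0: "0 \<le> X l" for l by (simp add: X_def)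
  define m where "m = Max ((\<lambda>l. D l / X l ^ k) ` {..<N})"
  have "m \<in> (\<lambda>l. D l / X l ^ k) ` {..<N}" unfolding m_def using False by (intro Max_in) auto
  then obtain l0 where l0: "l0 < N" "m = D l0 / X l0 ^ k" by auto
  have le: "D l / X l ^ k \<le> m" if "l < N" for l unfolding m_def using that by (intro Max_ge) auto
  have m0: "0 \<le> m" using l0 D[OF l0(1)] X1[of l0] by simp
  have "(\<Sum>l<N. D l / X l ^ (2 * k)) \<le> (\<Sum>l<N. m * (1 / (X l)\<^sup>2))"
  proof (rule sum_mono)
    fix l assume l: "l \<in> {..<N}"
    have "D l / X l ^ (2 * k) = (D l / X l ^ k) * (1 / X l ^ k)" by (simp add: mult_2 power_add)
    also have "\<dots> \<le> m * (1 / X l ^ 2)"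
      using le[of l] l m0 X1[of l] k(1) by (intro mult_mono divide_left_mono power_increasing) auto
    finally show "D l / X l ^ (2 * k) \<le> m * (1 / (X l)\<^sup>2)" .
  qed
  also have "\<dots> = m * (\<Sum>l<N. 1 / (1 + \<bar>real l - real i\<bar>)\<^sup>2)" by (simp add: X_def sum_distrib_left abs_minus_commute)
  also have "\<dots> \<le> m * 4" using m0 sum_inverse_square_distances_le[of "{..<N}" i] by (intro mult_left_mono) auto
  finally have "(\<Sum>l<N. D l / X l ^ (2 * k)) powr p \<le> (m * 4) powr p"
    using p D X0 by (intro powr_mono2 sum_nonneg divide_nonneg_nonneg) auto
  also have "\<dots> = 4 powr p * m powr p" using m0 by (simp add: powr_mult)
  also have "m powr p \<le> D l0 powr p / X l0 ^ M"
  proof -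
    have "m powr p = D l0 powr p / (X l0 ^ k) powr p" using D[OF l0(1)] X1[of l0] by (simp add: l0(2) powr_divide)
    also have "(X l0 ^ k) powr p = X l0 powr (real k * p)" using X1[of l0] by (simp add: powr_realpow[symmetric] powr_powr)
    also have "D l0 powr p / X l0 powr (real k * p) \<le> D l0 powr p / X l0 powr real M"
      using X1[of l0] k(2) by (intro divide_left_mono powr_mono) auto
    also have "X l0 powr real M = X l0 ^ M" using X1[of l0] by (simp add: powr_realpow)
    finally show ?thesis .
  qed
  also have "\<dots> \<le> (\<Sum>l<N. D l powr p / X l ^ M)"
    using l0(1) X0 by (intro member_le_sum) auto
  finally show ?thesis unfolding X_def by simp
qed (use p in simp)

lemma grid_weights:
  "\<exists>C\<ge>1. \<exists>m::nat. \<forall>w n. doubling_weight w L \<longrightarrow> 1 \<le> n \<longrightarrow>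
    (\<forall>i\<le>n. \<forall>l\<le>n. avg_weight w n (grid n i) \<le> C * (1 + \<bar>real i - real l\<bar>) ^ m * avg_weight w n (grid n l)) \<and>
    (\<forall>i<n. \<forall>x\<in>{grid n (min (i + 2) n)..grid n i}.
       avg_weight w n (grid n i) \<le> C * avg_weight w n x \<and> avg_weight w n x \<le> C * avg_weight w n (grid n i))"
proof -
  obtain C m where C: "0 < C" and cmp: "\<forall>w n s t d. doubling_weight w L \<longrightarrow> 1 \<le> n \<longrightarrow> s \<in> {0..pi} \<longrightarrow> t \<in> {0..pi} \<longrightarrow> real n * \<bar>t - s\<bar> \<le> d \<longrightarrow>
     avg_weight w n (cos t) \<le> C * (1 + d) ^ m * avg_weight w n (cos s)"
    using avg_weight_comparison[of L] by (elim exE conjE)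
  \<comment> \<open>9^m covers both uses: indices at distance d have angles at most 4 d / n apart,
    and a point of a two-cell interval has an angle at most 8 / n away from that of
    \<open>grid n i\<close>.\<close>
  define C' where "C' = (C + 1) * 9 ^ m"
  have C'1: "1 \<le> C'" using C mult_mono[of 1 "C + 1" 1 "9 ^ m"] by (simp add: C'_def)
  have one: "avg_weight w n (grid n i) \<le> C' * (1 + \<bar>real i - real l\<bar>) ^ m * avg_weight w n (grid n l)"
    if w: "doubling_weight w L" and n: "1 \<le> n" and il: "i \<le> n" "l \<le> n" for w n i l
  proof -
    have n0: "0 < real n" using n by simp
    have v0: "0 \<le> avg_weight w n (grid n l)" by (rule avg_weight_nonneg[OF w grid_bounds n])
    have "real n * \<bar>real i * pi / real n - real l * pi / real n\<bar> = \<bar>real i * pi - real l * pi\<bar>"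
      using n0 by (simp add: abs_divide flip: diff_divide_distrib)
    also have "\<dots> = pi * \<bar>real i - real l\<bar>" by (simp add: abs_mult flip: left_diff_distrib)
    also have "\<dots> \<le> 4 * \<bar>real i - real l\<bar>" using pi_less_4 by (intro mult_right_mono) auto
    finally have "avg_weight w n (grid n i) \<le> C * (1 + 4 * \<bar>real i - real l\<bar>) ^ m * avg_weight w n (grid n l)"
      using cmp[rule_format, OF w n, of "real l * pi / real n" "real i * pi / real n" "4 * \<bar>real i - real l\<bar>"]
        grid_angle[OF n il(1)] grid_angle[OF n il(2)] by (simp add: grid_def)
    also have "C * (1 + 4 * \<bar>real i - real l\<bar>) ^ m \<le> (C + 1) * (9 * (1 + \<bar>real i - real l\<bar>)) ^ m"
      using C by (intro mult_mono power_mono) auto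
    also have "\<dots> = C' * (1 + \<bar>real i - real l\<bar>) ^ m" by (simp only: power_mult_distrib C'_def mult.assoc)
    finally show ?thesis using v0 by (simp add: mult_right_mono)
  qed
  have two: "avg_weight w n (grid n i) \<le> C' * avg_weight w n x \<and> avg_weight w n x \<le> C' * avg_weight w n (grid n i)"
    if w: "doubling_weight w L" and n: "1 \<le> n" and i: "i < n" and x: "x \<in> {grid n (min (i + 2) n)..grid n i}" for w n i x
  proof -
    have n0: "0 < real n" using n by simp
    obtain t where t: "x = cos t" "real i * pi / real n \<le> t" "t \<le> real (min (i + 2) n) * pi / real n" "0 \<le> t" "t \<le> pi"
      using grid_interval_param[OF n _ _ x] i by auto
    have "real (min (i + 2) n) * pi / real n \<le> (real i + 2) * pi / real n" by (intro divide_right_mono mult_right_mono) auto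
    then have "t - real i * pi / real n \<le> 2 * pi / real n" using t(3) by (simp add: add_divide_distrib distrib_right)
    then have "\<bar>t - real i * pi / real n\<bar> \<le> 2 * pi / real n" using t(2) by simp
    then have "real n * \<bar>t - real i * pi / real n\<bar> \<le> real n * (2 * pi / real n)" using n0 by (intro mult_left_mono) auto
    also have "\<dots> \<le> 8" using n0 pi_less_4 by simp
    finally have d: "real n * \<bar>t - real i * pi / real n\<bar> \<le> 8" "real n * \<bar>real i * pi / real n - t\<bar> \<le> 8"
      by (simp_all add: abs_minus_commute)
    have ia: "real i * pi / real n \<in> {0..pi}" using grid_angle[of n i] n i by auto
    have tp: "t \<in> {0..pi}" using t by auto
    have v0: "0 \<le> avg_weight w n (cos t)" "0 \<le> avg_weight w n (cos (real i * pi / real n))"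
      by (auto intro!: avg_weight_nonneg[OF w _ n])
    have c9: "C * (1 + 8) ^ m \<le> C'" by (simp add: C'_def)
    have "avg_weight w n (cos (real i * pi / real n)) \<le> C * (1 + 8) ^ m * avg_weight w n (cos t)"
      by (rule cmp[rule_format, OF w n tp ia d(2)])
    also have "\<dots> \<le> C' * avg_weight w n (cos t)" using c9 v0 by (intro mult_right_mono) auto
    finally have a: "avg_weight w n (cos (real i * pi / real n)) \<le> C' * avg_weight w n (cos t)" .
    have "avg_weight w n (cos t) \<le> C * (1 + 8) ^ m * avg_weight w n (cos (real i * pi / real n))"
      by (rule cmp[rule_format, OF w n ia tp d(1)])
    also have "\<dots> \<le> C' * avg_weight w n (cos (real i * pi / real n))" using c9 v0 by (intro mult_right_mono) auto
    finally show ?thesis using a unfolding t(1) grid_def by blast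
  qed
  show ?thesis using C'1 one two by (intro exI[of _ C'] conjI exI[of _ m]) auto
qed

text \<open>552 = 46 * 3 * 4: two comparisons of a cell length with \<open>rho\<close>, and one of
  \<open>rho\<close> at the two nodes, where \<pi> < 4.\<close>

lemma cell_length_comparison:
  assumes n: "1 \<le> n" and il: "i < n" "l < n"
  shows "grid n i - grid n (Suc i) \<le> 552 * (1 + \<bar>real i - real l\<bar>) * (grid n l - grid n (Suc l))"
proof -
  have n0: "0 < real n" using n by simp
  have step: "real (Suc j) * pi / real n - real j * pi / real n = pi / real n" for j
    by (simp add: diff_divide_distrib[symmetric] algebra_simps)
  have rho_len: "rho n (grid n j) \<le> 3 * (grid n j - grid n (Suc j))" "grid n j - grid n (Suc j) \<le> 46 * rho n (grid n j)" if "j < n" for j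
    unfolding grid_def
    by (rule cos_interval_length[OF _ _ n, where t = "real j * pi / real n"];
        use grid_angle[of n j] grid_angle[of n "Suc j"] n that step[of j] n0 in \<open>auto simp: divide_right_mono\<close>)+
  have "real n * \<bar>real i * pi / real n - real l * pi / real n\<bar> = \<bar>real i * pi - real l * pi\<bar>"
    using n0 by (simp add: abs_divide flip: diff_divide_distrib)
  also have "\<dots> = pi * \<bar>real i - real l\<bar>" by (simp add: abs_mult flip: left_diff_distrib)
  also have "\<dots> \<le> 4 * \<bar>real i - real l\<bar>" using pi_less_4 by (intro mult_right_mono) auto
  finally have d: "real n * \<bar>real i * pi / real n - real l * pi / real n\<bar> \<le> 4 * \<bar>real i - real l\<bar>" .
  have rl: "0 < rho n (grid n l)" by (rule rho_pos[OF grid_bounds n])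
  have "grid n i - grid n (Suc i) \<le> 46 * rho n (grid n i)" by (rule rho_len(2)[OF il(1)])
  also have "rho n (grid n i) \<le> rho n (grid n l) * (1 + 4 * \<bar>real i - real l\<bar>)"
    unfolding grid_def by (rule rho_cos_le) (use grid_angle[of n i] grid_angle[of n l] n il d in auto)
  also have "\<dots> \<le> rho n (grid n l) * (4 * (1 + \<bar>real i - real l\<bar>))" using rl by (intro mult_left_mono) auto
  also have "\<dots> \<le> 3 * (grid n l - grid n (Suc l)) * (4 * (1 + \<bar>real i - real l\<bar>))"
    using rho_len(1)[OF il(2)] by (intro mult_right_mono) auto
  finally show ?thesis by (simp add: algebra_simps)
qed

text \<open>The exponent m + 3 is used up by the weight ratio (m), the ratio of cell lengths (1) and
  the summation over i (2). The shift from l to l + 1 in \<open>len\<close> doubles 552 to 1104, and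
  the sum over i contributes the factor 4.\<close>

lemma weighted_kernel_sum:
  fixes V len D :: "nat \<Rightarrow> real"
  assumes p: "0 < p" and k: "2 \<le> k" "real (m + 3) \<le> real k * p" and C: "0 \<le> C"
    and V: "\<And>i. 0 \<le> V i" "\<And>i l. i < n \<Longrightarrow> l < n \<Longrightarrow> V i \<le> C * (1 + \<bar>real i - real l\<bar>) ^ m * V l"
    and len: "\<And>i. i < n \<Longrightarrow> 0 \<le> len i" "\<And>i l. i < n \<Longrightarrow> l < n \<Longrightarrow> len i \<le> 552 * (1 + \<bar>real i - real l\<bar>) * len l"
    and D: "\<And>l. l < n - 1 \<Longrightarrow> 0 \<le> D l"
  shows "(\<Sum>i<n. V i * len i * (\<Sum>l<n - 1. D l / (1 + \<bar>real i - real l\<bar>) ^ (2 * k)) powr p)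
    \<le> 4 powr p * (4416 * C) * (\<Sum>l<n - 1. V l * (len (Suc l) * D l powr p))"
proof -
  define X where "X i l = 1 + \<bar>real i - real l\<bar>" for i l :: nat
  have X1: "1 \<le> X i l" "0 < X i l" for i l by (auto simp: X_def)
  have "(\<Sum>i<n. V i * len i * (\<Sum>l<n - 1. D l / X i l ^ (2 * k)) powr p)
    \<le> (\<Sum>i<n. V i * len i * (4 powr p * (\<Sum>l<n - 1. D l powr p / X i l ^ (m + 3))))"
    unfolding X_def by (intro sum_mono mult_left_mono discrete_kernel_sum) (use D p k V len in auto)
  also have "\<dots> = 4 powr p * (\<Sum>i<n. \<Sum>l<n - 1. V i * len i * (D l powr p / X i l ^ (m + 3)))"
    by (simp add: sum_distrib_left mult_ac)
  also have "\<dots> \<le> 4 powr p * (\<Sum>i<n. \<Sum>l<n - 1. 1104 * C * (V l * (len (Suc l) * D l powr p)) * (1 / (X i l)\<^sup>2))"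
  proof (intro mult_left_mono sum_mono)
    fix i l assume il: "i \<in> {..<n}" "l \<in> {..<n - 1}"
    then have il': "i < n" "l < n" "Suc l < n" by auto
    have "len i \<le> 552 * X i (Suc l) * len (Suc l)" unfolding X_def using len(2) il' by blast
    also have "\<dots> \<le> 552 * (2 * X i l) * len (Suc l)"
      using len(1)[OF il'(3)] by (intro mult_right_mono mult_left_mono) (auto simp: X_def abs_if)
    finally have "V i * len i \<le> (C * X i l ^ m * V l) * (1104 * X i l * len (Suc l))"
      using V(2)[OF il'(1,2)] V(1) len(1)[OF il'(1)] C X1(2)[of i l] unfolding X_def[symmetric]
      by (intro mult_mono) (auto simp: less_imp_le)
    also have "\<dots> = 1104 * C * V l * len (Suc l) * X i l ^ (m + 1)" by simp
    finally have "V i * len i * (D l powr p / X i l ^ (m + 3)) \<le> 1104 * C * V l * len (Suc l) * X i l ^ (m + 1) * (D l powr p / X i l ^ (m + 3))"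
      using X1(2)[of i l] by (intro mult_right_mono) (auto simp: less_imp_le)
    also have "\<dots> = 1104 * C * V l * len (Suc l) * D l powr p * (X i l ^ (m + 1) / X i l ^ (m + 3))" by simp
    also have "X i l ^ (m + 1) / X i l ^ (m + 3) = 1 / (X i l)\<^sup>2"
    proof -
      have "X i l ^ (m + 3) = X i l ^ (m + 1) * (X i l)\<^sup>2"
        unfolding power_add[symmetric] by (simp add: numeral_3_eq_3)
      then show ?thesis using X1(2)[of i l] by simp
    qed
    finally show "V i * len i * (D l powr p / X i l ^ (m + 3)) \<le> 1104 * C * (V l * (len (Suc l) * D l powr p)) * (1 / (X i l)\<^sup>2)"
      by (simp add: mult_ac)
  qed auto
  also have "\<dots> = 4 powr p * (\<Sum>l<n - 1. 1104 * C * (V l * (len (Suc l) * D l powr p)) * (\<Sum>i<n. 1 / (X i l)\<^sup>2))"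
    by (subst sum.swap) (simp add: sum_distrib_left)
  also have "\<dots> \<le> 4 powr p * (\<Sum>l<n - 1. 1104 * C * (V l * (len (Suc l) * D l powr p)) * 4)"
  proof (intro mult_left_mono sum_mono)
    fix l assume l: "l \<in> {..<n - 1}"
    show "(\<Sum>i<n. 1 / (X i l)\<^sup>2) \<le> 4" unfolding X_def by (rule sum_inverse_square_distances_le) simp
    show "0 \<le> 1104 * C * (V l * (len (Suc l) * D l powr p))" using C V(1) len(1)[of "Suc l"] l by auto
  qed auto
  also have "\<dots> = 4 powr p * (4416 * C) * (\<Sum>l<n - 1. V l * (len (Suc l) * D l powr p))"
    by (simp add: sum_distrib_left mult_ac)
  finally show ?thesis unfolding X_def .
qed

lemma Lp_integral_mono_set:
  "A \<subseteq> B \<Longrightarrow> Lp_integral p A g \<le> Lp_integral p B g"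
  unfolding Lp_integral_def by (intro nn_integral_mono) (auto split: split_indicator)

lemma Lp_integral_add_le:
  assumes [measurable]: "g \<in> borel_measurable borel" "h \<in> borel_measurable borel" "A \<in> sets borel" and p: "0 < p"
    and le: "\<And>x. x \<in> A \<Longrightarrow> \<bar>k x\<bar> \<le> \<bar>g x\<bar> + \<bar>h x\<bar>"
  shows "Lp_integral p A k \<le> ennreal (2 powr p) * (Lp_integral p A g + Lp_integral p A h)"
proof -
  have "Lp_integral p A k \<le> (\<integral>\<^sup>+x. ennreal (2 powr p) * (ennreal (\<bar>g x\<bar> powr p) * indicator A x + ennreal (\<bar>h x\<bar> powr p) * indicator A x) \<partial>lborel)"
    unfolding Lp_integral_def
  proof (rule nn_integral_mono)
    fix x :: real
    show "ennreal (\<bar>k x\<bar> powr p) * indicator A x \<le> ennreal (2 powr p) * (ennreal (\<bar>g x\<bar> powr p) * indicator A x + ennreal (\<bar>h x\<bar> powr p) * indicator A x)"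
    proof (cases "x \<in> A")
      case True
      have "\<bar>k x\<bar> powr p \<le> (\<bar>g x\<bar> + \<bar>h x\<bar>) powr p" using le[OF True] p by (intro powr_mono2) auto
      also have "\<dots> \<le> 2 powr p * (\<bar>g x\<bar> powr p + \<bar>h x\<bar> powr p)" using p by (intro powr_add_le) auto
      finally have "ennreal (\<bar>k x\<bar> powr p) \<le> ennreal (2 powr p * (\<bar>g x\<bar> powr p + \<bar>h x\<bar> powr p))" by (rule ennreal_leI)
      then show ?thesis using True by (simp add: ennreal_mult ennreal_plus)
    qed simp
  qed
  also have "\<dots> = ennreal (2 powr p) * (Lp_integral p A g + Lp_integral p A h)"
    unfolding Lp_integral_def by (simp add: nn_integral_cmult nn_integral_add)
  finally show ?thesis .
qed

lemma Lp_integral_const: "Lp_integral p {a..b} (\<lambda>x. c) = ennreal (\<bar>c\<bar> powr p) * ennreal (max 0 (b - a))"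
  unfolding Lp_integral_def by (simp add: nn_integral_cmult_indicator emeasure_lborel_Icc_eq max_def)

lemma weighted_integral_le_cells:
  fixes n :: nat
  assumes n: "1 \<le> n" and [measurable]: "g \<in> borel_measurable borel" "v \<in> borel_measurable borel"
    and v: "\<And>i x. i < n \<Longrightarrow> x \<in> {grid n (Suc i)..grid n i} \<Longrightarrow> v x \<le> C * V i" and C: "0 \<le> C" "\<And>i. 0 \<le> V i"
  shows "(\<integral>\<^sup>+x\<in>{-1..1}. ennreal (\<bar>g x\<bar> powr p * v x) \<partial>lborel)
    \<le> (\<Sum>i<n. ennreal (C * V i) * Lp_integral p {grid n (Suc i)..grid n i} g)"
proof -
  have "(\<integral>\<^sup>+x\<in>{-1..1}. ennreal (\<bar>g x\<bar> powr p * v x) \<partial>lborel)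
    \<le> (\<integral>\<^sup>+x. (\<Sum>i<n. ennreal (C * V i) * (ennreal (\<bar>g x\<bar> powr p) * indicator {grid n (Suc i)..grid n i} x)) \<partial>lborel)"
  proof (rule nn_integral_mono)
    fix x :: real
    show "ennreal (\<bar>g x\<bar> powr p * v x) * indicator {-1..1} x
      \<le> (\<Sum>i<n. ennreal (C * V i) * (ennreal (\<bar>g x\<bar> powr p) * indicator {grid n (Suc i)..grid n i} x))"
    proof (cases "x \<in> {-1..1}")
      case True
      obtain i where i: "i < n" "x \<in> {grid n (Suc i)..grid n i}" using grid_cover[OF n True] by blast
      have "\<bar>g x\<bar> powr p * v x \<le> \<bar>g x\<bar> powr p * (C * V i)" using v[OF i] by (intro mult_left_mono) auto
      then have "ennreal (\<bar>g x\<bar> powr p * v x) \<le> ennreal (C * V i * \<bar>g x\<bar> powr p)" by (intro ennreal_leI) (simp add: mult.commute)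
      also have "\<dots> = ennreal (C * V i) * (ennreal (\<bar>g x\<bar> powr p) * indicator {grid n (Suc i)..grid n i} x)"
        using i C by (simp add: ennreal_mult)
      also have "\<dots> \<le> (\<Sum>i<n. ennreal (C * V i) * (ennreal (\<bar>g x\<bar> powr p) * indicator {grid n (Suc i)..grid n i} x))"
        using i by (intro member_le_sum) auto
      finally show ?thesis using True by simp
    qed simp
  qed
  also have "\<dots> = (\<Sum>i<n. ennreal (C * V i) * Lp_integral p {grid n (Suc i)..grid n i} g)"
    unfolding Lp_integral_def by (subst nn_integral_sum) (auto simp: nn_integral_cmult)
  finally show ?thesis .
qed

lemma finite_exponent_approximation:
  assumes r: "1 \<le> r" and p: "0 < p" and \<theta>: "0 < \<theta>" "\<theta> \<le> 1"
  shows "\<exists>C>0. \<forall>w f n. doubling_weight w L \<longrightarrow> f \<in> borel_measurable borel \<longrightarrow> Lp_integral p {-1..1} f < \<infinity> \<longrightarrow> r \<le> n \<longrightarrow>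
    (\<exists>P. degree P \<le> n - 1 \<and>
      (\<integral>\<^sup>+x\<in>{-1..1}. ennreal (\<bar>f x - poly P x\<bar> powr p * avg_weight w n x) \<partial>lborel)
        \<le> ennreal C * (ennreal (real n / \<theta>) * (\<integral>\<^sup>+h\<in>{0<..\<theta> / real n}. (\<integral>\<^sup>+x\<in>{-1..1}.
             ennreal (\<bar>symm_difference r (h * phi x) f x\<bar> powr p * avg_weight w n x) \<partial>lborel) \<partial>lborel)) \<and>
      (\<forall>\<nu>. r \<le> \<nu> \<longrightarrow> \<nu> \<le> \<nu>\<^sub>0 \<longrightarrow>
        (\<integral>\<^sup>+x\<in>{-1..1}. ennreal (\<bar>rho n x ^ \<nu> * poly ((pderiv ^^ \<nu>) P) x\<bar> powr p * avg_weight w n x) \<partial>lborel)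
        \<le> ennreal C * (ennreal (real n / \<theta>) * (\<integral>\<^sup>+h\<in>{0<..\<theta> / real n}. (\<integral>\<^sup>+x\<in>{-1..1}.
             ennreal (\<bar>symm_difference r (h * phi x) f x\<bar> powr p * avg_weight w n x) \<partial>lborel) \<partial>lborel))))"
proof -
  obtain Cw m where Cw: "1 \<le> Cw" and gw: "\<forall>w n. doubling_weight w L \<longrightarrow> 1 \<le> n \<longrightarrow>
    (\<forall>i\<le>n. \<forall>l\<le>n. avg_weight w n (grid n i) \<le> Cw * (1 + \<bar>real i - real l\<bar>) ^ m * avg_weight w n (grid n l)) \<and>
    (\<forall>i<n. \<forall>x\<in>{grid n (min (i + 2) n)..grid n i}.
       avg_weight w n (grid n i) \<le> Cw * avg_weight w n x \<and> avg_weight w n x \<le> Cw * avg_weight w n (grid n i))"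
    using grid_weights[of L] by (elim exE conjE)
  \<comment> \<open>Taking p-th powers with small p weakens the decay of the kernel, so k p has to
    reach m + 3.\<close>
  define k where "k = max 2 (nat \<lceil>real (m + 3) / p\<rceil>)"
  have k: "2 \<le> k" "real (m + 3) \<le> real k * p"
  proof -
    have "real (m + 3) / p \<le> real (nat \<lceil>real (m + 3) / p\<rceil>)" by (rule real_nat_ceiling_ge)
    also have "\<dots> \<le> real k" unfolding k_def by (rule of_nat_mono) simp
    finally have "real (m + 3) / p \<le> real k" .
    then show "real (m + 3) \<le> real k * p" using p by (simp add: divide_le_eq)
  qed (simp add: k_def)
  obtain Cl where Cl: "0 < Cl" and local: "\<forall>f\<in>borel_measurable borel. \<forall>n a b. 1 \<le> n \<longrightarrow> 0 \<le> a \<longrightarrow> b \<le> pi \<longrightarrow>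
     pi / real n \<le> b - a \<longrightarrow> b - a \<le> 2 * pi / real n \<longrightarrow> Lp_integral p {cos b..cos a} f < \<infinity> \<longrightarrow>
     (\<exists>q. degree q < r \<and> Lp_integral p {cos b..cos a} (\<lambda>x. f x - poly q x) \<le> ennreal Cl * (ennreal (real n / \<theta>) *
        (\<integral>\<^sup>+h\<in>{0<..\<theta> / real n}. (\<integral>\<^sup>+x\<in>{cos b..cos a}. ennreal (\<bar>symm_difference r (h * phi x) f x\<bar> powr p) \<partial>lborel) \<partial>lborel)))"
    using local_approximation[OF r p \<theta>] by (elim exE conjE)
  obtain Cg where Cg: "0 < Cg" and glue: "\<forall>n q D. r \<le> n \<longrightarrow> (\<forall>i<n. degree (q i) < r) \<longrightarrow>
    (\<forall>l. Suc l < n \<longrightarrow> (\<forall>x\<in>{cos (real (l + 2) * pi / real n)..cos (real (l + 1) * pi / real n)}. \<bar>poly (q l) x - poly (q (Suc l)) x\<bar> \<le> D l)) \<longrightarrow>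
    (\<exists>P. degree P \<le> n - 1 \<and> (\<forall>i<n. \<forall>\<tau>. real i * pi / real n \<le> \<tau> \<longrightarrow> \<tau> \<le> (real i + 1) * pi / real n \<longrightarrow>
       \<bar>poly (q i) (cos \<tau>) - poly P (cos \<tau>)\<bar> \<le> Cg * (\<Sum>l<n - 1. D l / (1 + \<bar>real i - real l\<bar>) ^ (2 * k)) \<and>
       (\<forall>\<nu>. r \<le> \<nu> \<longrightarrow> \<nu> \<le> \<nu>\<^sub>0 \<longrightarrow> \<bar>rho n (cos \<tau>) ^ \<nu> * poly ((pderiv ^^ \<nu>) P) (cos \<tau>)\<bar>
           \<le> Cg * (\<Sum>l<n - 1. D l / (1 + \<bar>real i - real l\<bar>) ^ (2 * k)))))"
    using polynomial_gluing[OF r, where \<kappa> = "2 * k" and \<nu>\<^sub>0 = \<nu>\<^sub>0] by (elim exE conjE)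
  define CN where "CN = real r * real r * (real r * real r ^ r) powr p"
  have CN: "0 \<le> CN" by (simp add: CN_def)
  \<comment> \<open>\<open>K1\<close> collects the kernel sum, the comparison of sup and integral
    for polynomials, and the passage from V l to V (l + 1), which costs
    \<open>Cw * 2 ^ m\<close>.\<close>
  define K1 where "K1 = 4 powr p * (4416 * Cw) * (CN * 2 powr p * (1 + Cw * 2 ^ m))"
  have K1: "0 \<le> K1" using Cw CN by (simp add: K1_def)
  define K2 where "K2 = Cw * 2 powr p * (1 + Cg powr p * K1)"
  have K2: "0 \<le> K2" using Cw K1 by (simp add: K2_def)
  define C where "C = K2 * (3 * Cw * Cl) + 1"
  have C0: "0 < C" using K2 Cw Cl by (simp add: C_def add_nonneg_pos)
  have "\<exists>P. degree P \<le> n - 1 \<and>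
      (\<integral>\<^sup>+x\<in>{-1..1}. ennreal (\<bar>f x - poly P x\<bar> powr p * avg_weight w n x) \<partial>lborel)
        \<le> ennreal C * (ennreal (real n / \<theta>) * (\<integral>\<^sup>+h\<in>{0<..\<theta> / real n}. (\<integral>\<^sup>+x\<in>{-1..1}.
             ennreal (\<bar>symm_difference r (h * phi x) f x\<bar> powr p * avg_weight w n x) \<partial>lborel) \<partial>lborel)) \<and>
      (\<forall>\<nu>. r \<le> \<nu> \<longrightarrow> \<nu> \<le> \<nu>\<^sub>0 \<longrightarrow>
        (\<integral>\<^sup>+x\<in>{-1..1}. ennreal (\<bar>rho n x ^ \<nu> * poly ((pderiv ^^ \<nu>) P) x\<bar> powr p * avg_weight w n x) \<partial>lborel)
        \<le> ennreal C * (ennreal (real n / \<theta>) * (\<integral>\<^sup>+h\<in>{0<..\<theta> / real n}. (\<integral>\<^sup>+x\<in>{-1..1}.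
             ennreal (\<bar>symm_difference r (h * phi x) f x\<bar> powr p * avg_weight w n x) \<partial>lborel) \<partial>lborel)))"
    if w: "doubling_weight w L" and f[measurable]: "f \<in> borel_measurable borel" and fin: "Lp_integral p {-1..1} f < \<infinity>" and nr: "r \<le> n" for w f n
  proof -
    have n1: "1 \<le> n" using r nr by simp
    have n0: "0 < real n" using n1 by simp
    define v where "v = avg_weight w n"
    define V where "V i = v (grid n i)" for i
    define T where "T h x = ennreal (\<bar>symm_difference r (h * phi x) f x\<bar> powr p)" for h x
    define \<Omega> where "\<Omega> = ennreal (real n / \<theta>) * (\<integral>\<^sup>+h\<in>{0<..\<theta> / real n}. (\<integral>\<^sup>+x\<in>{-1..1}. ennreal (\<bar>symm_difference r (h * phi x) f x\<bar> powr p * v x) \<partial>lborel) \<partial>lborel)"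
    have v_meas[measurable]: "v \<in> borel_measurable borel" unfolding v_def by (rule avg_weight_measurable[OF w])
    have T_meas[measurable]: "(\<lambda>x. T (a x) (b x)) \<in> borel_measurable M"
      if [measurable]: "a \<in> borel_measurable M" "b \<in> borel_measurable M" for a b and M :: "'z measure"
      unfolding T_def by measurable
    have V0: "0 \<le> V i" for i unfolding V_def v_def by (rule avg_weight_nonneg[OF w grid_bounds n1])
    have v0: "0 \<le> v x" if "x \<in> {-1..1}" for x unfolding v_def by (rule avg_weight_nonneg[OF w that n1])
    have gw1: "V i \<le> Cw * (1 + \<bar>real i - real l\<bar>) ^ m * V l" if "i \<le> n" "l \<le> n" for i l
      using gw[rule_format, OF w n1] that unfolding V_def v_def by blast
    have gw2: "V i \<le> Cw * v x" "v x \<le> Cw * V i" if "i < n" "x \<in> {grid n (min (i + 2) n)..grid n i}" for i x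
      using gw[rule_format, OF w n1] that unfolding V_def v_def by blast+
    \<comment> \<open>Two cells, truncated at the last index: two neighbouring local polynomials are
      then both good on the whole common cell \<open>I (Suc l)\<close>.\<close>
    define J where "J i = {grid n (min (i + 2) n)..grid n i}" for i
    define I where "I i = {grid n (Suc i)..grid n i}" for i
    define len where "len i = grid n i - grid n (Suc i)" for i
    have IJ: "I i \<subseteq> J i" if "i < n" for i
      using grid_antimono[OF n1, of "Suc i" "min (i + 2) n"] that by (auto simp: I_def J_def)
    have IJ2: "I (Suc l) \<subseteq> J l" "I (Suc l) \<subseteq> J (Suc l)" if "Suc l < n" for l
      using IJ[OF that] that grid_antimono[OF n1, of l "Suc l"] by (auto simp: I_def J_def min_def)
    have J1: "J i \<subseteq> {-1..1}" for i using grid_bounds[of n i] grid_bounds[of n "min (i + 2) n"] by (auto simp: J_def)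
    have J_meas[measurable]: "J i \<in> sets borel" "I i \<in> sets borel" for i by (auto simp: J_def I_def)
    have len0: "0 < len i" if "i < n" for i unfolding len_def using grid_strict_antimono[OF n1, of i "Suc i"] that by simp
    have "\<exists>q. \<forall>i. i < n \<longrightarrow> degree (q i) < r \<and> Lp_integral p (J i) (\<lambda>x. f x - poly (q i) x) \<le> ennreal Cl * (ennreal (real n / \<theta>) *
        (\<integral>\<^sup>+h\<in>{0<..\<theta> / real n}. (\<integral>\<^sup>+x\<in>J i. T h x \<partial>lborel) \<partial>lborel))"
    proof (rule choice, rule allI)
      fix i
      show "\<exists>q. i < n \<longrightarrow> degree q < r \<and> Lp_integral p (J i) (\<lambda>x. f x - poly q x) \<le> ennreal Cl * (ennreal (real n / \<theta>) *
        (\<integral>\<^sup>+h\<in>{0<..\<theta> / real n}. (\<integral>\<^sup>+x\<in>J i. T h x \<partial>lborel) \<partial>lborel))"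
      proof (cases "i < n")
        case True
        have fJ: "Lp_integral p {cos (real (min (i + 2) n) * pi / real n)..cos (real i * pi / real n)} f < \<infinity>"
          using order.strict_trans1[OF Lp_integral_mono_set[OF J1[of i]] fin] by (simp add: J_def grid_def)
        have "real (min (i + 2) n) * pi / real n - real i * pi / real n = (real (min (i + 2) n) - real i) * pi / real n"
          by (simp add: diff_divide_distrib left_diff_distrib)
        moreover have "1 \<le> real (min (i + 2) n) - real i" "real (min (i + 2) n) - real i \<le> 2" using True by (auto simp: min_def)
        ultimately have d: "pi / real n \<le> real (min (i + 2) n) * pi / real n - real i * pi / real n"
          "real (min (i + 2) n) * pi / real n - real i * pi / real n \<le> 2 * pi / real n"
          by (auto intro!: divide_right_mono simp: mult_right_mono)
        show ?thesis
          using local[rule_format, OF f n1 grid_angle(1) grid_angle(2) d fJ] True n1 unfolding J_def grid_def T_def by auto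
      qed simp
    qed
    then obtain q where q: "\<And>i. i < n \<Longrightarrow> degree (q i) < r"
      and qloc: "\<And>i. i < n \<Longrightarrow> Lp_integral p (J i) (\<lambda>x. f x - poly (q i) x) \<le> ennreal Cl * (ennreal (real n / \<theta>) *
        (\<integral>\<^sup>+h\<in>{0<..\<theta> / real n}. (\<integral>\<^sup>+x\<in>J i. T h x \<partial>lborel) \<partial>lborel))" by blast
    have q_meas[measurable]: "poly Q \<in> borel_measurable borel" for Q :: "real poly"
      by (intro borel_measurable_continuous_onI continuous_intros)
    \<comment> \<open>Local errors as real numbers; \<open>ee\<close> ensures that
      \<open>enn2real\<close> hides no infinity.\<close>
    define e where "e i = enn2real (Lp_integral p (J i) (\<lambda>x. f x - poly (q i) x))" for i
    have e0: "0 \<le> e i" for i by (simp add: e_def)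
    have ee: "Lp_integral p (J i) (\<lambda>x. f x - poly (q i) x) = ennreal (e i)" for i
    proof -
      have "Lp_integral p (J i) f < \<infinity>" using order.strict_trans1[OF Lp_integral_mono_set[OF J1[of i]] fin] by simp
      then have "Lp_integral p (J i) (\<lambda>x. f x - poly (q i) x) < \<infinity>"
        unfolding J_def by (intro Lp_integral_minus_poly_finite[OF f _ p])
      then show ?thesis by (simp add: e_def)
    qed
    define E where "E = (\<Sum>i<n. V i * e i)"
    have E0: "0 \<le> E" unfolding E_def using V0 e0 by (intro sum_nonneg) auto
    \<comment> \<open>The constant \<open>V i\<close> is moved under the integral at the price of
      \<open>Cw\<close>, and the overlap of the intervals costs 3.\<close>
    have E_le: "ennreal E \<le> ennreal (3 * Cw * Cl) * \<Omega>"
    proof -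
      have "ennreal E = (\<Sum>i<n. ennreal (V i) * ennreal (e i))"
        unfolding E_def using V0 e0 by (simp add: sum_ennreal[symmetric] ennreal_mult)
      also have "\<dots> \<le> (\<Sum>i<n. ennreal (V i) * (ennreal Cl * (ennreal (real n / \<theta>) * (\<integral>\<^sup>+h\<in>{0<..\<theta> / real n}. (\<integral>\<^sup>+x\<in>J i. T h x \<partial>lborel) \<partial>lborel))))"
        unfolding ee[symmetric] by (intro sum_mono mult_left_mono qloc) auto
      also have "\<dots> = ennreal Cl * ennreal (real n / \<theta>) * (\<Sum>i<n. (\<integral>\<^sup>+h\<in>{0<..\<theta> / real n}. (\<integral>\<^sup>+x. ennreal (V i) * T h x * indicator (J i) x \<partial>lborel) \<partial>lborel))"
        by (simp add: sum_distrib_left mult_ac nn_integral_cmult[symmetric])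
      also have "(\<Sum>i<n. (\<integral>\<^sup>+h\<in>{0<..\<theta> / real n}. (\<integral>\<^sup>+x. ennreal (V i) * T h x * indicator (J i) x \<partial>lborel) \<partial>lborel))
         = (\<integral>\<^sup>+h\<in>{0<..\<theta> / real n}. (\<integral>\<^sup>+x. (\<Sum>i<n. ennreal (V i) * T h x * indicator (J i) x) \<partial>lborel) \<partial>lborel)"
        by (simp add: nn_integral_sum sum_distrib_right del: sum_mult_indicator sum_indicator_mult)
      also have "\<dots> \<le> (\<integral>\<^sup>+h\<in>{0<..\<theta> / real n}. (\<integral>\<^sup>+x. ennreal (3 * Cw) * (ennreal (\<bar>symm_difference r (h * phi x) f x\<bar> powr p * v x) * indicator {-1..1} x) \<partial>lborel) \<partial>lborel)"
      proof (intro nn_integral_mono mult_right_mono)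
        fix h x :: real
        show "(\<Sum>i<n. ennreal (V i) * T h x * indicator (J i) x) \<le> ennreal (3 * Cw) * (ennreal (\<bar>symm_difference r (h * phi x) f x\<bar> powr p * v x) * indicator {-1..1} x)"
        proof (cases "x \<in> {-1..1}")
          case True
          have "(\<Sum>i<n. ennreal (V i) * T h x * indicator (J i) x) \<le> (\<Sum>i<n. ennreal (Cw * v x) * T h x * indicator (J i) x)"
            by (intro sum_mono mult_indicator_mono mult_right_mono ennreal_leI gw2) (auto simp: J_def)
          also have "\<dots> = ennreal (Cw * v x) * T h x * (\<Sum>i<n. indicator (J i) x)" by (simp only: sum_distrib_left)
          also have "\<dots> \<le> ennreal (Cw * v x) * T h x * 3"
            unfolding J_def by (intro mult_left_mono grid_overlap[OF n1 True]) auto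
          also have "\<dots> = ennreal (3 * Cw) * (T h x * ennreal (v x))"
            using Cw v0[OF True] by (simp add: ennreal_mult mult_ac)
          also have "T h x * ennreal (v x) = ennreal (\<bar>symm_difference r (h * phi x) f x\<bar> powr p * v x)"
            unfolding T_def using v0[OF True] by (simp add: ennreal_mult)
          finally show ?thesis using True by simp
        next
          case False
          then have "x \<notin> J i" for i using J1 by blast
          then show ?thesis by simp
        qed
      qed simp
      also have "\<dots> = ennreal (3 * Cw) * (\<integral>\<^sup>+h\<in>{0<..\<theta> / real n}. (\<integral>\<^sup>+x\<in>{-1..1}. ennreal (\<bar>symm_difference r (h * phi x) f x\<bar> powr p * v x) \<partial>lborel) \<partial>lborel)"
        by (simp add: nn_integral_cmult mult.assoc)
      finally have "ennreal E \<le> ennreal Cl * ennreal (real n / \<theta>) * (ennreal (3 * Cw) * (\<integral>\<^sup>+h\<in>{0<..\<theta> / real n}. (\<integral>\<^sup>+x\<in>{-1..1}. ennreal (\<bar>symm_difference r (h * phi x) f x\<bar> powr p * v x) \<partial>lborel) \<partial>lborel))"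
        by (simp add: mult_left_mono)
      also have "\<dots> = (ennreal (3 * Cw) * ennreal Cl) * \<Omega>" unfolding \<Omega>_def by (simp only: ac_simps)
      also have "ennreal (3 * Cw) * ennreal Cl = ennreal (3 * Cw * Cl)" using Cw Cl by (subst ennreal_mult) auto
      finally show ?thesis .
    qed
    define d where "d l = enn2real (Lp_integral p (I (Suc l)) (\<lambda>x. poly (q l - q (Suc l)) x))" for l
    \<comment> \<open>A sup bound on the common cell, obtained from the integral \<open>d l\<close>;
      the length of the cell enters to the power -1 / p.\<close>
    define D where "D l = (CN * d l / len (Suc l)) powr (1 / p)" for l
    have d_le: "ennreal (d l) = Lp_integral p (I (Suc l)) (\<lambda>x. poly (q l - q (Suc l)) x)" "d l \<le> 2 powr p * (e l + e (Suc l))" if l: "Suc l < n" for l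
    proof -
      have "Lp_integral p (I (Suc l)) (\<lambda>x. poly (q l - q (Suc l)) x)
        \<le> ennreal (2 powr p) * (Lp_integral p (I (Suc l)) (\<lambda>x. f x - poly (q l) x) + Lp_integral p (I (Suc l)) (\<lambda>x. f x - poly (q (Suc l)) x))"
        using p by (intro Lp_integral_add_le) auto
      also have "\<dots> \<le> ennreal (2 powr p) * (ennreal (e l) + ennreal (e (Suc l)))"
        unfolding ee[symmetric] using IJ2[OF l] by (intro mult_left_mono add_mono Lp_integral_mono_set) auto
      also have "\<dots> = ennreal (2 powr p * (e l + e (Suc l)))" using e0 by (simp add: ennreal_mult ennreal_plus)
      finally have le: "Lp_integral p (I (Suc l)) (\<lambda>x. poly (q l - q (Suc l)) x) \<le> ennreal (2 powr p * (e l + e (Suc l)))" .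
      then have "Lp_integral p (I (Suc l)) (\<lambda>x. poly (q l - q (Suc l)) x) < \<infinity>"
        by (rule order.strict_trans1) simp
      then show 1: "ennreal (d l) = Lp_integral p (I (Suc l)) (\<lambda>x. poly (q l - q (Suc l)) x)" by (simp add: d_def)
      have "0 \<le> 2 powr p * (e l + e (Suc l))" using e0 by simp
      then show "d l \<le> 2 powr p * (e l + e (Suc l))" using le unfolding 1[symmetric] by (simp only: ennreal_le_iff)
    qed
    have Dsup: "\<bar>poly (q l) x - poly (q (Suc l)) x\<bar> \<le> D l" if l: "Suc l < n" and x: "x \<in> I (Suc l)" for l x
    proof -
      have Ieq: "I (Suc l) = {grid n (Suc (Suc l))..grid n (Suc (Suc l)) + len (Suc l)}" by (simp add: I_def len_def)
      have "degree (q l - q (Suc l)) < r" using q l by (intro degree_diff_less) auto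
      then have "ennreal (\<bar>poly (q l - q (Suc l)) x\<bar> powr p) * ennreal (len (Suc l)) \<le> ennreal CN * Lp_integral p (I (Suc l)) (poly (q l - q (Suc l)))"
        unfolding CN_def Ieq by (rule poly_sup_le_Lp_integral[OF p _ len0[OF l]]) (use x Ieq in simp)
      also have "\<dots> = ennreal (CN * d l)" unfolding d_le(1)[OF l, symmetric] using CN by (simp add: ennreal_mult d_def)
      finally have "ennreal (\<bar>poly (q l - q (Suc l)) x\<bar> powr p * len (Suc l)) \<le> ennreal (CN * d l)"
        using len0[OF l] by (simp add: ennreal_mult)
      then have "\<bar>poly (q l - q (Suc l)) x\<bar> powr p * len (Suc l) \<le> CN * d l"
        using CN by (simp add: ennreal_le_iff d_def)
      then have "\<bar>poly (q l - q (Suc l)) x\<bar> powr p \<le> CN * d l / len (Suc l)" using len0[OF l] by (simp add: le_divide_eq)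
      then have "(\<bar>poly (q l - q (Suc l)) x\<bar> powr p) powr (1 / p) \<le> D l" unfolding D_def using p by (intro powr_mono2) auto
      then show ?thesis using p by (simp add: powr_powr)
    qed
    have D0: "0 \<le> D l" for l by (simp add: D_def)
    define S where "S i = (\<Sum>l<n - 1. D l / (1 + \<bar>real i - real l\<bar>) ^ (2 * k))" for i
    have S0: "0 \<le> S i" for i unfolding S_def using D0 by (intro sum_nonneg) auto
    have "\<exists>P. degree P \<le> n - 1 \<and> (\<forall>i<n. \<forall>\<tau>. real i * pi / real n \<le> \<tau> \<longrightarrow> \<tau> \<le> (real i + 1) * pi / real n \<longrightarrow>
       \<bar>poly (q i) (cos \<tau>) - poly P (cos \<tau>)\<bar> \<le> Cg * S i \<and>
       (\<forall>\<nu>. r \<le> \<nu> \<longrightarrow> \<nu> \<le> \<nu>\<^sub>0 \<longrightarrow> \<bar>rho n (cos \<tau>) ^ \<nu> * poly ((pderiv ^^ \<nu>) P) (cos \<tau>)\<bar> \<le> Cg * S i))"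
      unfolding S_def
    proof (rule glue[rule_format, OF nr q])
      fix l x assume "Suc l < n" "x \<in> {cos (real (l + 2) * pi / real n)..cos (real (l + 1) * pi / real n)}"
      then show "\<bar>poly (q l) x - poly (q (Suc l)) x\<bar> \<le> D l" by (intro Dsup) (auto simp: I_def grid_def)
    qed
    then obtain P where degP: "degree P \<le> n - 1" and Pbd: "\<forall>i<n. \<forall>\<tau>. real i * pi / real n \<le> \<tau> \<longrightarrow> \<tau> \<le> (real i + 1) * pi / real n \<longrightarrow>
       \<bar>poly (q i) (cos \<tau>) - poly P (cos \<tau>)\<bar> \<le> Cg * S i \<and>
       (\<forall>\<nu>. r \<le> \<nu> \<longrightarrow> \<nu> \<le> \<nu>\<^sub>0 \<longrightarrow> \<bar>rho n (cos \<tau>) ^ \<nu> * poly ((pderiv ^^ \<nu>) P) (cos \<tau>)\<bar> \<le> Cg * S i)" by blast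
    have Pq: "\<bar>poly (q i) x - poly P x\<bar> \<le> Cg * S i"
      and PD: "\<And>\<nu>. r \<le> \<nu> \<Longrightarrow> \<nu> \<le> \<nu>\<^sub>0 \<Longrightarrow> \<bar>rho n x ^ \<nu> * poly ((pderiv ^^ \<nu>) P) x\<bar> \<le> Cg * S i" if i: "i < n" and x: "x \<in> I i" for i x
    proof -
      obtain \<tau> where \<tau>: "x = cos \<tau>" "real i * pi / real n \<le> \<tau>" "\<tau> \<le> real (Suc i) * pi / real n"
        using grid_interval_param[OF n1, of i "Suc i" x] i x by (auto simp: I_def)
      have \<tau>': "\<tau> \<le> (real i + 1) * pi / real n" using \<tau>(3) by (simp add: add.commute)
      show "\<bar>poly (q i) x - poly P x\<bar> \<le> Cg * S i"
        "\<And>\<nu>. r \<le> \<nu> \<Longrightarrow> \<nu> \<le> \<nu>\<^sub>0 \<Longrightarrow> \<bar>rho n x ^ \<nu> * poly ((pderiv ^^ \<nu>) P) x\<bar> \<le> Cg * S i"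
        using Pbd[rule_format, OF i \<tau>(2) \<tau>'] \<tau>(1) by auto
    qed
    \<comment> \<open>The length of the cell cancels in the p-th power of \<open>D\<close>, and only
      the errors of two neighbours remain, so the double sum reduces to the weighted sum
      \<open>E\<close> of local errors.\<close>
    have key: "(\<Sum>i<n. V i * len i * S i powr p) \<le> K1 * E"
    proof -
      have "(\<Sum>i<n. V i * len i * S i powr p) \<le> 4 powr p * (4416 * Cw) * (\<Sum>l<n - 1. V l * (len (Suc l) * D l powr p))"
        unfolding S_def
      proof (rule weighted_kernel_sum[OF p k])
        show "len i \<le> 552 * (1 + \<bar>real i - real l\<bar>) * len l" if "i < n" "l < n" for i l
          unfolding len_def by (rule cell_length_comparison[OF n1 that])
      qed (use Cw V0 gw1 len0 D0 in \<open>auto simp: less_imp_le\<close>)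
      also have "(\<Sum>l<n - 1. V l * (len (Suc l) * D l powr p)) \<le> (\<Sum>l<n - 1. CN * 2 powr p * (V l * e l + Cw * 2 ^ m * (V (Suc l) * e (Suc l))))"
      proof (rule sum_mono)
        fix l assume "l \<in> {..<n - 1}"
        then have l: "Suc l < n" by auto
        have "0 \<le> CN * d l" using CN by (simp add: d_def)
        then have "len (Suc l) * D l powr p = CN * d l" using p len0[OF l] by (simp add: D_def powr_powr)
        also have "\<dots> \<le> CN * (2 powr p * (e l + e (Suc l)))" using d_le(2)[OF l] CN by (intro mult_left_mono) auto
        finally have "V l * (len (Suc l) * D l powr p) \<le> V l * (CN * (2 powr p * (e l + e (Suc l))))"
          using V0 by (intro mult_left_mono) auto
        also have "\<dots> = CN * 2 powr p * (V l * e l + V l * e (Suc l))" by (simp add: algebra_simps)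
        also have "\<dots> \<le> CN * 2 powr p * (V l * e l + Cw * 2 ^ m * (V (Suc l) * e (Suc l)))"
        proof (intro mult_left_mono add_left_mono)
          have "V l \<le> Cw * 2 ^ m * V (Suc l)" using gw1[of l "Suc l"] l by simp
          then have "V l * e (Suc l) \<le> (Cw * 2 ^ m * V (Suc l)) * e (Suc l)" using e0 by (intro mult_right_mono) auto
          then show "V l * e (Suc l) \<le> Cw * 2 ^ m * (V (Suc l) * e (Suc l))" by (simp add: mult.assoc)
        qed (use CN in auto)
        finally show "V l * (len (Suc l) * D l powr p) \<le> CN * 2 powr p * (V l * e l + Cw * 2 ^ m * (V (Suc l) * e (Suc l)))" .
      qed
      also have "\<dots> = CN * 2 powr p * ((\<Sum>l<n - 1. V l * e l) + Cw * 2 ^ m * (\<Sum>l<n - 1. V (Suc l) * e (Suc l)))"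
        by (simp add: sum_distrib_left sum.distrib distrib_left)
      also have "\<dots> \<le> CN * 2 powr p * (E + Cw * 2 ^ m * E)"
      proof (intro mult_left_mono add_mono)
        show "(\<Sum>l<n - 1. V l * e l) \<le> E" unfolding E_def using V0 e0 by (intro sum_mono2) auto
        have "(\<Sum>l<n - 1. V (Suc l) * e (Suc l)) = (\<Sum>l\<in>{1..<n}. V l * e l)"
          using n1 by (intro sum.reindex_bij_witness[of _ "\<lambda>l. l - 1" Suc]) auto
        also have "\<dots> \<le> E" unfolding E_def using V0 e0 by (intro sum_mono2) auto
        finally show "(\<Sum>l<n - 1. V (Suc l) * e (Suc l)) \<le> E" .
      qed (use CN Cw in auto)
      finally have "(\<Sum>i<n. V i * len i * S i powr p) \<le> 4 powr p * (4416 * Cw) * (CN * 2 powr p * (E + Cw * 2 ^ m * E))"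
        using Cw by (simp add: mult_left_mono)
      also have "\<dots> = K1 * E" by (simp add: K1_def algebra_simps)
      finally show ?thesis .
    qed
    have vI: "v x \<le> Cw * V i" if "i < n" "x \<in> {grid n (Suc i)..grid n i}" for i x
      using gw2(2)[OF that(1)] IJ[OF that(1)] that(2) by (auto simp: I_def J_def)
    have const: "Lp_integral p (I i) (\<lambda>x. Cg * S i) = ennreal (Cg powr p * (len i * S i powr p))" if "i < n" for i
      unfolding I_def Lp_integral_const using Cg S0[of i] len0[OF that]
      by (simp add: len_def powr_mult ennreal_mult[symmetric] max_def mult_ac)
    \<comment> \<open>Stated for any g with this bound, so that it serves both f - P and the
      weighted derivatives of P; for the latter the term with f - q i is simply added.\<close>
    have final: "(\<integral>\<^sup>+x\<in>{-1..1}. ennreal (\<bar>g x\<bar> powr p * v x) \<partial>lborel) \<le> ennreal C * \<Omega>"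
      if [measurable]: "g \<in> borel_measurable borel" and g: "\<And>i x. i < n \<Longrightarrow> x \<in> I i \<Longrightarrow> \<bar>g x\<bar> \<le> \<bar>f x - poly (q i) x\<bar> + Cg * S i" for g
    proof -
      have "(\<integral>\<^sup>+x\<in>{-1..1}. ennreal (\<bar>g x\<bar> powr p * v x) \<partial>lborel) \<le> (\<Sum>i<n. ennreal (Cw * V i) * Lp_integral p {grid n (Suc i)..grid n i} g)"
        by (rule weighted_integral_le_cells[OF n1 _ _ vI]) (use Cw V0 in auto)
      also have "\<dots> \<le> (\<Sum>i<n. ennreal (Cw * V i) * ennreal (2 powr p * (e i + Cg powr p * (len i * S i powr p))))"
      proof (intro sum_mono mult_left_mono)
        fix i assume "i \<in> {..<n}"
        then have i: "i < n" by simp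
        have "Lp_integral p (I i) g \<le> ennreal (2 powr p) * (Lp_integral p (I i) (\<lambda>x. f x - poly (q i) x) + Lp_integral p (I i) (\<lambda>x. Cg * S i))"
          using p g[OF i] Cg S0[of i] by (intro Lp_integral_add_le) auto
        also have "\<dots> \<le> ennreal (2 powr p) * (ennreal (e i) + ennreal (Cg powr p * (len i * S i powr p)))"
          unfolding const[OF i] ee[symmetric] by (intro mult_left_mono add_right_mono Lp_integral_mono_set IJ i) auto
        also have "\<dots> = ennreal (2 powr p * (e i + Cg powr p * (len i * S i powr p)))"
          using e0 len0[OF i] by (simp add: ennreal_mult ennreal_plus)
        finally show "Lp_integral p {grid n (Suc i)..grid n i} g \<le> ennreal (2 powr p * (e i + Cg powr p * (len i * S i powr p)))"
          by (simp add: I_def)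
      qed auto
      also have "\<dots> = ennreal (\<Sum>i<n. Cw * V i * (2 powr p * (e i + Cg powr p * (len i * S i powr p))))"
        using Cw V0 e0 len0 by (subst sum_ennreal[symmetric]) (auto simp: ennreal_mult less_imp_le intro!: mult_nonneg_nonneg add_nonneg_nonneg sum.cong)
      also have "\<dots> \<le> ennreal (K2 * E)"
      proof (rule ennreal_leI)
        have "(\<Sum>i<n. Cw * V i * (2 powr p * (e i + Cg powr p * (len i * S i powr p))))
          = Cw * 2 powr p * (E + Cg powr p * (\<Sum>i<n. V i * len i * S i powr p))"
          by (simp add: E_def sum_distrib_left sum.distrib[symmetric] algebra_simps)
        also have "\<dots> \<le> Cw * 2 powr p * (E + Cg powr p * (K1 * E))"
          using key Cw by (intro mult_left_mono add_left_mono) auto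
        also have "\<dots> = K2 * E" by (simp add: K2_def algebra_simps)
        finally show "(\<Sum>i<n. Cw * V i * (2 powr p * (e i + Cg powr p * (len i * S i powr p)))) \<le> K2 * E" .
      qed
      also have "\<dots> = ennreal K2 * ennreal E" using K2 E0 by (simp add: ennreal_mult)
      also have "\<dots> \<le> ennreal K2 * (ennreal (3 * Cw * Cl) * \<Omega>)" by (intro mult_left_mono E_le) auto
      also have "\<dots> = ennreal (K2 * (3 * Cw * Cl)) * \<Omega>" using K2 Cw Cl by (subst ennreal_mult) (auto simp: mult.assoc)
      also have "\<dots> \<le> ennreal C * \<Omega>" by (intro mult_right_mono ennreal_leI) (auto simp: C_def)
      finally show ?thesis .
    qed
    have rho_meas[measurable]: "rho n \<in> borel_measurable borel" unfolding rho_def by measurable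
    have "(\<integral>\<^sup>+x\<in>{-1..1}. ennreal (\<bar>f x - poly P x\<bar> powr p * v x) \<partial>lborel) \<le> ennreal C * \<Omega>"
    proof (rule final)
      show "\<bar>f x - poly P x\<bar> \<le> \<bar>f x - poly (q i) x\<bar> + Cg * S i" if "i < n" "x \<in> I i" for i x
        using Pq[OF that] by linarith
    qed measurable
    moreover have "(\<integral>\<^sup>+x\<in>{-1..1}. ennreal (\<bar>rho n x ^ \<nu> * poly ((pderiv ^^ \<nu>) P) x\<bar> powr p * v x) \<partial>lborel) \<le> ennreal C * \<Omega>"
      if nu: "r \<le> \<nu>" "\<nu> \<le> \<nu>\<^sub>0" for \<nu>
    proof (rule final)
      show "\<bar>rho n x ^ \<nu> * poly ((pderiv ^^ \<nu>) P) x\<bar> \<le> \<bar>f x - poly (q i) x\<bar> + Cg * S i" if ix: "i < n" "x \<in> I i" for i x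
        using PD[OF ix nu] by linarith
    qed measurable
    ultimately show ?thesis using degP unfolding \<Omega>_def v_def by blast
  qed
  then show ?thesis using C0 by (intro exI[of _ C]) blast
qed

section \<open>Borel representatives and the quasi-norms\<close>

text \<open>The map x + c phi(x) need not be injective and its derivative may vanish, so null sets
  are pulled back through explicit inverses. For y = x + c phi(x) the quadratic equation (K x - y)^2
  = c^2 (K - y^2) has the two branches \<open>g c\<close> and \<open>g (- c)\<close>, smooth where
  y^2 < K; for y^2 = K only two points x remain. This makes differences of f independent of its
  representative up to null sets.\<close>

lemma negligible_preimage_add_phi:
  assumes N: "negligible N"
  shows "negligible {x \<in> {-1..1}. x + c * phi x \<in> N}"
proof -
  define K where "K = 1 + c\<^sup>2"
  have K0: "0 < K" by (simp add: K_def add_pos_nonneg)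
  define g where "g e y = (y + e * sqrt (K - y\<^sup>2)) / K" for e y :: real
  define U where "U = {y. y\<^sup>2 < K}"
  have neg: "negligible (g e ` (N \<inter> U))" for e
  proof (rule negligible_differentiable_image_negligible)
    show "negligible (N \<inter> U)" by (rule negligible_subset[OF N]) auto
    have "(g e) differentiable (at y)" if "y \<in> U" for y
    proof -
      have "0 < K - y\<^sup>2" using that by (simp add: U_def)
      then have "((\<lambda>y. (y + e * sqrt (K - y\<^sup>2)) / K) has_real_derivative ((1 + e * ((- 2 * y) * (inverse (sqrt (K - y\<^sup>2)) / 2))) / K)) (at y)"
        using K0 by (auto intro!: derivative_eq_intros simp: field_simps)
      then show ?thesis unfolding g_def[abs_def] by (meson differentiableI real_differentiable_def real_differentiableE field_differentiable_imp_differentiable field_differentiable_def)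
    qed
    then show "g e differentiable_on (N \<inter> U)"
      by (auto simp: differentiable_on_def intro: differentiable_at_withinI)
  qed simp
  have "{x \<in> {-1..1}. x + c * phi x \<in> N} \<subseteq> g c ` (N \<inter> U) \<union> g (- c) ` (N \<inter> U) \<union> {sqrt K / K, - sqrt K / K}"
  proof
    fix x assume "x \<in> {x \<in> {-1..1}. x + c * phi x \<in> N}"
    then have x: "-1 \<le> x" "x \<le> 1" and yN: "x + c * phi x \<in> N" by auto
    define y where "y = x + c * phi x"
    have ph: "(phi x)\<^sup>2 = 1 - x\<^sup>2" using x by (simp add: phi_def abs_square_le_1)
    \<comment> \<open>c x - phi(x) is the companion of y: by phi(x)^2 = 1 - x^2 their squares add up
      to K.\<close>
    have id1: "(K * x - y)\<^sup>2 = c\<^sup>2 * (K - y\<^sup>2)"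
    proof -
      have "K * x - y = c * (c * x - phi x)" by (simp add: K_def y_def algebra_simps power2_eq_square)
      then have "(K * x - y)\<^sup>2 = c\<^sup>2 * (c * x - phi x)\<^sup>2" by (simp add: power_mult_distrib)
      also have "(c * x - phi x)\<^sup>2 = K - y\<^sup>2"
      proof -
        have "(c * x - phi x)\<^sup>2 + y\<^sup>2 = K * (x\<^sup>2 + (phi x)\<^sup>2)" by (simp add: K_def y_def algebra_simps power2_eq_square)
        then show ?thesis unfolding ph by simp
      qed
      finally show ?thesis .
    qed
    have yK: "y\<^sup>2 \<le> K"
    proof -
      have "(c * x - phi x)\<^sup>2 + y\<^sup>2 = K * (x\<^sup>2 + (phi x)\<^sup>2)" by (simp add: K_def y_def algebra_simps power2_eq_square)
      then have "(c * x - phi x)\<^sup>2 + y\<^sup>2 = K" unfolding ph by simp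
      then show ?thesis using zero_le_power2[of "c * x - phi x"] by linarith
    qed
    show "x \<in> g c ` (N \<inter> U) \<union> g (- c) ` (N \<inter> U) \<union> {sqrt K / K, - sqrt K / K}"
    proof (cases "y\<^sup>2 = K")
      case True
      then have "K * x = y" using id1 by simp
      then have xy: "x = y / K" using K0 by (simp add: field_simps)
      have "\<bar>y\<bar> = sqrt K" using True by (metis real_sqrt_abs)
      then have "y = sqrt K \<or> y = - sqrt K" by linarith
      then show ?thesis using xy by auto
    next
      case False
      then have yU: "y \<in> N \<inter> U" using yK yN by (simp add: U_def y_def)
      have "(K * x - y)\<^sup>2 = (c * sqrt (K - y\<^sup>2))\<^sup>2" using id1 yK by (simp add: power_mult_distrib)
      then have "K * x - y = c * sqrt (K - y\<^sup>2) \<or> K * x - y = - (c * sqrt (K - y\<^sup>2))" by (simp add: power2_eq_iff)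
      then have "x = g c y \<or> x = g (- c) y" using K0 by (auto simp: g_def field_simps)
      then show ?thesis using yU by auto
    qed
  qed
  moreover have "negligible (g c ` (N \<inter> U) \<union> g (- c) ` (N \<inter> U) \<union> {sqrt K / K, - sqrt K / K})"
    using neg by auto
  ultimately show ?thesis using negligible_subset by blast
qed

lemma AE_lebesgue_on_iff:
  "(AE x in lebesgue_on {-1..1::real}. Q x) \<longleftrightarrow> (AE x in lborel. x \<in> {-1..1} \<longrightarrow> Q x)"
  by (simp add: AE_restrict_space_iff AE_completion_iff)

lemma nn_integral_lebesgue_on:
  fixes a b :: real
  shows "(\<integral>\<^sup>+x. g x \<partial>lebesgue_on {a..b}) = (\<integral>\<^sup>+x\<in>{a..b}. g x \<partial>lborel)"
  by (simp add: nn_integral_restrict_space nn_integral_completion)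

text \<open>All r + 1 points of the difference are of the form x + c phi(x), so only finitely many
  null sets are removed. Whatever the sign of h, these points lie between the two extreme ones and
  hence in [-1, 1] when the difference is not set to 0.\<close>

lemma symm_difference_AE_cong:
  assumes fg: "AE x in lborel. x \<in> {-1..1} \<longrightarrow> f x = g x"
  shows "AE x in lborel. x \<in> {-1..1} \<longrightarrow> symm_difference r (h * phi x) f x = symm_difference r (h * phi x) g x"
proof -
  define N where "N = {x \<in> {-1..1}. f x \<noteq> g x}"
  have neg: "negligible N"
  proof -
    obtain N' where N'': "{x \<in> space lborel. \<not> (x \<in> {-1..1} \<longrightarrow> f x = g x)} \<subseteq> N'" "emeasure lborel N' = 0" "N' \<in> sets lborel"
      using fg by (rule AE_E)
    then have N': "N' \<in> null_sets lborel" "{x \<in> space lborel. \<not> (x \<in> {-1..1} \<longrightarrow> f x = g x)} \<subseteq> N'" by auto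
    then have "negligible N'" by (simp add: negligible_iff_null_sets null_sets_completionI)
    then show ?thesis by (rule negligible_subset) (use N'(2) in \<open>auto simp: N_def\<close>)
  qed
  define B where "B = (\<Union>i\<le>r. {x \<in> {-1..1}. x + ((real i - real r / 2) * h) * phi x \<in> N})"
  have "negligible B" unfolding B_def
    by (rule negligible_Union) (simp, use negligible_preimage_add_phi[OF neg] in blast)
  then have "B \<in> null_sets lebesgue" by (simp add: negligible_iff_null_sets)
  then have "AE x in lebesgue. x \<notin> B" by (rule AE_not_in)
  then have "AE x in lborel. x \<notin> B" by (simp add: AE_completion_iff)
  then show ?thesis
  proof eventually_elim
    case (elim x)
    show ?case
    proof
      assume x: "x \<in> {-1..1}"
      show "symm_difference r (h * phi x) f x = symm_difference r (h * phi x) g x"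
      proof (cases "x - real r * (h * phi x) / 2 \<in> {-1..1} \<and> x + real r * (h * phi x) / 2 \<in> {-1..1}")
        case True
        have "f (x - real r * (h * phi x) / 2 + real i * (h * phi x)) = g (x - real r * (h * phi x) / 2 + real i * (h * phi x))" if i: "i \<le> r" for i
        proof -
          define d where "d = h * phi x"
          define z where "z = x - real r * d / 2 + real i * d"
          have zi: "z \<in> {-1..1}"
          proof (cases "0 \<le> d")
            case d: True
            have "0 \<le> real i * d" "real i * d \<le> real r * d" using i d by (auto intro: mult_right_mono)
            then show ?thesis using True unfolding z_def d_def[symmetric] by auto
          next
            case False
            then have "real i * d \<le> 0" "real r * d \<le> real i * d" using i by (auto intro: mult_right_mono_neg mult_nonneg_nonpos)
            then show ?thesis using True unfolding z_def d_def[symmetric] by auto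
          qed
          have "z = x + ((real i - real r / 2) * h) * phi x" by (simp add: z_def d_def algebra_simps)
          then have "z \<notin> N" using elim x i by (auto simp: B_def)
          then show ?thesis using zi by (auto simp: N_def z_def d_def)
        qed
        then show ?thesis using True by (simp add: symm_difference_def)
      next
        case False
        then show ?thesis unfolding symm_difference_def by (simp only: if_False)
      qed
    qed
  qed
qed

text \<open>Exchanging the integrals over position and step requires joint measurability, which a
  Borel representative provides.\<close>

lemma borel_representative:
  assumes "f \<in> borel_measurable (lebesgue_on {-1..1::real})"
  obtains g :: "real \<Rightarrow> real" where "g \<in> borel_measurable borel" "AE x in lborel. x \<in> {-1..1} \<longrightarrow> f x = g x"
proof -
  have "(\<lambda>x. if x \<in> {-1..1} then f x else 0) \<in> borel_measurable lebesgue"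
    using assms by (subst borel_measurable_if) auto
  from completion_ex_borel_measurable_real[OF this] obtain g where g: "g \<in> borel_measurable lborel"
    "AE x in lborel. (if x \<in> {-1..1} then f x else 0) = g x" by blast
  have "AE x in lborel. x \<in> {-1..1} \<longrightarrow> f x = g x" using g(2) by eventually_elim auto
  then show thesis using that[of g] g(1) by simp
qed

section \<open>Extended powers and the comparison of the two moduli\<close>

lemma epowr_epowr: "0 < a \<Longrightarrow> epowr (epowr x (1 / a)) a = x"
  by (cases x) (auto simp: epowr_def powr_powr)

lemma epowr_mono: "x \<le> y \<Longrightarrow> 0 < a \<Longrightarrow> epowr x a \<le> epowr y a"
  by (cases x; cases y) (auto simp: epowr_def top_unique intro!: ennreal_leI powr_mono2)

lemma epowr_cmult: "0 < c \<Longrightarrow> 0 < a \<Longrightarrow> epowr (ennreal c * x) a = ennreal (c powr a) * epowr x a"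
  by (cases x) (auto simp: epowr_def ennreal_mult_top ennreal_mult[symmetric] powr_mult)

lemma wnorm_finite:
  assumes "p \<noteq> \<infinity>"
  shows "wnorm p v g = epowr (\<integral>\<^sup>+x\<in>{-1..1}. ennreal (\<bar>g x\<bar> powr enn2real p * v x) \<partial>lborel) (1 / enn2real p)"
  using assms by (simp add: wnorm_def nn_integral_lebesgue_on)

lemma nn_integral_Icc_Ioc: "(\<integral>\<^sup>+h\<in>{0..t::real}. F h \<partial>lborel) = (\<integral>\<^sup>+h\<in>{0<..t}. F h \<partial>lborel)"
proof (rule nn_integral_cong_AE)
  have "AE h in lborel. h \<noteq> (0::real)" by (rule AE_lborel_singleton)
  then show "AE h in lborel. F h * indicator {0..t} h = F h * indicator {0<..t} h"
    by eventually_elim (auto split: split_indicator)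
qed

lemma avg_modulus_le_modulus:
  assumes p: "0 < p" and t: "0 < t"
  shows "avg_modulus r f t p v \<le> modulus r f t p v"
proof (cases "p = \<infinity>")
  case False
  define a where "a = enn2real p"
  have a0: "0 < a" using p False by (simp add: a_def enn2real_positive_iff less_top)
  define S where "S = modulus r f t p v"
  have "(\<integral>\<^sup>+h. epowr (wnorm p v (\<lambda>x. symm_difference r (h * phi x) f x)) a \<partial>lebesgue_on {0..t}) \<le> (\<integral>\<^sup>+h\<in>{0<..t}. epowr S a \<partial>lborel)"
    unfolding nn_integral_lebesgue_on nn_integral_Icc_Ioc S_def modulus_def
    by (intro nn_integral_mono mult_indicator_mono epowr_mono a0 SUP_upper)
  also have "\<dots> = ennreal t * epowr S a" using t by (simp add: nn_integral_cmult_indicator mult.commute)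
  finally have "ennreal (1 / t) * (\<integral>\<^sup>+h. epowr (wnorm p v (\<lambda>x. symm_difference r (h * phi x) f x)) a \<partial>lebesgue_on {0..t}) \<le> ennreal (1 / t) * (ennreal t * epowr S a)"
    by (intro mult_left_mono) auto
  also have "\<dots> = epowr S a"
  proof -
    have "ennreal (1 / t) * ennreal t = 1" using t by (simp flip: ennreal_mult)
    then show ?thesis by (simp flip: mult.assoc)
  qed
  finally have "avg_modulus r f t p v \<le> epowr (epowr S a) (1 / a)"
    using False a0 unfolding avg_modulus_def a_def by (simp add: epowr_mono)
  also have "\<dots> = S" using epowr_epowr[of "1 / a" S] a0 by simp
  finally show ?thesis by (simp add: S_def)
qed (simp add: avg_modulus_def)

section \<open>The exponent \<open>\<infinity>\<close>\<close>

text \<open>Averaging the pointwise inequality over s in (0, \<sigma>] turns the values of g at x +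
  k s into integrals over the interval, so an integral bound becomes an essential bound.
  \<open>F\<close> stands for a difference attached to x and \<epsilon> for the direction of the
  steps; \<open>zero\<close> expresses that |F| \<le> B for almost all pairs, and exchanging
  integrals gives this for almost every x and then almost every s.\<close>

lemma bootstrap_half:
  fixes g :: "real \<Rightarrow> real" and F :: "real \<Rightarrow> real \<Rightarrow> real"
  assumes g[measurable]: "g \<in> borel_measurable borel" and F[measurable]: "(\<lambda>(x, s). F s x) \<in> borel_measurable (borel \<Otimes>\<^sub>M borel)"
    and X[measurable]: "X \<in> sets borel" and B: "0 \<le> B" and \<sigma>: "0 < \<sigma>" and \<epsilon>: "\<bar>\<epsilon>\<bar> = 1"
    and pt: "\<And>x s. \<bar>g x\<bar> \<le> \<bar>F s x\<bar> + 2 ^ r * (\<Sum>k\<in>{1..r}. \<bar>g (x + \<epsilon> * real k * s)\<bar>)"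
    and inJ: "\<And>x s k. x \<in> X \<Longrightarrow> s \<in> {0<..\<sigma>} \<Longrightarrow> k \<in> {1..r} \<Longrightarrow> x + \<epsilon> * real k * s \<in> {a..b}"
    and zero: "(\<integral>\<^sup>+s\<in>{0<..\<sigma>}. (\<integral>\<^sup>+x\<in>X. indicator {B<..} \<bar>F s x\<bar> \<partial>lborel) \<partial>lborel) = 0"
  shows "AE x in lborel. x \<in> X \<longrightarrow> ennreal (\<bar>g x\<bar> * \<sigma>) \<le> ennreal (B * \<sigma>) + ennreal (2 ^ r * real r) * Lp_integral 1 {a..b} g"
proof -
  have "(\<integral>\<^sup>+x\<in>X. (\<integral>\<^sup>+s\<in>{0<..\<sigma>}. indicator {B<..} \<bar>F s x\<bar> \<partial>lborel) \<partial>lborel) = 0"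
    unfolding zero[symmetric] by (rule nn_integral_set_swap) auto
  then have "AE x in lborel. (\<integral>\<^sup>+s\<in>{0<..\<sigma>}. indicator {B<..} \<bar>F s x\<bar> \<partial>lborel) * indicator X x = 0"
    by (subst (asm) nn_integral_0_iff_AE) auto
  then show ?thesis
  proof eventually_elim
    case (elim x)
    show ?case
    proof
      assume x: "x \<in> X"
      then have "(\<integral>\<^sup>+s\<in>{0<..\<sigma>}. indicator {B<..} \<bar>F s x\<bar> \<partial>lborel) = 0" using elim by simp
      then have ae: "AE s in lborel. indicator {B<..} \<bar>F s x\<bar> * indicator {0<..\<sigma>} s = (0::ennreal)"
        by (subst (asm) nn_integral_0_iff_AE) auto
      \<comment> \<open>The substitution x + c s with |c| = k \<ge> 1 does not increase the
        integral.\<close>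
      have one: "(\<integral>\<^sup>+s. ennreal \<bar>g (x + \<epsilon> * real k * s)\<bar> * indicator {0<..\<sigma>} s \<partial>lborel) \<le> Lp_integral 1 {a..b} g" if k: "k \<in> {1..r}" for k
      proof -
        define c where "c = \<epsilon> * real k"
        have c1: "1 \<le> \<bar>c\<bar>" using k \<epsilon> by (simp add: c_def abs_mult)
        have "(\<integral>\<^sup>+s. ennreal \<bar>g (x + \<epsilon> * real k * s)\<bar> * indicator {0<..\<sigma>} s \<partial>lborel)
          \<le> (\<integral>\<^sup>+s. ennreal (\<bar>g (x + c * s)\<bar> powr 1) * indicator {a..b} (x + c * s) \<partial>lborel)"
          using inJ[OF x _ k] by (intro nn_integral_mono) (auto simp: c_def split: split_indicator)
        also have "\<dots> \<le> ennreal \<bar>c\<bar> * (\<integral>\<^sup>+s. ennreal (\<bar>g (x + c * s)\<bar> powr 1) * indicator {a..b} (x + c * s) \<partial>lborel)"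
          using mult_right_mono[of 1 "ennreal \<bar>c\<bar>" "\<integral>\<^sup>+s. ennreal (\<bar>g (x + c * s)\<bar> powr 1) * indicator {a..b} (x + c * s) \<partial>lborel"] c1
          by simp
        also have "\<dots> = Lp_integral 1 {a..b} g"
          unfolding Lp_integral_def using c1 by (intro nn_integral_real_affine[symmetric]) auto
        finally show ?thesis .
      qed
      have "ennreal (\<bar>g x\<bar> * \<sigma>) = (\<integral>\<^sup>+s\<in>{0<..\<sigma>}. ennreal \<bar>g x\<bar> \<partial>lborel)"
        using \<sigma> by (simp add: nn_integral_cmult_indicator ennreal_mult)
      also have "\<dots> \<le> (\<integral>\<^sup>+s. ennreal B * indicator {0<..\<sigma>} s + ennreal (2 ^ r) * (\<Sum>k\<in>{1..r}. ennreal \<bar>g (x + \<epsilon> * real k * s)\<bar> * indicator {0<..\<sigma>} s) \<partial>lborel)"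
      proof (rule nn_integral_mono_AE, use ae in eventually_elim)
        case (elim s)
        show ?case
        proof (cases "s \<in> {0<..\<sigma>}")
          case True
          then have "\<bar>F s x\<bar> \<le> B" using elim by (auto split: split_indicator_asm)
          then have "\<bar>g x\<bar> \<le> B + 2 ^ r * (\<Sum>k\<in>{1..r}. \<bar>g (x + \<epsilon> * real k * s)\<bar>)" using pt[of x s] by linarith
          then have "ennreal \<bar>g x\<bar> \<le> ennreal (B + 2 ^ r * (\<Sum>k\<in>{1..r}. \<bar>g (x + \<epsilon> * real k * s)\<bar>))" by (rule ennreal_leI)
          also have "\<dots> = ennreal B + ennreal (2 ^ r) * (\<Sum>k\<in>{1..r}. ennreal \<bar>g (x + \<epsilon> * real k * s)\<bar>)"
            using B by (simp add: ennreal_plus ennreal_mult sum_nonneg sum_ennreal)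
          finally show ?thesis using True by simp
        qed simp
      qed
      also have "\<dots> = ennreal B * ennreal \<sigma> + ennreal (2 ^ r) * (\<Sum>k\<in>{1..r}. (\<integral>\<^sup>+s. ennreal \<bar>g (x + \<epsilon> * real k * s)\<bar> * indicator {0<..\<sigma>} s \<partial>lborel))"
        using \<sigma> by (simp add: nn_integral_add nn_integral_cmult nn_integral_sum nn_integral_cmult_indicator del: sum_mult_indicator sum_indicator_mult)
      also have "\<dots> \<le> ennreal B * ennreal \<sigma> + ennreal (2 ^ r) * (\<Sum>k\<in>{1..r}. Lp_integral 1 {a..b} g)"
        by (intro add_left_mono mult_left_mono sum_mono one) auto
      also have "\<dots> = ennreal (B * \<sigma>) + ennreal (2 ^ r * real r) * Lp_integral 1 {a..b} g"
        using B \<sigma> by (simp add: ennreal_mult ennreal_of_nat_eq_real_of_nat mult.assoc)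
      finally show "ennreal (\<bar>g x\<bar> * \<sigma>) \<le> ennreal (B * \<sigma>) + ennreal (2 ^ r * real r) * Lp_integral 1 {a..b} g" .
    qed
  qed
qed

text \<open>The value at x enters its difference with a coefficient of modulus 1, each other value
  with at most 2^r.\<close>

lemma abs_le_fwd_diff:
  assumes "1 \<le> r"
  shows "\<bar>g x\<bar> \<le> \<bar>fwd_diff r s g x\<bar> + 2 ^ r * (\<Sum>k\<in>{1..r}. \<bar>g (x + real k * s)\<bar>)"
proof -
  have "fwd_diff r s g x = (-1) ^ r * g x + (\<Sum>k\<in>{1..r}. real (r choose k) * (-1) ^ (r - k) * g (x + real k * s))"
    unfolding fwd_diff_def by (simp add: atMost_atLeast0 sum.atLeast_Suc_atMost)
  then have "\<bar>g x\<bar> \<le> \<bar>fwd_diff r s g x\<bar> + \<bar>\<Sum>k\<in>{1..r}. real (r choose k) * (-1) ^ (r - k) * g (x + real k * s)\<bar>"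
    by (cases "even r") (auto simp: minus_one_power_iff)
  also have "\<bar>\<Sum>k\<in>{1..r}. real (r choose k) * (-1) ^ (r - k) * g (x + real k * s)\<bar> \<le> (\<Sum>k\<in>{1..r}. 2 ^ r * \<bar>g (x + real k * s)\<bar>)"
  proof (rule order.trans[OF sum_abs], rule sum_mono)
    fix k
    have "real (r choose k) \<le> 2 ^ r" using of_nat_mono[OF binomial_le_pow2[of r k], where 'a = real] by simp
    then show "\<bar>real (r choose k) * (-1) ^ (r - k) * g (x + real k * s)\<bar> \<le> 2 ^ r * \<bar>g (x + real k * s)\<bar>"
      by (simp add: abs_mult power_abs mult_right_mono)
  qed
  finally show ?thesis by (simp add: sum_distrib_left)
qed

text \<open>Points of the left half step to the right and points of the right half to the left, so
  that r steps of length at most \<sigma> stay inside. On the right half the difference is based at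
  x - r s, with x as its last point.\<close>

lemma ess_bound_from_differences:
  fixes q :: "real poly"
  assumes r: "1 \<le> r" and f[measurable]: "f \<in> borel_measurable borel" and q: "degree q < r"
    and l: "0 < l" and \<sigma>: "0 < \<sigma>" "2 * real r * \<sigma> \<le> l" and B: "0 \<le> B"
    and zero: "(\<integral>\<^sup>+s\<in>{0<..\<sigma>}. (\<integral>\<^sup>+y\<in>{a..a + l - real r * s}. indicator {B<..} \<bar>fwd_diff r s f y\<bar> \<partial>lborel) \<partial>lborel) = 0"
  shows "AE x in lborel. x \<in> {a..a + l} \<longrightarrow> ennreal (\<bar>f x - poly q x\<bar> * \<sigma>)
    \<le> ennreal (B * \<sigma>) + ennreal (2 ^ r * real r) * Lp_integral 1 {a..a + l} (\<lambda>x. f x - poly q x)"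
proof -
  have [measurable]: "poly q \<in> borel_measurable borel"
    by (intro borel_measurable_continuous_onI continuous_intros)
  define g where "g x = f x - poly q x" for x
  have [measurable]: "g \<in> borel_measurable borel" unfolding g_def by measurable
  have dg: "fwd_diff r s g y = fwd_diff r s f y" for s y unfolding g_def by (rule fwd_diff_minus_poly[OF q])
  have ks: "real k * s \<le> l / 2" "0 \<le> real k * s" if "s \<in> {0<..\<sigma>}" "k \<le> r" for s k
  proof -
    have "real k * s \<le> real r * \<sigma>" using that by (intro mult_mono) auto
    then show "real k * s \<le> l / 2" "0 \<le> real k * s" using \<sigma> that by auto
  qed
  have left: "AE x in lborel. x \<in> {a..a + l / 2} \<longrightarrow> ennreal (\<bar>g x\<bar> * \<sigma>) \<le> ennreal (B * \<sigma>) + ennreal (2 ^ r * real r) * Lp_integral 1 {a..a + l} g"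
  proof (rule bootstrap_half[where \<epsilon> = 1 and F = "\<lambda>s x. fwd_diff r s g x"])
    show "\<bar>g x\<bar> \<le> \<bar>fwd_diff r s g x\<bar> + 2 ^ r * (\<Sum>k\<in>{1..r}. \<bar>g (x + 1 * real k * s)\<bar>)" for x s
      using abs_le_fwd_diff[OF r, of g x s] by simp
    show "x + 1 * real k * s \<in> {a..a + l}" if "x \<in> {a..a + l / 2}" "s \<in> {0<..\<sigma>}" "k \<in> {1..r}" for x s k
    proof -
      have "a \<le> x" "x \<le> a + l / 2" "k \<le> r" using that by auto
      then show ?thesis using ks[OF that(2), of k] unfolding atLeastAtMost_iff mult_1_left by linarith
    qed
    have "(\<integral>\<^sup>+s\<in>{0<..\<sigma>}. (\<integral>\<^sup>+x\<in>{a..a + l / 2}. indicator {B<..} \<bar>fwd_diff r s g x\<bar> \<partial>lborel) \<partial>lborel)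
      \<le> (\<integral>\<^sup>+s\<in>{0<..\<sigma>}. (\<integral>\<^sup>+y\<in>{a..a + l - real r * s}. indicator {B<..} \<bar>fwd_diff r s f y\<bar> \<partial>lborel) \<partial>lborel)"
      unfolding dg using ks[of _ r] l
      by (intro nn_integral_mono mult_indicator_mono) (auto intro!: nn_integral_mono split: split_indicator; force)
    then show "(\<integral>\<^sup>+s\<in>{0<..\<sigma>}. (\<integral>\<^sup>+x\<in>{a..a + l / 2}. indicator {B<..} \<bar>fwd_diff r s g x\<bar> \<partial>lborel) \<partial>lborel) = 0"
      unfolding zero by simp
  qed (use B \<sigma> in auto)
  have right: "AE x in lborel. x \<in> {a + l / 2..a + l} \<longrightarrow> ennreal (\<bar>g x\<bar> * \<sigma>) \<le> ennreal (B * \<sigma>) + ennreal (2 ^ r * real r) * Lp_integral 1 {a..a + l} g"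
  proof (rule bootstrap_half[where \<epsilon> = "-1" and F = "\<lambda>s x. fwd_diff r s g (x - real r * s)"])
    show "\<bar>g x\<bar> \<le> \<bar>fwd_diff r s g (x - real r * s)\<bar> + 2 ^ r * (\<Sum>k\<in>{1..r}. \<bar>g (x + -1 * real k * s)\<bar>)" for x s
      using abs_le_fwd_diff[OF r, of "\<lambda>t. g (0 - t)" "- x" s] abs_fwd_diff_reflect[of r s g 0 "- x"] by simp
    show "x + -1 * real k * s \<in> {a..a + l}" if "x \<in> {a + l / 2..a + l}" "s \<in> {0<..\<sigma>}" "k \<in> {1..r}" for x s k
    proof -
      have "a + l / 2 \<le> x" "x \<le> a + l" "k \<le> r" using that by auto
      moreover have "x + -1 * real k * s = x - real k * s" by simp
      ultimately show ?thesis using ks[OF that(2), of k] unfolding atLeastAtMost_iff by linarith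
    qed
    have "(\<integral>\<^sup>+s\<in>{0<..\<sigma>}. (\<integral>\<^sup>+x\<in>{a + l / 2..a + l}. indicator {B<..} \<bar>fwd_diff r s g (x - real r * s)\<bar> \<partial>lborel) \<partial>lborel)
      \<le> (\<integral>\<^sup>+s\<in>{0<..\<sigma>}. (\<integral>\<^sup>+y\<in>{a..a + l - real r * s}. indicator {B<..} \<bar>fwd_diff r s f y\<bar> \<partial>lborel) \<partial>lborel)"
    proof (intro nn_integral_mono, rule mult_indicator_mono)
      fix s assume s: "s \<in> {0<..\<sigma>}"
      show "(\<integral>\<^sup>+x\<in>{a + l / 2..a + l}. indicator {B<..} \<bar>fwd_diff r s g (x - real r * s)\<bar> \<partial>lborel)
        \<le> (\<integral>\<^sup>+y\<in>{a..a + l - real r * s}. indicator {B<..} \<bar>fwd_diff r s f y\<bar> \<partial>lborel)"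
        unfolding dg using nn_integral_shift_le[of "\<lambda>y. indicator {B<..} \<bar>fwd_diff r s f y\<bar>" "{a + l / 2..a + l}" "- (real r * s)" a "a + l - real r * s"] ks[OF s, of r]
        by (simp add: algebra_simps)
    qed
    then show "(\<integral>\<^sup>+s\<in>{0<..\<sigma>}. (\<integral>\<^sup>+x\<in>{a + l / 2..a + l}. indicator {B<..} \<bar>fwd_diff r s g (x - real r * s)\<bar> \<partial>lborel) \<partial>lborel) = 0"
      unfolding zero by simp
  qed (use B \<sigma> in auto)
  from left right show ?thesis unfolding g_def[symmetric] by eventually_elim (auto simp: not_le)
qed

text \<open>The local polynomials are those for p = 1. Dividing the weighted bound B by the weight
  of the cell gives unweighted bounds \<open>b i\<close> for the differences, and with these the
  integral estimate on each interval is upgraded to an essential one.\<close>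

lemma infinite_exponent_approximation:
  assumes r: "1 \<le> r" and \<theta>: "0 < \<theta>" "\<theta> \<le> 1"
  shows "\<exists>C>0. \<forall>w f n B. doubling_weight w L \<longrightarrow> f \<in> borel_measurable borel \<longrightarrow> Lp_integral 1 {-1..1} f < \<infinity> \<longrightarrow> r \<le> n \<longrightarrow> 0 \<le> B \<longrightarrow>
    (\<forall>h\<in>{0<..\<theta> / real n}. AE x in lborel. x \<in> {-1..1} \<longrightarrow> \<bar>symm_difference r (h * phi x) f x\<bar> * avg_weight w n x \<le> B) \<longrightarrow>
    (\<exists>P. degree P \<le> n - 1 \<and>
      (AE x in lborel. x \<in> {-1..1} \<longrightarrow> \<bar>f x - poly P x\<bar> * avg_weight w n x \<le> C * B) \<and>
      (\<forall>\<nu>. r \<le> \<nu> \<longrightarrow> \<nu> \<le> \<nu>\<^sub>0 \<longrightarrow> (\<forall>x\<in>{-1..1}. \<bar>rho n x ^ \<nu> * poly ((pderiv ^^ \<nu>) P) x\<bar> * avg_weight w n x \<le> C * B)))"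
proof -
  obtain Cw m where Cw: "1 \<le> Cw" and gw: "\<forall>w n. doubling_weight w L \<longrightarrow> 1 \<le> n \<longrightarrow>
    (\<forall>i\<le>n. \<forall>l\<le>n. avg_weight w n (grid n i) \<le> Cw * (1 + \<bar>real i - real l\<bar>) ^ m * avg_weight w n (grid n l)) \<and>
    (\<forall>i<n. \<forall>x\<in>{grid n (min (i + 2) n)..grid n i}.
       avg_weight w n (grid n i) \<le> Cw * avg_weight w n x \<and> avg_weight w n x \<le> Cw * avg_weight w n (grid n i))"
    using grid_weights[of L] by (elim exE conjE)
  obtain Cl where Cl: "0 < Cl" and local: "\<forall>f\<in>borel_measurable borel. \<forall>n a b. 1 \<le> n \<longrightarrow> 0 \<le> a \<longrightarrow> b \<le> pi \<longrightarrow>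
     pi / real n \<le> b - a \<longrightarrow> b - a \<le> 2 * pi / real n \<longrightarrow> Lp_integral 1 {cos b..cos a} f < \<infinity> \<longrightarrow>
     (\<exists>q. degree q < r \<and> Lp_integral 1 {cos b..cos a} (\<lambda>x. f x - poly q x) \<le> ennreal Cl * (ennreal (real n / \<theta>) *
        (\<integral>\<^sup>+h\<in>{0<..\<theta> / real n}. (\<integral>\<^sup>+x\<in>{cos b..cos a}. ennreal (\<bar>symm_difference r (h * phi x) f x\<bar> powr 1) \<partial>lborel) \<partial>lborel)))"
    using local_approximation[OF r zero_less_one \<theta>] by (elim exE conjE)
  obtain Cg where Cg: "0 < Cg" and glue: "\<forall>n q D. r \<le> n \<longrightarrow> (\<forall>i<n. degree (q i) < r) \<longrightarrow>
    (\<forall>l. Suc l < n \<longrightarrow> (\<forall>x\<in>{cos (real (l + 2) * pi / real n)..cos (real (l + 1) * pi / real n)}. \<bar>poly (q l) x - poly (q (Suc l)) x\<bar> \<le> D l)) \<longrightarrow>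
    (\<exists>P. degree P \<le> n - 1 \<and> (\<forall>i<n. \<forall>\<tau>. real i * pi / real n \<le> \<tau> \<longrightarrow> \<tau> \<le> (real i + 1) * pi / real n \<longrightarrow>
       \<bar>poly (q i) (cos \<tau>) - poly P (cos \<tau>)\<bar> \<le> Cg * (\<Sum>l<n - 1. D l / (1 + \<bar>real i - real l\<bar>) ^ (m + 2)) \<and>
       (\<forall>\<nu>. r \<le> \<nu> \<longrightarrow> \<nu> \<le> \<nu>\<^sub>0 \<longrightarrow> \<bar>rho n (cos \<tau>) ^ \<nu> * poly ((pderiv ^^ \<nu>) P) (cos \<tau>)\<bar>
           \<le> Cg * (\<Sum>l<n - 1. D l / (1 + \<bar>real i - real l\<bar>) ^ (m + 2)))))"
    using polynomial_gluing[OF r, where \<kappa> = "m + 2" and \<nu>\<^sub>0 = \<nu>\<^sub>0] by (elim exE conjE)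
  have r0: "0 < real r" using r by simp
  \<comment> \<open>The factor 184 is that of the transfer; dividing by 2 r lets r steps fit into
    half an interval.\<close>
  define \<kappa> where "\<kappa> = \<theta>\<^sup>2 / 184 / (2 * real r)"
  have \<kappa>0: "0 < \<kappa>" using \<theta> r0 by (simp add: \<kappa>_def)
  have \<theta>2: "\<theta>\<^sup>2 \<le> 1" using \<theta> by (simp add: power_le_one)
  have \<kappa>1: "\<kappa> \<le> \<theta>\<^sup>2 / 184" "2 * real r * \<kappa> \<le> 1"
    using r \<theta>2 unfolding \<kappa>_def by (auto simp: divide_le_eq mult_le_cancel_left1)
  \<comment> \<open>The integral bound, proportional to the length, is divided by \<sigma> =
    \<kappa> * len, so the lengths cancel and \<open>Kb\<close> is independent of the cell.\<close>
  define Kb where "Kb = 1 + 2 ^ r * real r * Cl / \<kappa>"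
  have Kb: "1 \<le> Kb" using Cl \<kappa>0 by (simp add: Kb_def)
  define CN where "CN = real r * real r * (real r * real r ^ r) powr 1"
  have CN: "0 \<le> CN" by (simp add: CN_def)
  define K where "K = CN * Kb * (Cw * Cw * (1 + 2 ^ m))"
  have K: "0 \<le> K" using CN Kb Cw by (simp add: K_def)
  define C where "C = Cw * (Kb * Cw + Cg * (4 * K))"
  have C0: "0 < C" using Cw Kb Cg K by (simp add: C_def add_pos_nonneg)
  have "\<exists>P. degree P \<le> n - 1 \<and>
      (AE x in lborel. x \<in> {-1..1} \<longrightarrow> \<bar>f x - poly P x\<bar> * avg_weight w n x \<le> C * B) \<and>
      (\<forall>\<nu>. r \<le> \<nu> \<longrightarrow> \<nu> \<le> \<nu>\<^sub>0 \<longrightarrow> (\<forall>x\<in>{-1..1}. \<bar>rho n x ^ \<nu> * poly ((pderiv ^^ \<nu>) P) x\<bar> * avg_weight w n x \<le> C * B))"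
    if w: "doubling_weight w L" and f[measurable]: "f \<in> borel_measurable borel" and fin: "Lp_integral 1 {-1..1} f < \<infinity>" and nr: "r \<le> n" and B: "0 \<le> B"
      and mod: "\<forall>h\<in>{0<..\<theta> / real n}. AE x in lborel. x \<in> {-1..1} \<longrightarrow> \<bar>symm_difference r (h * phi x) f x\<bar> * avg_weight w n x \<le> B" for w f n B
  proof -
    have n1: "1 \<le> n" using r nr by simp
    have n0: "0 < real n" using n1 by simp
    define v where "v = avg_weight w n"
    define V where "V i = v (grid n i)" for i
    have V0: "0 \<le> V i" for i unfolding V_def v_def by (rule avg_weight_nonneg[OF w grid_bounds n1])
    have v0: "0 \<le> v x" if "x \<in> {-1..1}" for x unfolding v_def by (rule avg_weight_nonneg[OF w that n1])
    have gw1: "V i \<le> Cw * (1 + \<bar>real i - real l\<bar>) ^ m * V l" if "i \<le> n" "l \<le> n" for i l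
      using gw[rule_format, OF w n1] that unfolding V_def v_def by blast
    have gw2: "V i \<le> Cw * v x" "v x \<le> Cw * V i" if "i < n" "x \<in> {grid n (min (i + 2) n)..grid n i}" for i x
      using gw[rule_format, OF w n1] that unfolding V_def v_def by blast+
    define J where "J i = {grid n (min (i + 2) n)..grid n i}" for i
    define I where "I i = {grid n (Suc i)..grid n i}" for i
    have IJ: "I i \<subseteq> J i" if "i < n" for i
      using grid_antimono[OF n1, of "Suc i" "min (i + 2) n"] that by (auto simp: I_def J_def)
    have IJ2: "I (Suc l) \<subseteq> J l" "I (Suc l) \<subseteq> J (Suc l)" if "Suc l < n" for l
      using IJ[OF that] that grid_antimono[OF n1, of l "Suc l"] by (auto simp: I_def J_def min_def)
    have J1: "J i \<subseteq> {-1..1}" for i using grid_bounds[of n i] grid_bounds[of n "min (i + 2) n"] by (auto simp: J_def)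
    show ?thesis
    \<comment> \<open>If the averaged weight vanishes at the point 1, the comparison makes it vanish
      everywhere on [-1, 1] and P = 0 serves; otherwise every \<open>V i\<close> is positive and may
      be divided by.\<close>
    proof (cases "V 0 = 0")
      case True
      have "v x = 0" if x: "x \<in> {-1..1}" for x
      proof -
        obtain i where i: "i < n" "x \<in> I i" using grid_cover[OF n1 x] by (auto simp: I_def)
        have "V i \<le> 0" using gw1[of i 0] i True by simp
        then have "V i = 0" using V0[of i] by simp
        then show ?thesis using gw2(2)[of i x] i IJ[OF i(1)] v0[OF x] by (auto simp: J_def)
      qed
      then show ?thesis using C0 B by (intro exI[of _ 0]) (auto simp: v_def)
    next
      case False
      have Vpos: "0 < V i" if "i \<le> n" for i
      proof -
        have "0 < V 0" using False V0[of 0] by simp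
        also have "V 0 \<le> Cw * (1 + \<bar>real 0 - real i\<bar>) ^ m * V i" using gw1[of 0 i] that by simp
        finally show ?thesis using V0[of i] by (cases "V i = 0") auto
      qed
      define b where "b i = Cw * B / V i" for i
      have b0: "0 \<le> b i" for i using Cw B V0 by (simp add: b_def)
      define len where "len i = grid n i - grid n (min (i + 2) n)" for i
      have len0: "0 < len i" if "i < n" for i
        unfolding len_def using grid_strict_antimono[OF n1, of i "min (i + 2) n"] that by simp
      have diff_le: "AE x in lborel. x \<in> J i \<longrightarrow> \<bar>symm_difference r (h * phi x) f x\<bar> \<le> b i" if i: "i < n" and h: "h \<in> {0<..\<theta> / real n}" for i h
        using mod[rule_format, OF h]
      proof eventually_elim
        case (elim x)
        show ?case
        proof
          assume x: "x \<in> J i"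
          have "V i \<le> Cw * v x" using gw2(1)[OF i] x by (simp add: J_def)
          moreover have "\<bar>symm_difference r (h * phi x) f x\<bar> * v x \<le> B" using elim x J1 unfolding v_def by blast
          ultimately have "\<bar>symm_difference r (h * phi x) f x\<bar> * V i \<le> \<bar>symm_difference r (h * phi x) f x\<bar> * (Cw * v x)"
            by (intro mult_left_mono) auto
          also have "\<dots> = Cw * (\<bar>symm_difference r (h * phi x) f x\<bar> * v x)" by simp
          also have "\<dots> \<le> Cw * B" using \<open>\<bar>symm_difference r (h * phi x) f x\<bar> * v x \<le> B\<close> Cw by (intro mult_left_mono) auto
          finally show "\<bar>symm_difference r (h * phi x) f x\<bar> \<le> b i" using Vpos[of i] i by (simp add: b_def le_divide_eq)
        qed
      qed
      have ang: "pi / real n \<le> real (min (i + 2) n) * pi / real n - real i * pi / real n"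
          "real (min (i + 2) n) * pi / real n - real i * pi / real n \<le> 2 * pi / real n" if i: "i < n" for i
      proof -
        have "real (min (i + 2) n) * pi / real n - real i * pi / real n = (real (min (i + 2) n) - real i) * pi / real n"
          by (simp add: diff_divide_distrib left_diff_distrib)
        moreover have "1 \<le> real (min (i + 2) n) - real i" "real (min (i + 2) n) - real i \<le> 2" using i by (auto simp: min_def)
        ultimately show "pi / real n \<le> real (min (i + 2) n) * pi / real n - real i * pi / real n"
          "real (min (i + 2) n) * pi / real n - real i * pi / real n \<le> 2 * pi / real n"
          by (auto intro!: divide_right_mono simp: mult_right_mono)
      qed
      have "\<exists>q. i < n \<longrightarrow> degree q < r \<and> (AE x in lborel. x \<in> J i \<longrightarrow> \<bar>f x - poly q x\<bar> \<le> Kb * b i)" for i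
      proof (cases "i < n")
        case i: True
        have fJ: "Lp_integral 1 {cos (real (min (i + 2) n) * pi / real n)..cos (real i * pi / real n)} f < \<infinity>"
          using order.strict_trans1[OF Lp_integral_mono_set[OF J1[of i]] fin] by (simp add: J_def grid_def)
        obtain q where q: "degree q < r" and qi: "Lp_integral 1 (J i) (\<lambda>x. f x - poly q x) \<le> ennreal Cl * (ennreal (real n / \<theta>) *
          (\<integral>\<^sup>+h\<in>{0<..\<theta> / real n}. (\<integral>\<^sup>+x\<in>J i. ennreal (\<bar>symm_difference r (h * phi x) f x\<bar> powr 1) \<partial>lborel) \<partial>lborel))"
          using local[rule_format, OF f n1 grid_angle(1) grid_angle(2) ang[OF i] fJ] i n1 unfolding J_def grid_def by auto
        have qL: "Lp_integral 1 (J i) (\<lambda>x. f x - poly q x) \<le> ennreal (Cl * b i * len i)"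
        proof -
          have "(\<integral>\<^sup>+h\<in>{0<..\<theta> / real n}. (\<integral>\<^sup>+x\<in>J i. ennreal (\<bar>symm_difference r (h * phi x) f x\<bar> powr 1) \<partial>lborel) \<partial>lborel)
            \<le> (\<integral>\<^sup>+h\<in>{0<..\<theta> / real n}. ennreal (b i * len i) \<partial>lborel)"
          proof (intro nn_integral_mono, rule mult_indicator_mono)
            fix h assume h: "h \<in> {0<..\<theta> / real n}"
            have "(\<integral>\<^sup>+x\<in>J i. ennreal (\<bar>symm_difference r (h * phi x) f x\<bar> powr 1) \<partial>lborel) \<le> (\<integral>\<^sup>+x\<in>J i. ennreal (b i) \<partial>lborel)"
              by (rule nn_integral_mono_AE, use diff_le[OF i h] in eventually_elim) (auto split: split_indicator intro: ennreal_leI)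
            also have "\<dots> = ennreal (b i * len i)"
              using len0[OF i] b0 by (simp add: J_def len_def nn_integral_cmult_indicator emeasure_lborel_Icc_eq ennreal_mult)
            finally show "(\<integral>\<^sup>+x\<in>J i. ennreal (\<bar>symm_difference r (h * phi x) f x\<bar> powr 1) \<partial>lborel) \<le> ennreal (b i * len i)" .
          qed
          also have "\<dots> = ennreal (b i * len i * (\<theta> / real n))"
            using b0 len0[OF i] \<theta> n0 by (simp add: nn_integral_cmult_indicator ennreal_mult[symmetric])
          finally have "ennreal Cl * (ennreal (real n / \<theta>) * (\<integral>\<^sup>+h\<in>{0<..\<theta> / real n}. (\<integral>\<^sup>+x\<in>J i. ennreal (\<bar>symm_difference r (h * phi x) f x\<bar> powr 1) \<partial>lborel) \<partial>lborel))
            \<le> ennreal Cl * (ennreal (real n / \<theta>) * ennreal (b i * len i * (\<theta> / real n)))"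
            by (intro mult_left_mono) auto
          also have "\<dots> = ennreal (Cl * (real n / \<theta> * (b i * len i * (\<theta> / real n))))"
            using Cl b0[of i] len0[OF i] \<theta> n0 by (simp add: ennreal_mult[symmetric])
          also have "Cl * (real n / \<theta> * (b i * len i * (\<theta> / real n))) = Cl * b i * len i" using \<theta> n0 by simp
          finally show ?thesis using qi by simp
        qed
        have Jeq: "J i = {grid n (min (i + 2) n)..grid n (min (i + 2) n) + len i}" by (simp add: J_def len_def)
        define \<sigma> where "\<sigma> = \<kappa> * len i"
        have \<sigma>0: "0 < \<sigma>" using \<kappa>0 len0[OF i] by (simp add: \<sigma>_def)
        have \<sigma>len: "2 * real r * \<sigma> \<le> len i"
          using mult_right_mono[OF \<kappa>1(2), of "len i"] len0[OF i] by (simp add: \<sigma>_def mult.assoc)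
        \<comment> \<open>The transfer is applied to the indicator of the values above
          \<open>b i\<close>: forward differences inside the interval exceed \<open>b i\<close> only
          on a null set of pairs (s, y).\<close>
        have zero: "(\<integral>\<^sup>+s\<in>{0<..\<sigma>}. (\<integral>\<^sup>+y\<in>{grid n (min (i + 2) n)..grid n (min (i + 2) n) + len i - real r * s}. indicator {b i<..} \<bar>fwd_diff r s f y\<bar> \<partial>lborel) \<partial>lborel) = 0"
        proof -
          have "(\<integral>\<^sup>+s\<in>{0<..\<sigma>}. (\<integral>\<^sup>+y\<in>{grid n (min (i + 2) n)..grid n (min (i + 2) n) + len i - real r * s}. indicator {b i<..} \<bar>fwd_diff r s f y\<bar> \<partial>lborel) \<partial>lborel)
            \<le> (\<integral>\<^sup>+s\<in>{0<..\<theta>\<^sup>2 / 184 * len i}. (\<integral>\<^sup>+y\<in>{grid n (min (i + 2) n)..grid n i - real r * s}. indicator {b i<..} \<bar>fwd_diff r s f y\<bar> \<partial>lborel) \<partial>lborel)"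
          proof (rule nn_integral_mono)
            fix s :: real
            have "\<sigma> \<le> \<theta>\<^sup>2 / 184 * len i" unfolding \<sigma>_def using \<kappa>1(1) len0[OF i] by (intro mult_right_mono) auto
            then show "(\<integral>\<^sup>+y\<in>{grid n (min (i + 2) n)..grid n (min (i + 2) n) + len i - real r * s}. indicator {b i<..} \<bar>fwd_diff r s f y\<bar> \<partial>lborel) * indicator {0<..\<sigma>} s
              \<le> (\<integral>\<^sup>+y\<in>{grid n (min (i + 2) n)..grid n i - real r * s}. indicator {b i<..} \<bar>fwd_diff r s f y\<bar> \<partial>lborel) * indicator {0<..\<theta>\<^sup>2 / 184 * len i} s"
              by (auto simp: len_def split: split_indicator)
          qed
          also have "\<dots> \<le> ennreal (3 * real n * len i) * (\<integral>\<^sup>+h\<in>{0<..\<theta> / real n}. (\<integral>\<^sup>+x\<in>J i. indicator {b i<..} \<bar>symm_difference r (h * phi x) f x\<bar> \<partial>lborel) \<partial>lborel)"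
            unfolding len_def J_def grid_def
            by (rule difference_transfer[OF r \<theta> n1 f, where \<Phi> = "\<lambda>y. indicator {Cw * B / V i<..} \<bar>y\<bar>", folded b_def])
               (use grid_angle[OF n1, of i] grid_angle[OF n1, of "min (i + 2) n"] ang[OF i] i in auto)
          also have "(\<integral>\<^sup>+h\<in>{0<..\<theta> / real n}. (\<integral>\<^sup>+x\<in>J i. indicator {b i<..} \<bar>symm_difference r (h * phi x) f x\<bar> \<partial>lborel) \<partial>lborel) \<le> (\<integral>\<^sup>+h\<in>{0<..\<theta> / real n}. 0 \<partial>lborel)"
          proof (intro nn_integral_mono, rule mult_indicator_mono)
            fix h assume h: "h \<in> {0<..\<theta> / real n}"
            have "(\<integral>\<^sup>+x\<in>J i. indicator {b i<..} \<bar>symm_difference r (h * phi x) f x\<bar> \<partial>lborel) \<le> (\<integral>\<^sup>+x. 0 \<partial>(lborel :: real measure))"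
            proof (rule nn_integral_mono_AE)
              show "AE x in lborel. indicator {b i<..} \<bar>symm_difference r (h * phi x) f x\<bar> * indicator (J i) x \<le> (0::ennreal)"
                using diff_le[OF i h] by eventually_elim (auto split: split_indicator)
            qed
            then show "(\<integral>\<^sup>+x\<in>J i. indicator {b i<..} \<bar>symm_difference r (h * phi x) f x\<bar> \<partial>lborel) \<le> 0" by simp
          qed
          finally show ?thesis by (simp add: mult_left_mono)
        qed
        have "AE x in lborel. x \<in> J i \<longrightarrow> ennreal (\<bar>f x - poly q x\<bar> * \<sigma>)
          \<le> ennreal (b i * \<sigma>) + ennreal (2 ^ r * real r) * Lp_integral 1 (J i) (\<lambda>x. f x - poly q x)"
          unfolding Jeq by (rule ess_bound_from_differences[OF r f q len0[OF i] \<sigma>0 \<sigma>len b0 zero])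
        then have "AE x in lborel. x \<in> J i \<longrightarrow> \<bar>f x - poly q x\<bar> \<le> Kb * b i"
        proof eventually_elim
          case (elim x)
          show ?case
          proof
            assume x: "x \<in> J i"
            have "ennreal (\<bar>f x - poly q x\<bar> * \<sigma>) \<le> ennreal (b i * \<sigma>) + ennreal (2 ^ r * real r) * Lp_integral 1 (J i) (\<lambda>x. f x - poly q x)"
              using elim x by blast
            also have "\<dots> \<le> ennreal (b i * \<sigma>) + ennreal (2 ^ r * real r) * ennreal (Cl * b i * len i)"
              by (intro add_left_mono mult_left_mono qL) auto
            also have "\<dots> = ennreal (b i * \<sigma> + 2 ^ r * real r * (Cl * b i * len i))"
              using b0[of i] \<sigma>0 Cl len0[OF i] by (subst ennreal_plus) (auto simp: ennreal_mult)
            also have "b i * \<sigma> + 2 ^ r * real r * (Cl * b i * len i) = Kb * b i * \<sigma>"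
              using \<kappa>0 by (simp add: Kb_def \<sigma>_def field_simps)
            finally have "\<bar>f x - poly q x\<bar> * \<sigma> \<le> Kb * b i * \<sigma>"
              using Kb b0[of i] \<sigma>0 by (subst (asm) ennreal_le_iff) auto
            then show "\<bar>f x - poly q x\<bar> \<le> Kb * b i" using \<sigma>0 by simp
          qed
        qed
        then show ?thesis using q by blast
      qed simp
      then obtain q where q: "\<And>i. i < n \<Longrightarrow> degree (q i) < r" and qae: "\<And>i. i < n \<Longrightarrow> AE x in lborel. x \<in> J i \<longrightarrow> \<bar>f x - poly (q i) x\<bar> \<le> Kb * b i"
        by metis
      have q_meas[measurable]: "poly Q \<in> borel_measurable borel" for Q :: "real poly"
        by (intro borel_measurable_continuous_onI continuous_intros)
      define D where "D l = CN * (Kb * (b l + b (Suc l)))" for l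
      have Dsup: "\<bar>poly (q l) x - poly (q (Suc l)) x\<bar> \<le> D l" if l: "Suc l < n" and x: "x \<in> I (Suc l)" for l x
      proof -
        define c where "c = grid n (Suc l) - grid n (Suc (Suc l))"
        have c0: "0 < c" unfolding c_def using grid_strict_antimono[OF n1, of "Suc l" "Suc (Suc l)"] l by simp
        have Ieq: "I (Suc l) = {grid n (Suc (Suc l))..grid n (Suc (Suc l)) + c}" by (simp add: I_def c_def)
        have "degree (q l - q (Suc l)) < r" using q l by (intro degree_diff_less) auto
        then have "ennreal (\<bar>poly (q l - q (Suc l)) x\<bar> powr 1) * ennreal c \<le> ennreal CN * Lp_integral 1 (I (Suc l)) (poly (q l - q (Suc l)))"
          unfolding CN_def Ieq by (rule poly_sup_le_Lp_integral[OF zero_less_one _ c0]) (use x Ieq in simp)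
        also have "Lp_integral 1 (I (Suc l)) (poly (q l - q (Suc l))) \<le> (\<integral>\<^sup>+x\<in>I (Suc l). ennreal (Kb * (b l + b (Suc l))) \<partial>lborel)"
          unfolding Lp_integral_def
        proof (rule nn_integral_mono_AE)
          have "AE x in lborel. (x \<in> J l \<longrightarrow> \<bar>f x - poly (q l) x\<bar> \<le> Kb * b l) \<and> (x \<in> J (Suc l) \<longrightarrow> \<bar>f x - poly (q (Suc l)) x\<bar> \<le> Kb * b (Suc l))"
            using qae[of l] qae[of "Suc l"] l by auto
          then show "AE x in lborel. ennreal (\<bar>poly (q l - q (Suc l)) x\<bar> powr 1) * indicator (I (Suc l)) x \<le> ennreal (Kb * (b l + b (Suc l))) * indicator (I (Suc l)) x"
          proof eventually_elim
            case (elim x)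
            show ?case
            proof (rule mult_indicator_mono)
              assume "x \<in> I (Suc l)"
              then have "x \<in> J l" "x \<in> J (Suc l)" using IJ2[OF l] by auto
              then have "\<bar>poly (q l) x - poly (q (Suc l)) x\<bar> \<le> Kb * b l + Kb * b (Suc l)" using elim by linarith
              then show "ennreal (\<bar>poly (q l - q (Suc l)) x\<bar> powr 1) \<le> ennreal (Kb * (b l + b (Suc l)))"
                by (intro ennreal_leI) (simp add: distrib_left)
            qed
          qed
        qed
        also have "(\<integral>\<^sup>+x\<in>I (Suc l). ennreal (Kb * (b l + b (Suc l))) \<partial>lborel) = ennreal (Kb * (b l + b (Suc l)) * c)"
          using c0 Kb b0 unfolding Ieq by (simp add: nn_integral_cmult_indicator emeasure_lborel_Icc_eq ennreal_mult)
        finally have "ennreal (\<bar>poly (q l - q (Suc l)) x\<bar> * c) \<le> ennreal (D l * c)"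
          using c0 CN Kb b0 by (simp add: D_def ennreal_mult mult.assoc mult_left_mono)
        moreover have "0 \<le> D l * c" using c0 CN Kb b0 by (simp add: D_def)
        ultimately have "\<bar>poly (q l - q (Suc l)) x\<bar> * c \<le> D l * c" by (simp only: ennreal_le_iff)
        then show ?thesis using c0 by simp
      qed
      define S where "S i = (\<Sum>l<n - 1. D l / (1 + \<bar>real i - real l\<bar>) ^ (m + 2))" for i
      have "\<exists>P. degree P \<le> n - 1 \<and> (\<forall>i<n. \<forall>\<tau>. real i * pi / real n \<le> \<tau> \<longrightarrow> \<tau> \<le> (real i + 1) * pi / real n \<longrightarrow>
         \<bar>poly (q i) (cos \<tau>) - poly P (cos \<tau>)\<bar> \<le> Cg * S i \<and>
         (\<forall>\<nu>. r \<le> \<nu> \<longrightarrow> \<nu> \<le> \<nu>\<^sub>0 \<longrightarrow> \<bar>rho n (cos \<tau>) ^ \<nu> * poly ((pderiv ^^ \<nu>) P) (cos \<tau>)\<bar> \<le> Cg * S i))"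
        unfolding S_def
      proof (rule glue[rule_format, OF nr q])
        fix l x assume "Suc l < n" "x \<in> {cos (real (l + 2) * pi / real n)..cos (real (l + 1) * pi / real n)}"
        then show "\<bar>poly (q l) x - poly (q (Suc l)) x\<bar> \<le> D l" by (intro Dsup) (auto simp: I_def grid_def)
      qed
      then obtain P where degP: "degree P \<le> n - 1" and Pbd: "\<forall>i<n. \<forall>\<tau>. real i * pi / real n \<le> \<tau> \<longrightarrow> \<tau> \<le> (real i + 1) * pi / real n \<longrightarrow>
         \<bar>poly (q i) (cos \<tau>) - poly P (cos \<tau>)\<bar> \<le> Cg * S i \<and>
         (\<forall>\<nu>. r \<le> \<nu> \<longrightarrow> \<nu> \<le> \<nu>\<^sub>0 \<longrightarrow> \<bar>rho n (cos \<tau>) ^ \<nu> * poly ((pderiv ^^ \<nu>) P) (cos \<tau>)\<bar> \<le> Cg * S i)" by blast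
      \<comment> \<open>Weight ratios use m of the exponent m + 2 and the sum over l uses 2; the
        weights in the denominators of \<open>b l\<close> and \<open>b (Suc l)\<close>
        cancel.\<close>
      have VS: "V i * S i \<le> 4 * K * B" if i: "i < n" for i
      proof -
        have "V i * S i = (\<Sum>l<n - 1. V i * D l / (1 + \<bar>real i - real l\<bar>) ^ (m + 2))" by (simp add: S_def sum_distrib_left)
        also have "\<dots> \<le> (\<Sum>l<n - 1. K * B * (1 / (1 + \<bar>real l - real i\<bar>)\<^sup>2))"
        proof (rule sum_mono)
          fix l assume l: "l \<in> {..<n - 1}"
          then have ln: "l \<le> n" "Suc l \<le> n" by auto
          define X where "X = 1 + \<bar>real i - real l\<bar>"
          have X1: "1 \<le> X" by (simp add: X_def)
          have "V i * b l \<le> Cw * X ^ m * V l * b l"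
            using gw1[of i l] i ln b0 unfolding X_def by (intro mult_right_mono) auto
          also have "\<dots> = Cw * Cw * B * X ^ m" using Vpos[OF ln(1)] by (simp add: b_def)
          finally have 1: "V i * b l \<le> Cw * Cw * B * X ^ m" .
          have "V i * b (Suc l) \<le> Cw * (1 + \<bar>real i - real (Suc l)\<bar>) ^ m * V (Suc l) * b (Suc l)"
            using gw1[of i "Suc l"] i ln b0 by (intro mult_right_mono) auto
          also have "\<dots> = Cw * Cw * B * (1 + \<bar>real i - real (Suc l)\<bar>) ^ m" using Vpos[OF ln(2)] by (simp add: b_def)
          also have "\<dots> \<le> Cw * Cw * B * (2 * X) ^ m"
            using Cw B by (intro mult_left_mono power_mono) (auto simp: X_def abs_if)
          also have "\<dots> = Cw * Cw * B * (2 ^ m * X ^ m)" by (simp only: power_mult_distrib)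
          finally have 2: "V i * b (Suc l) \<le> Cw * Cw * B * (2 ^ m * X ^ m)" .
          have "V i * D l = CN * Kb * (V i * b l + V i * b (Suc l))" by (simp add: D_def algebra_simps)
          also have "\<dots> \<le> CN * Kb * (Cw * Cw * B * X ^ m + Cw * Cw * B * (2 ^ m * X ^ m))"
            using 1 2 CN Kb by (intro mult_left_mono add_mono) auto
          also have "\<dots> = K * B * X ^ m" by (simp add: K_def algebra_simps)
          finally have "V i * D l / X ^ (m + 2) \<le> K * B * X ^ m / X ^ (m + 2)" using X1 by (intro divide_right_mono) auto
          also have "\<dots> = K * B * (1 / X\<^sup>2)" using X1 by (simp add: power_add power2_eq_square)
          finally show "V i * D l / (1 + \<bar>real i - real l\<bar>) ^ (m + 2) \<le> K * B * (1 / (1 + \<bar>real l - real i\<bar>)\<^sup>2)"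
            unfolding X_def by (simp add: abs_minus_commute)
        qed
        also have "\<dots> = K * B * (\<Sum>l<n - 1. 1 / (1 + \<bar>real l - real i\<bar>)\<^sup>2)" by (simp add: sum_distrib_left)
        also have "\<dots> \<le> K * B * 4" using K B by (intro mult_left_mono sum_inverse_square_distances_le) auto
        finally show ?thesis by simp
      qed
      have S0: "0 \<le> S i" for i unfolding S_def using CN Kb b0 by (intro sum_nonneg) (auto simp: D_def)
      have bound: "(Kb * b i + Cg * S i) * v x \<le> C * B" if i: "i < n" and x: "x \<in> I i" for i x
      proof -
        have vx: "v x \<le> Cw * V i" using gw2(2)[OF i] x IJ[OF i] by (auto simp: J_def)
        have "(Kb * b i + Cg * S i) * v x \<le> (Kb * b i + Cg * S i) * (Cw * V i)"
          using vx Kb b0 Cg S0 by (intro mult_left_mono) auto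
        also have "\<dots> = Cw * (Kb * (V i * b i) + Cg * (V i * S i))" by (simp add: algebra_simps)
        also have "\<dots> \<le> Cw * (Kb * (Cw * B) + Cg * (4 * K * B))"
        proof (intro mult_left_mono add_mono)
          show "V i * b i \<le> Cw * B" using Vpos[of i] i by (simp add: b_def)
          show "V i * S i \<le> 4 * K * B" by (rule VS[OF i])
        qed (use Cw Kb Cg in auto)
        also have "\<dots> = C * B" by (simp add: C_def algebra_simps)
        finally show ?thesis .
      qed
      have Pq: "\<bar>poly (q i) x - poly P x\<bar> \<le> Cg * S i"
        and PD: "\<And>\<nu>. r \<le> \<nu> \<Longrightarrow> \<nu> \<le> \<nu>\<^sub>0 \<Longrightarrow> \<bar>rho n x ^ \<nu> * poly ((pderiv ^^ \<nu>) P) x\<bar> \<le> Cg * S i" if i: "i < n" and x: "x \<in> I i" for i x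
      proof -
        obtain \<tau> where \<tau>: "x = cos \<tau>" "real i * pi / real n \<le> \<tau>" "\<tau> \<le> real (Suc i) * pi / real n"
          using grid_interval_param[OF n1, of i "Suc i" x] i x by (auto simp: I_def)
        have \<tau>': "\<tau> \<le> (real i + 1) * pi / real n" using \<tau>(3) by (simp add: add.commute)
        show "\<bar>poly (q i) x - poly P x\<bar> \<le> Cg * S i"
          "\<And>\<nu>. r \<le> \<nu> \<Longrightarrow> \<nu> \<le> \<nu>\<^sub>0 \<Longrightarrow> \<bar>rho n x ^ \<nu> * poly ((pderiv ^^ \<nu>) P) x\<bar> \<le> Cg * S i"
          using Pbd[rule_format, OF i \<tau>(2) \<tau>'] \<tau>(1) by auto
      qed
      have "AE x in lborel. \<forall>i\<in>{..<n}. x \<in> J i \<longrightarrow> \<bar>f x - poly (q i) x\<bar> \<le> Kb * b i"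
        using qae by (intro AE_finite_allI) auto
      then have "AE x in lborel. x \<in> {-1..1} \<longrightarrow> \<bar>f x - poly P x\<bar> * v x \<le> C * B"
      proof eventually_elim
        case (elim x)
        show ?case
        proof
          assume x: "x \<in> {-1..1}"
          obtain i where i: "i < n" "x \<in> I i" using grid_cover[OF n1 x] by (auto simp: I_def)
          have "\<bar>f x - poly (q i) x\<bar> \<le> Kb * b i" using elim i IJ[OF i(1)] by auto
          then have "\<bar>f x - poly P x\<bar> \<le> Kb * b i + Cg * S i" using Pq[OF i] by linarith
          then have "\<bar>f x - poly P x\<bar> * v x \<le> (Kb * b i + Cg * S i) * v x" using v0[OF x] by (intro mult_right_mono) auto
          also have "\<dots> \<le> C * B" by (rule bound[OF i])
          finally show "\<bar>f x - poly P x\<bar> * v x \<le> C * B" .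
        qed
      qed
      moreover have "\<bar>rho n x ^ \<nu> * poly ((pderiv ^^ \<nu>) P) x\<bar> * v x \<le> C * B" if nu: "r \<le> \<nu>" "\<nu> \<le> \<nu>\<^sub>0" and x: "x \<in> {-1..1}" for \<nu> x
      proof -
        obtain i where i: "i < n" "x \<in> I i" using grid_cover[OF n1 x] by (auto simp: I_def)
        have "0 \<le> Kb * b i" using Kb b0 by simp
        then have "\<bar>rho n x ^ \<nu> * poly ((pderiv ^^ \<nu>) P) x\<bar> \<le> Kb * b i + Cg * S i" using PD[OF i nu] by linarith
        then have "\<bar>rho n x ^ \<nu> * poly ((pderiv ^^ \<nu>) P) x\<bar> * v x \<le> (Kb * b i + Cg * S i) * v x" using v0[OF x] by (intro mult_right_mono) auto
        also have "\<dots> \<le> C * B" by (rule bound[OF i])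
        finally show ?thesis .
      qed
      ultimately show ?thesis using degP unfolding v_def by blast
    qed
  qed
  then show ?thesis using C0 by (intro exI[of _ C]) blast
qed

section \<open>Back to the norms and moduli of the statement\<close>

lemma nn_integral_cong_on_interval:
  assumes "AE x in lborel. x \<in> {-1..1::real} \<longrightarrow> F x = G x"
  shows "(\<integral>\<^sup>+x\<in>{-1..1}. H (F x) x \<partial>lborel) = (\<integral>\<^sup>+x\<in>{-1..1}. H (G x) x \<partial>lborel)"
  by (rule nn_integral_cong_AE, use assms in eventually_elim) (auto split: split_indicator)

text \<open>The root in \<open>wnorm\<close> is undone by the p-th power, and f is replaced by its
  Borel representative under the integral.\<close>

lemma avg_modulus_finite:
  assumes p: "0 < p" "p \<noteq> \<infinity>" and fg: "AE x in lborel. x \<in> {-1..1} \<longrightarrow> f x = g x"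
  shows "avg_modulus r f t p v = epowr (ennreal (1 / t) * (\<integral>\<^sup>+h\<in>{0<..t}. (\<integral>\<^sup>+x\<in>{-1..1}.
     ennreal (\<bar>symm_difference r (h * phi x) g x\<bar> powr enn2real p * v x) \<partial>lborel) \<partial>lborel)) (1 / enn2real p)"
proof -
  have a0: "0 < enn2real p" using p by (simp add: enn2real_positive_iff less_top)
  have "epowr (wnorm p v (\<lambda>x. symm_difference r (h * phi x) f x)) (enn2real p)
    = (\<integral>\<^sup>+x\<in>{-1..1}. ennreal (\<bar>symm_difference r (h * phi x) g x\<bar> powr enn2real p * v x) \<partial>lborel)" for h
    unfolding wnorm_finite[OF p(2)] epowr_epowr[OF a0]
    by (rule nn_integral_cong_on_interval[OF symm_difference_AE_cong[OF fg], where H = "\<lambda>y x. ennreal (\<bar>y\<bar> powr enn2real p * v x)"])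
  then show ?thesis
    using p(2) unfolding avg_modulus_def nn_integral_lebesgue_on nn_integral_Icc_Ioc by simp
qed

lemma borel_measurable_lebesgue_onI:
  "h \<in> borel_measurable borel \<Longrightarrow> h \<in> borel_measurable (lebesgue_on S)"
  by (intro measurable_restrict_space1 measurable_completion) simp

lemma wnorm_infinite_le:
  assumes "g \<in> borel_measurable (lebesgue_on {-1..1})" "v \<in> borel_measurable borel"
    and "AE x in lborel. x \<in> {-1..1} \<longrightarrow> \<bar>g x\<bar> * v x \<le> B"
  shows "wnorm \<infinity> v g \<le> ennreal B"
proof -
  note [measurable] = assms(1) borel_measurable_lebesgue_onI[OF assms(2), of "{-1..1}"]
  have "AE x in lebesgue_on {-1..1}. ennreal (\<bar>g x\<bar> * v x) \<le> ennreal B"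
    unfolding AE_lebesgue_on_iff using assms(3) by eventually_elim (auto intro: ennreal_leI)
  then show ?thesis unfolding wnorm_def by (simp add: esssup_I)
qed

lemma jackson_estimate_finite:
  fixes r \<nu>\<^sub>0 :: nat and p :: ennreal and \<theta> L :: real
  assumes r: "1 \<le> r" and p: "0 < p" "p \<noteq> \<infinity>" and \<theta>: "0 < \<theta>" "\<theta> \<le> 1"
  shows "\<exists>c::real. c > 0 \<and>
    (\<forall>w f n. doubling_weight w L \<longrightarrow> f \<in> Lp_space p \<longrightarrow> r \<le> n \<longrightarrow>
      (\<exists>P :: real poly. degree P \<le> n - 1 \<and>
         wnorm p (avg_weight w n) (\<lambda>x. f x - poly P x)
           \<le> ennreal c * avg_modulus r f (\<theta> / real n) p (avg_weight w n) \<and>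
         (\<forall>\<nu>. r \<le> \<nu> \<longrightarrow> \<nu> \<le> \<nu>\<^sub>0 \<longrightarrow>
            wnorm p (avg_weight w n) (\<lambda>x. rho n x ^ \<nu> * poly ((pderiv ^^ \<nu>) P) x)
              \<le> ennreal c * avg_modulus r f (\<theta> / real n) p (avg_weight w n))))"
proof -
  define a where "a = enn2real p"
  have a0: "0 < a" using p by (simp add: a_def enn2real_positive_iff less_top)
  obtain C where C: "0 < C" and approx: "\<forall>w f n. doubling_weight w L \<longrightarrow> f \<in> borel_measurable borel \<longrightarrow> Lp_integral a {-1..1} f < \<infinity> \<longrightarrow> r \<le> n \<longrightarrow>
    (\<exists>P. degree P \<le> n - 1 \<and>
      (\<integral>\<^sup>+x\<in>{-1..1}. ennreal (\<bar>f x - poly P x\<bar> powr a * avg_weight w n x) \<partial>lborel)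
        \<le> ennreal C * (ennreal (real n / \<theta>) * (\<integral>\<^sup>+h\<in>{0<..\<theta> / real n}. (\<integral>\<^sup>+x\<in>{-1..1}.
             ennreal (\<bar>symm_difference r (h * phi x) f x\<bar> powr a * avg_weight w n x) \<partial>lborel) \<partial>lborel)) \<and>
      (\<forall>\<nu>. r \<le> \<nu> \<longrightarrow> \<nu> \<le> \<nu>\<^sub>0 \<longrightarrow>
        (\<integral>\<^sup>+x\<in>{-1..1}. ennreal (\<bar>rho n x ^ \<nu> * poly ((pderiv ^^ \<nu>) P) x\<bar> powr a * avg_weight w n x) \<partial>lborel)
        \<le> ennreal C * (ennreal (real n / \<theta>) * (\<integral>\<^sup>+h\<in>{0<..\<theta> / real n}. (\<integral>\<^sup>+x\<in>{-1..1}.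
             ennreal (\<bar>symm_difference r (h * phi x) f x\<bar> powr a * avg_weight w n x) \<partial>lborel) \<partial>lborel))))"
    using finite_exponent_approximation[OF r a0 \<theta>, of L \<nu>\<^sub>0] by (elim exE conjE)
  \<comment> \<open>The estimates so far are between p-th powers; the root is taken only
    here.\<close>
  define c where "c = C powr (1 / a)"
  have "\<exists>P :: real poly. degree P \<le> n - 1 \<and>
         wnorm p (avg_weight w n) (\<lambda>x. f x - poly P x)
           \<le> ennreal c * avg_modulus r f (\<theta> / real n) p (avg_weight w n) \<and>
         (\<forall>\<nu>. r \<le> \<nu> \<longrightarrow> \<nu> \<le> \<nu>\<^sub>0 \<longrightarrow>
            wnorm p (avg_weight w n) (\<lambda>x. rho n x ^ \<nu> * poly ((pderiv ^^ \<nu>) P) x)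
              \<le> ennreal c * avg_modulus r f (\<theta> / real n) p (avg_weight w n))"
    if w: "doubling_weight w L" and f: "f \<in> Lp_space p" and nr: "r \<le> n" for w f n
  proof -
    have fm: "f \<in> borel_measurable (lebesgue_on {-1..1})" and ff: "wnorm p (\<lambda>_. 1) f < \<infinity>"
      using f by (auto simp: Lp_space_def)
    obtain g where g: "g \<in> borel_measurable borel" and fg: "AE x in lborel. x \<in> {-1..1} \<longrightarrow> f x = g x"
      using borel_representative[OF fm] by blast
    have "(\<integral>\<^sup>+x\<in>{-1..1}. ennreal (\<bar>f x\<bar> powr a * 1) \<partial>lborel) < \<infinity>"
      using ff unfolding wnorm_finite[OF p(2)] a_def[symmetric] by (auto simp: epowr_def less_top split: if_splits)
    also have "(\<integral>\<^sup>+x\<in>{-1..1}. ennreal (\<bar>f x\<bar> powr a * 1) \<partial>lborel) = Lp_integral a {-1..1} g"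
      unfolding Lp_integral_def using nn_integral_cong_on_interval[OF fg, of "\<lambda>y x. ennreal (\<bar>y\<bar> powr a * 1)"] by simp
    finally have gfin: "Lp_integral a {-1..1} g < \<infinity>" .
    define \<Omega> where "\<Omega> = ennreal (real n / \<theta>) * (\<integral>\<^sup>+h\<in>{0<..\<theta> / real n}. (\<integral>\<^sup>+x\<in>{-1..1}.
             ennreal (\<bar>symm_difference r (h * phi x) g x\<bar> powr a * avg_weight w n x) \<partial>lborel) \<partial>lborel)"
    have mod: "avg_modulus r f (\<theta> / real n) p (avg_weight w n) = epowr \<Omega> (1 / a)"
      unfolding avg_modulus_finite[OF p fg] \<Omega>_def a_def by simp
    obtain P where degP: "degree P \<le> n - 1"
      and P1: "(\<integral>\<^sup>+x\<in>{-1..1}. ennreal (\<bar>g x - poly P x\<bar> powr a * avg_weight w n x) \<partial>lborel) \<le> ennreal C * \<Omega>"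
      and P2: "\<And>\<nu>. r \<le> \<nu> \<Longrightarrow> \<nu> \<le> \<nu>\<^sub>0 \<Longrightarrow> (\<integral>\<^sup>+x\<in>{-1..1}. ennreal (\<bar>rho n x ^ \<nu> * poly ((pderiv ^^ \<nu>) P) x\<bar> powr a * avg_weight w n x) \<partial>lborel) \<le> ennreal C * \<Omega>"
      using approx[rule_format, OF w g gfin nr] unfolding \<Omega>_def by blast
    have root: "epowr X (1 / a) \<le> ennreal c * epowr \<Omega> (1 / a)" if "X \<le> ennreal C * \<Omega>" for X
      using epowr_mono[OF that, of "1 / a"] epowr_cmult[OF C, of "1 / a" \<Omega>] a0 by (simp add: c_def)
    have "(\<integral>\<^sup>+x\<in>{-1..1}. ennreal (\<bar>f x - poly P x\<bar> powr a * avg_weight w n x) \<partial>lborel) \<le> ennreal C * \<Omega>"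
      using P1 nn_integral_cong_on_interval[OF fg, of "\<lambda>y x. ennreal (\<bar>y - poly P x\<bar> powr a * avg_weight w n x)"] by simp
    from root[OF this] have "wnorm p (avg_weight w n) (\<lambda>x. f x - poly P x) \<le> ennreal c * epowr \<Omega> (1 / a)"
      unfolding wnorm_finite[OF p(2)] a_def .
    moreover have "wnorm p (avg_weight w n) (\<lambda>x. rho n x ^ \<nu> * poly ((pderiv ^^ \<nu>) P) x) \<le> ennreal c * epowr \<Omega> (1 / a)"
      if "r \<le> \<nu>" "\<nu> \<le> \<nu>\<^sub>0" for \<nu>
      using root[OF P2[OF that]] unfolding wnorm_finite[OF p(2)] a_def .
    ultimately show ?thesis using degP unfolding mod by blast
  qed
  moreover have "0 < c" using C by (simp add: c_def)
  ultimately show ?thesis by blast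
qed

lemma jackson_estimate_infinite:
  fixes r \<nu>\<^sub>0 :: nat and \<theta> L :: real
  assumes r: "1 \<le> r" and \<theta>: "0 < \<theta>" "\<theta> \<le> 1"
  shows "\<exists>c::real. c > 0 \<and>
    (\<forall>w f n. doubling_weight w L \<longrightarrow> f \<in> Lp_space \<infinity> \<longrightarrow> r \<le> n \<longrightarrow>
      (\<exists>P :: real poly. degree P \<le> n - 1 \<and>
         wnorm \<infinity> (avg_weight w n) (\<lambda>x. f x - poly P x)
           \<le> ennreal c * avg_modulus r f (\<theta> / real n) \<infinity> (avg_weight w n) \<and>
         (\<forall>\<nu>. r \<le> \<nu> \<longrightarrow> \<nu> \<le> \<nu>\<^sub>0 \<longrightarrow>
            wnorm \<infinity> (avg_weight w n) (\<lambda>x. rho n x ^ \<nu> * poly ((pderiv ^^ \<nu>) P) x)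
              \<le> ennreal c * avg_modulus r f (\<theta> / real n) \<infinity> (avg_weight w n))))"
proof -
  obtain C where C: "0 < C" and approx: "\<forall>w f n B. doubling_weight w L \<longrightarrow> f \<in> borel_measurable borel \<longrightarrow> Lp_integral 1 {-1..1} f < \<infinity> \<longrightarrow> r \<le> n \<longrightarrow> 0 \<le> B \<longrightarrow>
    (\<forall>h\<in>{0<..\<theta> / real n}. AE x in lborel. x \<in> {-1..1} \<longrightarrow> \<bar>symm_difference r (h * phi x) f x\<bar> * avg_weight w n x \<le> B) \<longrightarrow>
    (\<exists>P. degree P \<le> n - 1 \<and>
      (AE x in lborel. x \<in> {-1..1} \<longrightarrow> \<bar>f x - poly P x\<bar> * avg_weight w n x \<le> C * B) \<and>
      (\<forall>\<nu>. r \<le> \<nu> \<longrightarrow> \<nu> \<le> \<nu>\<^sub>0 \<longrightarrow> (\<forall>x\<in>{-1..1}. \<bar>rho n x ^ \<nu> * poly ((pderiv ^^ \<nu>) P) x\<bar> * avg_weight w n x \<le> C * B)))"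
    using infinite_exponent_approximation[OF r \<theta>, of L \<nu>\<^sub>0] by (elim exE conjE)
  have "\<exists>P :: real poly. degree P \<le> n - 1 \<and>
         wnorm \<infinity> (avg_weight w n) (\<lambda>x. f x - poly P x)
           \<le> ennreal C * avg_modulus r f (\<theta> / real n) \<infinity> (avg_weight w n) \<and>
         (\<forall>\<nu>. r \<le> \<nu> \<longrightarrow> \<nu> \<le> \<nu>\<^sub>0 \<longrightarrow>
            wnorm \<infinity> (avg_weight w n) (\<lambda>x. rho n x ^ \<nu> * poly ((pderiv ^^ \<nu>) P) x)
              \<le> ennreal C * avg_modulus r f (\<theta> / real n) \<infinity> (avg_weight w n))"
    if w: "doubling_weight w L" and f: "f \<in> Lp_space \<infinity>" and nr: "r \<le> n" for w f n
  proof (cases "avg_modulus r f (\<theta> / real n) \<infinity> (avg_weight w n)")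
    \<comment> \<open>An infinite modulus times C > 0 bounds everything, so P = 0 serves.\<close>
    case top
    then show ?thesis using C by (intro exI[of _ 0]) (auto simp: ennreal_mult_top)
  next
    case (real B)
    have fm: "f \<in> borel_measurable (lebesgue_on {-1..1})" and ff: "wnorm \<infinity> (\<lambda>_. 1) f < \<infinity>"
      using f by (auto simp: Lp_space_def)
    obtain g where g[measurable]: "g \<in> borel_measurable borel" and fg: "AE x in lborel. x \<in> {-1..1} \<longrightarrow> f x = g x"
      using borel_representative[OF fm] by blast
    obtain R where R: "0 \<le> R" "wnorm \<infinity> (\<lambda>_. 1) f = ennreal R"
      using ff by (cases "wnorm \<infinity> (\<lambda>_. 1) f") auto
    have "AE x in lebesgue_on {-1..1}. ennreal (\<bar>f x\<bar> * 1) \<le> ennreal R"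
      using esssup_AE[of "\<lambda>x. ennreal (\<bar>f x\<bar> * 1)" "lebesgue_on {-1..1}"] R(2) by (simp add: wnorm_def)
    then have fR: "AE x in lborel. x \<in> {-1..1} \<longrightarrow> ennreal (\<bar>f x\<bar> * 1) \<le> ennreal R" unfolding AE_lebesgue_on_iff .
    \<comment> \<open>An essentially bounded function on a bounded interval is integrable, which
      gives access to the local polynomials for p = 1.\<close>
    have "Lp_integral 1 {-1..1} g \<le> (\<integral>\<^sup>+x\<in>{-1..1::real}. ennreal R \<partial>lborel)"
      unfolding Lp_integral_def
      by (rule nn_integral_mono_AE, use fR fg in eventually_elim) (auto split: split_indicator)
    also have "\<dots> < \<infinity>" by (simp add: nn_integral_cmult_indicator emeasure_lborel_Icc_eq ennreal_mult_less_top)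
    finally have gfin: "Lp_integral 1 {-1..1} g < \<infinity>" .
    \<comment> \<open>The exceptional null set may depend on h; this is enough because the
      differences enter the argument only through integrals over h.\<close>
    have mod: "AE x in lborel. x \<in> {-1..1} \<longrightarrow> \<bar>symm_difference r (h * phi x) g x\<bar> * avg_weight w n x \<le> B"
      if h: "h \<in> {0<..\<theta> / real n}" for h
    proof -
      have "wnorm \<infinity> (avg_weight w n) (\<lambda>x. symm_difference r (h * phi x) f x) \<le> ennreal B"
        using real(2) h unfolding avg_modulus_def modulus_def by (metis (mono_tags, lifting) SUP_upper)
      then have "AE x in lebesgue_on {-1..1}. ennreal (\<bar>symm_difference r (h * phi x) f x\<bar> * avg_weight w n x) \<le> ennreal B"
        using esssup_AE[of "\<lambda>x. ennreal (\<bar>symm_difference r (h * phi x) f x\<bar> * avg_weight w n x)" "lebesgue_on {-1..1}"]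
        by (auto simp: wnorm_def elim!: eventually_mono intro: order.trans)
      then have "AE x in lborel. x \<in> {-1..1} \<longrightarrow> ennreal (\<bar>symm_difference r (h * phi x) f x\<bar> * avg_weight w n x) \<le> ennreal B"
        unfolding AE_lebesgue_on_iff .
      with symm_difference_AE_cong[OF fg, of r h] show ?thesis
        by eventually_elim (use real(1) in \<open>auto simp: ennreal_le_iff\<close>)
    qed
    obtain P where degP: "degree P \<le> n - 1"
      and P1: "AE x in lborel. x \<in> {-1..1} \<longrightarrow> \<bar>g x - poly P x\<bar> * avg_weight w n x \<le> C * B"
      and P2: "\<forall>\<nu>. r \<le> \<nu> \<longrightarrow> \<nu> \<le> \<nu>\<^sub>0 \<longrightarrow> (\<forall>x\<in>{-1..1}. \<bar>rho n x ^ \<nu> * poly ((pderiv ^^ \<nu>) P) x\<bar> * avg_weight w n x \<le> C * B)"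
      using approx[rule_format, OF w g gfin nr real(1), of] mod by blast
    have v: "avg_weight w n \<in> borel_measurable borel" by (rule avg_weight_measurable[OF w])
    have pm: "poly Q \<in> borel_measurable borel" for Q :: "real poly"
      by (intro borel_measurable_continuous_onI continuous_intros)
    have CB: "ennreal C * ennreal B = ennreal (C * B)" using C real(1) by (simp add: ennreal_mult)
    have "wnorm \<infinity> (avg_weight w n) (\<lambda>x. f x - poly P x) \<le> ennreal (C * B)"
    proof (rule wnorm_infinite_le[OF _ v])
      show "(\<lambda>x. f x - poly P x) \<in> borel_measurable (lebesgue_on {-1..1})"
        by (intro borel_measurable_diff fm borel_measurable_lebesgue_onI pm)
      show "AE x in lborel. x \<in> {-1..1} \<longrightarrow> \<bar>f x - poly P x\<bar> * avg_weight w n x \<le> C * B"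
        using P1 fg by eventually_elim auto
    qed
    moreover have "wnorm \<infinity> (avg_weight w n) (\<lambda>x. rho n x ^ \<nu> * poly ((pderiv ^^ \<nu>) P) x) \<le> ennreal (C * B)"
      if "r \<le> \<nu>" "\<nu> \<le> \<nu>\<^sub>0" for \<nu>
    proof (rule wnorm_infinite_le[OF _ v])
      have [measurable]: "rho n \<in> borel_measurable borel" "poly ((pderiv ^^ \<nu>) P) \<in> borel_measurable borel"
        unfolding rho_def by (measurable, rule pm)
      show "(\<lambda>x. rho n x ^ \<nu> * poly ((pderiv ^^ \<nu>) P) x) \<in> borel_measurable (lebesgue_on {-1..1})"
        by (rule borel_measurable_lebesgue_onI) measurable
    qed (use P2 that in auto)
    ultimately show ?thesis using degP unfolding real(2) CB by blast
  qed
  then show ?thesis using C by blast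
qed

text \<open>The constant is quantified before \<open>w\<close>, \<open>f\<close> and
  \<open>n\<close>, with \<open>L\<close> fixed outside, which expresses that it depends only on r,
  \<open>\<nu>\<^sub>0\<close>, p, \<theta> and L. One polynomial P serves all orders \<nu> at
  once.\<close>

theorem theorem5p3:
  fixes r \<nu>\<^sub>0 :: nat and p :: ennreal and \<theta> L :: real
  assumes "1 \<le> r" and "r \<le> \<nu>\<^sub>0" and "0 < p" and "0 < \<theta>" and "\<theta> \<le> 1"
  shows "\<exists>c::real. c > 0 \<and>
    (\<forall>w f n. doubling_weight w L \<longrightarrow> f \<in> Lp_space p \<longrightarrow> r \<le> n \<longrightarrow>
      (\<exists>P :: real poly. degree P \<le> n - 1 \<and>
         wnorm p (avg_weight w n) (\<lambda>x. f x - poly P x)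
           \<le> ennreal c * avg_modulus r f (\<theta> / real n) p (avg_weight w n) \<and>
         (\<forall>\<nu>. r \<le> \<nu> \<longrightarrow> \<nu> \<le> \<nu>\<^sub>0 \<longrightarrow>
            wnorm p (avg_weight w n) (\<lambda>x. rho n x ^ \<nu> * poly ((pderiv ^^ \<nu>) P) x)
              \<le> ennreal c * avg_modulus r f (\<theta> / real n) p (avg_weight w n)) \<and>
         ennreal c * avg_modulus r f (\<theta> / real n) p (avg_weight w n)
           \<le> ennreal c * modulus r f (\<theta> / real n) p (avg_weight w n)))"
proof -
  obtain c where c: "0 < c" and approx: "\<forall>w f n. doubling_weight w L \<longrightarrow> f \<in> Lp_space p \<longrightarrow> r \<le> n \<longrightarrow>
      (\<exists>P :: real poly. degree P \<le> n - 1 \<and>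
         wnorm p (avg_weight w n) (\<lambda>x. f x - poly P x)
           \<le> ennreal c * avg_modulus r f (\<theta> / real n) p (avg_weight w n) \<and>
         (\<forall>\<nu>. r \<le> \<nu> \<longrightarrow> \<nu> \<le> \<nu>\<^sub>0 \<longrightarrow>
            wnorm p (avg_weight w n) (\<lambda>x. rho n x ^ \<nu> * poly ((pderiv ^^ \<nu>) P) x)
              \<le> ennreal c * avg_modulus r f (\<theta> / real n) p (avg_weight w n)))"
  proof (cases "p = \<infinity>")
    case True
    show thesis
      using jackson_estimate_infinite[OF assms(1,4,5), of L \<nu>\<^sub>0, folded True] by (elim exE conjE) (rule that)
  next
    case False
    show thesis
      using jackson_estimate_finite[OF assms(1,3) False assms(4,5), of L \<nu>\<^sub>0] by (elim exE conjE) (rule that)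
  qed
  have le: "ennreal c * avg_modulus r f (\<theta> / real n) p (avg_weight w n) \<le> ennreal c * modulus r f (\<theta> / real n) p (avg_weight w n)"
    if "r \<le> n" for w f n
    using assms that by (intro mult_left_mono avg_modulus_le_modulus) auto
  show ?thesis using c approx le by (intro exI[of _ c]) blast
qed

end
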